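(* Let $\Gamma$ be a countable group whose Furstenberg URS $\mathcal{A}_\Gamma$ comes from a faithful and extremely proximal action, and let $G$ be a locally compact group containing $\Gamma$ as a lattice. The following hold: (a) Assume that $\mathrm{Env}(\mathcal{A}_\Gamma)$ is finitely generated and co-amenable in $\Gamma$. Then $G$ cannot be a direct product $G = G_1 \times G_2$ of two non-compact groups. (b) Assume that $\mathrm{Env}(\mathcal{A}_\Gamma)$ has finite index in $\Gamma$ and finite abelianization. Then any continuous morphism with dense image from $G$ to a product of locally compact groups $G \rightarrow G_1 \times G_2$ is such that one factor $G_i$ is compact.
   Context: Conventions: locally compact groups are assumed second countable; compact spaces are Hausdorff; countable groups are viewed as discrete groups. A lattice in $G$ is a discrete subgroup $\Gamma\le G$ such that $G/\Gamma$ carries a $G$-invariant probability measure. URS: for a locally compact group $G$, $\mathrm{Sub}(G)$ is the compact space of closed subgroups of $G$ with the Chabauty topology (basis: the sets $\{H : H\cap K=\emptyset,\ H\cap U_i\neq\emptyset \ \forall i\}$ with $K\subset G$ compact and $U_1,\dots,U_n\subset G$ open), on which $G$ acts by conjugation. A uniformly recurrent subgroup (URS) of $G$ is a non-empty closed $G$-invariant minimal subset of $\mathrm{Sub}(G)$. The envelope $\mathrm{Env}(\mathcal{H})$ of a URS $\mathcal{H}$ is the closed subgroup of $G$ generated by all $H\in\mathcal{H}$. Stabilizer URS: a compact $G$-space is a compact space with a continuous $G$-action; it is minimal if all orbits are dense. If $X$ is a minimal compact $G$-space and $X_0\subset X$ is the (dense) set of points where $x\mapsto G_x$, $X\to\mathrm{Sub}(G)$,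 is continuous ($G_x$ is the stabilizer of $x$), then $\mathcal{S}_G(X)$, the closure of $\{G_x : x\in X_0\}$ in $\mathrm{Sub}(G)$, is a URS, called the stabilizer URS of $X$. Extremely proximal actions: a closed subset $C$ of a compact $G$-space $X$ is compressible if there is $x\in X$ such that for every neighbourhood $U$ of $x$ there is $g\in G$ with $g(C)\subset U$. The action is extremely proximal if every closed subset $C\subsetneq X$ is compressible. A URS $\mathcal{H}$ of $G$ comes from a (faithful and) extremely proximal action if there is a compact $G$-space $Z$ on which the action is minimal, extremely proximal (and faithful), with $\mathcal{S}_G(Z)=\mathcal{H}$. Furstenberg URS: a $G$-boundary is a compact $G$-space $X$ that is minimal and strongly proximal (the closure of every $G$-orbit in the space $\mathrm{Prob}(X)$ of regular Borel probability measures, with the weak* topology, contains a Dirac measure). The Furstenberg boundary $\partial_{sp}G$ is the universal $G$-boundary (it surjects continuously and equivariantly onto every $G$-boundary). The Furstenberg URS $\mathcal{A}_\Gamma$ of a countable group $\Gamma$ is the stabilizer URS of the $\Gamma$-action on $\partial_{sp}\Gamma$. Co-amenability: a convex compact $G$-space is a non-empty compact convex subset of a locally convex space with a continuous affine $G$-action. A subgroup $L\le G$ is co-amenable in $G$ if every convex compact $G$-space with an $L$-fixed point has a $G$-fixed point. *)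

theory Defs
  imports "HOL-Analysis.Finite_Function_Topology" "HOL-Probability.Giry_Monad" "HOL-Algebra.Group_Action" "HOL-Algebra.Left_Coset"
    "HOL-Algebra.Generated_Groups"
begin

section \<open>Locally compact groups and lattices\<close>

definition topological_group :: "('g, 'm) monoid_scheme \<Rightarrow> 'g topology \<Rightarrow> bool" where
  "topological_group G T \<longleftrightarrow>
     group G \<and> topspace T = carrier G \<and>
     continuous_map (prod_topology T T) T (\<lambda>(x, y). x \<otimes>\<^bsub>G\<^esub> y) \<and>
     continuous_map T T (\<lambda>x. inv\<^bsub>G\<^esub> x)"

definition second_countable_space :: "'x topology \<Rightarrow> bool" where
  "second_countable_space X \<longleftrightarrow>
     (\<exists>\<B>. countable \<B> \<and> openin X = arbitrary union_of (\<lambda>U. U \<in> \<B>))"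

text \<open>Locally compact groups are Hausdorff and, throughout, second countable.\<close>

definition lcsc_group :: "('g, 'm) monoid_scheme \<Rightarrow> 'g topology \<Rightarrow> bool" where
  "lcsc_group G T \<longleftrightarrow>
     topological_group G T \<and> Hausdorff_space T \<and> locally_compact_space T \<and>
     second_countable_space T"

text \<open>\<open>G/H\<close> with the quotient topology.\<close>

definition coset_space :: "('g, 'm) monoid_scheme \<Rightarrow> 'g topology \<Rightarrow> 'g set \<Rightarrow> 'g set topology" where
  "coset_space G T H = topology (\<lambda>\<U>. \<U> \<subseteq> lcosets\<^bsub>G\<^esub> H \<and>
     openin T {x \<in> topspace T. x <#\<^bsub>G\<^esub> H \<in> \<U>})"

lemma openin_coset_space:
  "openin (coset_space G T H) \<U> \<longleftrightarrow>
     \<U> \<subseteq> lcosets\<^bsub>G\<^esub> H \<and> openin T {x \<in> topspace T. x <#\<^bsub>G\<^esub> H \<in> \<U>}"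
proof -
  have "istopology (\<lambda>\<U>. \<U> \<subseteq> lcosets\<^bsub>G\<^esub> H \<and> openin T {x \<in> topspace T. x <#\<^bsub>G\<^esub> H \<in> \<U>})"
    unfolding istopology_def
  proof (intro conjI allI impI)
    fix S S'
    assume S: "S \<subseteq> lcosets\<^bsub>G\<^esub> H \<and> openin T {x \<in> topspace T. x <#\<^bsub>G\<^esub> H \<in> S}"
      and S': "S' \<subseteq> lcosets\<^bsub>G\<^esub> H \<and> openin T {x \<in> topspace T. x <#\<^bsub>G\<^esub> H \<in> S'}"
    have "{x \<in> topspace T. x <#\<^bsub>G\<^esub> H \<in> S \<inter> S'} =
        {x \<in> topspace T. x <#\<^bsub>G\<^esub> H \<in> S} \<inter> {x \<in> topspace T. x <#\<^bsub>G\<^esub> H \<in> S'}"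
      by auto
    then show "openin T {x \<in> topspace T. x <#\<^bsub>G\<^esub> H \<in> S \<inter> S'}"
      using S S' by (simp only: openin_Int)
    show "S \<inter> S' \<subseteq> lcosets\<^bsub>G\<^esub> H" using S by auto
  next
    fix \<K>
    assume *: "\<forall>K\<in>\<K>. K \<subseteq> lcosets\<^bsub>G\<^esub> H \<and> openin T {x \<in> topspace T. x <#\<^bsub>G\<^esub> H \<in> K}"
    have "{x \<in> topspace T. x <#\<^bsub>G\<^esub> H \<in> \<Union>\<K>} =
        (\<Union>K\<in>\<K>. {x \<in> topspace T. x <#\<^bsub>G\<^esub> H \<in> K})"
      by auto
    then show "openin T {x \<in> topspace T. x <#\<^bsub>G\<^esub> H \<in> \<Union>\<K>}"
      using * by auto
    show "\<Union>\<K> \<subseteq> lcosets\<^bsub>G\<^esub> H" using * by auto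
  qed
  then show ?thesis
    by (simp add: coset_space_def)
qed

definition borel_on :: "'x topology \<Rightarrow> 'x measure" where
  "borel_on X = sigma (topspace X) {U. openin X U}"

definition lattice_in :: "('g, 'm) monoid_scheme \<Rightarrow> 'g topology \<Rightarrow> 'g set \<Rightarrow> bool" where
  "lattice_in G T \<Gamma> \<longleftrightarrow>
     subgroup \<Gamma> G \<and> subtopology T \<Gamma> = discrete_topology \<Gamma> \<and>
     (\<exists>\<mu>. prob_space \<mu> \<and> sets \<mu> = sets (borel_on (coset_space G T \<Gamma>)) \<and>
        (\<forall>g\<in>carrier G. distr \<mu> \<mu> (\<lambda>C. g <#\<^bsub>G\<^esub> C) = \<mu>))"

section \<open>The Chabauty space and envelopes\<close>

definition closed_subgroups :: "('g, 'm) monoid_scheme \<Rightarrow> 'g topology \<Rightarrow> 'g set set" where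
  "closed_subgroups G T = {H. subgroup H G \<and> closedin T H}"

definition chabauty :: "('g, 'm) monoid_scheme \<Rightarrow> 'g topology \<Rightarrow> 'g set topology" where
  "chabauty G T = topology_generated_by
     {{H \<in> closed_subgroups G T. H \<inter> K = {} \<and> (\<forall>U\<in>\<U>. H \<inter> U \<noteq> {})} | K \<U>.
        compactin T K \<and> finite \<U> \<and> (\<forall>U\<in>\<U>. openin T U)}"

lemma topspace_chabauty: "topspace (chabauty G T) = closed_subgroups G T"
proof -
  have "closed_subgroups G T \<in> {{H \<in> closed_subgroups G T. H \<inter> K = {} \<and> (\<forall>U\<in>\<U>. H \<inter> U \<noteq> {})}
      | K \<U>. compactin T K \<and> finite \<U> \<and> (\<forall>U\<in>\<U>. openin T U)}"
    by (rule CollectI, rule exI[of _ "{}"], rule exI[of _ "{}"]) auto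
  then show ?thesis
    unfolding chabauty_def topology_generated_by_topspace by blast
qed

definition envelope :: "('g, 'm) monoid_scheme \<Rightarrow> 'g topology \<Rightarrow> 'g set set \<Rightarrow> 'g set" where
  "envelope G T \<H> = T closure_of (generate G (\<Union>\<H>))"

section \<open>Compact $G$-spaces and stabilizer URSs\<close>

definition continuous_action ::
  "('g, 'm) monoid_scheme \<Rightarrow> 'g topology \<Rightarrow> 'x topology \<Rightarrow> ('g \<Rightarrow> 'x \<Rightarrow> 'x) \<Rightarrow> bool" where
  "continuous_action G T X \<phi> \<longleftrightarrow>
     group_action G (topspace X) \<phi> \<and>
     continuous_map (prod_topology T X) X (\<lambda>(g, x). \<phi> g x)"

text \<open>Compact spaces are Hausdorff; a space being acted on is non-empty.\<close>

definition compact_G_space ::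
  "('g, 'm) monoid_scheme \<Rightarrow> 'g topology \<Rightarrow> 'x topology \<Rightarrow> ('g \<Rightarrow> 'x \<Rightarrow> 'x) \<Rightarrow> bool" where
  "compact_G_space G T X \<phi> \<longleftrightarrow>
     topspace X \<noteq> {} \<and> compact_space X \<and> Hausdorff_space X \<and> continuous_action G T X \<phi>"

definition minimal_action ::
  "('g, 'm) monoid_scheme \<Rightarrow> 'x topology \<Rightarrow> ('g \<Rightarrow> 'x \<Rightarrow> 'x) \<Rightarrow> bool" where
  "minimal_action G X \<phi> \<longleftrightarrow>
     (\<forall>x\<in>topspace X. X closure_of (orbit G \<phi> x) = topspace X)"

definition stabilizer_URS ::
  "('g, 'm) monoid_scheme \<Rightarrow> 'g topology \<Rightarrow> 'x topology \<Rightarrow> ('g \<Rightarrow> 'x \<Rightarrow> 'x) \<Rightarrow> 'g set set" where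
  "stabilizer_URS G T X \<phi> = chabauty G T closure_of
     (stabilizer G \<phi> `
        {x \<in> topspace X. topcontinuous_at X (chabauty G T) (stabilizer G \<phi>) x})"

definition compressible ::
  "('g, 'm) monoid_scheme \<Rightarrow> 'x topology \<Rightarrow> ('g \<Rightarrow> 'x \<Rightarrow> 'x) \<Rightarrow> 'x set \<Rightarrow> bool" where
  "compressible G X \<phi> C \<longleftrightarrow>
     (\<exists>x\<in>topspace X. \<forall>U. openin X U \<and> x \<in> U \<longrightarrow> (\<exists>g\<in>carrier G. \<phi> g ` C \<subseteq> U))"

definition extremely_proximal ::
  "('g, 'm) monoid_scheme \<Rightarrow> 'x topology \<Rightarrow> ('g \<Rightarrow> 'x \<Rightarrow> 'x) \<Rightarrow> bool" where
  "extremely_proximal G X \<phi> \<longleftrightarrow>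
     (\<forall>C. closedin X C \<and> C \<noteq> topspace X \<longrightarrow> compressible G X \<phi> C)"

section \<open>Boundaries and the Furstenberg boundary\<close>

definition Prob :: "'x topology \<Rightarrow> 'x measure set" where
  "Prob X = {\<mu>. prob_space \<mu> \<and> sets \<mu> = sets (borel_on X) \<and>
     (\<forall>A\<in>sets \<mu>.
        emeasure \<mu> A = (SUP K\<in>{K. compactin X K \<and> K \<subseteq> A}. emeasure \<mu> K) \<and>
        emeasure \<mu> A = (INF U\<in>{U. openin X U \<and> A \<subseteq> U}. emeasure \<mu> U))}"

text \<open>The coarsest topology on \<open>Prob X\<close> making integration of every continuous real function
  continuous.\<close>

definition weak_star :: "'x topology \<Rightarrow> 'x measure topology" where
  "weak_star X = pullback_topology (Prob X)
     (\<lambda>\<mu>. \<lambda>f\<in>{f. continuous_map X euclideanreal f}. integral\<^sup>L \<mu> f)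
     (product_topology (\<lambda>_. euclideanreal) {f. continuous_map X euclideanreal f})"

definition strongly_proximal ::
  "('g, 'm) monoid_scheme \<Rightarrow> 'x topology \<Rightarrow> ('g \<Rightarrow> 'x \<Rightarrow> 'x) \<Rightarrow> bool" where
  "strongly_proximal G X \<phi> \<longleftrightarrow>
     (\<forall>\<mu>\<in>Prob X. \<exists>x\<in>topspace X.
        return (borel_on X) x \<in>
          weak_star X closure_of {distr \<mu> (borel_on X) (\<phi> g) | g. g \<in> carrier G})"

definition boundary ::
  "('g, 'm) monoid_scheme \<Rightarrow> 'g topology \<Rightarrow> 'x topology \<Rightarrow> ('g \<Rightarrow> 'x \<Rightarrow> 'x) \<Rightarrow> bool" where
  "boundary G T X \<phi> \<longleftrightarrow>
     compact_G_space G T X \<phi> \<and> minimal_action G X \<phi> \<and> strongly_proximal G X \<phi>"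

definition G_factor_map ::
  "('g, 'm) monoid_scheme \<Rightarrow> 'x topology \<Rightarrow> ('g \<Rightarrow> 'x \<Rightarrow> 'x) \<Rightarrow>
   'y topology \<Rightarrow> ('g \<Rightarrow> 'y \<Rightarrow> 'y) \<Rightarrow> ('x \<Rightarrow> 'y) \<Rightarrow> bool" where
  "G_factor_map G X \<phi> Y \<psi> f \<longleftrightarrow>
     continuous_map X Y f \<and> f ` topspace X = topspace Y \<and>
     (\<forall>g\<in>carrier G. \<forall>x\<in>topspace X. f (\<phi> g x) = \<psi> g (f x))"

text \<open>The universal boundary, up to isomorphism. Quantifying over boundaries whose points lie in
  \<^typ>\<open>'g set set\<close> loses nothing: if \<open>Y\<close> is any boundary and \<open>y\<^sub>0\<close> a point of it, then the orbit of
  \<open>y\<^sub>0\<close> is dense in the Hausdorff space \<open>Y\<close>, so that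
  \<open>y \<mapsto> {A. y \<in> closure (A y\<^sub>0)}\<close> (with \<open>A\<close> ranging over subsets of \<open>G\<close>) is injective, and \<open>Y\<close> can be
  transported along this injection. The space \<open>B\<close> itself may live in an arbitrary type.\<close>

definition Furstenberg_boundary ::
  "('g, 'm) monoid_scheme \<Rightarrow> 'g topology \<Rightarrow> 'x topology \<Rightarrow> ('g \<Rightarrow> 'x \<Rightarrow> 'x) \<Rightarrow> bool" where
  "Furstenberg_boundary G T B \<beta> \<longleftrightarrow>
     boundary G T B \<beta> \<and>
     (\<forall>(Y :: 'g set set topology) \<psi>.
        boundary G T Y \<psi> \<longrightarrow> (\<exists>f. G_factor_map G B \<beta> Y \<psi> f))"

section \<open>Co-amenability\<close>

definition locally_convex_space :: "'v::real_vector topology \<Rightarrow> bool" where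
  "locally_convex_space V \<longleftrightarrow>
     topspace V = UNIV \<and> Hausdorff_space V \<and>
     continuous_map (prod_topology V V) V (\<lambda>(x, y). x + y) \<and>
     continuous_map (prod_topology euclideanreal V) V (\<lambda>(c, x). c *\<^sub>R x) \<and>
     (\<forall>U. openin V U \<and> 0 \<in> U \<longrightarrow> (\<exists>W. openin V W \<and> convex W \<and> 0 \<in> W \<and> W \<subseteq> U))"

definition convex_compact_G_space ::
  "('g, 'm) monoid_scheme \<Rightarrow> 'g topology \<Rightarrow> 'v::real_vector topology \<Rightarrow> 'v set \<Rightarrow>
   ('g \<Rightarrow> 'v \<Rightarrow> 'v) \<Rightarrow> bool" where
  "convex_compact_G_space G T V K \<phi> \<longleftrightarrow>
     locally_convex_space V \<and> K \<noteq> {} \<and> compactin V K \<and> convex K \<and>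
     continuous_action G T (subtopology V K) \<phi> \<and>
     (\<forall>g\<in>carrier G. \<forall>x\<in>K. \<forall>y\<in>K. \<forall>t\<in>{0..1}.
        \<phi> g ((1 - t) *\<^sub>R x + t *\<^sub>R y) = (1 - t) *\<^sub>R \<phi> g x + t *\<^sub>R \<phi> g y)"

text \<open>The locally convex topology is arbitrary, but the underlying vector space is taken to be the
  real vector space with basis indexed by \<^typ>\<open>'g set set\<close>. This loses nothing: if some convex compact
  \<open>G\<close>-space has an \<open>L\<close>-fixed point \<open>x\<close> but no \<open>G\<close>-fixed point, then so does the closed convex hull
  of the orbit of \<open>x\<close>, and the linear span of that hull has dimension at most the cardinality of
  \<^typ>\<open>'g set set\<close> (if \<open>G\<close> is infinite, the hull has a dense subset of the cardinality of \<open>G\<close>; if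
  \<open>G\<close> is finite, the span is finite dimensional, of dimension at most the order of \<open>G\<close>). Hence the
  span embeds as a linear summand, and adding any locally convex topology on a complement extends
  its topology.\<close>

definition co_amenable ::
  "('g, 'm) monoid_scheme \<Rightarrow> 'g topology \<Rightarrow> 'g set \<Rightarrow> bool" where
  "co_amenable G T L \<longleftrightarrow>
     (\<forall>(V :: ('g set set \<Rightarrow>\<^sub>0 real) topology) K \<phi>.
        convex_compact_G_space G T V K \<phi> \<longrightarrow>
        (\<exists>x\<in>K. \<forall>g\<in>L. \<phi> g x = x) \<longrightarrow>
        (\<exists>x\<in>K. \<forall>g\<in>carrier G. \<phi> g x = x))"

section \<open>Group-theoretic notions\<close>

definition finitely_generated :: "('g, 'm) monoid_scheme \<Rightarrow> 'g set \<Rightarrow> bool" where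
  "finitely_generated G H \<longleftrightarrow> (\<exists>S. finite S \<and> S \<subseteq> H \<and> generate G S = H)"

definition finite_index :: "('g, 'm) monoid_scheme \<Rightarrow> 'g set \<Rightarrow> bool" where
  "finite_index G H \<longleftrightarrow> finite (rcosets\<^bsub>G\<^esub> H)"

definition abelianization :: "('g, 'm) monoid_scheme \<Rightarrow> 'g set monoid" where
  "abelianization G = G Mod (derived G (carrier G))"

end

theory Submission
 imports Defs
begin

text \<open>Write \<open>E\<close> for the subgroup of \<open>\<Gamma>\<close> generated by the elements that fix some non-empty open subset of
the extremely proximal space \<open>Z\<close>. A Baire argument identifies \<open>E\<close> with the envelope of the stabilizer URS of
\<open>Z\<close> (\<open>envelope_eq\<close>), and both assumptions on the envelope are used first of all through one consequence: a
\<open>\<Gamma>\<close>-invariant mean on \<open>\<Gamma>/E\<close>, by which every \<open>E\<close>-fixed point of an affine \<open>\<Gamma>\<close>-flow produces a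
\<open>\<Gamma>\<close>-fixed one. If \<open>\<Gamma>\<close> is finite, a lattice embedding forces \<open>G\<close>, hence both factors, to be
compact. If \<open>\<Gamma>\<close> is infinite, then \<open>E\<close> is not trivial, because \<open>\<Gamma>\<close> contains ping-pong pairs
and so carries no invariant mean itself.

The heart is that one of the projections \<open>p\<^sub>i : \<Gamma> \<rightarrow> G\<^sub>i\<close> has a kernel (\<open>not_both_injective\<close>). Suppose both are
injective. Choose an irreducible affine \<open>G\<^sub>i\<close>-flow \<open>K\<^sub>i\<close> inside the space of means on uniformly continuous functions
on \<open>G\<^sub>i\<close>. Three facts about these flows conflict.

\<^item> \<open>E\<close> fixes no point of \<open>K\<^sub>i\<close>. Otherwise \<open>\<Gamma>\<close> would fix a point, and averaging over \<open>G/\<Gamma>\<close> and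
using density, so would \<open>G\<^sub>i\<close>. But elements whose projection is close to the identity cannot move a given open set off itself
(\<open>near_identity_meets\<close>), so that a ping-pong group is discrete in \<open>G\<^sub>i\<close>; an invariant mean on \<open>G\<^sub>i\<close>
would restrict to it (\<open>discrete_subgroup_mean\<close>), which the paradoxical decomposition forbids.

\<^item> The elements acting trivially near a point \<open>z\<close> of \<open>Z\<close> have a common fixed point in each \<open>K\<^sub>i\<close>.
Finitely many of them lie in one point stabilizer of the Furstenberg boundary, as the two stabilizer URSs agree,
and such a stabilizer fixes a point in every affine flow: an irreducible flow contains a \<open>\<Gamma>\<close>-boundary
(\<open>Furstenberg_stabilizer_fixes\<close>). The pairs \<open>(x, y)\<close> in \<open>K\<^sub>1 \<times> K\<^sub>2\<close> fixed by all germs at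
some point \<open>z\<close> therefore form a non-empty \<open>\<Gamma>\<close>-invariant relation \<open>R\<close>.

\<^item> Irreducible flows concentrate orbits near a far point, even averaged over \<open>G/\<Gamma>\<close>, and as \<open>G\<close> has
dense image in the product this can be arranged in the two factors at once: for all \<open>a \<in> G\<^sub>1\<close>, \<open>b \<in> G\<^sub>2\<close> some pair
\<open>(x, y)\<close> in \<open>R\<close> has \<open>a x\<close> and \<open>b y\<close> close to the far points (\<open>product_concentration\<close>).

By the first fact there are elements \<open>s\<^sub>1\<close>, \<open>s\<^sub>2\<close>, trivial on open sets \<open>O\<^sub>1\<close>, \<open>O\<^sub>2\<close>, that fix
no point near the far points. Extreme proximality gives \<open>\<gamma>\<close> with \<open>\<gamma>(Z - O\<^sub>1) \<subseteq> O\<^sub>2\<close>, so every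
\<open>z\<close> lies in \<open>\<gamma> O\<^sub>1\<close> or \<open>O\<^sub>2\<close>, and each pair in \<open>R\<close> has its first component fixed by
\<open>\<gamma> s\<^sub>1 \<gamma>\<^sup>-\<^sup>1\<close> or its second by \<open>s\<^sub>2\<close>. This contradicts the third fact for
\<open>a = p\<^sub>1(\<gamma>)\<^sup>-\<^sup>1\<close> and \<open>b = 1\<close>.

So some \<open>n \<noteq> 1\<close> has \<open>p\<^sub>1(n) = 1\<close>, say. Commutators with \<open>n\<close> then show that \<open>p\<^sub>1(E)\<close> is abelian
(\<open>hom_kernel_envelope_commute\<close>). In (b) it follows that \<open>p\<^sub>1(E)\<close>, hence \<open>p\<^sub>1(\<Gamma>)\<close>, is finite,
and a factor in which the lattice has finite image is compact. In (a) finite generation of \<open>E\<close> makes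
\<open>p\<^sub>2\<close> injective with discrete image, and Poincare recurrence for the first factor acting on \<open>G/\<Gamma>\<close> shows
that this factor is compact.\<close>

section \<open>Compact convex sets in function spaces\<close>

abbreviation disc :: "('g, 'm) monoid_scheme => 'g topology" where
 "disc G \<equiv> discrete_topology (carrier G)"

text \<open>Flows are realized as sets of functions \<open>'i \<Rightarrow> real\<close> with the product topology, so that convexity, compactness and
duality are coordinatewise and no space of functionals is needed.\<close>
definition fconvex :: "('i => real) set => bool" where
 "fconvex K \<longleftrightarrow> (\<forall>x\<in>K. \<forall>y\<in>K. \<forall>t\<in>{0..1}. (\<lambda>i. (1 - t) * x i + t * y i)\<in>K)"

definition box_at :: "'i set => real => ('i => real) => ('i => real) set" where
 "box_at J e x = {y. \<forall>j\<in>J. \<bar>y j - x j\<bar> < e}"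

lemma Hausdorff_fun: "Hausdorff_space (euclidean :: ('i => 'b::t2_space) topology)"
proof -
 have "Hausdorff_space (product_topology (\<lambda>_. euclidean :: 'b topology) (UNIV :: 'i set))"
  unfolding Hausdorff_space_product_topology
  by (simp add: Hausdorff_space_def disjnt_def) (metis hausdorff)
 then show ?thesis by (simp only: euclidean_product_topology)
qed

lemma hausdorff_fun:
 fixes x y :: "'i => 'b::t2_space"
 assumes "x\<noteq>y"
 obtains U V where "open U" "open V" "x\<in>U" "y\<in>V" "U \<inter> V = {}"
proof -
 from assms obtain i where "x i\<noteq>y i" by blast
 from hausdorff[OF this] obtain U V where *: "open U" "open V" "x i\<in>U" "y i\<in>V" "U \<inter> V = {}"
  by blast
 have "open ((\<lambda>z :: 'i => 'b. z i) -` U)" "open ((\<lambda>z :: 'i => 'b. z i) -` V)"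
  by (rule open_vimage[OF *(1) continuous_on_product_coordinates],
    rule open_vimage[OF *(2) continuous_on_product_coordinates])
 moreover have "x\<in>(\<lambda>z. z i) -` U" "y\<in>(\<lambda>z. z i) -` V" "(\<lambda>z. z i) -` U \<inter> (\<lambda>z. z i) -` V = {}"
  using *(3-5) by auto
 ultimately show ?thesis by (rule that)
qed

lemma compact_fun_closed: "compact (K :: ('i => 'b::t2_space) set) ==> closed K"
 using compactin_imp_closedin[OF Hausdorff_fun] by (simp add: compactin_euclidean_iff)

lemma continuous_on_coord [continuous_intros]: "continuous_on S (\<lambda>x::'i => 'b::topological_space. x i)"
 by (rule continuous_on_product_coordinates[THEN continuous_on_subset]) simp

lemma open_box_at: "finite J ==> open (box_at J e x)"
proof -
 assume "finite J"
 have "box_at J e x = (\<Inter>j\<in>J. {y. \<bar>y j - x j\<bar> < e})" by (auto simp: box_at_def)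
 also have "open \<dots>"
  using \<open>finite J\<close> by (intro open_INT ballI open_Collect_less continuous_intros) auto
 finally show ?thesis .
qed

lemma box_at_self: "e > 0 ==> x\<in>box_at J e x"
 by (simp add: box_at_def)

lemma open_fun_box:
 fixes x :: "'i => real"
 assumes "open U" "x\<in>U"
 obtains J e where "finite J" "e > 0" "box_at J e x\<subseteq>U"
proof -
 have "openin (product_topology (\<lambda>i::'i. euclidean) UNIV) U"
  using assms(1) unfolding open_fun_def by simp
 from product_topology_open_contains_basis[OF this assms(2)]
 obtain X where X: "x\<in>Pi\<^sub>E UNIV X" "\<And>i. openin euclidean (X i)" "finite {i. X i\<noteq>topspace (euclidean::real topology)}"
  "Pi\<^sub>E UNIV X\<subseteq>U" by auto
 define J where "J = {i. X i\<noteq>UNIV}"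
 have fin: "finite J" using X(3) by (simp add: J_def)
 have "\<exists>e>0. \<forall>y. \<bar>y - x i\<bar> < e --> y\<in>X i" for i
 proof -
  have "open (X i)" "x i\<in>X i" using X(1,2) by (auto simp: PiE_iff)
  then obtain e where "e > 0" "ball (x i) e\<subseteq>X i" using open_contains_ball by blast
  then show ?thesis by (intro exI[of _ e]) (auto simp: subset_iff dist_real_def abs_minus_commute)
 qed
 then obtain f where f: "\<And>i. f i > 0" "\<And>i y. \<bar>y - x i\<bar> < f i ==> y\<in>X i" by metis
 define e where "e = (if J = {} then 1 else Min (f ` J))"
 have "e > 0" using fin f by (auto simp: e_def)
 moreover have "e\<le>f j" if "j\<in>J" for j using fin that by (auto simp: e_def)
 ultimately have "box_at J e x\<subseteq>U"
 proof -
  assume 1: "\<And>j. j\<in>J ==> e\<le>f j"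
  have "y\<in>Pi\<^sub>E UNIV X" if "y\<in>box_at J e x" for y
  proof -
   have "y i\<in>X i" for i
   proof (cases "i\<in>J")
    case True then show ?thesis using that 1[OF True] f(2)[of "y i" i] by (force simp: box_at_def)
   next
    case False then show ?thesis by (simp add: J_def)
   qed
   then show ?thesis by auto
  qed
  then show ?thesis using X(4) by blast
 qed
 then show ?thesis using that fin \<open>e > 0\<close> by blast
qed

text \<open>The Lebesgue number lemma for the product uniformity: halve the box that works at each point, extract a finite
subcover, and take all coordinates and the smallest radius that occur.\<close>
lemma Lebesgue_box:
 fixes K :: "('i => real) set"
 assumes "compact K" and cov: "\<And>x. x\<in>K ==> \<exists>U\<in>\<U>. open U \<and> x\<in>U"
 shows "\<exists>J e. finite J \<and> e > 0 \<and> (\<forall>x\<in>K. \<exists>U\<in>\<U>. box_at J e x\<subseteq>U)"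
proof -
 have "\<exists>J e U. finite J \<and> e > 0 \<and> U\<in>\<U> \<and> box_at J (2*e) x\<subseteq>U" if x: "x\<in>K" for x
 proof -
  obtain U where U: "U\<in>\<U>" "open U" "x\<in>U" using cov[OF x] by blast
  obtain J e where "finite J" "e > 0" "box_at J e x\<subseteq>U" using open_fun_box[OF U(2,3)] .
  then show ?thesis using U by (intro exI[of _ J] exI[of _ "e/2"] exI[of _ U]) auto
 qed
 then obtain J e U where JeU: "\<And>x. x\<in>K ==> finite (J x) \<and> e x > 0 \<and> U x\<in>\<U> \<and> box_at (J x) (2 * e x) x\<subseteq>U x"
  by metis
 have 1: "open (box_at (J x) (e x) x)" if "x\<in>K" for x
  using JeU[OF that] by (simp add: open_box_at)
 have 2: "K\<subseteq>(\<Union>x\<in>K. box_at (J x) (e x) x)"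
  using JeU box_at_self by fastforce
 obtain C' where C': "C'\<subseteq>K" "finite C'" "K\<subseteq>(\<Union>x\<in>C'. box_at (J x) (e x) x)"
  by (rule compactE_image[OF assms(1) 1 2]) auto
 define J' where "J' = (\<Union>x\<in>C'. J x)"
 define e' where "e' = (if C' = {} then 1 else Min (e ` C'))"
 have "finite J'" using C' JeU by (auto simp: J'_def)
 moreover have "e' > 0" using C' JeU by (auto simp: e'_def)
 moreover have "\<exists>U\<in>\<U>. box_at J' e' x\<subseteq>U" if "x\<in>K" for x
 proof -
  from that C'(3) obtain c where c: "c\<in>C'" "x\<in>box_at (J c) (e c) c" by blast
  have "e'\<le>e c" using c C' by (auto simp: e'_def)
  have "box_at J' e' x\<subseteq>box_at (J c) (2 * e c) c"
  proof
   fix y assume y: "y\<in>box_at J' e' x"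
   have "\<bar>y j - c j\<bar> < 2 * e c" if "j\<in>J c" for j
   proof -
    have "\<bar>y j - x j\<bar> < e c" using y that c \<open>e'\<le>e c\<close> by (force simp: box_at_def J'_def)
    moreover have "\<bar>x j - c j\<bar> < e c" using c that by (auto simp: box_at_def)
    ultimately show ?thesis by linarith
   qed
   then show "y\<in>box_at (J c) (2 * e c) c" by (auto simp: box_at_def)
  qed
  then show ?thesis using JeU c C' by blast
 qed
 ultimately show ?thesis by blast
qed

text \<open>Separation with finitely many coordinates. If \<open>b\<close> were outside \<open>K\<close>, some box around \<open>b\<close> would miss \<open>K\<close>; the point
\<open>p\<close> of \<open>K\<close> closest to \<open>b\<close> in the coordinates \<open>J\<close> of that box gives the separating functional \<open>p - b\<close>.\<close>
lemma HB_function_space: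
 fixes K :: "('i => real) set"
 assumes "compact K" "fconvex K" "K\<noteq>{}"
  and b: "\<And>J c d. finite J ==> (\<And>x. x\<in>K ==> d\<le>(\<Sum>j\<in>J. c j * x j)) ==> d\<le>(\<Sum>j\<in>J. c j * b j)"
 shows "b\<in>K"
proof (rule ccontr)
 assume "b\<notin>K"
 have "closed K" by (rule compact_fun_closed[OF assms(1)])
 then have "open (-K)" "b\<in>-K" using \<open>b\<notin>K\<close> by auto
 from open_fun_box[OF this] obtain J e where J: "finite J" "e > 0" "box_at J e b\<subseteq>- K" by metis
 define q where "q = (\<lambda>x. \<Sum>j\<in>J. (x j - b j)\<^sup>2)"
 have "continuous_on K q" unfolding q_def by (intro continuous_intros)
 from continuous_attains_inf[OF assms(1,3) this]
 obtain p where p: "p\<in>K" "\<And>y. y\<in>K ==> q p\<le>q y" by blast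
 define c where "c = (\<lambda>j. p j - b j)"
 have main: "(\<Sum>j\<in>J. c j * p j)\<le>(\<Sum>j\<in>J. c j * y j)" if y: "y\<in>K" for y
 proof -
  define A where "A = (\<Sum>j\<in>J. c j * (y j - p j))"
  define B where "B = (\<Sum>j\<in>J. (y j - p j)\<^sup>2)"
  have *: "0\<le>2 * A * t + B * t\<^sup>2" if t: "t\<in>{0..1}" for t
  proof -
   have "(\<lambda>i. (1 - t) * p i + t * y i)\<in>K" using assms(2) p(1) y t unfolding fconvex_def by blast
   from p(2)[OF this] have "q p\<le>(\<Sum>j\<in>J. ((1 - t) * p j + t * y j - b j)\<^sup>2)" by (simp add: q_def)
   also have "\<dots> = (\<Sum>j\<in>J. (p j - b j)\<^sup>2 + 2 * t * (c j * (y j - p j)) + t\<^sup>2 * (y j - p j)\<^sup>2)"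
    by (rule sum.cong) (auto simp: c_def power2_eq_square algebra_simps)
   also have "\<dots> = q p + 2 * A * t + B * t\<^sup>2"
    unfolding q_def A_def B_def sum.distrib sum_distrib_left [symmetric] by (simp add: mult.commute mult.left_commute)
   finally show ?thesis by simp
  qed
  have "B \<ge> 0" unfolding B_def by (intro sum_nonneg) auto
  have "A \<ge> 0"
  proof (rule ccontr)
   assume "\<not> A \<ge> 0"
   define t where "t = min 1 (-A / (B+1))"
   have t: "t\<in>{0..1}" "t > 0" using \<open>\<not> A \<ge> 0\<close> \<open>B \<ge> 0\<close> by (auto simp: t_def divide_simps)
   have "t\<le>-A/(B+1)" by (simp add: t_def)
   then have "t * (B+1)\<le>-A" using \<open>B \<ge> 0\<close> by (simp add: field_simps)
   then have "B * t\<le>- A" using t by (simp add: algebra_simps)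
   then have "2 * A + B * t < 0" using \<open>\<not> A \<ge> 0\<close> by linarith
   then have "t * (2 * A + B * t) < 0" using t by (simp add: mult_pos_neg)
   then show False using *[OF t(1)] by (simp add: algebra_simps power2_eq_square)
  qed
  then show ?thesis by (simp add: A_def sum_subtractf algebra_simps)
 qed
 from b[OF J(1) main] have "(\<Sum>j\<in>J. c j * p j)\<le>(\<Sum>j\<in>J. c j * b j)" .
 then have "(\<Sum>j\<in>J. c j * p j - c j * b j)\<le>0" by (simp add: sum_subtractf)
 then have "(\<Sum>j\<in>J. c j * c j)\<le>0" by (simp add: c_def right_diff_distrib)
 moreover have "(\<Sum>j\<in>J. c j * c j) \<ge> 0" by (intro sum_nonneg) auto
 ultimately have "(\<Sum>j\<in>J. c j * c j) = 0" by linarith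
 then have "\<And>j. j\<in>J ==> c j * c j = 0"
  using J(1) by (subst (asm) sum_nonneg_eq_0_iff) auto
 then have "p\<in>box_at J e b" using J(2) by (auto simp: box_at_def c_def)
 then show False using J p by blast
qed

lemma compact_coord_bounded:
 fixes K :: "('i => real) set"
 assumes "compact K" obtains B where "\<And>x. x\<in>K ==> \<bar>x i\<bar>\<le>B"
proof -
 have "compact ((\<lambda>x. x i) ` K)" by (intro compact_continuous_image assms continuous_intros)
 then have "bounded ((\<lambda>x. x i) ` K)" by (rule compact_imp_bounded)
 then show ?thesis using that by (auto simp: bounded_iff)
qed

text \<open>A functional bounded below on \<open>K\<close> keeps its bound under integration, so \<open>HB_function_space\<close> applies.\<close>
lemma barycenter_in:
 fixes K :: "('i => real) set"
 assumes "compact K" "fconvex K" "prob_space N"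
  and u: "\<And>w. w\<in>space N ==> u w\<in>K" "\<And>i. (\<lambda>w. u w i)\<in>borel_measurable N"
 shows "(\<lambda>i. \<integral>w. u w i \<partial>N)\<in>K" and "\<And>i. integrable N (\<lambda>w. u w i)"
proof -
 interpret prob_space N by fact
 show int: "integrable N (\<lambda>w. u w i)" for i
 proof -
  obtain B where B: "\<And>x. x\<in>K ==> \<bar>x i\<bar>\<le>B" using compact_coord_bounded[OF assms(1), where i=i] by blast
  show ?thesis by (rule integrable_const_bound[of _ B]) (use u B in auto)
 qed
 show "(\<lambda>i. \<integral>w. u w i \<partial>N)\<in>K"
 proof (rule HB_function_space[OF assms(1,2)])
  show "K\<noteq>{}" using u(1) not_empty by blast
  fix J c and d :: real assume J: "finite (J::'i set)" "\<And>x. x\<in>K ==> d\<le>(\<Sum>j\<in>J. c j * x j)"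
  have "d = (\<integral>w. d \<partial>N)" by (simp add: prob_space)
  also have "\<dots>\<le>(\<integral>w. (\<Sum>j\<in>J. c j * u w j) \<partial>N)"
   by (rule integral_mono) (use int J u in auto)
  also have "\<dots> = (\<Sum>j\<in>J. c j * (\<integral>w. u w j \<partial>N))"
   using int by (subst Bochner_Integration.integral_sum) auto
  finally show "d\<le>(\<Sum>j\<in>J. c j * (\<integral>w. u w j \<partial>N))" .
 qed
qed

section \<open>Irreducible affine flows and concentration of orbits\<close>

text \<open>The group acts on the index set by \<open>\<sigma>\<close> and on functions by \<open>x \<circ> \<sigma> g\<close>. Since composition reverses the order,
\<open>\<sigma>\<close> is required to be a right action; the action on \<open>K\<close> is then a left action, affine and continuous by construction.\<close>
definition affine_flow :: "('h, 'm) monoid_scheme => ('h => 'i => 'i) => ('i => real) set => bool" where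
 "affine_flow H \<sigma> K \<longleftrightarrow>
  (\<forall>g\<in>carrier H. \<forall>h\<in>carrier H. \<forall>i. \<sigma> (g \<otimes>\<^bsub>H\<^esub> h) i = \<sigma> h (\<sigma> g i)) \<and>
  (\<forall>i. \<sigma> \<one>\<^bsub>H\<^esub> i = i) \<and> compact K \<and> fconvex K \<and> K\<noteq>{} \<and>
  (\<forall>g\<in>carrier H. \<forall>x\<in>K. x \<circ> \<sigma> g\<in>K)"

definition irreducible_flow :: "('h, 'm) monoid_scheme => ('h => 'i => 'i) => ('i => real) set => bool" where
 "irreducible_flow H \<sigma> K \<longleftrightarrow>
  affine_flow H \<sigma> K \<and> (\<forall>L\<subseteq>K. affine_flow H \<sigma> L --> L = K)"

lemma affine_flowD:
 assumes "affine_flow H \<sigma> K"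
 shows "\<And>g h i. g\<in>carrier H ==> h\<in>carrier H ==> \<sigma> (g \<otimes>\<^bsub>H\<^esub> h) i = \<sigma> h (\<sigma> g i)"
  and "\<And>i. \<sigma> \<one>\<^bsub>H\<^esub> i = i" and "compact K" "fconvex K" "K\<noteq>{}"
  and "\<And>g x. g\<in>carrier H ==> x\<in>K ==> x \<circ> \<sigma> g\<in>K"
 using assms unfolding affine_flow_def by auto

text \<open>Zorn's lemma along chains of compact sets, whose intersection is not empty.\<close>
lemma minimal_compact_subset:
 fixes K :: "('i => real) set"
 assumes "P K" and cpt: "\<And>L. P L ==> compact L \<and> L\<noteq>{}"
  and inter: "\<And>C. C\<noteq>{} ==> (\<And>L. L\<in>C ==> P L) ==> \<Inter>C\<noteq>{} ==> P (\<Inter>C)"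
 obtains M where "M\<subseteq>K" "P M" "\<And>L. L\<subseteq>M ==> P L ==> L = M"
proof -
 define A where "A = {L. P L \<and> L\<subseteq>K}"
 have "\<exists>M\<in>uminus ` A. \<forall>X\<in>uminus ` A. M\<subseteq>X --> X = M"
 proof (rule subset_Zorn)
  fix C assume C: "subset.chain (uminus ` A) C"
  show "\<exists>U\<in>uminus ` A. \<forall>X\<in>C. X\<subseteq>U"
  proof (cases "C = {}")
   case True
   have "K\<in>A" using assms(1) by (simp add: A_def)
   then show ?thesis using True by auto
  next
   case False
   define D where "D = uminus ` C"
   have sub: "D\<subseteq>A" using C unfolding D_def subset.chain_def by auto
   have ne: "D\<noteq>{}" using False by (simp add: D_def)
   have lin: "X\<subseteq>Y \<or> Y\<subseteq>X" if "X\<in>D" "Y\<in>D" for X Y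
   proof -
    from that have "-X\<in>C" "-Y\<in>C" by (auto simp: D_def)
    then have "-X\<subseteq>-Y \<or> -Y\<subseteq>-X" using C unfolding subset.chain_def by blast
    then show ?thesis by auto
   qed
   have fin: "F\<noteq>{} ==> \<Inter>F\<in>D" if "finite F" "F\<subseteq>D" for F
    using that
   proof (induction F rule: finite_induct)
    case (insert X F)
    show ?case
    proof (cases "F = {}")
     case True then show ?thesis using insert by auto
    next
     case False
     then have "\<Inter>F\<in>D" "X\<in>D" using insert by auto
     from lin[OF this] show ?thesis
      using \<open>\<Inter>F\<in>D\<close> \<open>X\<in>D\<close> by (auto simp: Int_absorb1 Int_absorb2)
    qed
   qed simp
   obtain L0 where L0: "L0\<in>D" using ne by blast
   have PD: "P L" if "L\<in>D" for L using sub that by (auto simp: A_def)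
   have "L0 \<inter> \<Inter>D\<noteq>{}"
   proof (rule compact_imp_fip)
    show "compact L0" using cpt PD L0 by blast
    show "closed T" if "T\<in>D" for T using cpt PD compact_fun_closed that by blast
    fix F' assume F: "finite F'" "F'\<subseteq>D"
    have "\<Inter>(insert L0 F')\<in>D" using fin[of "insert L0 F'"] F L0 by auto
    then have "\<Inter>(insert L0 F')\<noteq>{}" using cpt PD by blast
    then show "L0 \<inter> \<Inter>F'\<noteq>{}" by simp
   qed
   then have "\<Inter>D\<noteq>{}" by blast
   then have "P (\<Inter>D)" using inter[OF ne PD] by blast
   moreover have "\<Inter>D\<subseteq>K" using L0 sub by (auto simp: A_def)
   ultimately have "- \<Inter>D\<in>uminus ` A" by (auto simp: A_def)
   moreover have "X\<subseteq>- \<Inter>D" if "X\<in>C" for X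
   proof -
    have "-X\<in>D" using that by (simp add: D_def)
    then show ?thesis by blast
   qed
   ultimately show ?thesis by blast
  qed
 qed
 then obtain M where M: "M\<in>A" "\<And>X. X\<in>A ==> - M\<subseteq>- X ==> - X = - M" by auto
 have "L = M" if "L\<subseteq>M" "P L" for L
 proof -
  have "L\<in>A" using that M(1) by (auto simp: A_def)
  then have "- L = - M" using M(2) that by auto
  then show ?thesis by auto
 qed
 then show ?thesis using that[of M] M(1) by (auto simp: A_def)
qed

lemma irreducible_exists:
 assumes "affine_flow H \<sigma> K"
 obtains M where "M\<subseteq>K" "irreducible_flow H \<sigma> M"
proof -
 obtain M where M: "M\<subseteq>K" "affine_flow H \<sigma> M" "\<And>L. L\<subseteq>M ==> affine_flow H \<sigma> L ==> L = M"
 proof (rule minimal_compact_subset[where P = "affine_flow H \<sigma>" and K = K])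
  show "compact L \<and> L\<noteq>{}" if "affine_flow H \<sigma> L" for L using affine_flowD[OF that] by auto
  fix C assume C: "C\<noteq>{}" "\<And>L. L\<in>C ==> affine_flow H \<sigma> L" "\<Inter>C\<noteq>{}"
  have 1: "compact (\<Inter>C)"
  proof -
   obtain L where L: "L\<in>C" using C(1) by blast
   have "closed (\<Inter>C)" using C(2) affine_flowD(3) compact_fun_closed by (metis closed_Inter)
   then have "compact (L \<inter> \<Inter>C)" using affine_flowD(3)[OF C(2)[OF L]] by (rule compact_Int_closed[rotated])
   moreover have "L \<inter> \<Inter>C = \<Inter>C" using L by blast
   ultimately show ?thesis by simp
  qed
  have 2: "fconvex (\<Inter>C)"
   using C(2) unfolding affine_flow_def fconvex_def by blast
  show "affine_flow H \<sigma> (\<Inter>C)"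
   using C 1 2 unfolding affine_flow_def by blast
 qed (use assms in auto)
 then show ?thesis using that unfolding irreducible_flow_def by blast
qed

text \<open>A point of \<open>K\<close> farthest from the origin in the coordinates \<open>J\<close>. It plays the role of an exposed point: the
half-space through it orthogonal to it cuts off an arbitrarily small slice of \<open>K\<close>.\<close>
definition far_point :: "('i => real) set => 'i set => 'i => real" where
 "far_point K J = (SOME p. p\<in>K \<and> (\<forall>y\<in>K. (\<Sum>j\<in>J. (y j)\<^sup>2)\<le>(\<Sum>j\<in>J. (p j)\<^sup>2)))"

lemma far_point:
 assumes "compact K" "K\<noteq>{}"
 shows "far_point K J\<in>K" "\<And>y. y\<in>K ==> (\<Sum>j\<in>J. (y j)\<^sup>2)\<le>(\<Sum>j\<in>J. (far_point K J j)\<^sup>2)"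
proof -
 have "continuous_on K (\<lambda>x. \<Sum>j\<in>J. (x j)\<^sup>2)" by (intro continuous_intros)
 from continuous_attains_sup[OF assms this]
 have "\<exists>p. p\<in>K \<and> (\<forall>y\<in>K. (\<Sum>j\<in>J. (y j)\<^sup>2)\<le>(\<Sum>j\<in>J. (p j)\<^sup>2))" by blast
 from someI_ex[OF this] show "far_point K J\<in>K" "\<And>y. y\<in>K ==> (\<Sum>j\<in>J. (y j)\<^sup>2)\<le>(\<Sum>j\<in>J. (far_point K J j)\<^sup>2)"
  unfolding far_point_def by auto
qed

text \<open>With \<open>p\<close> the far point, expand \<open>|x - p|\<^sup>2 = |x|\<^sup>2 - 2 <p,x> + |p|\<^sup>2 \<le> 2 (H - <p,x>)\<close>.\<close>
lemma far_point_slice: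
 assumes K: "compact K" "K\<noteq>{}" and x: "x\<in>K" and e: "e > 0" "finite J"
 defines "p \<equiv> far_point K J"
 defines "H \<equiv> (\<Sum>j\<in>J. p j * p j)"
 shows "(\<Sum>j\<in>J. p j * x j)\<le>H"
  and "H - e\<^sup>2 / 2 < (\<Sum>j\<in>J. p j * x j) ==> x\<in>box_at J e p"
proof -
 have q: "(\<Sum>j\<in>J. (x j)\<^sup>2)\<le>H"
  using far_point(2)[OF K x, of J] by (simp add: H_def p_def power2_eq_square)
 have d: "(\<Sum>j\<in>J. (x j - p j)\<^sup>2) = (\<Sum>j\<in>J. (x j)\<^sup>2) + H - 2 * (\<Sum>j\<in>J. p j * x j)"
  unfolding H_def by (simp add: power2_eq_square algebra_simps sum.distrib sum_subtractf sum_distrib_left)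
 have "(\<Sum>j\<in>J. (x j - p j)\<^sup>2) \<ge> 0" by (intro sum_nonneg) auto
 then show "(\<Sum>j\<in>J. p j * x j)\<le>H" using d q by linarith
 assume *: "H - e\<^sup>2 / 2 < (\<Sum>j\<in>J. p j * x j)"
 then have s: "(\<Sum>j\<in>J. (x j - p j)\<^sup>2) < e\<^sup>2" using d q by linarith
 have "\<bar>x j - p j\<bar> < e" if "j\<in>J" for j
 proof -
  have "(x j - p j)\<^sup>2\<le>(\<Sum>j\<in>J. (x j - p j)\<^sup>2)" by (rule member_le_sum) (use that e in auto)
  then have "(x j - p j)\<^sup>2 < e\<^sup>2" using s by linarith
  then show ?thesis using e by (metis abs_le_square_iff abs_of_pos linorder_not_less)
 qed
 then show "x\<in>box_at J e p" by (simp add: box_at_def)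
qed

text \<open>The points whose whole orbit satisfies a weak linear inequality form a closed convex invariant set, which in an
irreducible flow is empty or everything.\<close>
lemma irreducible_sup:
 assumes "group H" "irreducible_flow H \<sigma> K" "x\<in>K" "p\<in>K" "d > 0" "finite J"
 shows "\<exists>g\<in>carrier H. (\<Sum>j\<in>J. c j * p j) - d < (\<Sum>j\<in>J. c j * (x \<circ> \<sigma> g) j)"
proof (rule ccontr)
 interpret group H by fact
 assume neg: "\<not> ?thesis"
 define r where "r = (\<Sum>j\<in>J. c j * p j) - d"
 define L where "L = {y\<in>K. \<forall>g\<in>carrier H. (\<Sum>j\<in>J. c j * (y (\<sigma> g j)))\<le>r}"
 have fl: "affine_flow H \<sigma> K" using assms(2) by (simp add: irreducible_flow_def)
 note K = affine_flowD[OF fl]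
 have "x\<in>L" using neg assms(3) by (auto simp: L_def r_def not_less)
 have "affine_flow H \<sigma> L" unfolding affine_flow_def
 proof (intro conjI ballI allI)
  show "L\<noteq>{}" using \<open>x\<in>L\<close> by blast
  have "closed {y. (\<Sum>j\<in>J. c j * (y (\<sigma> g j)))\<le>r}" for g
   by (intro closed_Collect_le continuous_intros)
  then have "closed (\<Inter>g\<in>carrier H. {y. (\<Sum>j\<in>J. c j * (y (\<sigma> g j)))\<le>r})" by blast
  then have "compact (K \<inter> (\<Inter>g\<in>carrier H. {y. (\<Sum>j\<in>J. c j * (y (\<sigma> g j)))\<le>r}))"
   using K(3) by (rule compact_Int_closed[rotated])
  also have "K \<inter> (\<Inter>g\<in>carrier H. {y. (\<Sum>j\<in>J. c j * (y (\<sigma> g j)))\<le>r}) = L"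
   by (auto simp: L_def)
  finally show "compact L" .
  show "fconvex L" unfolding fconvex_def
  proof (intro ballI)
   fix y z t assume yz: "y\<in>L" "z\<in>L" and t: "t\<in>{0..1::real}"
   have "(\<Sum>j\<in>J. c j * ((1 - t) * y (\<sigma> g j) + t * z (\<sigma> g j)))\<le>r" if g: "g\<in>carrier H" for g
   proof -
    have "(\<Sum>j\<in>J. c j * ((1 - t) * y (\<sigma> g j) + t * z (\<sigma> g j))) =
     (1 - t) * (\<Sum>j\<in>J. c j * y (\<sigma> g j)) + t * (\<Sum>j\<in>J. c j * z (\<sigma> g j))"
     by (simp add: sum_distrib_left sum.distrib [symmetric] algebra_simps)
    also have "\<dots>\<le>(1 - t) * r + t * r"
     using yz t g by (intro add_mono mult_left_mono) (auto simp: L_def)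
    finally show ?thesis by (simp add: algebra_simps)
   qed
   moreover have "(\<lambda>i. (1 - t) * y i + t * z i)\<in>K"
    using K(4) yz t unfolding fconvex_def L_def by blast
   ultimately show "(\<lambda>i. (1 - t) * y i + t * z i)\<in>L" by (simp add: L_def)
  qed
  fix g y assume g: "g\<in>carrier H" and y: "y\<in>L"
  have "(\<Sum>j\<in>J. c j * (y (\<sigma> g (\<sigma> h j))))\<le>r" if h: "h\<in>carrier H" for h
  proof -
   have "(\<Sum>j\<in>J. c j * (y (\<sigma> (h \<otimes>\<^bsub>H\<^esub> g) j)))\<le>r" using y g h by (simp add: L_def)
   then show ?thesis using K(1)[OF h g] by simp
  qed
  then show "y \<circ> \<sigma> g\<in>L" using y K(6)[OF g] by (simp add: L_def)
 qed (use K in auto)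
 then have "L = K" using assms(2) unfolding irreducible_flow_def by (auto simp: L_def)
 then have "(\<Sum>j\<in>J. c j * (p (\<sigma> \<one>\<^bsub>H\<^esub> j)))\<le>r" using assms(4) by (auto simp: L_def)
 then show False using K(2) assms(5) by (simp add: r_def)
qed

lemma box_event_sets:
 assumes "finite J" "\<And>i. (\<lambda>w. u w i)\<in>borel_measurable N"
 shows "{w\<in>space N. u w \<circ> \<sigma>\<notin>box_at J e p}\<in>sets N"
proof -
 have "{w\<in>space N. \<forall>j\<in>J. \<bar>u w (\<sigma> j) - p j\<bar> < e}\<in>sets N"
 proof (rule sets.sets_Collect_finite_All[OF _ assms(1)])
  fix j
  have "(\<lambda>w. \<bar>u w (\<sigma> j) - p j\<bar>)\<in>borel_measurable N" using assms(2) by measurable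
  then show "{w\<in>space N. \<bar>u w (\<sigma> j) - p j\<bar> < e}\<in>sets N" by measurable
 qed
 then have "space N - {w\<in>space N. \<forall>j\<in>J. \<bar>u w (\<sigma> j) - p j\<bar> < e}\<in>sets N" by (rule sets.compl_sets)
 also have "space N - {w\<in>space N. \<forall>j\<in>J. \<bar>u w (\<sigma> j) - p j\<bar> < e} = {w\<in>space N. u w \<circ> \<sigma>\<notin>box_at J e p}"
  by (auto simp: box_at_def)
 finally show ?thesis .
qed

text \<open>Move the barycenter of the pushed-forward measure into the thin slice at the far point. The functional defining the
slice is at most \<open>H\<close> on all of \<open>K\<close>, so by Markov's inequality most of the mass lies in the slice too.\<close>
lemma concentration:
 assumes "group H" "irreducible_flow H \<sigma> K" "finite J" "e > 0" "\<eta> > 0"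
  and "prob_space N" and u: "\<And>w. w\<in>space N ==> u w\<in>K" "\<And>i. (\<lambda>w. u w i)\<in>borel_measurable N"
 shows "\<exists>g\<in>carrier H. measure N {w\<in>space N. u w \<circ> \<sigma> g\<notin>box_at J e (far_point K J)}\<le>\<eta>"
proof -
 interpret N: prob_space N by fact
 have fl: "affine_flow H \<sigma> K" using assms(2) by (simp add: irreducible_flow_def)
 note K = affine_flowD[OF fl]
 define p where "p = far_point K J"
 have p: "p\<in>K" unfolding p_def by (rule far_point) (use K in auto)
 define R where "R = (\<Sum>j\<in>J. p j * p j)"
 \<comment> \<open>Markov: mass at most \<open>d / (e\<^sup>2/2) = \<eta>\<close> lies outside the slice.\<close>
 define d where "d = \<eta> * (e\<^sup>2 / 2)"
 have "d > 0" using assms by (simp add: d_def)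
 note bar = barycenter_in[OF K(3,4) assms(6) u]
 obtain g where g: "g\<in>carrier H" "R - d < (\<Sum>j\<in>J. p j * ((\<lambda>i. \<integral>w. u w i \<partial>N) \<circ> \<sigma> g) j)"
  using irreducible_sup[OF assms(1,2) bar(1) p \<open>d > 0\<close> assms(3)] unfolding R_def by blast
 define f where "f = (\<lambda>w. R - (\<Sum>j\<in>J. p j * (u w \<circ> \<sigma> g) j))"
 have int: "integrable N f" unfolding f_def using bar(2) by auto
 have nonneg: "f w \<ge> 0" if "w\<in>space N" for w
  using far_point_slice(1)[OF K(3,5) K(6)[OF g(1) u(1)[OF that]] assms(4,3)]
  by (simp add: f_def R_def p_def)
 have "(\<integral>w. f w \<partial>N) = R - (\<Sum>j\<in>J. p j * (\<integral>w. u w (\<sigma> g j) \<partial>N))"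
  unfolding f_def using bar(2) by (simp add: N.prob_space)
 also have "\<dots> < d" using g(2) by simp
 finally have less: "(\<integral>w. f w \<partial>N) < d" .
 have "measure N {w\<in>space N. f w \<ge> e\<^sup>2 / 2}\<le>(\<integral>w. f w \<partial>N) / (e\<^sup>2 / 2)"
  by (rule integral_Markov_inequality_measure[where A = "{}"]) (use int nonneg assms in auto)
 also have "\<dots>\<le>\<eta>" using less assms by (simp add: d_def field_simps)
 finally have 1: "measure N {w\<in>space N. f w \<ge> e\<^sup>2 / 2}\<le>\<eta>" .
 have "measure N {w\<in>space N. u w \<circ> \<sigma> g\<notin>box_at J e p}\<le>measure N {w\<in>space N. f w \<ge> e\<^sup>2 / 2}"
 proof (rule N.finite_measure_mono)
  show "{w\<in>space N. f w \<ge> e\<^sup>2 / 2}\<in>sets N" using int by measurable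
  show "{w\<in>space N. u w \<circ> \<sigma> g\<notin>box_at J e p}\<subseteq>{w\<in>space N. f w \<ge> e\<^sup>2 / 2}"
  proof clarify
   fix w assume w: "w\<in>space N" "u w \<circ> \<sigma> g\<notin>box_at J e p"
   have "\<not> R - e\<^sup>2 / 2 < (\<Sum>j\<in>J. p j * (u w \<circ> \<sigma> g) j)"
    using far_point_slice(2)[OF K(3,5) K(6)[OF g(1) u(1)[OF w(1)]] assms(4,3)] w(2)
    unfolding p_def R_def by blast
   then show "e\<^sup>2 / 2\<le>f w" by (simp add: f_def)
  qed
 qed
 then show ?thesis using 1 g(1) unfolding p_def by (meson order_trans)
qed

section \<open>Regular measures and boundaries\<close>

lemma space_borel_on [simp]: "space (borel_on X) = topspace X"
 by (simp add: borel_on_def space_measure_of_conv)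

lemma sets_borel_on: "sets (borel_on X) = sigma_sets (topspace X) {U. openin X U}"
 unfolding borel_on_def by (rule sets_measure_of) (auto dest: openin_subset)

lemma openin_borel_on: "openin X U ==> U\<in>sets (borel_on X)"
 by (simp add: sets_borel_on)

lemma closedin_borel_on: "closedin X U ==> U\<in>sets (borel_on X)"
proof -
 assume U: "closedin X U"
 then have "topspace X - U\<in>sets (borel_on X)" by (intro openin_borel_on) auto
 then have "topspace X - (topspace X - U)\<in>sets (borel_on X)"
  using sets.compl_sets[of "topspace X - U" "borel_on X"] by simp
 then show ?thesis using closedin_subset[OF U] by (simp add: double_diff)
qed

lemma continuous_map_measurable:
 assumes "continuous_map X Y f"
 shows "f\<in>measurable (borel_on X) (borel_on Y)"
proof -
 have "f\<in>measurable (borel_on X) (sigma (topspace Y) {U. openin Y U})"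
 proof (rule measurable_sigma_sets[OF sets_measure_of])
  show "{U. openin Y U}\<subseteq>Pow (topspace Y)" by (auto dest: openin_subset)
  then show "{U. openin Y U}\<subseteq>Pow (topspace Y)" .
  show "f\<in>space (borel_on X) \<rightarrow> topspace Y" using assms by (auto simp: continuous_map_def)
  fix A assume "A\<in>{U. openin Y U}"
  then have "openin X {x\<in>topspace X. f x\<in>A}" using assms by (auto simp: continuous_map_def)
  moreover have "f -` A \<inter> space (borel_on X) = {x\<in>topspace X. f x\<in>A}" by auto
  ultimately show "f -` A \<inter> space (borel_on X)\<in>sets (borel_on X)" by (simp add: openin_borel_on)
 qed
 then show ?thesis by (simp add: borel_on_def)
qed

lemma continuous_map_borel_measurable:
 assumes "continuous_map X (euclidean :: 'b::topological_space topology) f" "sets M = sets (borel_on X)"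
 shows "f\<in>borel_measurable M"
proof (rule borel_measurableI)
 fix S :: "'b set" assume "open S"
 then have "openin X {x\<in>topspace X. f x\<in>S}" using assms by (auto simp: continuous_map_def)
 moreover have "f -` S \<inter> space M = {x\<in>topspace X. f x\<in>S}"
  using sets_eq_imp_space_eq[OF assms(2)] by auto
 ultimately show "f -` S \<inter> space M\<in>sets M" using assms(2) by (simp add: openin_borel_on)
qed

lemma ProbD:
 assumes "\<mu>\<in>Prob X"
 shows "prob_space \<mu>" "sets \<mu> = sets (borel_on X)" "space \<mu> = topspace X"
 using assms sets_eq_imp_space_eq[of \<mu> "borel_on X"] by (auto simp: Prob_def)

lemma return_in_Prob:
 assumes "Hausdorff_space X" and x: "x\<in>topspace X"
 shows "return (borel_on X) x\<in>Prob X"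
proof -
 let ?r = "return (borel_on X) x"
 have comp: "K\<in>sets (borel_on X)" if "compactin X K" for K
  using that assms by (intro closedin_borel_on compactin_imp_closedin)
 have "emeasure ?r A = (SUP K\<in>{K. compactin X K \<and> K\<subseteq>A}. emeasure ?r K)" if A: "A\<in>sets ?r" for A
 proof (rule antisym)
  show "(SUP K\<in>{K. compactin X K \<and> K\<subseteq>A}. emeasure ?r K)\<le>emeasure ?r A"
   using A by (intro SUP_least emeasure_mono) auto
  show "emeasure ?r A\<le>(SUP K\<in>{K. compactin X K \<and> K\<subseteq>A}. emeasure ?r K)"
  proof (cases "x\<in>A")
   case True
   have "compactin X {x}" using x by (simp add: compactin_sing)
   then have "emeasure ?r {x}\<le>(SUP K\<in>{K. compactin X K \<and> K\<subseteq>A}. emeasure ?r K)"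
    using True by (intro SUP_upper) auto
   then show ?thesis using True A comp[OF \<open>compactin X {x}\<close>] by simp
  next
   case False then show ?thesis using A by simp
  qed
 qed
 moreover have "emeasure ?r A = (INF U\<in>{U. openin X U \<and> A\<subseteq>U}. emeasure ?r U)" if A: "A\<in>sets ?r" for A
 proof (rule antisym)
  have sub: "A\<subseteq>topspace X" using sets.sets_into_space[OF A] by simp
  show "emeasure ?r A\<le>(INF U\<in>{U. openin X U \<and> A\<subseteq>U}. emeasure ?r U)"
   by (intro INF_greatest emeasure_mono) (auto simp: openin_borel_on)
  show "(INF U\<in>{U. openin X U \<and> A\<subseteq>U}. emeasure ?r U)\<le>emeasure ?r A"
  proof (cases "x\<in>A")
   case True
   have "(INF U\<in>{U. openin X U \<and> A\<subseteq>U}. emeasure ?r U)\<le>emeasure ?r (topspace X)"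
    using sub by (intro INF_lower) auto
   also have "\<dots>\<le>emeasure ?r A" using True A x by (simp add: openin_borel_on indicator_def)
   finally show ?thesis .
  next
   case False
   have cl: "closedin X {x}" using assms by (simp add: compactin_imp_closedin compactin_sing)
   have "(INF U\<in>{U. openin X U \<and> A\<subseteq>U}. emeasure ?r U)\<le>emeasure ?r (topspace X - {x})"
    using sub False cl by (intro INF_lower) auto
   also have "\<dots> = 0"
    using openin_borel_on[OF openin_diff[OF openin_topspace cl]] by simp
   finally show ?thesis by simp
  qed
 qed
 ultimately show ?thesis
  unfolding Prob_def using x by (simp add: prob_space_return)
qed

lemma distr_homeo_in_Prob:
 assumes H: "Hausdorff_space X" and \<mu>: "\<mu>\<in>Prob X"
  and f: "continuous_map X X f" and g: "continuous_map X X g"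
  and gf: "\<And>x. x\<in>topspace X ==> g (f x) = x" and fg: "\<And>x. x\<in>topspace X ==> f (g x) = x"
 shows "distr \<mu> (borel_on X) f\<in>Prob X"
proof -
 let ?d = "distr \<mu> (borel_on X) f"
 note P = ProbD[OF \<mu>]
 have hom: "homeomorphic_map X X f" "homeomorphic_map X X g"
  using f g gf fg by (auto simp: homeomorphic_map_maps homeomorphic_maps_def)
 have reg: "emeasure \<mu> A = (SUP K\<in>{K. compactin X K \<and> K\<subseteq>A}. emeasure \<mu> K)"
  "emeasure \<mu> A = (INF U\<in>{U. openin X U \<and> A\<subseteq>U}. emeasure \<mu> U)" if "A\<in>sets (borel_on X)" for A
  using \<mu> that P(2) unfolding Prob_def by auto
 have meas: "f\<in>measurable \<mu> (borel_on X)"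
  using continuous_map_measurable[OF f] P(2) by (auto cong: measurable_cong_sets)
 have vim: "f -` A \<inter> topspace X = g ` A" if "A\<subseteq>topspace X" for A
  using that gf fg continuous_map_image_subset_topspace[OF g] by (force simp: image_iff)
 have em: "emeasure ?d A = emeasure \<mu> (g ` A)" if "A\<in>sets (borel_on X)" for A
  using meas that vim sets.sets_into_space[OF that] by (simp add: emeasure_distr P(3))
 have gfi: "g ` (f ` A) = A" and fgi: "f ` (g ` A) = A" if "A\<subseteq>topspace X" for A using that gf fg by force+
 have c: "compactin X (f ` K)" "compactin X (g ` K)" "K\<subseteq>topspace X" "K\<in>sets (borel_on X)" if "compactin X K" for K
  using that image_compactin f g H by (auto dest: compactin_subset_topspace intro: closedin_borel_on compactin_imp_closedin)
 have o: "openin X (f ` U)" "openin X (g ` U)" "U\<subseteq>topspace X" if "openin X U" for U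
  using that homeomorphic_imp_open_map[OF hom(1)] homeomorphic_imp_open_map[OF hom(2)]
  by (auto simp: open_map_def dest: openin_subset)
 have *: "emeasure ?d A = (SUP K\<in>{K. compactin X K \<and> K\<subseteq>A}. emeasure ?d K) \<and>
  emeasure ?d A = (INF U\<in>{U. openin X U \<and> A\<subseteq>U}. emeasure ?d U)" if A: "A\<in>sets (borel_on X)" for A
 proof -
  have sub: "A\<subseteq>topspace X" using sets.sets_into_space[OF A] by simp
  have gA: "g ` A\<in>sets (borel_on X)" using measurable_sets[OF meas A] vim[OF sub] P by simp
  have K: "{K. compactin X K \<and> K\<subseteq>g ` A} = (`) g ` {K. compactin X K \<and> K\<subseteq>A}" (is "?L = ?R")
  proof
   show "?L\<subseteq>?R"
   proof
    fix K assume "K\<in>?L"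
    then have "K = g ` (f ` K)" "compactin X (f ` K)" "f ` K\<subseteq>A" using c(1)[of K] gfi[OF c(3)[of K]] fgi[OF sub] image_mono[of K "g ` A" f] by auto
    then show "K\<in>?R" by blast
   qed
  qed (use c(2) in blast)
  have U: "{U. openin X U \<and> g ` A\<subseteq>U} = (`) g ` {U. openin X U \<and> A\<subseteq>U}" (is "?L = ?R")
  proof
   show "?L\<subseteq>?R"
   proof
    fix U assume "U\<in>?L"
    then have "U = g ` (f ` U)" "openin X (f ` U)" "A\<subseteq>f ` U" using o(1)[of U] gfi[OF o(3)[of U]] fgi[OF sub] image_mono[of "g ` A" U f] by auto
    then show "U\<in>?R" by blast
   qed
  qed (use o(2) in blast)
  show ?thesis using reg[OF gA] em c(4) A openin_borel_on[of X] unfolding K U image_image by simp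
 qed
 have "prob_space ?d" using P(1) meas by (rule prob_space.prob_space_distr)
 then show ?thesis unfolding Prob_def using conjunct1[OF *] conjunct2[OF *] by auto
qed

text \<open>A weak-star neighbourhood of a point mass only tests finitely many continuous functions, and each of them is nearly
constant on a neighbourhood of the point and bounded elsewhere.\<close>
lemma weak_star_near_point:
 assumes X: "compact_space X" and x: "x\<in>topspace X"
  and \<O>: "openin (weak_star X) \<O>" "return (borel_on X) x\<in>\<O>"
 shows "\<exists>N e. openin X N \<and> x\<in>N \<and> e > 0 \<and>
  (\<forall>\<nu>\<in>Prob X. measure \<nu> (topspace X - N)\<le>e --> \<nu>\<in>\<O>)"
proof -
 define S where "S = {f. continuous_map X euclideanreal f}"
 define F where "F = (\<lambda>\<mu>. \<lambda>f\<in>S. integral\<^sup>L \<mu> f)"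
 obtain U where U: "openin (product_topology (\<lambda>_. euclideanreal) S) U" "\<O> = F -` U \<inter> Prob X"
  using \<O>(1) unfolding weak_star_def openin_pullback_topology F_def S_def by blast
 let ?r = "return (borel_on X) x"
 have "F ?r\<in>U" using \<O>(2) U(2) by blast
 from product_topology_open_contains_basis[OF U(1) this]
 obtain V where V: "F ?r\<in>(\<Pi>\<^sub>E i\<in>S. V i)" "\<And>f. open (V f)" "finite {f. V f\<noteq>UNIV}" "(\<Pi>\<^sub>E i\<in>S. V i)\<subseteq>U"
  by auto
 define D where "D = {f\<in>S. V f\<noteq>UNIV}"
 have "finite D" using V(3) by (rule rev_finite_subset) (auto simp: D_def)
 have Fr: "F ?r f = f x" if "f\<in>S" for f
  unfolding F_def using that x
  by (auto simp: S_def intro!: integral_return continuous_map_borel_measurable)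
 have "\<exists>N e. openin X N \<and> x\<in>N \<and> e > 0 \<and> (\<forall>\<nu>\<in>Prob X. measure \<nu> (topspace X - N)\<le>e --> integral\<^sup>L \<nu> f\<in>V f)"
  if f: "f\<in>S" for f
 proof -
  have cont: "continuous_map X euclideanreal f" using f by (simp add: S_def)
  have "f x\<in>V f" using V(1) Fr[OF f] f by (auto simp: PiE_iff)
  then obtain d where d: "d > 0" "ball (f x) d\<subseteq>V f" using V(2) open_contains_ball by blast
  have "compact (f ` topspace X)"
   using image_compactin[OF X[unfolded compact_space_def] cont] by (simp add: compactin_euclidean_iff)
  then obtain b where b: "b > 0" "\<And>y. y\<in>topspace X ==> \<bar>f y\<bar>\<le>b"
   using compact_imp_bounded bounded_pos by (metis imageI real_norm_def)
  define N where "N = {y\<in>topspace X. f y\<in>ball (f x) (d/2)}"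
  have "openin euclideanreal (ball (f x) (d/2))" by simp
  then have N: "openin X N" using cont unfolding N_def continuous_map_def by blast
  have xN: "x\<in>N" using x d by (simp add: N_def)
  define e where "e = d / (8 * b)"
  have e: "e > 0" using d b by (simp add: e_def)
  have "integral\<^sup>L \<nu> f\<in>V f" if \<nu>: "\<nu>\<in>Prob X" "measure \<nu> (topspace X - N)\<le>e" for \<nu>
  proof -
   note P = ProbD[OF \<nu>(1)]
   interpret prob_space \<nu> by (rule P(1))
   have fm: "f\<in>borel_measurable \<nu>" using continuous_map_borel_measurable[OF cont P(2)] .
   have fi: "integrable \<nu> f" by (rule integrable_const_bound[of _ b]) (use b fm P(3) in auto)
   have Nm: "topspace X - N\<in>sets \<nu>" using N P(2) by (auto intro!: closedin_borel_on)
   have "\<bar>integral\<^sup>L \<nu> f - f x\<bar> = \<bar>\<integral>y. f y - f x \<partial>\<nu>\<bar>" using fi by (simp add: prob_space)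
   also have "\<dots>\<le>(\<integral>y. \<bar>f y - f x\<bar> \<partial>\<nu>)" by (rule integral_abs_bound)
   also have "\<dots>\<le>(\<integral>y. d / 2 + 2 * b * indicator (topspace X - N) y \<partial>\<nu>)"
   proof (rule integral_mono)
    show "integrable \<nu> (\<lambda>y. \<bar>f y - f x\<bar>)" using fi by simp
    show "integrable \<nu> (\<lambda>y. d / 2 + 2 * b * indicator (topspace X - N) y)"
     using Nm by (simp add: less_top[symmetric])
    fix y assume y: "y\<in>space \<nu>"
    show "\<bar>f y - f x\<bar>\<le>d / 2 + 2 * b * indicator (topspace X - N) y"
    proof (cases "y\<in>N")
     case True then show ?thesis by (simp add: N_def dist_real_def abs_minus_commute)
    next
     case False
     then have "indicator (topspace X - N) y = (1::real)" using y P(3) by simp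
     moreover have "\<bar>f y - f x\<bar>\<le>2 * b" using b(2)[of y] b(2)[OF x] y P(3) by auto
     ultimately show ?thesis using d(1) by simp
    qed
   qed
   also have "\<dots> = d / 2 + 2 * b * measure \<nu> (topspace X - N)"
    using Nm by (simp add: prob_space less_top[symmetric])
   also have "\<dots>\<le>d / 2 + 2 * b * e" using \<nu>(2) b(1) by simp
   also have "\<dots> < d" using d(1) b(1) by (simp add: e_def)
   finally show ?thesis using d(2) by (auto simp: dist_real_def abs_minus_commute subset_iff)
  qed
  then show ?thesis using N xN e by blast
 qed
 then obtain N e where Ne: "\<And>f. f\<in>S ==> openin X (N f)" "\<And>f. f\<in>S ==> x\<in>N f" "\<And>f. f\<in>S ==> e f > (0::real)"
  "\<And>f \<nu>. f\<in>S ==> \<nu>\<in>Prob X ==> measure \<nu> (topspace X - N f)\<le>e f ==> integral\<^sup>L \<nu> f\<in>V f"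
  by metis
 define N' where "N' = (\<Inter>f\<in>D. N f) \<inter> topspace X"
 define e' where "e' = (if D = {} then 1 else Min (e ` D))"
 have DS: "D\<subseteq>S" by (auto simp: D_def)
 show ?thesis
 proof (intro exI conjI ballI impI)
  show oN': "openin X N'"
  proof (cases "D = {}")
   case False
   then have "openin X (\<Inter>f\<in>D. N f)" using Ne(1) DS \<open>finite D\<close> by (intro openin_INT2) auto
   then show ?thesis unfolding N'_def by (intro openin_Int) auto
  qed (simp add: N'_def)
  show "x\<in>N'" using Ne(2) DS x by (auto simp: N'_def)
  show "e' > 0" using Ne(3) DS \<open>finite D\<close> by (auto simp: e'_def)
  fix \<nu> assume \<nu>: "\<nu>\<in>Prob X" "measure \<nu> (topspace X - N')\<le>e'"
  note P = ProbD[OF \<nu>(1)]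
  interpret prob_space \<nu> by (rule P(1))
  have "F \<nu>\<in>(\<Pi>\<^sub>E i\<in>S. V i)"
  proof (rule PiE_I)
   fix f assume f: "f\<in>S"
   show "F \<nu> f\<in>V f"
   proof (cases "f\<in>D")
    case True
    have "measure \<nu> (topspace X - N f)\<le>measure \<nu> (topspace X - N')"
     using True oN' P(2) by (intro finite_measure_mono) (auto simp: N'_def intro!: closedin_borel_on)
    also have "\<dots>\<le>e'" by (rule \<nu>(2))
    also have "e'\<le>e f" using True \<open>finite D\<close> unfolding e'_def by auto
    finally show ?thesis using Ne(4)[OF f \<nu>(1)] f by (simp add: F_def)
   next
    case False then have "V f = UNIV" using f by (simp add: D_def)
    then show ?thesis by simp
   qed
  qed (simp add: F_def)
  then show "\<nu>\<in>\<O>" using V(4) U(2) \<nu>(1) by blast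
 qed
qed

lemma group_actionI:
 assumes "group G" and ext: "\<And>g. g\<in>carrier G ==> \<phi> g\<in>extensional E"
  and cl: "\<And>g x. g\<in>carrier G ==> x\<in>E ==> \<phi> g x\<in>E"
  and one: "\<And>x. x\<in>E ==> \<phi> \<one>\<^bsub>G\<^esub> x = x"
  and mult: "\<And>g h x. g\<in>carrier G ==> h\<in>carrier G ==> x\<in>E ==> \<phi> (g \<otimes>\<^bsub>G\<^esub> h) x = \<phi> g (\<phi> h x)"
 shows "group_action G E \<phi>"
proof -
 interpret group G by fact
 have inv1: "\<phi> (inv\<^bsub>G\<^esub> g) (\<phi> g x) = x" "\<phi> g (\<phi> (inv\<^bsub>G\<^esub> g) x) = x" if "g\<in>carrier G" "x\<in>E" for g x
  using mult[of "inv\<^bsub>G\<^esub> g" g x] mult[of g "inv\<^bsub>G\<^esub> g" x] that one by auto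
 have bij: "\<phi> g\<in>Bij E" if "g\<in>carrier G" for g
 proof -
  have "bij_betw (\<phi> g) E E"
   by (rule bij_betw_byWitness[where f' = "\<phi> (inv\<^bsub>G\<^esub> g)"]) (use inv1 cl that in auto)
  then show ?thesis using ext[OF that] by (simp add: Bij_def)
 qed
 have "\<phi>\<in>hom G (BijGroup E)"
 proof (rule homI)
  show "\<phi> x\<in>carrier (BijGroup E)" if "x\<in>carrier G" for x using bij[OF that] by (simp add: BijGroup_def)
  fix g h assume gh: "g\<in>carrier G" "h\<in>carrier G"
  have "\<phi> (g \<otimes>\<^bsub>G\<^esub> h) = compose E (\<phi> g) (\<phi> h)"
   by (rule extensionalityI[where A = E]) (use ext mult gh in \<open>auto simp: compose_def\<close>)
  then show "\<phi> (g \<otimes>\<^bsub>G\<^esub> h) = \<phi> g \<otimes>\<^bsub>BijGroup E\<^esub> \<phi> h"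
   using bij gh by (simp add: BijGroup_def)
 qed
 then show ?thesis
  unfolding group_action_def group_hom_def group_hom_axioms_def
  using group_BijGroup is_group by blast
qed

lemma continuous_map_discrete_prod:
 assumes "\<And>g. g\<in>A ==> continuous_map X Y (f g)"
 shows "continuous_map (prod_topology (discrete_topology A) X) Y (\<lambda>(g, x). f g x)"
 unfolding continuous_map_def
proof (intro conjI allI impI)
 show "(\<lambda>(g, x). f g x)\<in>topspace (prod_topology (discrete_topology A) X) \<rightarrow> topspace Y"
  using assms by (auto simp: continuous_map_def)
 fix U assume U: "openin Y U"
 have "{p\<in>topspace (prod_topology (discrete_topology A) X). (case p of (g, x) => f g x)\<in>U}
   = (\<Union>g\<in>A. {g} \<times> {x\<in>topspace X. f g x\<in>U})"
  by auto
 also have "openin (prod_topology (discrete_topology A) X) \<dots>"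
  using assms U by (intro openin_Union) (auto simp: openin_prod_Times_iff continuous_map_def)
 finally show "openin (prod_topology (discrete_topology A) X)
  {p\<in>topspace (prod_topology (discrete_topology A) X). (case p of (g, x) => f g x)\<in>U}" .
qed

lemma compact_space_fun_image:
 assumes "continuous_map (subtopology euclidean Y) X f" "f ` Y = topspace X" "compact (Y :: ('i => real) set)"
 shows "compact_space X"
proof -
 have "compactin euclidean Y" using assms(3) by (simp only: compactin_euclidean_iff)
 then have "compactin (subtopology euclidean Y) Y" by (simp only: compactin_subtopology order_refl)
 from image_compactin[OF this assms(1)] show ?thesis unfolding compact_space_def assms(2) .
qed

text \<open>Strong proximality comes from \<open>concentration\<close>: if the orbit of a measure on \<open>Y\<close> stayed away from every point mass,
a Lebesgue number would make this uniform, whereas some translate puts almost all mass in one small box around the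
far point. The set \<open>Y\<close> is transported along a bijection \<open>\<psi>\<close> because universality of the Furstenberg boundary refers to
spaces whose points lie in a prescribed type.\<close>
lemma minimal_subset_boundary:
 fixes \<psi> :: "'x => 'i => real" and W :: "'x set" and \<Gamma> :: "('a, 'm) monoid_scheme"
 assumes grp: "group \<Gamma>" and irr: "irreducible_flow \<Gamma> \<sigma> M"
  and Y: "Y\<subseteq>M" "compact Y" "Y\<noteq>{}" "\<forall>g\<in>carrier \<Gamma>. \<forall>x\<in>Y. x \<circ> \<sigma> g\<in>Y"
  and min: "\<forall>L\<subseteq>Y. compact L \<and> L\<noteq>{} \<and> (\<forall>g\<in>carrier \<Gamma>. \<forall>x\<in>L. x \<circ> \<sigma> g\<in>L) --> L = Y"
  and \<psi>: "inj_on \<psi> W" "\<psi> ` W = Y"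
  and X_def: "X = pullback_topology W \<psi> euclidean"
  and \<phi>_def: "\<phi> = (\<lambda>g. \<lambda>w\<in>W. inv_into W \<psi> (\<psi> w \<circ> \<sigma> g))"
 shows "boundary \<Gamma> (disc \<Gamma>) X \<phi>"
  and "topspace X = W" and "\<And>g w. g\<in>carrier \<Gamma> ==> w\<in>W ==> \<psi> (\<phi> g w) = \<psi> w \<circ> \<sigma> g"
proof -
 interpret group \<Gamma> by fact
 have fl: "affine_flow \<Gamma> \<sigma> M" using irr by (simp add: irreducible_flow_def)
 note M = affine_flowD[OF fl]
 show top: "topspace X = W" by (simp add: X_def topspace_pullback_topology)
 have \<psi>Y: "\<psi> w\<in>Y" if "w\<in>W" for w using that \<psi>(2) by blast
 have inv\<psi>: "inv_into W \<psi> y\<in>W" "\<psi> (inv_into W \<psi> y) = y" if "y\<in>Y" for y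
  using inv_into_into[of y \<psi> W] f_inv_into_f[of y \<psi> W] that \<psi>(2) by simp_all
 have cl: "\<phi> g w\<in>W" if "g\<in>carrier \<Gamma>" "w\<in>W" for g w
  using that by (simp add: \<phi>_def inv\<psi> Y(4) \<psi>Y)
 show eq: "\<psi> (\<phi> g w) = \<psi> w \<circ> \<sigma> g" if "g\<in>carrier \<Gamma>" "w\<in>W" for g w
  using that by (simp add: \<phi>_def inv\<psi> Y(4) \<psi>Y)
 have \<psi>inj: "v = w" if "v\<in>W" "w\<in>W" "\<psi> v = \<psi> w" for v w using \<psi>(1) that by (simp add: inj_onD)
 have act: "group_action \<Gamma> W \<phi>"
 proof (rule group_actionI[OF grp])
  show "\<phi> g\<in>extensional W" if "g\<in>carrier \<Gamma>" for g by (simp add: \<phi>_def)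
  show "\<phi> \<one>\<^bsub>\<Gamma>\<^esub> x = x" if "x\<in>W" for x
  proof (rule \<psi>inj[OF cl[OF one_closed that] that])
   show "\<psi> (\<phi> \<one>\<^bsub>\<Gamma>\<^esub> x) = \<psi> x" unfolding eq[OF one_closed that] using M(2) by (simp add: fun_eq_iff)
  qed
  show "\<phi> (g \<otimes>\<^bsub>\<Gamma>\<^esub> h) x = \<phi> g (\<phi> h x)" if g: "g\<in>carrier \<Gamma>" and h: "h\<in>carrier \<Gamma>" and x: "x\<in>W" for g h x
  proof (rule \<psi>inj[OF cl[OF m_closed[OF g h] x] cl[OF g cl[OF h x]]])
   show "\<psi> (\<phi> (g \<otimes>\<^bsub>\<Gamma>\<^esub> h) x) = \<psi> (\<phi> g (\<phi> h x))"
    unfolding eq[OF m_closed[OF g h] x] eq[OF g cl[OF h x]] eq[OF h x] using M(1)[OF g h] by (simp add: fun_eq_iff)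
  qed
 qed (rule cl)
 have cont\<psi>: "continuous_map X euclidean \<psi>"
 proof -
  have "continuous_map X euclidean (id \<circ> \<psi>)" unfolding X_def by (rule continuous_map_pullback) simp
  then show ?thesis by simp
 qed
 have coord: "continuous_map X euclideanreal (\<lambda>w. \<psi> w i)" for i
 proof -
  have "continuous_map euclidean euclideanreal (\<lambda>x :: 'i => real. x i)"
   by (simp add: continuous_map_iff_continuous2 continuous_on_coord)
  from continuous_map_compose[OF cont\<psi> this] show ?thesis by (simp add: o_def)
 qed
 have into: "continuous_map V X h" if "h\<in>topspace V \<rightarrow> W" "\<And>i. continuous_map V euclideanreal (\<lambda>v. \<psi> (h v) i)"
  for V :: "'v topology" and h
 proof -
  have "continuous_map V (product_topology (\<lambda>_. euclideanreal) UNIV) (\<psi> \<circ> h)"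
   using that(2) by (simp add: continuous_map_componentwise_UNIV)
  then have "continuous_map V euclidean (\<psi> \<circ> h)" by (simp only: euclidean_product_topology)
  then show ?thesis unfolding X_def using that(1) by (intro continuous_map_pullback') auto
 qed
 have Haus: "Hausdorff_space X"
  by (rule Hausdorff_space_injective_preimage[OF Hausdorff_fun cont\<psi>]) (simp add: top \<psi>(1))
 have "continuous_map (subtopology euclidean Y) X (inv_into W \<psi>)"
 proof (rule into)
  fix i
  have "continuous_map (subtopology euclidean Y) euclideanreal (\<lambda>v. v i)"
   by (simp add: continuous_map_iff_continuous continuous_on_coord)
  then show "continuous_map (subtopology euclidean Y) euclideanreal (\<lambda>v. \<psi> (inv_into W \<psi> v) i)"
   by (rule continuous_map_eq) (simp add: inv\<psi>)
 qed (simp add: inv\<psi>)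
 then have comp: "compact_space X"
 proof (rule compact_space_fun_image)
  show "inv_into W \<psi> ` Y = topspace X" unfolding top using \<psi> by (metis inv_into_image_cancel order_refl)
 qed (rule Y(2))
 have cont\<phi>: "continuous_map X X (\<phi> g)" if g: "g\<in>carrier \<Gamma>" for g
 proof (rule into)
  show "\<phi> g\<in>topspace X \<rightarrow> W" using cl g by (simp add: top)
  fix i
  show "continuous_map X euclideanreal (\<lambda>v. \<psi> (\<phi> g v) i)"
   by (rule continuous_map_eq[OF coord[of "\<sigma> g i"]]) (simp add: top eq g)
 qed
 have cact: "continuous_action \<Gamma> (disc \<Gamma>) X \<phi>"
  unfolding continuous_action_def using act cont\<phi> by (simp add: top continuous_map_discrete_prod)
 have minimal: "minimal_action \<Gamma> X \<phi>" unfolding minimal_action_def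
 proof
  fix x assume x: "x\<in>topspace X"
  define C where "C = X closure_of (orbit \<Gamma> \<phi> x)"
  have xW: "x\<in>W" using x top by simp
  have orb: "orbit \<Gamma> \<phi> x\<subseteq>W" using cl xW by (auto simp: orbit_def)
  have CW: "C\<subseteq>W" unfolding C_def using closure_of_subset_topspace[of X] top by auto
  have "x\<in>orbit \<Gamma> \<phi> x" using group_action.orbit_refl[OF act xW] .
  then have xC: "x\<in>C" unfolding C_def using closure_of_subset[of _ X] orb top by blast
  have "\<psi> ` C = Y"
  proof -
   have 1: "\<psi> ` C\<subseteq>Y" using CW \<psi>Y by blast
   have "closedin X C" unfolding C_def by simp
   then have "compactin X C" by (rule closedin_compact_space[OF comp])
   from image_compactin[OF this cont\<psi>] have 2: "compact (\<psi> ` C)" by (simp add: compactin_euclidean_iff)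
   have 3: "\<psi> ` C\<noteq>{}" using xC by blast
   have 4: "y \<circ> \<sigma> g\<in>\<psi> ` C" if g: "g\<in>carrier \<Gamma>" and y: "y\<in>\<psi> ` C" for g y
   proof -
   from y obtain w where w: "w\<in>C" "y = \<psi> w" by blast
   have "\<phi> g ` orbit \<Gamma> \<phi> x\<subseteq>orbit \<Gamma> \<phi> x"
   proof clarify
    fix v assume "v\<in>orbit \<Gamma> \<phi> x"
    then obtain h where h: "h\<in>carrier \<Gamma>" "v = \<phi> h x" by (auto simp: orbit_def)
    then have "\<phi> g v = \<phi> (g \<otimes>\<^bsub>\<Gamma>\<^esub> h) x" using group_action.composition_rule[OF act xW g h(1)] by simp
    then show "\<phi> g v\<in>orbit \<Gamma> \<phi> x" using g h by (auto simp: orbit_def)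
   qed
   then have "\<phi> g ` C\<subseteq>C" unfolding C_def
    using continuous_map_image_closure_subset[OF cont\<phi>[OF g], of "orbit \<Gamma> \<phi> x"] closure_of_mono[of "\<phi> g ` orbit \<Gamma> \<phi> x" "orbit \<Gamma> \<phi> x" X]
    by blast
   then have "\<psi> (\<phi> g w)\<in>\<psi> ` C" using w by blast
   moreover have "\<psi> (\<phi> g w) = y \<circ> \<sigma> g" using eq[OF g, of w] w CW by auto
   ultimately show ?thesis by simp
   qed
   show ?thesis using min 1 2 3 4 by simp
  qed
  have "W\<subseteq>C"
  proof
   fix w assume w: "w\<in>W"
   then have "\<psi> w\<in>\<psi> ` C" using \<psi>Y \<open>\<psi> ` C = Y\<close> by simp
   then obtain c where c: "c\<in>C" "\<psi> w = \<psi> c" by blast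
   then have "w = c" using \<psi>inj[OF w] CW by blast
   then show "w\<in>C" using c by simp
  qed
  then show "X closure_of (orbit \<Gamma> \<phi> x) = topspace X" using CW by (auto simp: C_def top)
 qed
 have sp: "strongly_proximal \<Gamma> X \<phi>" unfolding strongly_proximal_def
 proof
  fix \<mu> assume \<mu>: "\<mu>\<in>Prob X"
  note P = ProbD[OF \<mu>]
  interpret prob_space \<mu> by (rule P(1))
  define D where "D = {distr \<mu> (borel_on X) (\<phi> g) | g. g\<in>carrier \<Gamma>}"
  have distr: "distr \<mu> (borel_on X) (\<phi> g)\<in>Prob X" if g: "g\<in>carrier \<Gamma>" for g
  proof (rule distr_homeo_in_Prob[OF Haus \<mu>])
   show "continuous_map X X (\<phi> g)" "continuous_map X X (\<phi> (inv\<^bsub>\<Gamma>\<^esub> g))" using cont\<phi> g by auto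
   show "\<phi> (inv\<^bsub>\<Gamma>\<^esub> g) (\<phi> g x) = x" if "x\<in>topspace X" for x
    by (rule group_action.orbit_sym_aux[OF act g]) (use that top in simp_all)
   show "\<phi> g (\<phi> (inv\<^bsub>\<Gamma>\<^esub> g) x) = x" if x: "x\<in>topspace X" for x
   proof -
    have "\<phi> (inv\<^bsub>\<Gamma>\<^esub> (inv\<^bsub>\<Gamma>\<^esub> g)) (\<phi> (inv\<^bsub>\<Gamma>\<^esub> g) x) = x"
     by (rule group_action.orbit_sym_aux[OF act inv_closed[OF g]]) (use x top in simp_all)
    then show ?thesis using g by simp
   qed
  qed
  have "\<exists>x\<in>topspace X. return (borel_on X) x\<in>weak_star X closure_of D"
  proof (rule ccontr)
   assume neg: "\<not> ?thesis"
   define Q where "Q = (\<lambda>x U e. open U \<and> \<psi> x\<in>U \<and> e > 0 \<and>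
     (\<forall>g\<in>carrier \<Gamma>. measure \<mu> {w\<in>W. \<psi> w \<circ> \<sigma> g\<notin>U} > (e::real)))"
   have "\<forall>x\<in>W. \<exists>U e. Q x U e"
   proof
    fix x assume x: "x\<in>W"
    have rP: "return (borel_on X) x\<in>Prob X" using return_in_Prob[OF Haus] x top by simp
    moreover have "topspace (weak_star X) = Prob X"
     by (auto simp: weak_star_def topspace_pullback_topology)
    moreover have "return (borel_on X) x\<notin>weak_star X closure_of D" using neg x top by simp
    ultimately have "\<exists>\<O>. openin (weak_star X) \<O> \<and> return (borel_on X) x\<in>\<O> \<and> \<O> \<inter> D = {}"
     unfolding in_closure_of by auto
    then obtain \<O> where \<O>: "openin (weak_star X) \<O>" "return (borel_on X) x\<in>\<O>" "\<O> \<inter> D = {}" by blast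
    have xX: "x\<in>topspace X" using x top by simp
    obtain N e where N: "openin X N" "x\<in>N" "e > (0::real)"
     "\<forall>\<nu>\<in>Prob X. measure \<nu> (topspace X - N)\<le>e --> \<nu>\<in>\<O>"
     using weak_star_near_point[OF comp xX \<O>(1,2)] by blast
    obtain U where U: "open U" "N = \<psi> -` U \<inter> W"
     using N(1) unfolding X_def openin_pullback_topology by auto
    have "measure \<mu> {w\<in>W. \<psi> w \<circ> \<sigma> g\<notin>U} > e" if g: "g\<in>carrier \<Gamma>" for g
    proof (rule ccontr)
     assume "\<not> ?thesis"
     moreover have "measure (distr \<mu> (borel_on X) (\<phi> g)) (topspace X - N) = measure \<mu> {w\<in>W. \<psi> w \<circ> \<sigma> g\<notin>U}"
     proof -
      have "topspace X - N\<in>sets (borel_on X)" using N(1) by (auto intro!: closedin_borel_on)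
      moreover have "\<phi> g\<in>measurable \<mu> (borel_on X)"
       using continuous_map_measurable[OF cont\<phi>[OF g]] P(2) by (auto cong: measurable_cong_sets)
      moreover have "\<phi> g -` (topspace X - N) \<inter> space \<mu> = {w\<in>W. \<psi> w \<circ> \<sigma> g\<notin>U}"
       using P(3) top U(2) cl g eq by auto
      ultimately show ?thesis by (simp add: measure_distr)
     qed
     ultimately have "distr \<mu> (borel_on X) (\<phi> g)\<in>\<O>" using N(4) distr[OF g] by simp
     then show False using \<O>(3) g by (auto simp: D_def)
    qed
    then show "\<exists>U e. Q x U e" using U N unfolding Q_def by blast
   qed
   from bchoice[OF this] obtain U where "\<forall>x\<in>W. \<exists>e. Q x (U x) e" by blast
   from bchoice[OF this] obtain e where "\<forall>x\<in>W. Q x (U x) (e x)" by blast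
   then have Ue: "\<And>x. x\<in>W ==> open (U x)" "\<And>x. x\<in>W ==> \<psi> x\<in>U x" "\<And>x. x\<in>W ==> e x > (0::real)"
    "\<And>x g. x\<in>W ==> g\<in>carrier \<Gamma> ==> measure \<mu> {w\<in>W. \<psi> w \<circ> \<sigma> g\<notin>U x} > e x"
    unfolding Q_def by blast+
   have cov: "Y\<subseteq>(\<Union>x\<in>W. U x)" using Ue(2) \<psi>(2) by blast
   obtain C where C: "C\<subseteq>W" "finite C" "Y\<subseteq>(\<Union>x\<in>C. U x)"
    using compactE_image[OF Y(2) Ue(1) cov] by metis
   have "C\<noteq>{}" using C(3) Y(3) by auto
   have covC: "\<exists>V\<in>U ` C. open V \<and> y\<in>V" if "y\<in>Y" for y
   proof -
    from that C(3) obtain x where x: "x\<in>C" "y\<in>U x" by blast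
    then have "open (U x)" using Ue(1) C(1) by blast
    then show ?thesis using x by blast
   qed
   obtain J d where J: "finite J" "d > 0" "\<forall>y\<in>Y. \<exists>V\<in>U ` C. box_at J d y\<subseteq>V"
    using Lebesgue_box[where K = Y and \<U> = "U ` C", OF Y(2)] covC by meson
   define \<eta> where "\<eta> = min (1/2) (Min (e ` C))"
   have \<eta>: "\<eta> > 0" "\<And>x. x\<in>C ==> \<eta>\<le>e x"
    using C Ue(3) \<open>C\<noteq>{}\<close> by (auto simp: \<eta>_def min_le_iff_disj)
   define p where "p = far_point M J"
   have meas: "(\<lambda>w. \<psi> w i)\<in>borel_measurable \<mu>" for i
    by (rule continuous_map_borel_measurable[OF coord P(2)])
   have uM: "\<psi> w\<in>M" if "w\<in>space \<mu>" for w using that P(3) top \<psi>Y Y(1) by auto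
   have d2: "d / 2 > 0" using J(2) by simp
   obtain g where g: "g\<in>carrier \<Gamma>" "measure \<mu> {w\<in>space \<mu>. \<psi> w \<circ> \<sigma> g\<notin>box_at J (d/2) p}\<le>\<eta>"
    using concentration[OF grp irr J(1) d2 \<eta>(1) P(1) uM meas] unfolding p_def by blast
   have "\<exists>w\<in>W. \<psi> w \<circ> \<sigma> g\<in>box_at J (d/2) p"
   proof (rule ccontr)
    assume "\<not> ?thesis"
    then have "{w\<in>space \<mu>. \<psi> w \<circ> \<sigma> g\<notin>box_at J (d/2) p} = space \<mu>" using P(3) top by auto
    then show False using g(2) prob_space by (simp add: \<eta>_def)
   qed
   then obtain w where w: "w\<in>W" "\<psi> w \<circ> \<sigma> g\<in>box_at J (d/2) p" by blast
   define y where "y = \<psi> w \<circ> \<sigma> g"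
   have "y\<in>Y" using w(1) \<psi>Y Y(4) g(1) by (simp add: y_def)
   then obtain x where x: "x\<in>C" "box_at J d y\<subseteq>U x" using J(3) by blast
   have sub: "box_at J (d/2) p\<subseteq>U x"
   proof
    fix z assume z: "z\<in>box_at J (d/2) p"
    have "\<bar>z j - y j\<bar> < d" if "j\<in>J" for j
    proof -
     have "\<bar>z j - p j\<bar> < d/2" "\<bar>y j - p j\<bar> < d/2" using z w(2) that by (auto simp: box_at_def y_def)
     then show ?thesis by linarith
    qed
    then show "z\<in>U x" using x(2) by (auto simp: box_at_def)
   qed
   have "measure \<mu> {w\<in>W. \<psi> w \<circ> \<sigma> g\<notin>U x}\<le>measure \<mu> {w\<in>space \<mu>. \<psi> w \<circ> \<sigma> g\<notin>box_at J (d/2) p}"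
   proof (rule finite_measure_mono)
    show "{w\<in>W. \<psi> w \<circ> \<sigma> g\<notin>U x}\<subseteq>{w\<in>space \<mu>. \<psi> w \<circ> \<sigma> g\<notin>box_at J (d/2) p}"
     using sub P(3) top by auto
    show "{w\<in>space \<mu>. \<psi> w \<circ> \<sigma> g\<notin>box_at J (d/2) p}\<in>sets \<mu>"
     by (rule box_event_sets[OF J(1) meas])
   qed
   then have "measure \<mu> {w\<in>W. \<psi> w \<circ> \<sigma> g\<notin>U x}\<le>e x" using g(2) \<eta>(2)[OF x(1)] by linarith
   moreover have "x\<in>W" using x(1) C(1) by blast
   then have "measure \<mu> {w\<in>W. \<psi> w \<circ> \<sigma> g\<notin>U x} > e x" by (rule Ue(4)[OF _ g(1)])
   ultimately show False by simp
  qed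
  then show "\<exists>x\<in>topspace X. return (borel_on X) x\<in>weak_star X closure_of {distr \<mu> (borel_on X) (\<phi> g) |g. g\<in>carrier \<Gamma>}"
   unfolding D_def .
 qed
 have "topspace X\<noteq>{}" using top \<psi>(2) Y(3) by blast
 then show "boundary \<Gamma> (disc \<Gamma>) X \<phi>"
  unfolding boundary_def compact_G_space_def using minimal sp cact comp Haus by simp
qed

section \<open>Fixed points of stabilizers of the Furstenberg boundary\<close>

text \<open>A minimal subset of an irreducible subflow is a boundary, hence an equivariant image of the Furstenberg boundary, and
the image of \<open>b\<close> is fixed by the stabilizer of \<open>b\<close>.\<close>
theorem Furstenberg_stabilizer_fixes:
 fixes \<Gamma> :: "('a, 'm) monoid_scheme" and K :: "('i => real) set"
 assumes grp: "group \<Gamma>" and F: "Furstenberg_boundary \<Gamma> (disc \<Gamma>) B \<beta>"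
  and K: "affine_flow \<Gamma> \<sigma> K" and b: "b\<in>topspace B"
 shows "\<exists>x\<in>K. \<forall>g\<in>stabilizer \<Gamma> \<beta> b. x \<circ> \<sigma> g = x"
proof -
 interpret group \<Gamma> by fact
 obtain M where M: "M\<subseteq>K" "irreducible_flow \<Gamma> \<sigma> M" using irreducible_exists[OF K] .
 have fl: "affine_flow \<Gamma> \<sigma> M" using M by (simp add: irreducible_flow_def)
 note MD = affine_flowD[OF fl]
 define P where "P = (\<lambda>L :: ('i => real) set. compact L \<and> L\<noteq>{} \<and> (\<forall>g\<in>carrier \<Gamma>. \<forall>x\<in>L. x \<circ> \<sigma> g\<in>L))"
 obtain Y where Y: "Y\<subseteq>M" "P Y" "\<And>L. L\<subseteq>Y ==> P L ==> L = Y"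
 proof (rule minimal_compact_subset[where P = P and K = M])
  show "P M" using MD by (simp add: P_def)
  fix C assume C: "C\<noteq>{}" "\<And>L. L\<in>C ==> P L" "\<Inter>C\<noteq>{}"
  obtain L where L: "L\<in>C" using C(1) by blast
  have "closed L" if "L\<in>C" for L using C(2)[OF that] by (simp add: P_def compact_fun_closed)
  then have "closed (\<Inter>C)" by blast
  moreover have "compact L" using C(2)[OF L] by (simp add: P_def)
  ultimately have "compact (L \<inter> \<Inter>C)" by (rule compact_Int_closed[rotated])
  moreover have "L \<inter> \<Inter>C = \<Inter>C" using L by blast
  moreover have "x \<circ> \<sigma> g\<in>\<Inter>C" if "g\<in>carrier \<Gamma>" "x\<in>\<Inter>C" for g x
   using C(2) that unfolding P_def by blast
  ultimately show "P (\<Inter>C)" using C(3) unfolding P_def by simp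
 qed (simp_all add: P_def)
 have PY: "compact Y" "Y\<noteq>{}" "\<forall>g\<in>carrier \<Gamma>. \<forall>x\<in>Y. x \<circ> \<sigma> g\<in>Y"
  using Y(2) by (auto simp: P_def)
 obtain y0 where y0: "y0\<in>Y" using PY(2) by blast
 \<comment> \<open>A point is recovered from the sets of group elements along which the orbit of \<open>y0\<close> accumulates at it.\<close>
 define \<tau> where "\<tau> = (\<lambda>y. {A. A\<subseteq>carrier \<Gamma> \<and> y\<in>closure ((\<lambda>g. y0 \<circ> \<sigma> g) ` A)})"
 have dense: "closure ((\<lambda>g. y0 \<circ> \<sigma> g) ` carrier \<Gamma>) = Y"
 proof (rule Y(3))
  have sub: "(\<lambda>g. y0 \<circ> \<sigma> g) ` carrier \<Gamma>\<subseteq>Y" using PY y0 by auto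
  show subc: "closure ((\<lambda>g. y0 \<circ> \<sigma> g) ` carrier \<Gamma>)\<subseteq>Y"
   by (rule closure_minimal[OF sub compact_fun_closed[OF PY(1)]])
  have "compact (closure ((\<lambda>g. y0 \<circ> \<sigma> g) ` carrier \<Gamma>))"
   using compact_Int_closed[OF PY(1) closed_closure, of "(\<lambda>g. y0 \<circ> \<sigma> g) ` carrier \<Gamma>"] subc
   by (simp add: Int_absorb1)
  moreover have "(\<lambda>g. y0 \<circ> \<sigma> g) ` carrier \<Gamma>\<noteq>{}" by auto
  moreover have "x \<circ> \<sigma> h\<in>closure ((\<lambda>g. y0 \<circ> \<sigma> g) ` carrier \<Gamma>)"
   if h: "h\<in>carrier \<Gamma>" and x: "x\<in>closure ((\<lambda>g. y0 \<circ> \<sigma> g) ` carrier \<Gamma>)" for h x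
  proof -
   have "continuous_on UNIV (\<lambda>x :: 'i => real. x \<circ> \<sigma> h)"
    unfolding o_def by (intro continuous_on_coordinatewise_then_product continuous_on_coord)
   then have c: "continuous_on (closure ((\<lambda>g. y0 \<circ> \<sigma> g) ` carrier \<Gamma>)) (\<lambda>x. x \<circ> \<sigma> h)"
    by (rule continuous_on_subset) simp
   have "(\<lambda>x. x \<circ> \<sigma> h) ` closure ((\<lambda>g. y0 \<circ> \<sigma> g) ` carrier \<Gamma>)\<subseteq>closure ((\<lambda>g. y0 \<circ> \<sigma> g) ` carrier \<Gamma>)"
   proof (rule image_closure_subset[OF c closed_closure])
    have "(y0 \<circ> \<sigma> g) \<circ> \<sigma> h\<in>(\<lambda>g. y0 \<circ> \<sigma> g) ` carrier \<Gamma>" if g: "g\<in>carrier \<Gamma>" for g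
    proof -
     have "(y0 \<circ> \<sigma> g) \<circ> \<sigma> h = y0 \<circ> \<sigma> (h \<otimes>\<^bsub>\<Gamma>\<^esub> g)" using MD(1)[OF h g] by (auto simp: fun_eq_iff)
     then show ?thesis using g h by auto
    qed
    then show "(\<lambda>x. x \<circ> \<sigma> h) ` ((\<lambda>g. y0 \<circ> \<sigma> g) ` carrier \<Gamma>)\<subseteq>closure ((\<lambda>g. y0 \<circ> \<sigma> g) ` carrier \<Gamma>)"
     using closure_subset by blast
   qed
   then show ?thesis using x by blast
  qed
  ultimately show "P (closure ((\<lambda>g. y0 \<circ> \<sigma> g) ` carrier \<Gamma>))" unfolding P_def closure_eq_empty by simp
 qed
 have inj: "inj_on \<tau> Y"
 proof (rule inj_onI, rule ccontr)
  fix y y' assume yy: "y\<in>Y" "y'\<in>Y" "\<tau> y = \<tau> y'" "y\<noteq>y'"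
  obtain U V where UV: "open U" "open V" "y\<in>U" "y'\<in>V" "U \<inter> V = {}"
   by (rule hausdorff_fun[OF yy(4)])
  define A where "A = {g\<in>carrier \<Gamma>. y0 \<circ> \<sigma> g\<in>U}"
  have "y\<in>closure ((\<lambda>g. y0 \<circ> \<sigma> g) ` A)"
  proof -
   have "y\<in>closure (U \<inter> (\<lambda>g. y0 \<circ> \<sigma> g) ` carrier \<Gamma>)"
    using open_Int_closure_subset[OF UV(1), of "(\<lambda>g. y0 \<circ> \<sigma> g) ` carrier \<Gamma>"] UV(3) yy(1) dense by blast
   also have "U \<inter> (\<lambda>g. y0 \<circ> \<sigma> g) ` carrier \<Gamma> = (\<lambda>g. y0 \<circ> \<sigma> g) ` A" by (auto simp: A_def)
   finally show ?thesis .
  qed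
  then have "A\<in>\<tau> y" by (simp add: \<tau>_def A_def)
  then have "A\<in>\<tau> y'" using yy(3) by simp
  then have "y'\<in>closure ((\<lambda>g. y0 \<circ> \<sigma> g) ` A)" by (simp add: \<tau>_def)
  moreover have "(\<lambda>g. y0 \<circ> \<sigma> g) ` A\<subseteq>- V" using UV(5) by (auto simp: A_def)
  then have "closure ((\<lambda>g. y0 \<circ> \<sigma> g) ` A)\<subseteq>- V" using UV(2) by (intro closure_minimal) auto
  ultimately show False using UV(4) by blast
 qed
 define W where "W = \<tau> ` Y"
 define \<psi> where "\<psi> = inv_into Y \<tau>"
 have \<psi>1: "inj_on \<psi> W" unfolding \<psi>_def W_def by (rule inj_on_inv_into) (rule order_refl)
 have \<psi>2: "\<psi> ` W = Y" unfolding \<psi>_def W_def by (rule inv_into_image_cancel[OF inj order_refl])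
 have min: "\<forall>L\<subseteq>Y. compact L \<and> L\<noteq>{} \<and> (\<forall>g\<in>carrier \<Gamma>. \<forall>x\<in>L. x \<circ> \<sigma> g\<in>L) --> L = Y"
 proof (intro allI impI)
  fix L assume "L\<subseteq>Y" "compact L \<and> L\<noteq>{} \<and> (\<forall>g\<in>carrier \<Gamma>. \<forall>x\<in>L. x \<circ> \<sigma> g\<in>L)"
  then show "L = Y" by (intro Y(3)) (simp_all add: P_def)
 qed
 define X where "X = pullback_topology W \<psi> euclidean"
 define \<phi> where "\<phi> = (\<lambda>g. \<lambda>w\<in>W. inv_into W \<psi> (\<psi> w \<circ> \<sigma> g))"
 note bd = minimal_subset_boundary[where \<sigma> = \<sigma> and M = M and Y = Y and \<psi> = \<psi> and W = W and X = X and \<phi> = \<phi>, OF grp M(2) Y(1) PY(1,2,3) min \<psi>1 \<psi>2 X_def \<phi>_def]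
 have bX: "boundary \<Gamma> (disc \<Gamma>) X \<phi>" by (rule bd(1))
 from F have "\<forall>(Y :: 'a set set topology) \<psi>. boundary \<Gamma> (disc \<Gamma>) Y \<psi> --> (\<exists>f. G_factor_map \<Gamma> B \<beta> Y \<psi> f)"
  unfolding Furstenberg_boundary_def by (rule conjunct2)
 from mp[OF spec[OF spec[OF this, of X], of \<phi>] bX]
 obtain f where f: "G_factor_map \<Gamma> B \<beta> X \<phi> f" by (rule exE)
 have top: "topspace X = W" by (rule bd(2))
 have fb: "f b\<in>W" using f b top unfolding G_factor_map_def by blast
 have "\<psi> (f b)\<in>K" using fb \<psi>2 Y(1) M(1) by blast
 moreover have "\<psi> (f b) \<circ> \<sigma> g = \<psi> (f b)" if g: "g\<in>stabilizer \<Gamma> \<beta> b" for g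
 proof -
  have gc: "g\<in>carrier \<Gamma>" "\<beta> g b = b" using g by (auto simp: stabilizer_def)
  have "f (\<beta> g b) = \<phi> g (f b)" using f b gc(1) unfolding G_factor_map_def by blast
  then have "f b = \<phi> g (f b)" by (simp add: gc(2))
  moreover have "\<psi> (\<phi> g (f b)) = \<psi> (f b) \<circ> \<sigma> g" by (rule bd(3)[OF gc(1) fb])
  ultimately show ?thesis by simp
 qed
 ultimately show ?thesis by blast
qed

section \<open>Faithful extremely proximal actions\<close>

lemma (in group) inv_cancel [simp]:
 assumes "g\<in>carrier G" "x\<in>carrier G"
 shows "inv g\<otimes>(g\<otimes>x) = x" "g\<otimes>(inv g\<otimes>x) = x"
 using assms by (simp_all add: m_assoc [symmetric])

lemma (in group) generate_commute:
 assumes "S\<subseteq>carrier G" "a\<in>carrier G" "\<And>s. s\<in>S ==> a\<otimes>s = s\<otimes>a" "x\<in>generate G S"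
 shows "a\<otimes>x = x\<otimes>a"
 using assms(4)
proof (induction rule: generate.induct)
 case one then show ?case using assms(2) by simp
next
 case (incl h) then show ?case by (rule assms(3))
next
 case (inv h)
 then have h: "h\<in>carrier G" using assms(1) by blast
 have "inv h\<otimes>(a\<otimes>h)\<otimes>inv h = inv h\<otimes>(h\<otimes>a)\<otimes>inv h" using assms(3)[OF inv] by simp
 then show ?case using h assms(2) by (simp add: m_assoc inv_solve_left)
next
 case (eng h1 h2)
 then have h: "h1\<in>carrier G" "h2\<in>carrier G" using generate_incl[OF assms(1)] by auto
 have "a\<otimes>(h1\<otimes>h2) = (a\<otimes>h1)\<otimes>h2" using h assms(2) by (simp add: m_assoc)
 also have "\<dots> = h1\<otimes>(a\<otimes>h2)" using h assms(2) eng by (simp add: m_assoc)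
 also have "\<dots> = (h1\<otimes>h2)\<otimes>a" using h assms(2) eng by (simp add: m_assoc)
 finally show ?case .
qed

locale ep_action =
 fixes \<Gamma> :: "('a, 'm) monoid_scheme" (structure) and Z :: "'z topology" and \<zeta> :: "'a => 'z => 'z"
 assumes grp: "group \<Gamma>"
  and cgs: "compact_G_space \<Gamma> (disc \<Gamma>) Z \<zeta>"
  and minim: "minimal_action \<Gamma> Z \<zeta>"
  and ep: "extremely_proximal \<Gamma> Z \<zeta>"
  and faith: "faithful_action \<Gamma> (topspace Z) \<zeta>"
begin

sublocale group \<Gamma> by (rule grp)

lemma ga: "group_action \<Gamma> (topspace Z) \<zeta>"
 using cgs by (simp add: compact_G_space_def continuous_action_def)

lemma Haus: "Hausdorff_space Z" and comp: "compact_space Z" and nonempty: "topspace Z\<noteq>{}"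
 using cgs by (simp_all add: compact_G_space_def)

lemma act_cl [simp]: "g\<in>carrier \<Gamma> ==> x\<in>topspace Z ==> \<zeta> g x\<in>topspace Z"
 by (rule group_action.element_image[OF ga _ _ refl])

lemma act_mult: "g\<in>carrier \<Gamma> ==> h\<in>carrier \<Gamma> ==> x\<in>topspace Z ==> \<zeta> (g\<otimes>h) x = \<zeta> g (\<zeta> h x)"
 by (rule group_action.composition_rule[OF ga])

lemma act_one [simp]: "x\<in>topspace Z ==> \<zeta> \<one> x = x"
 using group_action.id_eq_one[OF ga] by (metis restrict_apply')

lemma act_inv [simp]:
 assumes "g\<in>carrier \<Gamma>" "x\<in>topspace Z"
 shows "\<zeta> (inv g) (\<zeta> g x) = x" "\<zeta> g (\<zeta> (inv g) x) = x"
 using act_mult[of "inv g" g x] act_mult[of g "inv g" x] assms by simp_all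

lemma act_cont:
 assumes g: "g\<in>carrier \<Gamma>" shows "continuous_map Z Z (\<zeta> g)"
proof -
 have "continuous_map (prod_topology (disc \<Gamma>) Z) Z (\<lambda>(g, x). \<zeta> g x)"
  using cgs by (simp add: compact_G_space_def continuous_action_def)
 moreover have "continuous_map Z (prod_topology (disc \<Gamma>) Z) (\<lambda>x. (g, x))"
  using g by (simp add: continuous_map_pairedI)
 ultimately have "continuous_map Z Z ((\<lambda>(g, x). \<zeta> g x) \<circ> (\<lambda>x. (g, x)))"
  by (rule continuous_map_compose[rotated])
 then show ?thesis by (simp add: o_def)
qed

lemma act_image_eq:
 assumes "g\<in>carrier \<Gamma>" "A\<subseteq>topspace Z"
 shows "\<zeta> g ` A = {x\<in>topspace Z. \<zeta> (inv g) x\<in>A}"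
proof -
 have "x\<in>\<zeta> g ` A" if "x\<in>topspace Z" "\<zeta> (inv g) x\<in>A" for x
  using act_inv(2)[OF assms(1) that(1)] that(2) by (metis imageI)
 then show ?thesis using assms act_inv(1) by (auto simp: subset_iff)
qed

lemma act_open: "g\<in>carrier \<Gamma> ==> openin Z U ==> openin Z (\<zeta> g ` U)"
 using act_cont[of "inv g"] openin_subset[of Z U] by (simp add: act_image_eq continuous_map_def)

lemma faithD:
 assumes "g\<in>carrier \<Gamma>" "\<And>x. x\<in>topspace Z ==> \<zeta> g x = x"
 shows "g = \<one>"
proof -
 have ext: "\<zeta> h\<in>extensional (topspace Z)" if "h\<in>carrier \<Gamma>" for h
  using group_action.bij_prop0[OF ga that] by (simp add: Bij_def)
 have "\<zeta> g = \<zeta> \<one>"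
  by (rule extensionalityI[where A = "topspace Z"]) (use ext assms in auto)
 then show ?thesis using faithful_action.faithful[OF faith] assms(1) by (auto dest: inj_onD)
qed

lemma act_eqI:
 assumes "g\<in>carrier \<Gamma>" "h\<in>carrier \<Gamma>" "\<And>x. x\<in>topspace Z ==> \<zeta> g x = \<zeta> h x"
 shows "g = h"
proof -
 have "inv h\<otimes>g = \<one>"
 proof (rule faithD)
  show "\<zeta> (inv h\<otimes>g) x = x" if x: "x\<in>topspace Z" for x
   using act_mult[of "inv h" g x] x assms by simp
 qed (use assms in simp)
 then have "h\<otimes>(inv h\<otimes>g) = h" using assms by simp
 then show ?thesis using assms by simp
qed

lemma orbit_meets:
 assumes "x\<in>topspace Z" "openin Z U" "U\<noteq>{}"
 obtains g where "g\<in>carrier \<Gamma>" "\<zeta> g x\<in>U"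
proof -
 have "Z closure_of (orbit \<Gamma> \<zeta> x) = topspace Z" using minim assms(1) by (auto simp: minimal_action_def)
 moreover obtain y where "y\<in>U" using assms(3) by blast
 ultimately have "y\<in>Z closure_of (orbit \<Gamma> \<zeta> x)" using openin_subset[OF assms(2)] by blast
 then obtain v where "v\<in>orbit \<Gamma> \<zeta> x" "v\<in>U" using \<open>y\<in>U\<close> assms(2) by (auto simp: in_closure_of)
 then show ?thesis using that by (auto simp: orbit_def)
qed

text \<open>Extreme proximality squeezes \<open>C\<close> near one point, and minimality carries that point into any prescribed \<open>U\<close>.\<close>
lemma compress:
 assumes C: "closedin Z C" "C\<noteq>topspace Z" and U: "openin Z U" "U\<noteq>{}"
 obtains g where "g\<in>carrier \<Gamma>" "\<zeta> g ` C\<subseteq>U"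
proof -
 have "compressible \<Gamma> Z \<zeta> C" using ep C by (simp add: extremely_proximal_def)
 then obtain x where x: "x\<in>topspace Z" "\<forall>V. openin Z V \<and> x\<in>V --> (\<exists>g\<in>carrier \<Gamma>. \<zeta> g ` C\<subseteq>V)"
  unfolding compressible_def by blast
 obtain h where h: "h\<in>carrier \<Gamma>" "\<zeta> h x\<in>U" using orbit_meets[OF x(1) U] by metis
 have "openin Z (\<zeta> (inv h) ` U)" using act_open h U by simp
 moreover have "x\<in>\<zeta> (inv h) ` U"
 proof -
  have "x = \<zeta> (inv h) (\<zeta> h x)" using x(1) h(1) by simp
  then show ?thesis using h(2) by blast
 qed
 ultimately obtain g where g: "g\<in>carrier \<Gamma>" "\<zeta> g ` C\<subseteq>\<zeta> (inv h) ` U" using x(2) by blast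
 have "\<zeta> (h\<otimes>g) ` C\<subseteq>U"
 proof clarify
  fix c assume c: "c\<in>C"
  then have cZ: "c\<in>topspace Z" using closedin_subset[OF C(1)] by blast
  obtain u where u: "u\<in>U" "\<zeta> g c = \<zeta> (inv h) u" using g c by blast
  have "u\<in>topspace Z" using u openin_subset[OF U(1)] by blast
  then have "\<zeta> h (\<zeta> g c) = u" using u h by simp
  then show "\<zeta> (h\<otimes>g) c\<in>U" using act_mult[OF h(1) g(1) cZ] u by simp
 qed
 then show ?thesis using that[of "h\<otimes>g"] h g by simp
qed

text \<open>Rigid stabilizers: conjugating by a compressing element moves the support of an element into any open set.\<close>
definition rist :: "'z set => 'a set" where
 "rist U = {g\<in>carrier \<Gamma>. \<forall>x\<in>topspace Z - U. \<zeta> g x = x}"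

text \<open>The generators of the envelope; see \<open>envelope_eq\<close>.\<close>
definition fixopen :: "'a set" where
 "fixopen = {g\<in>carrier \<Gamma>. \<exists>U. openin Z U \<and> U\<noteq>{} \<and> (\<forall>x\<in>U. \<zeta> g x = x)}"

lemma ristD: "g\<in>rist U ==> g\<in>carrier \<Gamma>" "g\<in>rist U ==> x\<in>topspace Z ==> x\<notin>U ==> \<zeta> g x = x"
 by (auto simp: rist_def)

lemma fixes_inv:
 assumes "g\<in>carrier \<Gamma>" "x\<in>topspace Z" "\<zeta> g x = x" shows "\<zeta> (inv g) x = x"
 using act_inv(1)[OF assms(1,2)] assms(3) by simp

lemma rist_preserves:
 assumes "g\<in>rist U" "x\<in>topspace Z" "x\<in>U" shows "\<zeta> g x\<in>U"
proof (rule ccontr)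
 assume *: "\<zeta> g x\<notin>U"
 have g: "g\<in>carrier \<Gamma>" using assms ristD by blast
 have "\<zeta> g (\<zeta> g x) = \<zeta> g x" using ristD(2)[OF assms(1)] * g assms(2) by simp
 then have "\<zeta> (inv g) (\<zeta> g (\<zeta> g x)) = \<zeta> (inv g) (\<zeta> g x)" by simp
 then have "\<zeta> g x = x" using g assms(2) by simp
 then show False using * assms by simp
qed

lemma rist_commute:
 assumes "g\<in>rist U" "h\<in>rist V" "U \<inter> V = {}" shows "g\<otimes>h = h\<otimes>g"
proof -
 have c: "g\<in>carrier \<Gamma>" "h\<in>carrier \<Gamma>" using assms ristD by auto
 show ?thesis
 proof (rule act_eqI)
  fix x assume x: "x\<in>topspace Z"
  consider "x\<in>U" "x\<notin>V" | "x\<in>V" "x\<notin>U" | "x\<notin>U" "x\<notin>V" using assms(3) by blast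
  then have "\<zeta> g (\<zeta> h x) = \<zeta> h (\<zeta> g x)"
  proof cases
   case 1
   then have "\<zeta> g x\<in>U" using rist_preserves assms x by blast
   then have "\<zeta> g x\<notin>V" using assms(3) by blast
   then show ?thesis using ristD(2)[OF assms(2)] x 1 c by simp
  next
   case 2
   then have "\<zeta> h x\<in>V" using rist_preserves assms x by blast
   then have "\<zeta> h x\<notin>U" using assms(3) by blast
   then show ?thesis using ristD(2)[OF assms(1)] x 2 c by simp
  next
   case 3
   then show ?thesis using ristD(2)[OF assms(1)] ristD(2)[OF assms(2)] x by simp
  qed
  then show "\<zeta> (g\<otimes>h) x = \<zeta> (h\<otimes>g) x" using act_mult x c by simp
 qed (use c in auto)
qed

lemma rist_conj:
 assumes "r\<in>rist U" "g\<in>carrier \<Gamma>" "U\<subseteq>topspace Z"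
 shows "g\<otimes>r\<otimes>inv g\<in>rist (\<zeta> g ` U)"
proof -
 have r: "r\<in>carrier \<Gamma>" using assms ristD by blast
 have "\<zeta> (g\<otimes>r\<otimes>inv g) x = x" if x: "x\<in>topspace Z" "x\<notin>\<zeta> g ` U" for x
 proof -
  have "\<zeta> (inv g) x\<notin>U" using x assms by (simp add: act_image_eq)
  then have "\<zeta> r (\<zeta> (inv g) x) = \<zeta> (inv g) x" using ristD(2)[OF assms(1)] x assms(2) by simp
  then show ?thesis using act_mult x assms(2) r by simp
 qed
 then show ?thesis using r assms by (simp add: rist_def)
qed

lemma fixes_conj:
 assumes "r\<in>carrier \<Gamma>" "g\<in>carrier \<Gamma>" "U\<subseteq>topspace Z" "\<And>x. x\<in>U ==> \<zeta> r x = x" "y\<in>\<zeta> g ` U"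
 shows "\<zeta> (g\<otimes>r\<otimes>inv g) y = y"
proof -
 obtain x where x: "x\<in>U" "y = \<zeta> g x" using assms by blast
 then show ?thesis using assms(1-4) act_mult by (auto simp: subset_iff)
qed

lemma fixopen_conj:
 assumes "s\<in>fixopen" "g\<in>carrier \<Gamma>" shows "g\<otimes>s\<otimes>inv g\<in>fixopen"
proof -
 obtain U where U: "s\<in>carrier \<Gamma>" "openin Z U" "U\<noteq>{}" "\<And>x. x\<in>U ==> \<zeta> s x = x"
  using assms by (auto simp: fixopen_def)
 have "\<zeta> (g\<otimes>s\<otimes>inv g) y = y" if "y\<in>\<zeta> g ` U" for y
  using fixes_conj[OF U(1) assms(2) openin_subset[OF U(2)] U(4) that] .
 moreover have "\<zeta> g ` U\<noteq>{}" using U(3) by simp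
 moreover have "g\<otimes>s\<otimes>inv g\<in>carrier \<Gamma>" using U(1) assms(2) by simp
 ultimately show ?thesis unfolding fixopen_def using act_open[OF assms(2) U(2)] by blast
qed

text \<open>A point moved by \<open>r\<close> and its image have disjoint neighbourhoods. Such a point lies in every set that
supports \<open>r\<close>, which gives the last clause.\<close>
lemma displaced:
 assumes r: "r\<in>carrier \<Gamma>" "r\<noteq>\<one>"
 shows "\<exists>U. openin Z U \<and> U\<noteq>{} \<and> \<zeta> r ` U \<inter> U = {} \<and> (\<forall>W. r\<in>rist W --> U \<inter> W\<noteq>{})"
proof -
 obtain x where x: "x\<in>topspace Z" "\<zeta> r x\<noteq>x" using faithD[OF r(1)] r(2) by blast
 have "\<zeta> r x\<in>topspace Z" using x(1) r(1) by simp
 then have "\<exists>U V. openin Z U \<and> openin Z V \<and> x\<in>U \<and> \<zeta> r x\<in>V \<and> disjnt U V"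
  using Haus x unfolding Hausdorff_space_def by simp
 then obtain U V where UV: "openin Z U" "openin Z V" "x\<in>U" "\<zeta> r x\<in>V" "disjnt U V" by blast
 define O' where "O' = U \<inter> {y\<in>topspace Z. \<zeta> r y\<in>V}"
 have "openin Z {y\<in>topspace Z. \<zeta> r y\<in>V}" using act_cont[OF r(1)] UV(2) by (simp add: continuous_map_def)
 then have "openin Z O'" using UV(1) unfolding O'_def by blast
 moreover have xO: "x\<in>O'" using UV x by (simp add: O'_def)
 moreover have "\<zeta> r ` O' \<inter> O' = {}" using UV(5) by (auto simp: O'_def disjnt_def)
 moreover have "O' \<inter> W\<noteq>{}" if "r\<in>rist W" for W
 proof -
  have "x\<in>W" using ristD(2)[OF that x(1)] x(2) by blast
  then show ?thesis using xO by blast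
 qed
 ultimately show ?thesis by blast
qed

lemma displaced_in:
 assumes r: "r\<in>rist W" "r\<noteq>\<one>" "openin Z W"
 obtains U where "openin Z U" "U\<noteq>{}" "U\<subseteq>W" "\<zeta> r ` U \<inter> U = {}"
proof -
 have rc: "r\<in>carrier \<Gamma>" using r ristD by blast
 obtain U where U: "openin Z U" "U\<noteq>{}" "\<zeta> r ` U \<inter> U = {}" "U \<inter> W\<noteq>{}"
  using displaced[OF rc r(2)] r(1) by blast
 show ?thesis by (rule that[of "U \<inter> W"]) (use U r(3) in auto)
qed

end

text \<open>The action is not topologically free; every rigid stabilizer is then non-trivial, by compression.\<close>
locale micro_action = ep_action +
 assumes nontriv: "\<exists>s\<in>fixopen. s\<noteq>\<one>"
begin

lemma rist_nontrivial:
 assumes U: "openin Z U" "U\<noteq>{}"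
 obtains r where "r\<in>rist U" "r\<noteq>\<one>"
proof -
 obtain s W where s: "s\<in>carrier \<Gamma>" "s\<noteq>\<one>" "openin Z W" "W\<noteq>{}" "\<And>x. x\<in>W ==> \<zeta> s x = x"
  using nontriv by (auto simp: fixopen_def)
 have "s\<in>rist (topspace Z - W)" using s by (auto simp: rist_def)
 have C: "closedin Z (topspace Z - W)" "topspace Z - W\<noteq>topspace Z"
  using s(3,4) openin_subset[OF s(3)] by auto
 obtain g where g: "g\<in>carrier \<Gamma>" "\<zeta> g ` (topspace Z - W)\<subseteq>U" using compress[OF C U] by metis
 have "g\<otimes>s\<otimes>inv g\<in>rist (\<zeta> g ` (topspace Z - W))"
  using rist_conj[OF \<open>s\<in>rist _\<close> g(1)] by simp
 then have "g\<otimes>s\<otimes>inv g\<in>rist U" using g(2) unfolding rist_def by blast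
 moreover have "g\<otimes>s\<otimes>inv g\<noteq>\<one>"
 proof
  assume "g\<otimes>s\<otimes>inv g = \<one>"
  then have "inv g\<otimes>(g\<otimes>s\<otimes>inv g)\<otimes>g = \<one>" using g by simp
  then show False using g s by (simp add: m_assoc)
 qed
 ultimately show ?thesis using that by blast
qed

text \<open>An element supported in an open set that \<open>r\<close> displaces does not commute with \<open>r\<close>, as the conjugate has disjoint support.\<close>
lemma rist_nonabelian:
 assumes U: "openin Z U" "U\<noteq>{}"
 obtains r s where "r\<in>rist U" "s\<in>rist U" "r\<otimes>s\<noteq>s\<otimes>r"
proof -
 obtain r where r: "r\<in>rist U" "r\<noteq>\<one>" using rist_nontrivial[OF U] .
 obtain V where V: "openin Z V" "V\<noteq>{}" "V\<subseteq>U" "\<zeta> r ` V \<inter> V = {}" using displaced_in[OF r U(1)] .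
 obtain s where s: "s\<in>rist V" "s\<noteq>\<one>" using rist_nontrivial[OF V(1,2)] .
 have c: "r\<in>carrier \<Gamma>" "s\<in>carrier \<Gamma>" using r s ristD by auto
 have "r\<otimes>s\<noteq>s\<otimes>r"
 proof
  assume "r\<otimes>s = s\<otimes>r"
  then have "r\<otimes>s\<otimes>inv r = s" using c by (simp add: m_assoc)
  then have s': "s\<in>rist (\<zeta> r ` V)" using rist_conj[OF s(1) c(1) openin_subset[OF V(1)]] by simp
  have "s = \<one>"
  proof (rule faithD[OF c(2)])
   fix x assume "x\<in>topspace Z"
   then show "\<zeta> s x = x" using ristD(2)[OF s(1)] ristD(2)[OF s'] V(4) by blast
  qed
  then show False using s by simp
 qed
 moreover have "s\<in>rist U" using s V(3) by (auto simp: rist_def)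
 ultimately show ?thesis using that r by blast
qed

lemma centralizer_fixopen:
 assumes e: "e\<in>carrier \<Gamma>" "\<And>s. s\<in>fixopen ==> e\<otimes>s = s\<otimes>e"
 shows "e = \<one>"
proof (rule ccontr)
 assume ne: "e\<noteq>\<one>"
 obtain U where U: "openin Z U" "U\<noteq>{}" "\<zeta> e ` U \<inter> U = {}" using displaced[OF e(1) ne] by blast
 obtain s where s: "s\<in>rist U" "s\<noteq>\<one>" using rist_nontrivial[OF U(1,2)] .
 have c: "s\<in>carrier \<Gamma>" using s ristD by auto
 have Us: "U\<subseteq>topspace Z" using U(1) by (rule openin_subset)
 have oe: "openin Z (\<zeta> e ` U)" using act_open e U by simp
 have "s\<in>fixopen" unfolding fixopen_def
 proof (intro CollectI conjI exI)
  show "\<forall>x\<in>\<zeta> e ` U. \<zeta> s x = x"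
   using ristD(2)[OF s(1)] U(3) openin_subset[OF oe] by blast
 qed (use c oe U in auto)
 then have "e\<otimes>s\<otimes>inv e = s" using e c by (simp add: m_assoc)
 then have s': "s\<in>rist (\<zeta> e ` U)" using rist_conj[OF s(1) e(1) Us] by simp
 have "s = \<one>"
 proof (rule faithD[OF c])
  fix x assume "x\<in>topspace Z"
  then show "\<zeta> s x = x" using ristD(2)[OF s(1)] ristD(2)[OF s'] U(3) by blast
 qed
 then show False using s by simp
qed

end

section \<open>Means and co-amenability\<close>

text \<open>A translation-invariant space of bounded functions containing the constants. Functions count only through their values
on the carrier; the last axiom says so.\<close>
locale mean_class = group H for H :: "('h, 'm) monoid_scheme" (structure) +
 fixes F :: "('h => real) set"
 assumes F_bounded: "f\<in>F ==> \<exists>B. \<forall>h\<in>carrier H. \<bar>f h\<bar>\<le>B"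
  and F_const: "(\<lambda>_. c)\<in>F"
  and F_add: "f\<in>F ==> g\<in>F ==> (\<lambda>h. f h + g h)\<in>F"
  and F_scale: "f\<in>F ==> (\<lambda>h. c * f h)\<in>F"
  and F_translate: "f\<in>F ==> a\<in>carrier H ==> (\<lambda>h. f (a\<otimes>h))\<in>F"
  and F_cong: "f\<in>F ==> (\<And>h. h\<in>carrier H ==> f h = g h) ==> g\<in>F"
begin

text \<open>Left translation, acting as the identity off the carrier so that \<open>shift \<one>\<close> is the identity.\<close>
definition shift :: "'h => ('h => real) => 'h => real" where
 "shift g f = (\<lambda>h. if h\<in>carrier H then f (g\<otimes>h) else f h)"

text \<open>Forcing the value 0 off \<open>F\<close> makes a mean determined by its values on \<open>F\<close>, so that \<open>means\<close> is a compact set in the product.\<close>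
definition means :: "(('h => real) => real) set" where
 "means = {M. (\<forall>f\<in>F. \<forall>g\<in>F. M (\<lambda>h. f h + g h) = M f + M g) \<and> (\<forall>f\<in>F. \<forall>c. M (\<lambda>h. c * f h) = c * M f) \<and>
  (\<forall>f\<in>F. (\<forall>h\<in>carrier H. 0\<le>f h) --> 0\<le>M f) \<and> M (\<lambda>_. 1) = 1 \<and> (\<forall>f. f\<notin>F --> M f = 0)}"

lemma F_diff: "f\<in>F ==> g\<in>F ==> (\<lambda>h. f h - g h)\<in>F"
 using F_add[OF _ F_scale[of g "-1"], of f] by simp

lemma shift_F: "f\<in>F ==> g\<in>carrier H ==> shift g f\<in>F"
 by (rule F_cong[OF F_translate]) (auto simp: shift_def)

lemma shift_mult: "g\<in>carrier H ==> h\<in>carrier H ==> shift (g\<otimes>h) f = shift h (shift g f)"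
 by (auto simp: shift_def m_assoc)

lemma shift_one: "shift \<one> f = f"
 by (auto simp: shift_def)

lemma shift_F_iff: assumes g: "g\<in>carrier H" shows "shift g f\<in>F \<longleftrightarrow> f\<in>F"
 using shift_F[OF _ g, of f] shift_F[of "shift g f" "inv g"] shift_mult[OF g, of "inv g" f] g shift_one by auto

lemma meansD:
 assumes "M\<in>means"
 shows "f\<in>F ==> g\<in>F ==> M (\<lambda>h. f h + g h) = M f + M g" "f\<in>F ==> M (\<lambda>h. c * f h) = c * M f"
  "f\<in>F ==> (\<And>h. h\<in>carrier H ==> 0\<le>f h) ==> 0\<le>M f" "M (\<lambda>_. 1) = 1" "f\<notin>F ==> M f = 0"
 using assms unfolding means_def by blast+

lemma means_diff: "M\<in>means ==> f\<in>F ==> g\<in>F ==> M (\<lambda>h. f h - g h) = M f - M g"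
 using meansD(1)[of M f "\<lambda>h. (-1) * g h"] F_scale[of g "-1"] meansD(2)[of M g "-1"] by simp

lemma means_mono: "M\<in>means ==> f\<in>F ==> g\<in>F ==> (\<And>h. h\<in>carrier H ==> f h\<le>g h) ==> M f\<le>M g"
 using meansD(3)[of M "\<lambda>h. g h - f h"] F_diff[of g f] means_diff[of M g f] by simp

lemma means_cong: "M\<in>means ==> f\<in>F ==> (\<And>h. h\<in>carrier H ==> f h = g h) ==> M f = M g"
 using means_mono[of M f g] means_mono[of M g f] F_cong[of f g] by force

lemma means_const: "M\<in>means ==> M (\<lambda>_. c) = c"
 using meansD(2)[of M "\<lambda>_. 1" c] meansD(4)[of M] F_const by simp

lemma means_abs_le:
 assumes "M\<in>means" "f\<in>F" "\<And>h. h\<in>carrier H ==> \<bar>f h\<bar>\<le>B" shows "\<bar>M f\<bar>\<le>B"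
proof -
 have "M f\<le>M (\<lambda>_. B)" by (rule means_mono[OF assms(1,2) F_const]) (use assms(3) in \<open>auto dest: abs_le_D1\<close>)
 moreover have "M (\<lambda>_. -B)\<le>M f" by (rule means_mono[OF assms(1) F_const assms(2)]) (use assms(3) in \<open>force dest: abs_le_D2\<close>)
 ultimately show ?thesis using means_const[OF assms(1)] by auto
qed

lemma means_shift: "M\<in>means ==> f\<in>F ==> g\<in>carrier H ==> M (shift g f) = M (\<lambda>h. f (g\<otimes>h))"
 by (rule means_cong[OF _ shift_F]) (auto simp: shift_def)

lemma means_flow: "affine_flow H shift means"
 unfolding affine_flow_def
proof (intro conjI ballI allI)
 show "shift (g\<otimes>h) i = shift h (shift g i)" if "g\<in>carrier H" "h\<in>carrier H" for g h i
  by (rule shift_mult[OF that])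
 show "shift \<one> i = i" for i by (rule shift_one)
 show "means\<noteq>{}"
 proof -
  have "(\<lambda>f. if f\<in>F then f \<one> else 0)\<in>means"
   unfolding means_def using F_add F_scale F_const by auto
  then show ?thesis by blast
 qed
 show "fconvex means"
  unfolding fconvex_def
 proof (intro ballI)
  fix M N and t :: real assume M: "M\<in>means" and N: "N\<in>means" and t: "t\<in>{0..1}"
  show "(\<lambda>i. (1 - t) * M i + t * N i)\<in>means"
   unfolding means_def
  proof (intro CollectI conjI ballI allI impI)
   fix f assume f: "f\<in>F" "\<forall>h\<in>carrier H. 0\<le>f h"
   have "0\<le>M f" "0\<le>N f" using meansD(3)[OF M f(1)] meansD(3)[OF N f(1)] f(2) by blast+
   then show "0\<le>(1 - t) * M f + t * N f" using t by auto
  qed (use meansD[OF M] meansD[OF N] in \<open>auto simp: algebra_simps\<close>)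
 qed
 show "M \<circ> shift g\<in>means" if g: "g\<in>carrier H" and M: "M\<in>means" for g M
  unfolding means_def
 proof (intro CollectI conjI ballI allI impI)
  fix f f' assume f: "f\<in>F" "f'\<in>F"
  have "shift g (\<lambda>h. f h + f' h) = (\<lambda>h. shift g f h + shift g f' h)" by (auto simp: shift_def)
  then show "(M \<circ> shift g) (\<lambda>h. f h + f' h) = (M \<circ> shift g) f + (M \<circ> shift g) f'"
   using meansD(1)[OF M shift_F[OF f(1) g] shift_F[OF f(2) g]] by simp
 next
  fix f c assume f: "f\<in>F"
  have "shift g (\<lambda>h. c * f h) = (\<lambda>h. c * shift g f h)" by (auto simp: shift_def)
  then show "(M \<circ> shift g) (\<lambda>h. c * f h) = c * (M \<circ> shift g) f"
   using meansD(2)[OF M shift_F[OF f g]] by simp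
 next
  fix f assume f: "f\<in>F" "\<forall>h\<in>carrier H. 0\<le>f h"
  then show "0\<le>(M \<circ> shift g) f" using meansD(3)[OF M shift_F[OF f(1) g]] g by (simp add: shift_def)
 next
  have "shift g (\<lambda>_. 1) = (\<lambda>_. 1)" by (auto simp: shift_def)
  then show "(M \<circ> shift g) (\<lambda>_. 1) = 1" using meansD(4)[OF M] by simp
 next
  fix f assume "f\<notin>F"
  then show "(M \<circ> shift g) f = 0" using meansD(5)[OF M] shift_F_iff[OF g] by simp
 qed
 show "compact means"
 proof -
  have "\<forall>f. \<exists>B. f\<in>F --> (\<forall>h\<in>carrier H. \<bar>f h\<bar>\<le>B)" using F_bounded by blast
  then obtain B where B: "\<forall>f. f\<in>F --> (\<forall>h\<in>carrier H. \<bar>f h\<bar>\<le>B f)" by metis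
  define C where "C = (\<lambda>f. if f\<in>F then B f else 0)"
  have "compactin (product_topology (\<lambda>i. euclideanreal) UNIV) (PiE UNIV (\<lambda>f. {- C f..C f}))"
   by (subst compactin_PiE) simp
  then have K: "compact (PiE UNIV (\<lambda>f. {- C f..C f}))"
   by (simp add: euclidean_product_topology)
  have sub: "means\<subseteq>PiE UNIV (\<lambda>f. {- C f..C f})"
  proof
   fix M assume M: "M\<in>means"
   have "\<bar>M f\<bar>\<le>C f" for f
    using means_abs_le[OF M, of f "B f"] B meansD(5)[OF M, of f] by (auto simp: C_def)
   then show "M\<in>PiE UNIV (\<lambda>f. {- C f..C f})" by (auto simp: PiE_iff abs_le_iff) (smt (verit))
  qed
  have cc: "continuous_on UNIV (\<lambda>M. M f)" for f :: "'h => real" by (rule continuous_on_coord)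
  have "means = (\<Inter>f\<in>F. \<Inter>g\<in>F. {M. M (\<lambda>h. f h + g h) = M f + M g}) \<inter> (\<Inter>f\<in>F. \<Inter>c. {M. M (\<lambda>h. c * f h) = c * M f}) \<inter>
   (\<Inter>f\<in>{f\<in>F. \<forall>h\<in>carrier H. 0\<le>f h}. {M. 0\<le>M f}) \<inter> {M. M (\<lambda>_. 1) = 1} \<inter> (\<Inter>f\<in>-F. {M. M f = 0})"
   unfolding means_def by auto
  also have "closed \<dots>"
   by (intro closed_Int closed_INT ballI closed_Collect_eq closed_Collect_le continuous_intros cc)
  finally have "closed means" .
  then show ?thesis using K sub by (metis compact_Int_closed inf.absorb_iff2)
 qed
qed

end

lemma lookup_scaleR_real: "Poly_Mapping.lookup (c *\<^sub>R (v :: 'k \<Rightarrow>\<^sub>0 real)) i = c * Poly_Mapping.lookup v i"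
proof -
 have "finite {i. c *\<^sub>R Poly_Mapping.lookup v i\<noteq>0}"
  by (rule finite_subset[OF _ finite_lookup[of v]]) auto
 then show ?thesis unfolding scaleR_poly_mapping_def by (simp add: Abs_poly_mapping_inverse)
qed

lemma continuous_map_fun_euclidean:
 "continuous_map X (euclidean :: ('i => real) topology) f \<longleftrightarrow> (\<forall>i. continuous_map X euclideanreal (\<lambda>x. f x i))"
 using continuous_map_componentwise_UNIV[of X "\<lambda>_. euclideanreal" f] by (simp add: euclidean_product_topology)

lemma continuous_map_eval: "continuous_map (euclidean :: ('i => real) topology) euclideanreal (\<lambda>x. x i)"
 using continuous_map_fun_euclidean[of euclidean "\<lambda>x :: 'i => real. x"] by (simp add: continuous_map_id[unfolded id_def])

text \<open>The coarsest topology for which the coordinates of an injective linear map into a product of lines are continuous.\<close>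
lemma locally_convex_pullback:
 fixes h :: "'v::real_vector => 'i => real"
 assumes add: "\<And>x y i. h (x + y) i = h x i + h y i" and scale: "\<And>c x i. h (c *\<^sub>R x) i = c * h x i" and inj: "inj h"
 shows "locally_convex_space (pullback_topology UNIV h euclidean)"
proof -
 let ?V = "pullback_topology UNIV h (euclidean :: ('i => real) topology)"
 have top: "topspace ?V = UNIV" by (simp add: topspace_pullback_topology)
 have coord: "continuous_map ?V euclideanreal (\<lambda>v. h v i)" for i
  using continuous_map_pullback[OF continuous_map_eval[of i], of UNIV h] by (simp add: o_def)
 have h0: "h 0 i = 0" for i using scale[of 0 0 i] by simp
 show ?thesis
  unfolding locally_convex_space_def
 proof (intro conjI allI impI)
  show "topspace ?V = UNIV" by (rule top)
  show "Hausdorff_space ?V" unfolding Hausdorff_space_def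
  proof (intro allI impI)
   fix x y assume "x\<in>topspace ?V \<and> y\<in>topspace ?V \<and> x\<noteq>y"
   then have "h x\<noteq>h y" using inj by (auto dest: injD)
   then obtain U V where UV: "open U" "open V" "h x\<in>U" "h y\<in>V" "U \<inter> V = {}"
    using hausdorff_fun by (metis)
   have "openin ?V (h -` U)" "openin ?V (h -` V)" using UV(1,2) by (auto simp: openin_pullback_topology)
   then show "\<exists>U V. openin ?V U \<and> openin ?V V \<and> x\<in>U \<and> y\<in>V \<and> disjnt U V"
    using UV(3-5) by (intro exI[of _ "h -` U"] exI[of _ "h -` V"]) (auto simp: disjnt_def)
  qed
  have f: "continuous_map (prod_topology ?V ?V) euclideanreal (\<lambda>p. h (fst p) i)"
   "continuous_map (prod_topology ?V ?V) euclideanreal (\<lambda>p. h (snd p) i)"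
   "continuous_map (prod_topology euclideanreal ?V) euclideanreal (\<lambda>p. h (snd p) i)" for i
   using continuous_map_compose[OF continuous_map_fst coord] continuous_map_compose[OF continuous_map_snd coord]
   by (auto simp: o_def)
  show "continuous_map (prod_topology ?V ?V) ?V (\<lambda>(x, y). x + y)"
  proof (rule continuous_map_pullback')
   show "continuous_map (prod_topology ?V ?V) euclidean (h \<circ> (\<lambda>(x, y). x + y))"
    unfolding continuous_map_fun_euclidean using continuous_map_add[OF f(1,2)] by (simp add: o_def case_prod_beta add)
  qed simp
  show "continuous_map (prod_topology euclideanreal ?V) ?V (\<lambda>(c, x). c *\<^sub>R x)"
  proof (rule continuous_map_pullback')
   show "continuous_map (prod_topology euclideanreal ?V) euclidean (h \<circ> (\<lambda>(c, x). c *\<^sub>R x))"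
    unfolding continuous_map_fun_euclidean using continuous_map_real_mult[OF continuous_map_fst f(3)]
    by (simp add: o_def case_prod_beta scale)
  qed simp
  fix U assume "openin ?V U \<and> 0\<in>U"
  then obtain U' where U': "open U'" "U = h -` U'" "h 0\<in>U'" by (auto simp: openin_pullback_topology)
  obtain J e where J: "finite J" "e > 0" "box_at J e (h 0)\<subseteq>U'" using open_fun_box[OF U'(1,3)] .
  have "openin ?V (h -` box_at J e (h 0))" using open_box_at[OF J(1)] by (auto simp: openin_pullback_topology)
  moreover have "convex (h -` box_at J e (h 0))" unfolding convex_def
  proof (intro ballI allI impI)
   fix x y and u v :: real assume xy: "x\<in>h -` box_at J e (h 0)" "y\<in>h -` box_at J e (h 0)" and uv: "0\<le>u" "0\<le>v" "u + v = 1"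
   have "\<bar>u * h x j + v * h y j\<bar> < e" if "j\<in>J" for j
   proof -
    have b: "\<bar>h x j\<bar> < e" "\<bar>h y j\<bar> < e" using xy that by (auto simp: box_at_def h0)
    have "\<bar>u * h x j + v * h y j\<bar>\<le>u * \<bar>h x j\<bar> + v * \<bar>h y j\<bar>"
     using uv abs_triangle_ineq[of "u * h x j" "v * h y j"] by (simp add: abs_mult)
    also have "\<dots> < e" using convex_bound_lt[OF b uv] .
    finally show ?thesis .
   qed
   then show "u *\<^sub>R x + v *\<^sub>R y\<in>h -` box_at J e (h 0)" by (simp add: box_at_def h0 add scale)
  qed
  moreover have "0\<in>h -` box_at J e (h 0)" using J(2) by (simp add: box_at_def)
  ultimately show "\<exists>W. openin ?V W \<and> convex W \<and> 0\<in>W \<and> W\<subseteq>U" using J(3) U'(2) by blast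
 qed
qed

text \<open>Co-amenability speaks of convex sets in the vector space with basis \<open>'a set set\<close>. The injection \<open>code\<close> sends \<open>K\<close> to
basis vectors; \<open>\<Psi>\<close> is the linear map that sends the basis vector of \<open>y\<close> to \<open>y\<close>. On a complement of its kernel
\<open>\<Psi>\<close> is injective, and the part of that complement lying over \<open>K\<close> is a copy of the flow \<open>K\<close>.\<close>
lemma coamenable_fixed_point:
 fixes \<Gamma> :: "('a, 'm) monoid_scheme" and K :: "('i => real) set" and code :: "('i => real) => 'a set set"
 assumes grp: "group \<Gamma>" and co: "co_amenable \<Gamma> (disc \<Gamma>) L" and L: "L\<subseteq>carrier \<Gamma>"
  and K: "affine_flow \<Gamma> \<sigma> K" and inj: "inj_on code K" and x: "x\<in>K" "\<And>l. l\<in>L ==> x \<circ> \<sigma> l = x"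
 shows "\<exists>y\<in>K. \<forall>g\<in>carrier \<Gamma>. y \<circ> \<sigma> g = y"
proof -
 interpret group \<Gamma> by (rule grp)
 note Kd = affine_flowD[OF K]
 define d where "d = (\<lambda>k i. if k\<in>code ` K then inv_into K code k i else 0)"
 have d_code: "d (code y) = y" if "y\<in>K" for y using that inj by (auto simp: d_def)
 define \<Psi> where "\<Psi> = (\<lambda>(v :: 'a set set \<Rightarrow>\<^sub>0 real) i. \<Sum>k\<in>Poly_Mapping.keys v. Poly_Mapping.lookup v k * d k i)"
 have \<Psi>_eq: "\<Psi> v i = (\<Sum>k\<in>A. Poly_Mapping.lookup v k * d k i)" if "finite A" "Poly_Mapping.keys v\<subseteq>A" for v i A
  unfolding \<Psi>_def by (rule sum.mono_neutral_left) (use that in \<open>auto simp: in_keys_iff\<close>)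
 have \<Psi>_add: "\<Psi> (v + w) i = \<Psi> v i + \<Psi> w i" for v w i
 proof -
  let ?A = "Poly_Mapping.keys v \<union> Poly_Mapping.keys w"
  have "\<Psi> (v + w) i = (\<Sum>k\<in>?A. Poly_Mapping.lookup (v + w) k * d k i)" by (rule \<Psi>_eq) (auto simp: Poly_Mapping.keys_add)
  also have "\<dots> = (\<Sum>k\<in>?A. Poly_Mapping.lookup v k * d k i) + (\<Sum>k\<in>?A. Poly_Mapping.lookup w k * d k i)"
   by (simp add: lookup_add distrib_right sum.distrib)
  also have "\<dots> = \<Psi> v i + \<Psi> w i" using \<Psi>_eq[of ?A v i] \<Psi>_eq[of ?A w i] by simp
  finally show ?thesis .
 qed
 have \<Psi>_scale: "\<Psi> (c *\<^sub>R v) i = c * \<Psi> v i" for c v i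
 proof -
  have "\<Psi> (c *\<^sub>R v) i = (\<Sum>k\<in>Poly_Mapping.keys v. Poly_Mapping.lookup (c *\<^sub>R v) k * d k i)"
   by (rule \<Psi>_eq) (auto simp: in_keys_iff lookup_scaleR_real)
  then show ?thesis by (simp add: lookup_scaleR_real \<Psi>_def sum_distrib_left mult.assoc)
 qed
 have \<Psi>_single: "\<Psi> (Poly_Mapping.single (code y) 1) = y" if "y\<in>K" for y
  using d_code[OF that] by (auto simp: \<Psi>_def)
 define N where "N = {v. \<Psi> v = (\<lambda>_. 0)}"
 \<comment> \<open>\<open>P\<close> projects onto the kernel \<open>N\<close> of \<open>\<Psi>\<close>, so that \<open>(\<Psi>, P)\<close> is injective and \<open>\<Psi>\<close> alone is injective on \<open>P v = 0\<close>.\<close>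
 have "subspace N" unfolding subspace_def N_def using \<Psi>_scale[of 0 0] by (auto simp: \<Psi>_add \<Psi>_scale fun_eq_iff)
 then obtain P where P: "range P\<subseteq>N" "linear P" "\<forall>v\<in>N. P v = v"
  using linear_exists_left_inverse_on[OF linear_id, of N] by auto
 have P_add: "P (v + w) = P v + P w" and P_scale: "P (c *\<^sub>R v) = c *\<^sub>R P v" for v w c
  using P(2) by (simp_all add: linear_add linear_scale)
 have \<Psi>P: "\<Psi> (P v) i = 0" for v i using P(1) unfolding N_def by (auto simp: image_subset_iff fun_eq_iff)
 have PP: "P (P v) = P v" for v using P(1,3) by blast
 define h where "h = (\<lambda>v s. case s of Inl i => \<Psi> v i | Inr k => Poly_Mapping.lookup (P v) k)"
 have h_add: "h (v + w) s = h v s + h w s" and h_scale: "h (c *\<^sub>R v) s = c * h v s" for v w s c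
  unfolding h_def by (auto simp: \<Psi>_add \<Psi>_scale P_add P_scale lookup_add lookup_scaleR_real split: sum.split)
 have h_inj: "inj h"
 proof (rule injI)
  fix v w assume "h v = h w"
  then have "h v s = h w s" for s by simp
  then have 1: "\<Psi> v i = \<Psi> w i" and 2: "Poly_Mapping.lookup (P v) k = Poly_Mapping.lookup (P w) k" for i k
   unfolding h_def by (metis sum.simps(5), metis sum.simps(6))
  have "\<Psi> (v - w) i = 0" for i using \<Psi>_add[of "v - w" w i] 1 by simp
  then have "P (v - w) = v - w" using P(3) by (simp add: N_def fun_eq_iff)
  moreover have "P v = P w" using 2 by (intro poly_mapping_eqI)
  then have "P (v - w) = 0" using P_add[of "v - w" w] by simp
  ultimately show "v = w" by simp
 qed
 define V where "V = pullback_topology UNIV h (euclidean :: (('i + 'a set set) => real) topology)"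
 have lcV: "locally_convex_space V" unfolding V_def by (rule locally_convex_pullback[OF h_add h_scale h_inj])
 have topV: "topspace V = UNIV" using lcV by (simp add: locally_convex_space_def)
 define C where "C = {v. P v = 0 \<and> \<Psi> v\<in>K}"
 define \<kappa> where "\<kappa> = (\<lambda>y. Poly_Mapping.single (code y) 1 - P (Poly_Mapping.single (code y) 1))"
 have \<kappa>: "\<Psi> (\<kappa> y) = y" "P (\<kappa> y) = 0" "\<kappa> y\<in>C" if "y\<in>K" for y
 proof -
  have "\<Psi> (\<kappa> y) i = y i" for i
   using \<Psi>_add[of "\<kappa> y" "P (Poly_Mapping.single (code y) 1)" i] \<Psi>_single[OF that] \<Psi>P by (simp add: \<kappa>_def)
  then show 1: "\<Psi> (\<kappa> y) = y" by blast
  show 2: "P (\<kappa> y) = 0"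
   using P_add[of "\<kappa> y" "P (Poly_Mapping.single (code y) 1)"] PP by (simp add: \<kappa>_def)
  show "\<kappa> y\<in>C" using 1 2 that by (simp add: C_def)
 qed
 have C_eq: "v = w" if "v\<in>C" "w\<in>C" "\<Psi> v = \<Psi> w" for v w
 proof -
  have "h v s = h w s" for s using that by (auto simp: h_def C_def split: sum.split)
  then show ?thesis using h_inj by (auto dest: injD)
 qed
 have \<kappa>\<Psi>: "\<kappa> (\<Psi> v) = v" if "v\<in>C" for v
  by (rule C_eq) (use \<kappa> that in \<open>auto simp: C_def\<close>)
 have to_V: "continuous_map X V f" if cont: "\<And>i. continuous_map X euclideanreal (\<lambda>y. \<Psi> (f y) i)" and P0: "\<And>y. y\<in>topspace X ==> P (f y) = 0"
  for X and f :: "'y => 'a set set \<Rightarrow>\<^sub>0 real"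
 proof -
  have "continuous_map X euclideanreal (\<lambda>y. h (f y) s)" for s
  proof (cases s)
   case (Inl i) then show ?thesis using cont[of i] by (simp add: h_def)
  next
   case (Inr k)
   have "continuous_map X euclideanreal (\<lambda>y. 0)" by simp
   then show ?thesis by (rule continuous_map_eq) (use P0 Inr in \<open>simp add: h_def\<close>)
  qed
  then have "continuous_map X euclidean (h \<circ> f)" unfolding continuous_map_fun_euclidean by (simp add: o_def)
  then show ?thesis unfolding V_def by (rule continuous_map_pullback') simp
 qed
 have \<Psi>_cont: "continuous_map V euclideanreal (\<lambda>v. \<Psi> v i)" for i
  using continuous_map_pullback[OF continuous_map_eval[of "Inl i"], of UNIV h] unfolding V_def by (simp add: o_def h_def)
 define \<phi> where "\<phi> = (\<lambda>g. restrict (\<lambda>v. \<kappa> (\<Psi> v \<circ> \<sigma> g)) C)"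
 have \<phi>C: "\<phi> g v\<in>C" "\<Psi> (\<phi> g v) = \<Psi> v \<circ> \<sigma> g" if "g\<in>carrier \<Gamma>" "v\<in>C" for g v
  using \<kappa>[OF Kd(6)[OF that(1), of "\<Psi> v"]] that(2) by (auto simp: \<phi>_def C_def)
 have act: "group_action \<Gamma> C \<phi>"
 proof (rule group_actionI[OF grp])
  show "\<phi> g\<in>extensional C" for g by (simp add: \<phi>_def)
  show "\<phi> g v\<in>C" if "g\<in>carrier \<Gamma>" "v\<in>C" for g v by (rule \<phi>C(1)[OF that])
  show "\<phi> \<one>\<^bsub>\<Gamma>\<^esub> v = v" if "v\<in>C" for v
  proof (rule C_eq[OF \<phi>C(1) that])
   show "\<Psi> (\<phi> \<one>\<^bsub>\<Gamma>\<^esub> v) = \<Psi> v" using \<phi>C(2)[OF _ that] Kd(2) by (simp add: o_def)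
  qed (use that in auto)
  show "\<phi> (g \<otimes>\<^bsub>\<Gamma>\<^esub> g') v = \<phi> g (\<phi> g' v)" if "g\<in>carrier \<Gamma>" "g'\<in>carrier \<Gamma>" "v\<in>C" for g g' v
  proof (rule C_eq)
   show "\<Psi> (\<phi> (g \<otimes>\<^bsub>\<Gamma>\<^esub> g') v) = \<Psi> (\<phi> g (\<phi> g' v))"
    using \<phi>C that Kd(1) by (auto simp: o_def)
  qed (use \<phi>C that in auto)
 qed
 have "convex_compact_G_space \<Gamma> (disc \<Gamma>) V C \<phi>"
  unfolding convex_compact_G_space_def
 proof (intro conjI ballI)
  show "locally_convex_space V" by (rule lcV)
  show "C\<noteq>{}" using \<kappa>(3) x(1) by blast
  show "compactin V C"
  proof -
   have "compactin (subtopology euclidean K) K" using Kd(3) by (simp add: compactin_subtopology)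
   moreover have "continuous_map (subtopology euclidean K) V \<kappa>"
   proof (rule to_V)
    show "continuous_map (subtopology euclidean K) euclideanreal (\<lambda>y. \<Psi> (\<kappa> y) i)" for i
     by (rule continuous_map_eq[OF continuous_map_from_subtopology[OF continuous_map_eval[of i]]]) (simp add: \<kappa>(1))
   qed (simp add: \<kappa>(2))
   ultimately have "compactin V (\<kappa> ` K)" by (rule image_compactin)
   moreover have "\<kappa> ` K = C" using \<kappa>(3) \<kappa>\<Psi> by (force simp: C_def)
   ultimately show ?thesis by simp
  qed
  show "convex C" unfolding convex_def
  proof (intro ballI allI impI)
   fix v w and s t :: real assume vw: "v\<in>C" "w\<in>C" and st: "0\<le>s" "0\<le>t" "s + t = 1"
   have "(\<lambda>i. (1 - t) * \<Psi> v i + t * \<Psi> w i)\<in>K"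
    using Kd(4) vw st unfolding fconvex_def C_def by auto
   moreover have "\<Psi> (s *\<^sub>R v + t *\<^sub>R w) = (\<lambda>i. (1 - t) * \<Psi> v i + t * \<Psi> w i)"
    using st by (auto simp: \<Psi>_add \<Psi>_scale)
   ultimately show "s *\<^sub>R v + t *\<^sub>R w\<in>C" using vw by (simp add: C_def P_add P_scale)
  qed
  show "continuous_action \<Gamma> (disc \<Gamma>) (subtopology V C) \<phi>"
   unfolding continuous_action_def
  proof (intro conjI)
   show "group_action \<Gamma> (topspace (subtopology V C)) \<phi>" using act topV by simp
   show "continuous_map (prod_topology (disc \<Gamma>) (subtopology V C)) (subtopology V C) (\<lambda>(g, x). \<phi> g x)"
   proof (rule continuous_map_discrete_prod)
    fix g assume g: "g\<in>carrier \<Gamma>"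
    have "continuous_map (subtopology V C) V (\<phi> g)"
    proof (rule to_V)
     show "continuous_map (subtopology V C) euclideanreal (\<lambda>v. \<Psi> (\<phi> g v) i)" for i
      by (rule continuous_map_eq[OF continuous_map_from_subtopology[OF \<Psi>_cont[of "\<sigma> g i"]]]) (simp add: topV \<phi>C(2)[OF g])
     show "P (\<phi> g v) = 0" if "v\<in>topspace (subtopology V C)" for v
      using \<phi>C(1)[OF g] that topV by (simp add: C_def)
    qed
    then show "continuous_map (subtopology V C) (subtopology V C) (\<phi> g)"
     by (rule continuous_map_into_subtopology) (use \<phi>C(1)[OF g] topV in auto)
   qed
  qed
  fix g v w and t :: real assume g: "g\<in>carrier \<Gamma>" and v: "v\<in>C" and w: "w\<in>C" and t: "t\<in>{0..1}"
  have conv: "(1 - t) *\<^sub>R a + t *\<^sub>R b\<in>C" if "a\<in>C" "b\<in>C" for a b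
  proof -
   have "(\<lambda>i. (1 - t) * \<Psi> a i + t * \<Psi> b i)\<in>K"
    using Kd(4) that t unfolding fconvex_def C_def by auto
   moreover have "\<Psi> ((1 - t) *\<^sub>R a + t *\<^sub>R b) = (\<lambda>i. (1 - t) * \<Psi> a i + t * \<Psi> b i)"
    by (auto simp: \<Psi>_add \<Psi>_scale)
   ultimately show ?thesis using that by (simp add: C_def P_add P_scale)
  qed
  show "\<phi> g ((1 - t) *\<^sub>R v + t *\<^sub>R w) = (1 - t) *\<^sub>R \<phi> g v + t *\<^sub>R \<phi> g w"
  proof (rule C_eq)
   show "\<phi> g ((1 - t) *\<^sub>R v + t *\<^sub>R w)\<in>C" by (rule \<phi>C(1)[OF g conv[OF v w]])
   show "(1 - t) *\<^sub>R \<phi> g v + t *\<^sub>R \<phi> g w\<in>C" by (rule conv[OF \<phi>C(1)[OF g v] \<phi>C(1)[OF g w]])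
   show "\<Psi> (\<phi> g ((1 - t) *\<^sub>R v + t *\<^sub>R w)) = \<Psi> ((1 - t) *\<^sub>R \<phi> g v + t *\<^sub>R \<phi> g w)"
    using \<phi>C(2)[OF g conv[OF v w]] \<phi>C(2)[OF g v] \<phi>C(2)[OF g w] by (auto simp: \<Psi>_add \<Psi>_scale)
  qed
 qed
 moreover have "\<forall>l\<in>L. \<phi> l (\<kappa> x) = \<kappa> x"
  using x L \<kappa>[OF x(1)] by (auto simp: \<phi>_def)
 ultimately obtain v where v: "v\<in>C" "\<forall>g\<in>carrier \<Gamma>. \<phi> g v = v"
  using co \<kappa>(3)[OF x(1)] unfolding co_amenable_def by blast
 have "\<Psi> v \<circ> \<sigma> g = \<Psi> v" if "g\<in>carrier \<Gamma>" for g using \<phi>C(2)[OF that v(1)] v(2) that by simp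
 then show ?thesis using v(1) by (auto simp: C_def)
qed

text \<open>Bounded functions on \<open>\<Gamma>/L\<close>, viewed as right \<open>L\<close>-invariant functions on \<open>\<Gamma>\<close>.\<close>
definition coset_functions :: "('a, 'm) monoid_scheme => 'a set => ('a => real) set" where
 "coset_functions \<Gamma> L = {f. (\<exists>B. \<forall>h\<in>carrier \<Gamma>. \<bar>f h\<bar>\<le>B) \<and> (\<forall>h\<in>carrier \<Gamma>. \<forall>l\<in>L. f (h \<otimes>\<^bsub>\<Gamma>\<^esub> l) = f h)}"

definition invariant_coset_mean :: "('a, 'm) monoid_scheme => 'a set => (('a => real) => real) => bool" where
 "invariant_coset_mean \<Gamma> L \<nu> \<longleftrightarrow> \<nu>\<in>mean_class.means \<Gamma> (coset_functions \<Gamma> L) \<and>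
  (\<forall>g\<in>carrier \<Gamma>. \<nu> \<circ> mean_class.shift \<Gamma> g = \<nu>)"

lemma mean_class_coset_functions:
 assumes grp: "group \<Gamma>" and L: "L\<subseteq>carrier \<Gamma>"
 shows "mean_class \<Gamma> (coset_functions \<Gamma> L)"
proof -
 interpret group \<Gamma> by (rule grp)
 show ?thesis
 proof
  fix f assume f: "f\<in>coset_functions \<Gamma> L"
  show "\<exists>B. \<forall>h\<in>carrier \<Gamma>. \<bar>f h\<bar>\<le>B" using f by (simp add: coset_functions_def)
  then obtain B where B: "\<forall>h\<in>carrier \<Gamma>. \<bar>f h\<bar>\<le>B" by blast
  show "(\<lambda>h. c * f h)\<in>coset_functions \<Gamma> L" for c
  proof -
   have "\<forall>h\<in>carrier \<Gamma>. \<bar>c * f h\<bar>\<le>\<bar>c\<bar> * B" using B by (simp add: abs_mult mult_left_mono)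
   then show ?thesis using f unfolding coset_functions_def by auto
  qed
  show "(\<lambda>h. f (a \<otimes>\<^bsub>\<Gamma>\<^esub> h))\<in>coset_functions \<Gamma> L" if a: "a\<in>carrier \<Gamma>" for a
  proof -
   have "f (a \<otimes>\<^bsub>\<Gamma>\<^esub> (h \<otimes>\<^bsub>\<Gamma>\<^esub> l)) = f (a \<otimes>\<^bsub>\<Gamma>\<^esub> h)" if "h\<in>carrier \<Gamma>" "l\<in>L" for h l
   proof -
    have "a \<otimes>\<^bsub>\<Gamma>\<^esub> (h \<otimes>\<^bsub>\<Gamma>\<^esub> l) = (a \<otimes>\<^bsub>\<Gamma>\<^esub> h) \<otimes>\<^bsub>\<Gamma>\<^esub> l" using a that L by (auto simp: m_assoc)
    then show ?thesis using f a that by (simp add: coset_functions_def)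
   qed
   then show ?thesis using B a unfolding coset_functions_def by blast
  qed
  show "(\<lambda>h. f h + g h)\<in>coset_functions \<Gamma> L" if g: "g\<in>coset_functions \<Gamma> L" for g
  proof -
   obtain D where D: "\<forall>h\<in>carrier \<Gamma>. \<bar>g h\<bar>\<le>D" using g unfolding coset_functions_def by blast
   have "\<forall>h\<in>carrier \<Gamma>. \<bar>f h + g h\<bar>\<le>B + D" using B D by (meson abs_triangle_ineq add_mono order_trans)
   then show ?thesis using f g unfolding coset_functions_def by auto
  qed
  show "g\<in>coset_functions \<Gamma> L" if eq: "\<And>h. h\<in>carrier \<Gamma> ==> f h = g h" for g
  proof -
   have "g (h \<otimes>\<^bsub>\<Gamma>\<^esub> l) = g h" if "h\<in>carrier \<Gamma>" "l\<in>L" for h l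
    using f eq[of h] eq[of "h \<otimes>\<^bsub>\<Gamma>\<^esub> l"] that L by (auto simp: coset_functions_def)
   moreover have "\<forall>h\<in>carrier \<Gamma>. \<bar>g h\<bar>\<le>B" using B eq by simp
   ultimately show ?thesis unfolding coset_functions_def by blast
  qed
 next
  show "(\<lambda>_. c)\<in>coset_functions \<Gamma> L" for c unfolding coset_functions_def by auto
 qed
qed

text \<open>Evaluation at the coset \<open>L\<close> is an \<open>L\<close>-fixed point in the flow of means on \<open>\<Gamma>/L\<close>, so co-amenability yields a fixed mean,
once means are coded by elements of \<open>'a set set\<close>: a bounded function is coded by the rationals below its values, which as
\<open>\<Gamma> \<times> \<rat>\<close> is countable amounts to a subset of \<open>\<Gamma>\<close>, and a mean by the functions on which it is positive.\<close>
lemma coamenable_coset_mean: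
 fixes \<Gamma> :: "('a, 'm) monoid_scheme"
 assumes grp: "group \<Gamma>" and cnt: "countable (carrier \<Gamma>)" and inf: "infinite (carrier \<Gamma>)"
  and L: "subgroup L \<Gamma>" and co: "co_amenable \<Gamma> (disc \<Gamma>) L"
 shows "\<exists>\<nu>. invariant_coset_mean \<Gamma> L \<nu>"
proof -
 have LG: "L\<subseteq>carrier \<Gamma>" using subgroup.subset[OF L] .
 let ?F = "coset_functions \<Gamma> L"
 interpret mean_class \<Gamma> ?F by (rule mean_class_coset_functions[OF grp LG])
 \<comment> \<open>A subset of \<open>\<Gamma> \<times> \<rat>\<close> becomes a subset of \<open>\<Gamma>\<close>.\<close>
 define e where "e = from_nat_into (carrier \<Gamma>) \<circ> to_nat_on (carrier \<Gamma> \<times> (UNIV :: rat set))"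
 have e: "inj_on e (carrier \<Gamma> \<times> UNIV)" unfolding e_def
 proof (rule comp_inj_on)
  show "inj_on (to_nat_on (carrier \<Gamma> \<times> (UNIV :: rat set))) (carrier \<Gamma> \<times> UNIV)" using cnt by (intro inj_on_to_nat_on) auto
  show "inj_on (from_nat_into (carrier \<Gamma>)) (to_nat_on (carrier \<Gamma> \<times> (UNIV :: rat set)) ` (carrier \<Gamma> \<times> UNIV))"
   using bij_betw_from_nat_into[OF cnt inf] by (auto simp: bij_betw_def intro: inj_on_subset)
 qed
 define cut where "cut = (\<lambda>f. {(w, q). w\<in>carrier \<Gamma> \<and> real_of_rat q < f w})"
 define c1 where "c1 = (\<lambda>f. e ` cut f)"
 define F0 where "F0 = {f\<in>?F. \<forall>h. h\<notin>carrier \<Gamma> --> f h = 0}"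
 have c1: "f = f'" if f: "f\<in>F0" "f'\<in>F0" "c1 f = c1 f'" for f f'
 proof -
  have "cut f = cut f'"
   using inj_on_image_eq_iff[OF e, of "cut f" "cut f'"] f(3) by (auto simp: c1_def cut_def)
  then have iff: "real_of_rat q < f w \<longleftrightarrow> real_of_rat q < f' w" if "w\<in>carrier \<Gamma>" for q w
   using that by (auto simp: cut_def)
  have "f w = f' w" for w
  proof (cases "w\<in>carrier \<Gamma>")
   case True
   have "\<not> f w < f' w" "\<not> f' w < f w"
    using of_rat_dense[of "f w" "f' w"] of_rat_dense[of "f' w" "f w"] iff[OF True] by (metis less_asym)+
   then show ?thesis by simp
  next
   case False then show ?thesis using f by (simp add: F0_def)
  qed
  then show ?thesis by blast
 qed
 define code where "code = (\<lambda>\<nu> :: ('a => real) => real. {c1 f | f. f\<in>F0 \<and> 0 < \<nu> f})"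
 have le: "\<nu>' f\<le>\<nu> f" if \<nu>: "\<nu>\<in>means" "\<nu>'\<in>means" "code \<nu> = code \<nu>'" and f: "f\<in>?F" for \<nu> \<nu>' f
 proof (rule ccontr)
  assume "\<not> ?thesis"
  then obtain q where q: "\<nu> f < q" "q < \<nu>' f" using dense by (metis not_le)
  have d: "(\<lambda>h. f h - q)\<in>?F" by (rule F_diff[OF f F_const])
  define f' where "f' = (\<lambda>h. if h\<in>carrier \<Gamma> then f h - q else 0)"
  have f': "f'\<in>?F" by (rule F_cong[OF d]) (simp add: f'_def)
  have val: "M f' = M f - q" if M: "M\<in>means" for M
   using means_cong[OF M f', of "\<lambda>h. f h - q"] means_diff[OF M f F_const[of q]] means_const[OF M] by (simp add: f'_def)
  have "f'\<in>F0" using f' by (simp add: F0_def f'_def)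
  moreover have "0 < \<nu>' f'" using val[OF \<nu>(2)] q by simp
  ultimately have "c1 f'\<in>code \<nu>'" unfolding code_def by (intro CollectI exI[of _ f']) simp
  then have "c1 f'\<in>code \<nu>" using \<nu>(3) by simp
  then obtain f'' where "f''\<in>F0" "c1 f' = c1 f''" "0 < \<nu> f''" unfolding code_def by blast
  then have "0 < \<nu> f'" using c1 \<open>f'\<in>F0\<close> by blast
  then show False using val[OF \<nu>(1)] q by simp
 qed
 have inj: "inj_on code means"
 proof (rule inj_onI)
  fix \<nu> \<nu>' assume \<nu>: "\<nu>\<in>means" "\<nu>'\<in>means" "code \<nu> = code \<nu>'"
  have "\<nu> f = \<nu>' f" for f
  proof (cases "f\<in>?F")
   case True then show ?thesis using le[OF \<nu> True] le[OF \<nu>(2,1) \<nu>(3)[symmetric] True] by simp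
  next
   case False then show ?thesis using meansD(5)[OF \<nu>(1)] meansD(5)[OF \<nu>(2)] by simp
  qed
  then show "\<nu> = \<nu>'" by blast
 qed
 define x where "x = (\<lambda>f. if f\<in>?F then f \<one>\<^bsub>\<Gamma>\<^esub> else 0)"
 have x: "x\<in>means" unfolding means_def x_def using F_add F_scale F_const by auto
 have fixed: "x \<circ> shift l = x" if l: "l\<in>L" for l
 proof
  fix f
  have lc: "l\<in>carrier \<Gamma>" using l LG by blast
  have "f l = f \<one>\<^bsub>\<Gamma>\<^esub>" if "f\<in>?F"
  proof -
   have "\<forall>h\<in>carrier \<Gamma>. \<forall>l\<in>L. f (h \<otimes>\<^bsub>\<Gamma>\<^esub> l) = f h" using that by (simp add: coset_functions_def)
   then have "f (\<one>\<^bsub>\<Gamma>\<^esub> \<otimes>\<^bsub>\<Gamma>\<^esub> l) = f \<one>\<^bsub>\<Gamma>\<^esub>" using l one_closed by blast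
   then show ?thesis using lc by simp
  qed
  then show "(x \<circ> shift l) f = x f" using shift_F_iff[OF lc] lc by (simp add: x_def shift_def)
 qed
 have "\<exists>\<nu>\<in>means. \<forall>g\<in>carrier \<Gamma>. \<nu> \<circ> shift g = \<nu>"
  by (rule coamenable_fixed_point[OF grp co LG means_flow inj x fixed])
 then obtain \<nu> where "\<nu>\<in>means" "\<forall>g\<in>carrier \<Gamma>. \<nu> \<circ> shift g = \<nu>" by (elim bexE)
 then show ?thesis unfolding invariant_coset_mean_def by (intro exI[of _ \<nu>] conjI)
qed

text \<open>Averaging over the finitely many cosets; inversion turns right cosets into left ones.\<close>
lemma finite_index_coset_mean:
 fixes \<Gamma> :: "('a, 'm) monoid_scheme"
 assumes grp: "group \<Gamma>" and L: "subgroup L \<Gamma>" and fi: "finite_index \<Gamma> L"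
 shows "\<exists>\<nu>. invariant_coset_mean \<Gamma> L \<nu>"
proof -
 have LG: "L\<subseteq>carrier \<Gamma>" using subgroup.subset[OF L] .
 let ?F = "coset_functions \<Gamma> L"
 interpret mean_class \<Gamma> ?F by (rule mean_class_coset_functions[OF grp LG])
 let ?R = "rcosets\<^bsub>\<Gamma>\<^esub> L"
 have fin: "finite ?R" using fi by (simp add: finite_index_def)
 have RG: "C\<subseteq>carrier \<Gamma>" if "C\<in>?R" for C using rcosets_part_G[OF L] that by blast
 have ne: "?R\<noteq>{}" using rcosetsI[OF LG one_closed] by blast
 define r where "r = (\<lambda>C :: 'a set. SOME g. g\<in>C)"
 have r: "r C\<in>C" if C: "C\<in>?R" for C
 proof -
  obtain a where "a\<in>carrier \<Gamma>" "C = L #>\<^bsub>\<Gamma>\<^esub> a" using C by (auto simp: RCOSETS_def)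
  then have "a\<in>C" using rcos_self[OF _ L] by simp
  then show ?thesis unfolding r_def by (rule someI)
 qed
 have rc: "r C\<in>carrier \<Gamma>" if "C\<in>?R" for C using r RG that by blast
 have const: "f (inv\<^bsub>\<Gamma>\<^esub> g) = f (inv\<^bsub>\<Gamma>\<^esub> h)" if f: "f\<in>?F" and C: "C\<in>?R" "g\<in>C" "h\<in>C" for f g h C
 proof -
  obtain a where a: "a\<in>carrier \<Gamma>" "C = L #>\<^bsub>\<Gamma>\<^esub> a" using C(1) by (auto simp: RCOSETS_def)
  have "f (inv\<^bsub>\<Gamma>\<^esub> g) = f (inv\<^bsub>\<Gamma>\<^esub> a)" if gC: "g\<in>C" for g
  proof -
   obtain l where l: "l\<in>L" "g = l \<otimes>\<^bsub>\<Gamma>\<^esub> a" using gC a(2) by (auto simp: r_coset_def)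
   then have "inv\<^bsub>\<Gamma>\<^esub> g = inv\<^bsub>\<Gamma>\<^esub> a \<otimes>\<^bsub>\<Gamma>\<^esub> inv\<^bsub>\<Gamma>\<^esub> l" using a LG by (auto simp: inv_mult_group)
   then show ?thesis using f a(1) subgroup.m_inv_closed[OF L l(1)] by (simp add: coset_functions_def)
  qed
  then show ?thesis using C by simp
 qed
 define \<nu> where "\<nu> = (\<lambda>f. if f\<in>?F then (\<Sum>C\<in>?R. f (inv\<^bsub>\<Gamma>\<^esub> (r C))) / card ?R else 0)"
 have \<nu>: "\<nu>\<in>means" unfolding means_def
 proof (intro CollectI conjI ballI allI impI)
  show "0\<le>\<nu> f" if "f\<in>?F" "\<forall>h\<in>carrier \<Gamma>. 0\<le>f h" for f
   using that rc by (auto simp: \<nu>_def intro!: divide_nonneg_nonneg sum_nonneg)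
  show "\<nu> (\<lambda>_. 1) = 1" using F_const fin ne by (simp add: \<nu>_def)
 qed (auto simp: \<nu>_def F_add F_scale sum.distrib add_divide_distrib sum_distrib_left)
 have "\<nu> \<circ> shift g = \<nu>" if g: "g\<in>carrier \<Gamma>" for g
 proof
  fix f
  show "(\<nu> \<circ> shift g) f = \<nu> f"
  proof (cases "f\<in>?F")
   case False then show ?thesis using shift_F_iff[OF g] by (simp add: \<nu>_def)
  next
   case True
   define t where "t = (\<lambda>C. C #>\<^bsub>\<Gamma>\<^esub> inv\<^bsub>\<Gamma>\<^esub> g)"
   have tR: "t C\<in>?R" "t C #>\<^bsub>\<Gamma>\<^esub> g = C" "C #>\<^bsub>\<Gamma>\<^esub> g\<in>?R" "t (C #>\<^bsub>\<Gamma>\<^esub> g) = C" if C: "C\<in>?R" for C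
   proof -
    obtain a where a: "a\<in>carrier \<Gamma>" "C = L #>\<^bsub>\<Gamma>\<^esub> a" using C by (auto simp: RCOSETS_def)
    show "t C\<in>?R" "C #>\<^bsub>\<Gamma>\<^esub> g\<in>?R" using a g LG by (auto simp: t_def coset_mult_assoc intro!: rcosetsI)
    show "t C #>\<^bsub>\<Gamma>\<^esub> g = C" "t (C #>\<^bsub>\<Gamma>\<^esub> g) = C" using a g LG by (auto simp: t_def coset_mult_assoc m_assoc)
   qed
   have "(\<Sum>C\<in>?R. shift g f (inv\<^bsub>\<Gamma>\<^esub> (r C))) = (\<Sum>C\<in>?R. f (inv\<^bsub>\<Gamma>\<^esub> (r (t C))))"
   proof (rule sum.cong[OF refl])
    fix C assume C: "C\<in>?R"
    have "r C \<otimes>\<^bsub>\<Gamma>\<^esub> inv\<^bsub>\<Gamma>\<^esub> g\<in>t C" using r[OF C] by (auto simp: t_def r_coset_def)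
    then have "f (inv\<^bsub>\<Gamma>\<^esub> (r C \<otimes>\<^bsub>\<Gamma>\<^esub> inv\<^bsub>\<Gamma>\<^esub> g)) = f (inv\<^bsub>\<Gamma>\<^esub> (r (t C)))" using const[OF True tR(1)[OF C] _ r] tR(1)[OF C] by blast
    then show "shift g f (inv\<^bsub>\<Gamma>\<^esub> (r C)) = f (inv\<^bsub>\<Gamma>\<^esub> (r (t C)))" using g rc[OF C] by (simp add: shift_def inv_mult_group)
   qed
   also have "\<dots> = (\<Sum>C\<in>?R. f (inv\<^bsub>\<Gamma>\<^esub> (r C)))"
    by (rule sum.reindex_bij_witness[of _ "\<lambda>C. C #>\<^bsub>\<Gamma>\<^esub> g" t]) (use tR in auto)
   finally show ?thesis using shift_F[OF True g] True by (simp add: \<nu>_def)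
  qed
 qed
 then show ?thesis using \<nu> unfolding invariant_coset_mean_def by blast
qed

text \<open>The orbit map of an \<open>L\<close>-fixed point factors through \<open>\<Gamma>/L\<close>, so it can be averaged with the mean.\<close>
lemma invariant_coset_mean_fixed_point:
 fixes \<Gamma> :: "('a, 'm) monoid_scheme" and K :: "('i => real) set"
 assumes grp: "group \<Gamma>" and L: "L\<subseteq>carrier \<Gamma>" and \<nu>: "invariant_coset_mean \<Gamma> L \<nu>"
  and K: "affine_flow \<Gamma> \<sigma> K" and x: "x\<in>K" "\<And>l. l\<in>L ==> x \<circ> \<sigma> l = x"
 shows "\<exists>y\<in>K. \<forall>g\<in>carrier \<Gamma>. y \<circ> \<sigma> g = y"
proof -
 let ?F = "coset_functions \<Gamma> L"
 interpret mean_class \<Gamma> ?F by (rule mean_class_coset_functions[OF grp L])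
 note Kd = affine_flowD[OF K]
 have M: "\<nu>\<in>means" and inv: "\<nu> (shift g f) = \<nu> f" if "g\<in>carrier \<Gamma>" for g f
  using \<nu> that unfolding invariant_coset_mean_def by (auto simp: fun_eq_iff)
 have M: "\<nu>\<in>means" using M[OF one_closed] .
 define f where "f = (\<lambda>i g. x (\<sigma> g i))"
 have f: "f i\<in>?F" for i
 proof -
  obtain B where B: "\<And>y. y\<in>K ==> \<bar>y i\<bar>\<le>B" using compact_coord_bounded[OF Kd(3), where i=i] by blast
  have "\<bar>f i h\<bar>\<le>B" if "h\<in>carrier \<Gamma>" for h using B[OF Kd(6)[OF that x(1)]] by (simp add: f_def)
  moreover have "f i (h \<otimes>\<^bsub>\<Gamma>\<^esub> l) = f i h" if "h\<in>carrier \<Gamma>" "l\<in>L" for h l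
   using Kd(1)[OF that(1), of l i] that L fun_cong[OF x(2)[OF that(2)], of "\<sigma> h i"] by (auto simp: f_def)
  ultimately show ?thesis unfolding coset_functions_def by blast
 qed
 define y where "y = (\<lambda>i. \<nu> (f i))"
 have lin: "(\<lambda>g. \<Sum>j\<in>J. c j * f j g)\<in>?F \<and> \<nu> (\<lambda>g. \<Sum>j\<in>J. c j * f j g) = (\<Sum>j\<in>J. c j * \<nu> (f j))" if "finite J" for J c
  using that
 proof (induction J rule: finite_induct)
  case empty
  then show ?case using F_const[of 0] means_const[OF M, of 0] by simp
 next
  case (insert j J)
  have s: "(\<lambda>g. c j * f j g)\<in>?F" by (rule F_scale[OF f])
  show ?case using insert meansD(1)[OF M s, of "\<lambda>g. \<Sum>j\<in>J. c j * f j g"] F_add[OF s, of "\<lambda>g. \<Sum>j\<in>J. c j * f j g"]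
    meansD(2)[OF M f] by simp
 qed
 have "y\<in>K"
 proof (rule HB_function_space[OF Kd(3,4,5)])
  fix J c and d :: real assume J: "finite J" "\<And>z. z\<in>K ==> d\<le>(\<Sum>j\<in>J. c j * z j)"
  have "\<nu> (\<lambda>_. d)\<le>\<nu> (\<lambda>g. \<Sum>j\<in>J. c j * f j g)"
  proof (rule means_mono[OF M F_const])
   show "(\<lambda>g. \<Sum>j\<in>J. c j * f j g)\<in>?F" using lin[OF J(1)] by blast
   show "d\<le>(\<Sum>j\<in>J. c j * f j g)" if "g\<in>carrier \<Gamma>" for g
    using J(2)[OF Kd(6)[OF that x(1)]] by (simp add: f_def)
  qed
  then show "d\<le>(\<Sum>j\<in>J. c j * y j)" using lin[OF J(1), of c] means_const[OF M] by (simp add: y_def)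
 qed
 moreover have "y \<circ> \<sigma> g = y" if g: "g\<in>carrier \<Gamma>" for g
 proof
  fix i
  have "\<nu> (f (\<sigma> g i)) = \<nu> (shift g (f i))"
   by (rule means_cong[OF M f]) (use Kd(1)[OF g] g in \<open>simp add: f_def shift_def\<close>)
  then show "(y \<circ> \<sigma> g) i = y i" using inv[OF g] by (simp add: y_def)
 qed
 ultimately show ?thesis by blast
qed

section \<open>Ping-pong and homomorphisms with kernel\<close>

context micro_action
begin

text \<open>Overlapping supports are needed to link two elements that fix unrelated open sets. A conjugate \<open>k = d s d\<^sup>-\<^sup>1\<close> of a non-trivial
element fixing an open set does it: \<open>d\<close> compresses the complement of \<open>P = s X\<close> into \<open>U\<close>, hence \<open>W\<close>, if disjoint from
\<open>U\<close>, is contained in \<open>d P = k (d X)\<close>, where \<open>d X \<subseteq> U\<close>.\<close>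
lemma move_between:
 assumes U: "openin Z U" "U\<noteq>{}" and W: "openin Z W" "W\<noteq>{}"
 shows "\<exists>k\<in>carrier \<Gamma>. \<exists>V. openin Z V \<and> V\<noteq>{} \<and> V\<subseteq>U \<and> (\<forall>x\<in>V. \<zeta> k x = x) \<and> \<zeta> k ` U \<inter> W\<noteq>{}"
proof (cases "U \<inter> W = {}")
 case False
 then obtain x where x: "x\<in>U" "x\<in>W" by blast
 have UZ: "U\<subseteq>topspace Z" using openin_subset[OF U(1)] .
 show ?thesis
 proof (intro bexI exI conjI)
  show "openin Z U" "U\<noteq>{}" "U\<subseteq>U" using U by auto
  show "\<forall>x\<in>U. \<zeta> \<one> x = x" using UZ by auto
  have "\<zeta> \<one> x = x" using x UZ by auto
  then show "\<zeta> \<one> ` U \<inter> W\<noteq>{}" using x by force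
 qed simp
next
 case True
 obtain s F where s: "s\<in>carrier \<Gamma>" "s\<noteq>\<one>" "openin Z F" "F\<noteq>{}" "\<forall>x\<in>F. \<zeta> s x = x"
  using nontriv by (auto simp: fixopen_def)
 obtain X where X: "openin Z X" "X\<noteq>{}" "\<zeta> s ` X \<inter> X = {}" using displaced[OF s(1,2)] by blast
 define P where "P = \<zeta> s ` X"
 have P: "openin Z P" "P\<noteq>{}" using act_open[OF s(1) X(1)] X(2) by (auto simp: P_def)
 have XZ: "X\<subseteq>topspace Z" and FZ: "F\<subseteq>topspace Z" using openin_subset X(1) s(3) by auto
 have PF: "P \<inter> F = {}"
 proof (rule ccontr)
  assume "P \<inter> F\<noteq>{}"
  then obtain x where x: "x\<in>X" "\<zeta> s x\<in>F" by (auto simp: P_def)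
  then have "\<zeta> s (\<zeta> s x) = \<zeta> s x" using s(5) by blast
  then have "\<zeta> (inv s) (\<zeta> s (\<zeta> s x)) = \<zeta> (inv s) (\<zeta> s x)" by simp
  then have "\<zeta> s x = x" using s(1) x(1) XZ by (simp add: subset_iff)
  then show False using x(1) X(3) by force
 qed
 have C: "closedin Z (topspace Z - P)" "topspace Z - P\<noteq>topspace Z"
  using P openin_subset[OF P(1)] by auto
 obtain d where d: "d\<in>carrier \<Gamma>" "\<zeta> d ` (topspace Z - P)\<subseteq>U" using compress[OF C U] .
 obtain w where w: "w\<in>W" using W by blast
 have wZ: "w\<in>topspace Z" using w openin_subset[OF W(1)] by blast
 have "\<zeta> (inv d) w\<in>P"
 proof (rule ccontr)
  assume "\<zeta> (inv d) w\<notin>P"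
  then have "\<zeta> d (\<zeta> (inv d) w)\<in>U" using d wZ by (intro subsetD[OF d(2)] imageI) simp
  then show False using True w wZ d(1) by auto
 qed
 then obtain x where x: "x\<in>X" "\<zeta> (inv d) w = \<zeta> s x" by (auto simp: P_def)
 have xZ: "x\<in>topspace Z" using x XZ by blast
 have "x\<notin>P" using x X(3) by (auto simp: P_def)
 then have dx: "\<zeta> d x\<in>U" using d(2) xZ by blast
 define k where "k = d\<otimes>s\<otimes>inv d"
 have k: "k\<in>carrier \<Gamma>" using d s by (simp add: k_def)
 have "\<zeta> k (\<zeta> d x) = \<zeta> d (\<zeta> s x)" unfolding k_def using act_mult d(1) s(1) xZ by simp
 also have "\<dots> = w" using x(2)[symmetric] wZ d(1) by simp
 finally have 1: "\<zeta> k ` U \<inter> W\<noteq>{}" using dx w by blast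
 have 2: "\<forall>y\<in>\<zeta> d ` F. \<zeta> k y = y"
  unfolding k_def using fixes_conj[OF s(1) d(1) FZ] s(5) by blast
 have "F\<subseteq>topspace Z - P" using FZ PF by blast
 then have 3: "\<zeta> d ` F\<subseteq>U" using d(2) by blast
 show ?thesis using k 1 2 3 act_open[OF d(1) s(3)] s(4) by blast
qed

text \<open>If \<open>n\<close> displaces \<open>O\<^sub>1\<close> and \<open>p n = 1\<close>, then \<open>p g\<close> equals the image of \<open>n g n\<^sup>-\<^sup>1\<close>, which commutes with everything
supported in \<open>O\<^sub>1\<close>. Compression extends this to two elements fixing a common open set. For arbitrary \<open>g\<close> and
\<open>h\<close>, the element \<open>k\<close> of \<open>move_between\<close> shares fixed open sets with \<open>g\<close>, and \<open>k g k\<^sup>-\<^sup>1\<close> shares one with \<open>h\<close>;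
as \<open>p k\<close> commutes with \<open>p g\<close>, both \<open>g\<close> and \<open>k g k\<^sup>-\<^sup>1\<close> have the same image.\<close>
lemma hom_kernel_commute:
 assumes H: "group H" and p: "p\<in>hom \<Gamma> H"
  and n: "n\<in>carrier \<Gamma>" "n\<noteq>\<one>" "p n = \<one>\<^bsub>H\<^esub>"
  and g: "g\<in>fixopen" and h: "h\<in>fixopen"
 shows "p g \<otimes>\<^bsub>H\<^esub> p h = p h \<otimes>\<^bsub>H\<^esub> p g"
proof -
 interpret H: group H by (rule H)
 interpret p: group_hom \<Gamma> H p using grp H p by (simp add: group_hom_def group_hom_axioms_def)
 obtain O1 where O1: "openin Z O1" "O1\<noteq>{}" "\<zeta> n ` O1 \<inter> O1 = {}" using displaced[OF n(1,2)] by blast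
 have O1Z: "O1\<subseteq>topspace Z" using openin_subset[OF O1(1)] .
 have step1: "p g \<otimes>\<^bsub>H\<^esub> p h = p h \<otimes>\<^bsub>H\<^esub> p g" if g: "g\<in>rist O1" and h: "h\<in>rist O1" for g h
 proof -
  have c: "g\<in>carrier \<Gamma>" "h\<in>carrier \<Gamma>" using g h ristD by auto
  have ig: "inv g\<in>rist O1" using g c fixes_inv by (auto simp: rist_def)
  define g' where "g' = n\<otimes>inv g\<otimes>inv n"
  have g'c: "g'\<in>carrier \<Gamma>" using c n by (simp add: g'_def)
  have "g'\<in>rist (\<zeta> n ` O1)" unfolding g'_def by (rule rist_conj[OF ig n(1) O1Z])
  then have com: "g'\<otimes>h = h\<otimes>g'" using rist_commute[OF _ h O1(3)] by blast
  have pg': "p g' = inv\<^bsub>H\<^esub> (p g)" using c n by (simp add: g'_def)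
  have "p g' \<otimes>\<^bsub>H\<^esub> p h = p h \<otimes>\<^bsub>H\<^esub> p g'" using com c g'c by (metis p.hom_mult)
  then have "p g \<otimes>\<^bsub>H\<^esub> (inv\<^bsub>H\<^esub> (p g) \<otimes>\<^bsub>H\<^esub> p h) \<otimes>\<^bsub>H\<^esub> p g = p g \<otimes>\<^bsub>H\<^esub> (p h \<otimes>\<^bsub>H\<^esub> inv\<^bsub>H\<^esub> (p g)) \<otimes>\<^bsub>H\<^esub> p g"
   unfolding pg' by simp
  then show ?thesis using c by (simp add: H.m_assoc)
 qed
 have step2: "p g \<otimes>\<^bsub>H\<^esub> p h = p h \<otimes>\<^bsub>H\<^esub> p g"
  if c: "g\<in>carrier \<Gamma>" "h\<in>carrier \<Gamma>" and U: "openin Z U" "U\<noteq>{}" "\<forall>x\<in>U. \<zeta> g x = x" "\<forall>x\<in>U. \<zeta> h x = x" for g h U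
 proof -
  have C: "closedin Z (topspace Z - U)" "topspace Z - U\<noteq>topspace Z"
   using U openin_subset[OF U(1)] by auto
  obtain k where k: "k\<in>carrier \<Gamma>" "\<zeta> k ` (topspace Z - U)\<subseteq>O1" using compress[OF C O1(1,2)] .
  have conj: "k\<otimes>r\<otimes>inv k\<in>rist O1" if "r\<in>carrier \<Gamma>" "\<forall>x\<in>U. \<zeta> r x = x" for r
  proof -
   have "r\<in>rist (topspace Z - U)" using that by (auto simp: rist_def)
   then have "k\<otimes>r\<otimes>inv k\<in>rist (\<zeta> k ` (topspace Z - U))" by (rule rist_conj[OF _ k(1)]) simp
   then show ?thesis using k(2) unfolding rist_def by blast
  qed
  have "p (k\<otimes>g\<otimes>inv k) \<otimes>\<^bsub>H\<^esub> p (k\<otimes>h\<otimes>inv k) = p (k\<otimes>h\<otimes>inv k) \<otimes>\<^bsub>H\<^esub> p (k\<otimes>g\<otimes>inv k)"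
   by (rule step1) (use conj c U in blast)+
  then have "p k \<otimes>\<^bsub>H\<^esub> (p g \<otimes>\<^bsub>H\<^esub> p h) \<otimes>\<^bsub>H\<^esub> inv\<^bsub>H\<^esub> (p k) = p k \<otimes>\<^bsub>H\<^esub> (p h \<otimes>\<^bsub>H\<^esub> p g) \<otimes>\<^bsub>H\<^esub> inv\<^bsub>H\<^esub> (p k)"
   using c k(1) by (simp add: H.m_assoc)
  then show ?thesis using c k(1) by simp
 qed
 obtain U where U: "openin Z U" "U\<noteq>{}" "\<forall>x\<in>U. \<zeta> g x = x" and gc: "g\<in>carrier \<Gamma>"
  using g by (auto simp: fixopen_def)
 obtain W where W: "openin Z W" "W\<noteq>{}" "\<forall>x\<in>W. \<zeta> h x = x" and hc: "h\<in>carrier \<Gamma>"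
  using h by (auto simp: fixopen_def)
 have UZ: "U\<subseteq>topspace Z" using openin_subset[OF U(1)] .
 obtain k V where k: "k\<in>carrier \<Gamma>" and V: "openin Z V" "V\<noteq>{}" "V\<subseteq>U" "\<forall>x\<in>V. \<zeta> k x = x" "\<zeta> k ` U \<inter> W\<noteq>{}"
  using move_between[OF U(1,2) W(1,2)] by blast
 have kg: "p k \<otimes>\<^bsub>H\<^esub> p g = p g \<otimes>\<^bsub>H\<^esub> p k" by (rule step2[OF k gc V(1,2)]) (use V U in blast)+
 define g' where "g' = k\<otimes>g\<otimes>inv k"
 have g'c: "g'\<in>carrier \<Gamma>" using k gc by (simp add: g'_def)
 have "p g' \<otimes>\<^bsub>H\<^esub> p h = p h \<otimes>\<^bsub>H\<^esub> p g'"
 proof (rule step2[OF g'c hc, of "\<zeta> k ` U \<inter> W"])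
  show "openin Z (\<zeta> k ` U \<inter> W)" using act_open[OF k U(1)] W(1) by blast
  show "\<zeta> k ` U \<inter> W\<noteq>{}" by (rule V(5))
  show "\<forall>x\<in>\<zeta> k ` U \<inter> W. \<zeta> g' x = x" unfolding g'_def using fixes_conj[OF gc k UZ] U(3) by blast
  show "\<forall>x\<in>\<zeta> k ` U \<inter> W. \<zeta> h x = x" using W(3) by blast
 qed
 moreover have "p g' = p g"
 proof -
  have "p g' = p k \<otimes>\<^bsub>H\<^esub> p g \<otimes>\<^bsub>H\<^esub> inv\<^bsub>H\<^esub> (p k)" using k gc by (simp add: g'_def)
  also have "\<dots> = p g" unfolding kg using k gc by (simp add: H.m_assoc)
  finally show ?thesis .
 qed
 ultimately show ?thesis by simp
qed

theorem hom_kernel_envelope_commute: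
 assumes H: "group H" and p: "p\<in>hom \<Gamma> H"
  and n: "n\<in>carrier \<Gamma>" "n\<noteq>\<one>" "p n = \<one>\<^bsub>H\<^esub>"
  and g: "g\<in>generate \<Gamma> fixopen" and h: "h\<in>generate \<Gamma> fixopen"
 shows "p g \<otimes>\<^bsub>H\<^esub> p h = p h \<otimes>\<^bsub>H\<^esub> p g"
proof -
 interpret H: group H by (rule H)
 interpret p: group_hom \<Gamma> H p using grp H p by (simp add: group_hom_def group_hom_axioms_def)
 have fc: "fixopen\<subseteq>carrier \<Gamma>" by (auto simp: fixopen_def)
 have im: "p ` generate \<Gamma> fixopen = generate H (p ` fixopen)" using p.generate_img[OF fc] by simp
 have pc: "p ` fixopen\<subseteq>carrier H" using fc by auto
 have 1: "p s \<otimes>\<^bsub>H\<^esub> y = y \<otimes>\<^bsub>H\<^esub> p s" if s: "s\<in>fixopen" and y: "y\<in>generate H (p ` fixopen)" for s y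
  by (rule H.generate_commute[OF pc _ _ y]) (use s fc hom_kernel_commute[OF H p n] in auto)
 have ph: "p h\<in>generate H (p ` fixopen)" and pg: "p g\<in>generate H (p ` fixopen)"
  unfolding im [symmetric] using g h by simp_all
 have "p h\<in>carrier H" using generate_incl[OF fc] h by auto
 moreover have "p h \<otimes>\<^bsub>H\<^esub> y = y \<otimes>\<^bsub>H\<^esub> p h" if "y\<in>p ` fixopen" for y
  using 1[OF _ ph] that by force
 ultimately have "p h \<otimes>\<^bsub>H\<^esub> p g = p g \<otimes>\<^bsub>H\<^esub> p h"
  by (rule H.generate_commute[OF pc _ _ pg])
 then show ?thesis by simp
qed

lemma split_open:
 assumes U: "openin Z U" "U\<noteq>{}"
 shows "\<exists>V W. openin Z V \<and> V\<noteq>{} \<and> openin Z W \<and> W\<noteq>{} \<and> V\<subseteq>U \<and> W\<subseteq>U \<and> V \<inter> W = {}"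
proof -
 obtain r where r: "r\<in>rist U" "r\<noteq>\<one>" using rist_nontrivial[OF U] .
 obtain V where V: "openin Z V" "V\<noteq>{}" "V\<subseteq>U" "\<zeta> r ` V \<inter> V = {}" using displaced_in[OF r U(1)] .
 have rc: "r\<in>carrier \<Gamma>" using r ristD by auto
 have "\<zeta> r ` V\<subseteq>U" using rist_preserves[OF r(1)] V(3) openin_subset[OF U(1)] by blast
 then show ?thesis using V act_open[OF rc V(1)] by (intro exI[of _ V] exI[of _ "\<zeta> r ` V"]) auto
qed

lemma envelope_conj:
 assumes "g\<in>carrier \<Gamma>" "e\<in>generate \<Gamma> fixopen" shows "g\<otimes>e\<otimes>inv g\<in>generate \<Gamma> fixopen"
 using assms(2)
proof (induction rule: generate.induct)
 case one
 then show ?case using assms(1) by (simp add: generate.one)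
next
 case (incl h)
 then show ?case using fixopen_conj[OF _ assms(1)] by (blast intro: generate.incl)
next
 case (inv h)
 then have h: "h\<in>carrier \<Gamma>" by (auto simp: fixopen_def)
 have "inv (g\<otimes>h\<otimes>inv g)\<in>generate \<Gamma> fixopen" using fixopen_conj[OF inv assms(1)] by (rule generate.inv)
 then show ?case using h assms(1) by (simp add: inv_mult_group m_assoc)
next
 case (eng h1 h2)
 have fc: "fixopen\<subseteq>carrier \<Gamma>" by (auto simp: fixopen_def)
 have c: "h1\<in>carrier \<Gamma>" "h2\<in>carrier \<Gamma>" using eng generate_incl[OF fc] by auto
 have "(g\<otimes>h1\<otimes>inv g)\<otimes>(g\<otimes>h2\<otimes>inv g)\<in>generate \<Gamma> fixopen" using eng by (blast intro: generate.eng)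
 then show ?case using c assms(1) by (simp add: m_assoc)
qed

text \<open>Take non-commuting \<open>r\<close>, \<open>s\<close> supported in \<open>U\<close>. If \<open>u\<close> displaced \<open>U\<close>, then \<open>u r u\<^sup>-\<^sup>1\<close> would commute with
\<open>s\<close>; for \<open>p u\<close> close to 1 this fails, because it fails at 1 and \<open>H\<close> is Hausdorff.\<close>
lemma near_identity_meets:
 assumes H: "topological_group H T" "Hausdorff_space T" and p: "p\<in>hom \<Gamma> H" "inj_on p (carrier \<Gamma>)"
  and U: "openin Z U" "U\<noteq>{}"
 shows "\<exists>V. openin T V \<and> \<one>\<^bsub>H\<^esub>\<in>V \<and> (\<forall>u\<in>carrier \<Gamma>. p u\<in>V --> \<zeta> u ` U \<inter> U\<noteq>{})"
proof -
 have gH: "group H" and tH: "topspace T = carrier H"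
  and mult: "continuous_map (prod_topology T T) T (\<lambda>(x, y). x \<otimes>\<^bsub>H\<^esub> y)"
  and inv: "continuous_map T T (\<lambda>x. inv\<^bsub>H\<^esub> x)" using H by (auto simp: topological_group_def)
 interpret H: group H by (rule gH)
 interpret p: group_hom \<Gamma> H p using grp gH p by (simp add: group_hom_def group_hom_axioms_def)
 have cmult: "continuous_map T T (\<lambda>x. f x \<otimes>\<^bsub>H\<^esub> g x)" if "continuous_map T T f" "continuous_map T T g" for f g
  using continuous_map_compose[OF continuous_map_pairedI[OF that] mult] by (simp add: o_def)
 obtain r s where rs: "r\<in>rist U" "s\<in>rist U" "r\<otimes>s\<noteq>s\<otimes>r" using rist_nonabelian[OF U] .
 have c: "r\<in>carrier \<Gamma>" "s\<in>carrier \<Gamma>" using rs ristD by auto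
 define f where "f = (\<lambda>v. (v \<otimes>\<^bsub>H\<^esub> p r \<otimes>\<^bsub>H\<^esub> inv\<^bsub>H\<^esub> v) \<otimes>\<^bsub>H\<^esub> p s)"
 define k where "k = (\<lambda>v. p s \<otimes>\<^bsub>H\<^esub> (v \<otimes>\<^bsub>H\<^esub> p r \<otimes>\<^bsub>H\<^esub> inv\<^bsub>H\<^esub> v))"
 have cc: "continuous_map T T (\<lambda>_. p r)" "continuous_map T T (\<lambda>_. p s)" using c tH by simp_all
 have cf: "continuous_map T T f" "continuous_map T T k"
  unfolding f_def k_def by (intro cmult cc inv continuous_map_id[unfolded id_def])+
 define V where "V = topspace T - {v\<in>topspace T. f v = k v}"
 have "closedin T {v\<in>topspace T. f v = k v}" by (rule closedin_continuous_maps_eq[OF H(2) cf])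
 then have "openin T V" by (simp add: V_def openin_diff)
 moreover have "\<one>\<^bsub>H\<^esub>\<in>V"
 proof -
  have fk: "f \<one>\<^bsub>H\<^esub> = p (r\<otimes>s)" "k \<one>\<^bsub>H\<^esub> = p (s\<otimes>r)" using c by (simp_all add: f_def k_def)
  have "p (r\<otimes>s)\<noteq>p (s\<otimes>r)" using rs(3) c inj_onD[OF p(2), of "r\<otimes>s" "s\<otimes>r"] by blast
  then have "f \<one>\<^bsub>H\<^esub>\<noteq>k \<one>\<^bsub>H\<^esub>" unfolding fk .
  then show ?thesis by (simp add: V_def tH)
 qed
 moreover have "\<zeta> u ` U \<inter> U\<noteq>{}" if u: "u\<in>carrier \<Gamma>" "p u\<in>V" for u
 proof
  assume disj: "\<zeta> u ` U \<inter> U = {}"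
  have "u\<otimes>r\<otimes>inv u\<in>rist (\<zeta> u ` U)" by (rule rist_conj[OF rs(1) u(1) openin_subset[OF U(1)]])
  from rist_commute[OF this rs(2) disj]
  have "p ((u\<otimes>r\<otimes>inv u)\<otimes>s) = p (s\<otimes>(u\<otimes>r\<otimes>inv u))" by simp
  then have "f (p u) = k (p u)" using u c by (simp add: f_def k_def)
  then show False using u(2) by (auto simp: V_def)
 qed
 ultimately show ?thesis by blast
qed

end

text \<open>A letter is a pair of booleans: which generator, and whether it is inverted. The set \<open>T l\<close> receives everything that does not
start in the set of the inverse letter, and \<open>O'\<close> is a spare open set.\<close>
definition (in ep_action) schottky :: "(bool \<times> bool => 'a) => (bool \<times> bool => 'z set) => 'z set => bool" where
 "schottky v T O' \<longleftrightarrow> openin Z O' \<and> O'\<noteq>{} \<and>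
  (\<forall>l. v l\<in>carrier \<Gamma> \<and> T l\<subseteq>topspace Z \<and> T l \<inter> O' = {} \<and> (\<forall>m. m\<noteq>l --> T l \<inter> T m = {}) \<and>
    v (fst l, \<not> snd l) = inv (v l) \<and> \<zeta> (v l) ` (topspace Z - T (fst l, \<not> snd l))\<subseteq>T l)"

lemma (in ep_action) schottkyD:
 assumes "schottky v T O'"
 shows "openin Z O'" "O'\<noteq>{}" "v l\<in>carrier \<Gamma>" "T l\<subseteq>topspace Z" "T l \<inter> O' = {}"
  "m\<noteq>l ==> T l \<inter> T m = {}" "v (fst l, \<not> snd l) = inv (v l)"
  "\<zeta> (v l) ` (topspace Z - T (fst l, \<not> snd l))\<subseteq>T l"
 using assms unfolding schottky_def by blast+

text \<open>Compressing the complement of \<open>A'\<close> into \<open>A\<close> gives a generator \<open>a\<close>, whose inverse compresses the complement of \<open>A\<close> into \<open>A'\<close>.\<close>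
lemma (in ep_action) schottky_exists:
 assumes split: "\<And>U. openin Z U ==> U\<noteq>{} ==>
  \<exists>V W. openin Z V \<and> V\<noteq>{} \<and> openin Z W \<and> W\<noteq>{} \<and> V\<subseteq>U \<and> W\<subseteq>U \<and> V \<inter> W = {}"
 shows "\<exists>v T O'. schottky v T O'"
proof -
 obtain A R1 where A: "openin Z A" "A\<noteq>{}" "openin Z R1" "R1\<noteq>{}" "A \<inter> R1 = {}"
  using split[OF openin_topspace nonempty] by blast
 obtain A' R2 where A': "openin Z A'" "A'\<noteq>{}" "openin Z R2" "R2\<noteq>{}" "A' \<inter> R2 = {}" "A'\<subseteq>R1" "R2\<subseteq>R1"
  using split[OF A(3,4)] by blast
 obtain B R3 where B: "openin Z B" "B\<noteq>{}" "openin Z R3" "R3\<noteq>{}" "B \<inter> R3 = {}" "B\<subseteq>R2" "R3\<subseteq>R2"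
  using split[OF A'(3,4)] by blast
 obtain B' O' where B': "openin Z B'" "B'\<noteq>{}" "openin Z O'" "O'\<noteq>{}" "B' \<inter> O' = {}" "B'\<subseteq>R3" "O'\<subseteq>R3"
  using split[OF B(3,4)] by blast
 have cl: "closedin Z (topspace Z - X)" "topspace Z - X\<noteq>topspace Z" if "openin Z X" "X\<noteq>{}" for X
  using that openin_subset[OF that(1)] by auto
 obtain a where a: "a\<in>carrier \<Gamma>" "\<zeta> a ` (topspace Z - A')\<subseteq>A" using compress[OF cl[OF A'(1,2)] A(1,2)] .
 obtain b where b: "b\<in>carrier \<Gamma>" "\<zeta> b ` (topspace Z - B')\<subseteq>B" using compress[OF cl[OF B'(1,2)] B(1,2)] .
 have inv: "\<zeta> (inv g) ` (topspace Z - X)\<subseteq>Y" if "g\<in>carrier \<Gamma>" "\<zeta> g ` (topspace Z - Y)\<subseteq>X" for g X Y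
 proof clarify
  fix x assume x: "x\<in>topspace Z" "x\<notin>X"
  show "\<zeta> (inv g) x\<in>Y"
  proof (rule ccontr)
   assume "\<zeta> (inv g) x\<notin>Y"
   then have "\<zeta> g (\<zeta> (inv g) x)\<in>X" using that x by (intro subsetD[OF that(2)] imageI) simp
   then show False using x that by simp
  qed
 qed
 define v where "v = (\<lambda>l::bool \<times> bool. if fst l then (if snd l then inv b else b) else (if snd l then inv a else a))"
 define T where "T = (\<lambda>l::bool \<times> bool. if fst l then (if snd l then B' else B) else (if snd l then A' else A))"
 have d: "A \<inter> A' = {}" "A \<inter> B = {}" "A \<inter> B' = {}" "A \<inter> O' = {}" "A' \<inter> B = {}" "A' \<inter> B' = {}" "A' \<inter> O' = {}"
  "B \<inter> B' = {}" "B \<inter> O' = {}" "B' \<inter> O' = {}" using A(5) A'(5-7) B(5-7) B'(5-7) by blast+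
 have dd: "A' \<inter> A = {}" "B \<inter> A = {}" "B' \<inter> A = {}" "B \<inter> A' = {}" "B' \<inter> A' = {}" "B' \<inter> B = {}"
  using d by blast+
 have "schottky v T O'" unfolding schottky_def
 proof (intro conjI allI)
  fix l :: "bool \<times> bool"
  show "v l\<in>carrier \<Gamma>" using a b by (simp add: v_def)
  show "T l\<subseteq>topspace Z" using A(1) A'(1) B(1) B'(1) openin_subset by (auto simp: T_def)
  show "T l \<inter> O' = {}" by (simp add: T_def d)
  show "m\<noteq>l --> T l \<inter> T m = {}" for m
   by (cases l; cases m) (simp add: T_def d dd)
  show "v (fst l, \<not> snd l) = inv (v l)" using a b by (simp add: v_def)
  show "\<zeta> (v l) ` (topspace Z - T (fst l, \<not> snd l))\<subseteq>T l"
   using a b inv[OF a] inv[OF b] by (cases l) (auto simp: v_def T_def)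
 qed (use B' in auto)
 then show ?thesis by blast
qed

text \<open>Of a reduced word only the value and the first letter are recorded, since the first letter decides where ping-pong sends \<open>O'\<close>.\<close>
inductive reduced :: "('a, 'm) monoid_scheme => (bool \<times> bool => 'a) => bool \<times> bool => 'a => bool" for G v where
 single: "reduced G v l (v l)"
| extend: "reduced G v m w ==> m\<noteq>(fst l, \<not> snd l) ==> reduced G v l (v l \<otimes>\<^bsub>G\<^esub> w)"

context ep_action begin

lemma reduced_closed: "reduced \<Gamma> v l w ==> schottky v T O' ==> w\<in>carrier \<Gamma>"
 by (induction rule: reduced.induct) (auto intro: schottkyD(3))

lemma reduced_image:
 assumes "reduced \<Gamma> v l w" "schottky v T O'" "x\<in>O'"
 shows "\<zeta> w x\<in>T l"
 using assms(1)
proof (induction rule: reduced.induct)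
 case (single l)
 have "x\<in>topspace Z - T (fst l, \<not> snd l)" using assms(3) schottkyD(5)[OF assms(2), of "(fst l, \<not> snd l)"] openin_subset[OF schottkyD(1)[OF assms(2)]] by blast
 then show ?case using schottkyD(8)[OF assms(2), of l] by blast
next
 case (extend m w l)
 have wc: "w\<in>carrier \<Gamma>" using reduced_closed[OF extend(1) assms(2)] .
 have vl: "v l\<in>carrier \<Gamma>" by (rule schottkyD(3)[OF assms(2)])
 have xZ: "x\<in>topspace Z" using assms(3) schottkyD(5)[OF assms(2), of "(fst l, \<not> snd l)"] openin_subset[OF schottkyD(1)[OF assms(2)]] by blast
 have "T m \<inter> T (fst l, \<not> snd l) = {}" using schottkyD(6)[OF assms(2)] extend(2) by blast
 then have "\<zeta> w x\<in>topspace Z - T (fst l, \<not> snd l)" using extend(3) wc xZ by auto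
 then have "\<zeta> (v l) (\<zeta> w x)\<in>T l" using schottkyD(8)[OF assms(2), of l] by blast
 then show ?case using act_mult[OF vl wc xZ] by simp
qed

lemma schottky_word:
 assumes S: "schottky v T O'" and w: "w\<in>generate \<Gamma> (range v)"
 shows "w = \<one> \<or> (\<exists>l. reduced \<Gamma> v l w)"
proof -
 define D where "D = insert \<one> {w. \<exists>l. reduced \<Gamma> v l w}"
 have vc: "v l\<in>carrier \<Gamma>" for l by (rule schottkyD(3)[OF S])
 have DI: "u\<in>D" if "reduced \<Gamma> v l u" for l u using that unfolding D_def by blast
 have DC: "D\<subseteq>carrier \<Gamma>" using reduced_closed[OF _ S] by (auto simp: D_def)
 have step: "v l\<otimes>w\<in>D" if wD: "w\<in>D" for l w
 proof (cases "w = \<one>")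
  case True then show ?thesis using vc DI[OF single[of \<Gamma> v l]] by simp
 next
  case False
  then obtain m where m: "reduced \<Gamma> v m w" using wD unfolding D_def by blast
  show ?thesis
  proof (cases "m = (fst l, \<not> snd l)")
   case False then show ?thesis using DI[OF extend[OF m, of l]] by simp
  next
   case True
   then have vm: "v m = inv (v l)" using schottkyD(7)[OF S] by simp
   from m show ?thesis
   proof cases
    case single
    then show ?thesis using vm vc by (simp add: D_def)
   next
    case (extend m' w')
    have "w'\<in>carrier \<Gamma>" using reduced_closed[OF extend(2) S] .
    then have "v l\<otimes>w = w'" using extend(1) vm vc by simp
    then show ?thesis using DI[OF extend(2)] by simp
   qed
  qed
 qed
 have vinv: "inv (v l) = v (fst l, \<not> snd l)" for l using schottkyD(7)[OF S] by simp
 have "\<forall>u\<in>D. w\<otimes>u\<in>D" using w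
 proof (induction rule: generate.induct)
  case one then show ?case using DC by auto
 next
  case (incl h) then show ?case using step by auto
 next
  case (inv h)
  then obtain l where "h = v l" by blast
  then show ?case using step vinv by simp
 next
  case (eng h1 h2)
  have "h1\<in>carrier \<Gamma>" "h2\<in>carrier \<Gamma>" using eng(1,2) generate_incl[of "range v"] vc by blast+
  then show ?case using eng DC by (auto simp: m_assoc subset_iff)
 qed
 then have "w\<otimes>\<one>\<in>D" by (simp add: D_def)
 moreover have "w\<in>carrier \<Gamma>" using w generate_incl[of "range v"] vc by blast
 ultimately have "w\<in>D" by simp
 then show ?thesis unfolding D_def by blast
qed

text \<open>A non-trivial element is a reduced word, and ping-pong sends \<open>O'\<close> into the set of its first letter.\<close>
lemma schottky_wandering:
 assumes "schottky v T O'" "w\<in>generate \<Gamma> (range v)" "w\<noteq>\<one>"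
 shows "\<zeta> w ` O' \<inter> O' = {}"
proof -
 obtain l where l: "reduced \<Gamma> v l w" using schottky_word[OF assms(1,2)] assms(3) by blast
 have "T l \<inter> O' = {}" by (rule schottkyD(5)[OF assms(1)])
 then show ?thesis using reduced_image[OF l assms(1)] by blast
qed

text \<open>The inequalities behind the paradoxical decomposition of a free group, for the visit of \<open>w x\<close> to the ping-pong sets.\<close>
lemma schottky_paradox:
 assumes S: "schottky v T O'" and w: "w\<in>carrier \<Gamma>" and x: "x\<in>topspace Z"
 defines "f \<equiv> \<lambda>l w. if \<zeta> w x\<in>T l then 1 else (0::real)"
 shows "1\<le>f l w + f (fst l, \<not> snd l) (inv (v l)\<otimes>w)"
  and "f (False, False) w + f (False, True) w + f (True, False) w + f (True, True) w\<le>1"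
proof -
 have vl: "v l\<in>carrier \<Gamma>" by (rule schottkyD(3)[OF S])
 show "1\<le>f l w + f (fst l, \<not> snd l) (inv (v l)\<otimes>w)"
 proof (cases "\<zeta> w x\<in>T l")
  case True then show ?thesis by (simp add: f_def)
 next
  case False
  let ?m = "(fst l, \<not> snd l)"
  have "\<zeta> (v ?m) ` (topspace Z - T (fst ?m, \<not> snd ?m))\<subseteq>T ?m" by (rule schottkyD(8)[OF S])
  then have "\<zeta> (v ?m) (\<zeta> w x)\<in>T ?m" using False w x by auto
  moreover have "v ?m = inv (v l)" by (rule schottkyD(7)[OF S])
  ultimately have "\<zeta> (inv (v l)\<otimes>w) x\<in>T ?m" using act_mult w x vl by simp
  then show ?thesis by (simp add: f_def)
 qed
 have disj: "T l \<inter> T m = {}" if "l\<noteq>m" for l m using schottkyD(6)[OF S] that by blast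
 show "f (False, False) w + f (False, True) w + f (True, False) w + f (True, True) w\<le>1"
  using disj[of "(False,False)" "(False,True)"] disj[of "(False,False)" "(True,True)"] disj[of "(False,False)" "(True,False)"]
   disj[of "(False,True)" "(True,False)"] disj[of "(False,True)" "(True,True)"] disj[of "(True,False)" "(True,True)"]
  unfolding f_def by auto
qed

end

section \<open>The stabilizer URS of an extremely proximal action\<close>

lemma openin_chabauty_superset:
 assumes "finite S" "S\<subseteq>carrier G"
 shows "openin (chabauty G (disc G))
  {H\<in>closed_subgroups G (disc G). S\<subseteq>H}"
proof -
 let ?D = "disc G"
 have "{H\<in>closed_subgroups G ?D. S\<subseteq>H} =
  {H\<in>closed_subgroups G ?D. H \<inter> {} = {} \<and> (\<forall>U\<in>(\<lambda>s. {s}) ` S. H \<inter> U\<noteq>{})}" by auto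
 also have "openin (chabauty G ?D) \<dots>"
  unfolding chabauty_def
  by (rule topology_generated_by_Basis, rule CollectI, rule exI[of _ "{}"], rule exI[of _ "(\<lambda>s. {s}) ` S"])
   (use assms in auto)
 finally show ?thesis .
qed

lemma stabilizer_URS_finite_subset:
 assumes H: "H\<in>stabilizer_URS G (disc G) X \<phi>" and S: "finite S" "S\<subseteq>H"
 shows "\<exists>x. topcontinuous_at X (chabauty G (disc G)) (stabilizer G \<phi>) x \<and>
  x\<in>topspace X \<and> S\<subseteq>stabilizer G \<phi> x"
proof -
 let ?D = "disc G"
 have Hc: "H\<in>closed_subgroups G ?D"
  using H closure_of_subset_topspace[of "chabauty G ?D"] unfolding stabilizer_URS_def topspace_chabauty by blast
 then have "H\<subseteq>carrier G" by (simp add: closed_subgroups_def subgroup.subset)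
 then have o: "openin (chabauty G ?D) {L\<in>closed_subgroups G ?D. S\<subseteq>L}"
  using S by (intro openin_chabauty_superset) auto
 moreover have "H\<in>{L\<in>closed_subgroups G ?D. S\<subseteq>L}" using Hc S by simp
 moreover have "\<forall>T. H\<in>T \<and> openin (chabauty G ?D) T -->
   (\<exists>y. y\<in>stabilizer G \<phi> ` {x\<in>topspace X. topcontinuous_at X (chabauty G ?D) (stabilizer G \<phi>) x} \<and> y\<in>T)"
  using H unfolding stabilizer_URS_def in_closure_of by (rule conjunct2)
 ultimately have "\<exists>y. y\<in>stabilizer G \<phi> ` {x\<in>topspace X. topcontinuous_at X (chabauty G ?D) (stabilizer G \<phi>) x} \<and>
   y\<in>{L\<in>closed_subgroups G ?D. S\<subseteq>L}"
  by (simp only: simp_thms)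
 then show ?thesis by auto
qed

context ep_action begin

lemma stabilizer_closed_subgroup:
 assumes "x\<in>topspace Z"
 shows "stabilizer \<Gamma> \<zeta> x\<in>closed_subgroups \<Gamma> (disc \<Gamma>)"
 using group_action.stabilizer_subgroup[OF ga assms]
 by (simp add: closed_subgroups_def stabilizer_def Collect_restrict)

lemma closed_fixed_points:
 assumes "g\<in>carrier \<Gamma>" shows "closedin Z {x\<in>topspace Z. \<zeta> g x = x}"
 by (rule closedin_continuous_maps_eq[OF Haus act_cont[OF assms]]) (simp add: continuous_map_id[unfolded id_def])

text \<open>If every element fixing \<open>z\<close> fixes a neighbourhood of \<open>z\<close>, then near \<open>z\<close> stabilizers neither gain nor lose any of finitely
many elements, and these are all that the Chabauty topology of a discrete group sees.\<close>
lemma stabilizer_continuous_at: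
 assumes z: "z\<in>topspace Z"
  and int: "\<And>g. g\<in>carrier \<Gamma> ==> \<zeta> g z = z ==> z\<in>Z interior_of {x\<in>topspace Z. \<zeta> g x = x}"
 shows "topcontinuous_at Z (chabauty \<Gamma> (disc \<Gamma>)) (stabilizer \<Gamma> \<zeta>) z"
 unfolding topcontinuous_at_def
proof (intro conjI allI impI z)
 let ?D = "disc \<Gamma>"
 show "stabilizer \<Gamma> \<zeta>\<in>topspace Z \<rightarrow> topspace (chabauty \<Gamma> ?D)"
  using stabilizer_closed_subgroup by (simp add: topspace_chabauty)
 fix V assume V: "openin (chabauty \<Gamma> ?D) V \<and> stabilizer \<Gamma> \<zeta> z\<in>V"
 have "generate_topology_on {{H\<in>closed_subgroups \<Gamma> ?D. H \<inter> K = {} \<and> (\<forall>U\<in>\<U>. H \<inter> U\<noteq>{})} | K \<U>.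
    compactin ?D K \<and> finite \<U> \<and> (\<forall>U\<in>\<U>. openin ?D U)} V"
  using V by (simp add: chabauty_def openin_topology_generated_by_iff)
 then have "stabilizer \<Gamma> \<zeta> z\<in>V --> (\<exists>U. openin Z U \<and> z\<in>U \<and> (\<forall>y\<in>U. stabilizer \<Gamma> \<zeta> y\<in>V))"
 proof (induction rule: generate_topology_on.induct)
  case Empty then show ?case by simp
 next
  case (Int a b)
  show ?case
  proof
   assume "stabilizer \<Gamma> \<zeta> z\<in>a \<inter> b"
   then have za: "stabilizer \<Gamma> \<zeta> z\<in>a" and zb: "stabilizer \<Gamma> \<zeta> z\<in>b" by simp_all
   from mp[OF Int.IH(1) za] obtain U1 where U1: "openin Z U1" "z\<in>U1" "\<forall>y\<in>U1. stabilizer \<Gamma> \<zeta> y\<in>a" by blast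
   from mp[OF Int.IH(2) zb] obtain U2 where U2: "openin Z U2" "z\<in>U2" "\<forall>y\<in>U2. stabilizer \<Gamma> \<zeta> y\<in>b" by blast
   have "openin Z (U1 \<inter> U2)" by (rule openin_Int[OF U1(1) U2(1)])
   moreover have "z\<in>U1 \<inter> U2" using U1(2) U2(2) by simp
   moreover have "\<forall>y\<in>U1 \<inter> U2. stabilizer \<Gamma> \<zeta> y\<in>a \<inter> b" using U1(3) U2(3) by simp
   ultimately show "\<exists>U. openin Z U \<and> z\<in>U \<and> (\<forall>y\<in>U. stabilizer \<Gamma> \<zeta> y\<in>a \<inter> b)"
    by (intro exI conjI)
  qed
 next
  case (UN K)
  show ?case
  proof
   assume "stabilizer \<Gamma> \<zeta> z\<in>\<Union>K"
   then obtain k where k: "k\<in>K" "stabilizer \<Gamma> \<zeta> z\<in>k" by blast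
   from mp[OF UN.IH[OF k(1)] k(2)] obtain U where "openin Z U" "z\<in>U" "\<forall>y\<in>U. stabilizer \<Gamma> \<zeta> y\<in>k" by blast
   then show "\<exists>U. openin Z U \<and> z\<in>U \<and> (\<forall>y\<in>U. stabilizer \<Gamma> \<zeta> y\<in>\<Union>K)" using k(1) by blast
  qed
 next
  case (Basis s)
  then obtain K \<U> where s: "s = {H\<in>closed_subgroups \<Gamma> ?D. H \<inter> K = {} \<and> (\<forall>U\<in>\<U>. H \<inter> U\<noteq>{})}"
   and K: "compactin ?D K" and \<U>: "finite \<U>" by blast
  show ?case
  proof
   assume zs: "stabilizer \<Gamma> \<zeta> z\<in>s"
   have finK: "finite K" "K\<subseteq>carrier \<Gamma>" using K by (simp_all add: compactin_discrete_topology)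
   have "\<forall>U\<in>\<U>. \<exists>g. g\<in>stabilizer \<Gamma> \<zeta> z \<inter> U" using zs s by blast
   from bchoice[OF this] obtain g where g: "\<forall>U\<in>\<U>. g U\<in>stabilizer \<Gamma> \<zeta> z \<inter> U" by blast
   define W1 where "W1 = topspace Z - (\<Union>k\<in>K. {x\<in>topspace Z. \<zeta> k x = x})"
   define W2 where "W2 = topspace Z \<inter> (\<Inter>U\<in>\<U>. Z interior_of {x\<in>topspace Z. \<zeta> (g U) x = x})"
   have "closedin Z (\<Union>k\<in>K. {x\<in>topspace Z. \<zeta> k x = x})"
    using finK closed_fixed_points by (intro closedin_Union) auto
   then have o1: "openin Z W1" by (simp add: W1_def openin_diff)
   have o2: "openin Z W2"
   proof (cases "\<U> = {}")
    case False
    have "openin Z (\<Inter>U\<in>\<U>. Z interior_of {x\<in>topspace Z. \<zeta> (g U) x = x})"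
     using \<U> False by (intro openin_INT2) auto
    then show ?thesis unfolding W2_def by (intro openin_Int) auto
   qed (simp add: W2_def)
   have z1: "z\<in>W1" using zs z finK unfolding W1_def s stabilizer_def by blast
   have z2: "z\<in>W2" unfolding W2_def
   proof (intro IntI z INT_I)
    fix U assume "U\<in>\<U>"
    then have "g U\<in>carrier \<Gamma>" "\<zeta> (g U) z = z" using g by (auto simp: stabilizer_def)
    then show "z\<in>Z interior_of {x\<in>topspace Z. \<zeta> (g U) x = x}" by (rule int)
   qed
   have "stabilizer \<Gamma> \<zeta> y\<in>s" if y: "y\<in>W1 \<inter> W2" for y
   proof -
    have yZ: "y\<in>topspace Z" using y by (simp add: W1_def)
    have a: "stabilizer \<Gamma> \<zeta> y \<inter> K = {}" using y yZ unfolding W1_def stabilizer_def by blast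
    have "stabilizer \<Gamma> \<zeta> y \<inter> U\<noteq>{}" if U: "U\<in>\<U>" for U
    proof -
     have "y\<in>Z interior_of {x\<in>topspace Z. \<zeta> (g U) x = x}" using y U by (auto simp: W2_def)
     then have "\<zeta> (g U) y = y" using interior_of_subset[of Z "{x\<in>topspace Z. \<zeta> (g U) x = x}"] by blast
     then show ?thesis using g U by (auto simp: stabilizer_def)
    qed
    then show ?thesis unfolding s using a stabilizer_closed_subgroup[OF yZ] by blast
   qed
   then show "\<exists>U. openin Z U \<and> z\<in>U \<and> (\<forall>y\<in>U. stabilizer \<Gamma> \<zeta> y\<in>s)"
    using o1 o2 z1 z2 by (intro exI[of _ "W1 \<inter> W2"]) auto
  qed
 qed
 then show "\<exists>U. openin Z U \<and> z\<in>U \<and> (\<forall>y\<in>U. stabilizer \<Gamma> \<zeta> y\<in>V)" using V by blast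
qed

text \<open>The boundaries of the fixed point sets are closed with empty interior, and there are countably many; apply Baire's theorem.\<close>
lemma generic_point:
 assumes count: "countable (carrier \<Gamma>)" and U: "openin Z U" "U\<noteq>{}"
 shows "\<exists>z\<in>U. topcontinuous_at Z (chabauty \<Gamma> (disc \<Gamma>)) (stabilizer \<Gamma> \<zeta>) z"
proof -
 define Fx where "Fx = (\<lambda>g. {x\<in>topspace Z. \<zeta> g x = x})"
 define \<G> where "\<G> = (\<lambda>g. Fx g - Z interior_of (Fx g)) ` carrier \<Gamma>"
 have "Z interior_of \<Union>\<G> = {}"
 proof (rule Baire_category_alt)
  show "completely_metrizable_space Z \<or> locally_compact_space Z \<and> regular_space Z"
   using comp Haus compact_Hausdorff_imp_regular_space compact_imp_locally_compact_space by blast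
  show "countable \<G>" using count by (simp add: \<G>_def)
  fix A assume "A\<in>\<G>"
  then obtain g where g: "g\<in>carrier \<Gamma>" "A = Fx g - Z interior_of (Fx g)" by (auto simp: \<G>_def)
  have cl: "closedin Z (Fx g)" using closed_fixed_points[OF g(1)] by (simp add: Fx_def)
  have "Z interior_of A = {}"
  proof -
   have "Z interior_of A\<subseteq>Z interior_of (Fx g)" by (rule interior_of_mono) (use g in auto)
   moreover have "Z interior_of A\<subseteq>A" by (rule interior_of_subset)
   ultimately show ?thesis using g(2) by blast
  qed
  then show "closedin Z A \<and> Z interior_of A = {}" using cl g(2) by (simp add: closedin_diff)
 qed
 then have "\<not> U\<subseteq>\<Union>\<G>" using U interior_of_maximal[of U "\<Union>\<G>" Z] by blast
 then obtain z where z: "z\<in>U" "z\<notin>\<Union>\<G>" by blast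
 have zZ: "z\<in>topspace Z" using z openin_subset[OF U(1)] by blast
 have "topcontinuous_at Z (chabauty \<Gamma> (disc \<Gamma>)) (stabilizer \<Gamma> \<zeta>) z"
 proof (rule stabilizer_continuous_at[OF zZ])
  fix g assume "g\<in>carrier \<Gamma>" "\<zeta> g z = z"
  then show "z\<in>Z interior_of {x\<in>topspace Z. \<zeta> g x = x}"
   using z(2) zZ unfolding \<G>_def Fx_def by blast
 qed
 then show ?thesis using z by blast
qed

lemma generic_stabilizer_in_URS:
 assumes "topcontinuous_at Z (chabauty \<Gamma> (disc \<Gamma>)) (stabilizer \<Gamma> \<zeta>) z"
 shows "stabilizer \<Gamma> \<zeta> z\<in>stabilizer_URS \<Gamma> (disc \<Gamma>) Z \<zeta>"
proof -
 let ?S = "stabilizer \<Gamma> \<zeta> ` {x\<in>topspace Z. topcontinuous_at Z (chabauty \<Gamma> (disc \<Gamma>)) (stabilizer \<Gamma> \<zeta>) x}"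
 have "?S\<subseteq>topspace (chabauty \<Gamma> (disc \<Gamma>))"
  unfolding topspace_chabauty using stabilizer_closed_subgroup by blast
 from closure_of_subset[OF this] show ?thesis
  using assms unfolding stabilizer_URS_def topcontinuous_at_def by blast
qed

text \<open>An element of a generic stabilizer fixes an open set, and conversely a fixed open set contains generic points; finite sets of
elements pass to limits of subgroups.\<close>
lemma Union_stabilizer_URS:
 assumes count: "countable (carrier \<Gamma>)"
 shows "\<Union>(stabilizer_URS \<Gamma> (disc \<Gamma>) Z \<zeta>) = fixopen"
proof
 let ?D = "disc \<Gamma>"
 show "\<Union>(stabilizer_URS \<Gamma> ?D Z \<zeta>)\<subseteq>fixopen"
 proof
  fix g assume "g\<in>\<Union>(stabilizer_URS \<Gamma> ?D Z \<zeta>)"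
  then obtain H where H: "H\<in>stabilizer_URS \<Gamma> ?D Z \<zeta>" "{g}\<subseteq>H" by blast
  obtain z where z: "topcontinuous_at Z (chabauty \<Gamma> ?D) (stabilizer \<Gamma> \<zeta>) z" "z\<in>topspace Z" "g\<in>stabilizer \<Gamma> \<zeta> z"
   using stabilizer_URS_finite_subset[OF H(1) _ H(2)] by auto
  have gc: "g\<in>carrier \<Gamma>" using z(3) by (simp add: stabilizer_def)
  define V where "V = {L\<in>closed_subgroups \<Gamma> ?D. {g}\<subseteq>L}"
  have "openin (chabauty \<Gamma> ?D) V" unfolding V_def using gc by (intro openin_chabauty_superset) auto
  moreover have "stabilizer \<Gamma> \<zeta> z\<in>V" using z stabilizer_closed_subgroup by (simp add: V_def)
  ultimately obtain U where U: "openin Z U" "z\<in>U" "\<forall>y\<in>U. stabilizer \<Gamma> \<zeta> y\<in>V"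
   using z(1) unfolding topcontinuous_at_def by blast
  have "\<forall>y\<in>U. \<zeta> g y = y" using U(3) by (simp add: V_def stabilizer_def)
  then show "g\<in>fixopen" using U gc unfolding fixopen_def by blast
 qed
 show "fixopen\<subseteq>\<Union>(stabilizer_URS \<Gamma> ?D Z \<zeta>)"
 proof
  fix g assume "g\<in>fixopen"
  then obtain U where U: "g\<in>carrier \<Gamma>" "openin Z U" "U\<noteq>{}" "\<forall>x\<in>U. \<zeta> g x = x" by (auto simp: fixopen_def)
  obtain z where z: "z\<in>U" "topcontinuous_at Z (chabauty \<Gamma> ?D) (stabilizer \<Gamma> \<zeta>) z"
   using generic_point[OF count U(2,3)] by blast
  have "g\<in>stabilizer \<Gamma> \<zeta> z" using z U by (simp add: stabilizer_def)
  then show "g\<in>\<Union>(stabilizer_URS \<Gamma> ?D Z \<zeta>)" using generic_stabilizer_in_URS[OF z(2)] by blast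
 qed
qed

theorem envelope_eq:
 assumes "countable (carrier \<Gamma>)"
 shows "envelope \<Gamma> (disc \<Gamma>) (stabilizer_URS \<Gamma> (disc \<Gamma>) Z \<zeta>) = generate \<Gamma> fixopen"
proof -
 have "fixopen\<subseteq>carrier \<Gamma>" by (auto simp: fixopen_def)
 then have "generate \<Gamma> fixopen\<subseteq>carrier \<Gamma>" by (rule generate_incl)
 then show ?thesis unfolding envelope_def Union_stabilizer_URS[OF assms]
  by (intro closure_of_closedin) simp
qed

text \<open>Elements fixing a common open set lie in a generic stabilizer of \<open>Z\<close>, a member of the common URS; being finitely many, they
lie in a nearby stabilizer of \<open>B\<close>.\<close>
lemma finite_fixing_set_in_stabilizer:
 assumes count: "countable (carrier \<Gamma>)"
  and eq: "stabilizer_URS \<Gamma> (disc \<Gamma>) Z \<zeta> = stabilizer_URS \<Gamma> (disc \<Gamma>) B \<beta>"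
  and S: "finite S" "S\<subseteq>carrier \<Gamma>" and U: "openin Z U" "U\<noteq>{}" "\<forall>s\<in>S. \<forall>x\<in>U. \<zeta> s x = x"
 shows "\<exists>b\<in>topspace B. S\<subseteq>stabilizer \<Gamma> \<beta> b"
proof -
 let ?D = "disc \<Gamma>"
 obtain z where z: "z\<in>U" "topcontinuous_at Z (chabauty \<Gamma> ?D) (stabilizer \<Gamma> \<zeta>) z"
  using generic_point[OF count U(1,2)] by blast
 have "stabilizer \<Gamma> \<zeta> z\<in>stabilizer_URS \<Gamma> ?D B \<beta>" using generic_stabilizer_in_URS[OF z(2)] eq by simp
 moreover have "S\<subseteq>stabilizer \<Gamma> \<zeta> z" using S U z by (auto simp: stabilizer_def)
 ultimately show ?thesis using stabilizer_URS_finite_subset[OF _ S(1)] by blast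
qed

end

section \<open>Topological groups and lattices\<close>

locale tgroup =
 fixes H :: "('h, 'm) monoid_scheme" (structure) and T :: "'h topology"
 assumes tg: "topological_group H T"
begin

sublocale group H using tg by (simp add: topological_group_def)

lemma top [simp]: "topspace T = carrier H"
 using tg by (simp add: topological_group_def)

lemma open_carrier: "openin T (carrier H)"
 using openin_topspace[of T] by simp

lemma cmult:
 assumes "continuous_map X T f" "continuous_map X T g"
 shows "continuous_map X T (\<lambda>x. f x\<otimes>g x)"
proof -
 have "continuous_map (prod_topology T T) T (\<lambda>(x, y). x\<otimes>y)" using tg by (simp add: topological_group_def)
 from continuous_map_compose[OF continuous_map_pairedI[OF assms] this] show ?thesis by (simp add: o_def)
qed

lemma cinv:
 assumes "continuous_map X T f" shows "continuous_map X T (\<lambda>x. inv (f x))"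
proof -
 have "continuous_map T T (\<lambda>x. inv x)" using tg by (simp add: topological_group_def)
 from continuous_map_compose[OF assms this] show ?thesis by (simp add: o_def)
qed

lemma cid: "continuous_map T T (\<lambda>x. x)"
 by (simp add: continuous_map_id[unfolded id_def])

lemma cconst: "a\<in>carrier H ==> continuous_map X T (\<lambda>_. a)"
 by simp

lemma ltrans: "a\<in>carrier H ==> continuous_map T T (\<lambda>x. a\<otimes>x)"
 by (intro cmult cconst cid)

lemma rtrans: "a\<in>carrier H ==> continuous_map T T (\<lambda>x. x\<otimes>a)"
 by (intro cmult cconst cid)

lemma open_subset: "openin T U ==> U\<subseteq>carrier H"
 using openin_subset[of T U] by simp

lemma open_ltrans:
 assumes "a\<in>carrier H" "openin T U" shows "openin T ((\<lambda>x. a\<otimes>x) ` U)"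
proof -
 have "openin T {x\<in>topspace T. inv a\<otimes>x\<in>U}" using ltrans[of "inv a"] assms by (simp add: continuous_map_def)
 also have "{x\<in>topspace T. inv a\<otimes>x\<in>U} = (\<lambda>x. a\<otimes>x) ` U"
 proof (intro equalityI subsetI)
  fix x assume x: "x\<in>{x\<in>topspace T. inv a\<otimes>x\<in>U}"
  then have "x = a\<otimes>(inv a\<otimes>x)" using assms(1) by simp
  then show "x\<in>(\<lambda>x. a\<otimes>x) ` U" using x by blast
 next
  fix x assume "x\<in>(\<lambda>x. a\<otimes>x) ` U"
  then obtain u where u: "u\<in>U" "x = a\<otimes>u" by blast
  then have "u\<in>carrier H" using open_subset[OF assms(2)] by blast
  then show "x\<in>{x\<in>topspace T. inv a\<otimes>x\<in>U}" using assms(1) u by simp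
 qed
 finally show ?thesis .
qed

lemma open_rtrans:
 assumes "a\<in>carrier H" "openin T U" shows "openin T ((\<lambda>x. x\<otimes>a) ` U)"
proof -
 have "openin T {x\<in>topspace T. x\<otimes>inv a\<in>U}" using rtrans[of "inv a"] assms by (simp add: continuous_map_def)
 also have "{x\<in>topspace T. x\<otimes>inv a\<in>U} = (\<lambda>x. x\<otimes>a) ` U"
 proof (intro equalityI subsetI)
  fix x assume x: "x\<in>{x\<in>topspace T. x\<otimes>inv a\<in>U}"
  then have "x = (x\<otimes>inv a)\<otimes>a" using assms(1) by (simp add: m_assoc)
  then show "x\<in>(\<lambda>x. x\<otimes>a) ` U" using x by blast
 next
  fix x assume "x\<in>(\<lambda>x. x\<otimes>a) ` U"
  then show "x\<in>{x\<in>topspace T. x\<otimes>inv a\<in>U}" using assms open_subset[OF assms(2)] by (auto simp: m_assoc)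
 qed
 finally show ?thesis .
qed

lemma nbhd_product:
 assumes "continuous_map (prod_topology T T) T f" "f (a, b)\<in>W" "openin T W" "a\<in>carrier H" "b\<in>carrier H"
 shows "\<exists>U V. openin T U \<and> openin T V \<and> a\<in>U \<and> b\<in>V \<and> (\<forall>x\<in>U. \<forall>y\<in>V. f (x, y)\<in>W)"
proof -
 have "openin (prod_topology T T) {p\<in>topspace (prod_topology T T). f p\<in>W}"
  using assms by (simp add: continuous_map_def)
 moreover have "(a, b)\<in>{p\<in>topspace (prod_topology T T). f p\<in>W}" using assms by simp
 ultimately have "\<exists>U V. openin T U \<and> openin T V \<and> a\<in>U \<and> b\<in>V \<and>
   U \<times> V\<subseteq>{p\<in>topspace (prod_topology T T). f p\<in>W}"
  unfolding openin_prod_topology_alt by presburger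
 then show ?thesis by (elim ex_forward) auto
qed

text \<open>Taking \<open>x\<close> or \<open>y\<close> to be the identity shows that \<open>V\<close> and its inverse are contained in \<open>W\<close>.\<close>
lemma one_nbhd_quot:
 assumes "openin T W" "\<one>\<in>W"
 shows "\<exists>V. openin T V \<and> \<one>\<in>V \<and> (\<forall>x\<in>V. \<forall>y\<in>V. inv x\<otimes>y\<in>W \<and> x\<otimes>inv y\<in>W \<and> x\<otimes>y\<in>W)"
proof -
 have c1: "continuous_map (prod_topology T T) T (\<lambda>p. inv (fst p)\<otimes>snd p)"
  and c2: "continuous_map (prod_topology T T) T (\<lambda>p. fst p\<otimes>inv (snd p))"
  and c3: "continuous_map (prod_topology T T) T (\<lambda>p. fst p\<otimes>snd p)"
  by (intro cmult cinv continuous_map_fst continuous_map_snd)+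
 obtain U1 V1 where 1: "openin T U1" "openin T V1" "\<one>\<in>U1" "\<one>\<in>V1" "\<forall>x\<in>U1. \<forall>y\<in>V1. inv x\<otimes>y\<in>W"
  using nbhd_product[OF c1, of \<one> \<one> W] assms by auto
 obtain U2 V2 where 2: "openin T U2" "openin T V2" "\<one>\<in>U2" "\<one>\<in>V2" "\<forall>x\<in>U2. \<forall>y\<in>V2. x\<otimes>inv y\<in>W"
  using nbhd_product[OF c2, of \<one> \<one> W] assms by auto
 obtain U3 V3 where 3: "openin T U3" "openin T V3" "\<one>\<in>U3" "\<one>\<in>V3" "\<forall>x\<in>U3. \<forall>y\<in>V3. x\<otimes>y\<in>W"
  using nbhd_product[OF c3, of \<one> \<one> W] assms by auto
 define V where "V = U1 \<inter> V1 \<inter> (U2 \<inter> V2) \<inter> (U3 \<inter> V3)"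
 have "openin T V" unfolding V_def by (intro openin_Int 1 2 3)
 then show ?thesis using 1 2 3 by (intro exI[of _ V]) (auto simp: V_def)
qed

text \<open>Each point lies in a basic open set contained in a translate of \<open>V\<close>; choose one translate for each such basic set.\<close>
lemma countable_translates_cover:
 assumes sc: "second_countable_space T" and V: "openin T V" "\<one>\<in>V"
 shows "\<exists>c :: nat => 'h. (\<forall>n. c n\<in>carrier H) \<and> (\<forall>x\<in>carrier H. \<exists>n. inv (c n)\<otimes>x\<in>V) "
proof -
 obtain \<B> where B: "countable \<B>" "openin T = arbitrary union_of (\<lambda>U. U\<in>\<B>)"
  using sc unfolding second_countable_space_def by blast
 define P where "P = (\<lambda>b c. c\<in>carrier H \<and> (\<forall>x\<in>b. inv c\<otimes>x\<in>V))"
 define \<C> where "\<C> = {b\<in>\<B>. \<exists>c. P b c}"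
 obtain f where f: "\<forall>b\<in>\<C>. P b (f b)" using bchoice[of \<C> P] unfolding \<C>_def by blast
 have cov: "\<exists>b\<in>\<C>. x\<in>b" if x: "x\<in>carrier H" for x
 proof -
  have "openin T ((\<lambda>y. x\<otimes>y) ` V)" by (rule open_ltrans[OF x V(1)])
  moreover have "x\<in>(\<lambda>y. x\<otimes>y) ` V" using x V(2) by force
  moreover obtain \<U> where "\<U>\<subseteq>\<B>" "\<Union>\<U> = (\<lambda>y. x\<otimes>y) ` V"
   using calculation(1) unfolding B(2) union_of_def arbitrary_def by auto
  ultimately obtain b where b: "b\<in>\<B>" "x\<in>b" "b\<subseteq>(\<lambda>y. x\<otimes>y) ` V"
   by (metis UnionE Union_upper subsetD)
  have "P b x" unfolding P_def
  proof (intro conjI x ballI)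
   fix y assume "y\<in>b"
   then obtain v where v: "v\<in>V" "y = x\<otimes>v" using b by blast
   then show "inv x\<otimes>y\<in>V" using x open_subset[OF V(1)] by auto
  qed
  then show ?thesis using b by (auto simp: \<C>_def)
 qed
 have ne: "\<C>\<noteq>{}" using cov[OF one_closed] by blast
 have "countable \<C>" using B(1) unfolding \<C>_def by (rule countable_subset[rotated]) auto
 then obtain e :: "nat => 'h set" where e: "range e = \<C>"
  using ne by (metis range_from_nat_into)
 have "\<forall>n. f (e n)\<in>carrier H" using f e by (auto simp: P_def)
 moreover have "\<exists>n. inv (f (e n))\<otimes>x\<in>V" if "x\<in>carrier H" for x
 proof -
  obtain b where b: "b\<in>\<C>" "x\<in>b" using cov[OF \<open>x\<in>carrier H\<close>] by blast
  then obtain n where "b = e n" using e by blast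
  then show ?thesis using f b by (auto simp: P_def)
 qed
 ultimately show ?thesis by (intro exI[of _ "\<lambda>n. f (e n)"]) auto
qed

text \<open>Finitely many translates of a compact set do not cover a non-compact group, and a dense set meets the open remainder.\<close>
lemma noncompact_spread:
 assumes nc: "\<not> compact_space T" and haus: "Hausdorff_space T" and Q: "compactin T Q"
  and D: "T closure_of D = topspace T" "D\<subseteq>carrier H"
 shows "\<exists>g :: nat => 'h. \<forall>n. g n\<in>D \<and> (\<forall>i<n. inv (g i)\<otimes>g n\<notin>Q)"
proof (rule dependent_wellorder_choice)
 fix r and f g :: "nat => 'h" and n :: nat
 assume "\<And>y. y < n ==> f y = g y"
 then show "(r\<in>D \<and> (\<forall>i<n. inv (f i)\<otimes>r\<notin>Q)) = (r\<in>D \<and> (\<forall>i<n. inv (g i)\<otimes>r\<notin>Q))" by simp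
next
 fix n :: nat and f :: "nat => 'h"
 assume IH: "\<And>y. y < n ==> f y\<in>D \<and> (\<forall>i<y. inv (f i)\<otimes>f y\<notin>Q)"
 define C where "C = (\<Union>i<n. (\<lambda>x. f i\<otimes>x) ` Q)"
 have QH: "Q\<subseteq>carrier H" using compactin_subset_topspace[OF Q] by simp
 have fc: "f i\<in>carrier H" if "i < n" for i using IH[OF that] D(2) by blast
 have "compactin T C" unfolding C_def
 proof (rule compactin_Union)
  show "compactin T S" if "S\<in>(\<lambda>i. (\<lambda>x. f i\<otimes>x) ` Q) ` {..<n}" for S
   using that image_compactin[OF Q ltrans[OF fc]] by auto
 qed simp
 then have cl: "closedin T C" and "C\<noteq>topspace T"
  using compactin_imp_closedin[OF haus] nc by (auto simp: compact_space_def)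
 then have "openin T (topspace T - C)" "topspace T - C\<noteq>{}"
  using closedin_subset[OF cl] openin_diff[OF openin_topspace cl] by blast+
 moreover obtain y where "y\<in>topspace T - C" using calculation by blast
 moreover have "y\<in>T closure_of D" using D(1) calculation by auto
 ultimately obtain r where r: "r\<in>D" "r\<in>topspace T - C" unfolding in_closure_of by blast
 have "inv (f i)\<otimes>r\<notin>Q" if "i < n" for i
 proof
  assume "inv (f i)\<otimes>r\<in>Q"
  moreover have "f i\<otimes>(inv (f i)\<otimes>r) = r" using fc[OF that] r(2) by simp
  ultimately have "r\<in>C" unfolding C_def using that by force
  then show False using r by blast
 qed
 then show "\<exists>r. r\<in>D \<and> (\<forall>i<n. inv (f i)\<otimes>r\<notin>Q)" using r by blast
qed

lemma compactin_product_set: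
 assumes "compactin T A" "compactin T B" shows "compactin T {a\<otimes>b | a b. a\<in>A \<and> b\<in>B}"
proof -
 have "compactin (prod_topology T T) (A \<times> B)" using assms by (simp add: compactin_Times)
 moreover have "continuous_map (prod_topology T T) T (\<lambda>p. fst p\<otimes>snd p)"
  by (intro cmult continuous_map_fst continuous_map_snd)
 ultimately have "compactin T ((\<lambda>p. fst p\<otimes>snd p) ` (A \<times> B))" by (rule image_compactin)
 also have "(\<lambda>p. fst p\<otimes>snd p) ` (A \<times> B) = {a\<otimes>b | a b. a\<in>A \<and> b\<in>B}" by force
 finally show ?thesis .
qed

lemma compactin_inverse_set:
 assumes "compactin T A" shows "compactin T ((\<lambda>a. inv a) ` A)"
 by (rule image_compactin[OF assms cinv[OF cid]])

end

locale lattice = tgroup G T for G :: "('g, 'm) monoid_scheme" (structure) and T :: "'g topology" +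
 fixes \<Lambda> :: "'g set" and \<mu> :: "'g set measure"
 assumes haus: "Hausdorff_space T" and sc: "second_countable_space T"
  and sub: "subgroup \<Lambda> G" and discr: "subtopology T \<Lambda> = discrete_topology \<Lambda>"
  and prob: "prob_space \<mu>" and sets_mu: "sets \<mu> = sets (borel_on (coset_space G T \<Lambda>))"
  and invariant: "\<And>g. g\<in>carrier G ==> distr \<mu> \<mu> (\<lambda>C. g <# C) = \<mu>"
begin

sublocale prob_space \<mu> by (rule prob)

abbreviation X where "X \<equiv> coset_space G T \<Lambda>"

lemma Lcl: "l\<in>\<Lambda> ==> l\<in>carrier G" using subgroup.mem_carrier[OF sub] .
lemma Lm: "l\<in>\<Lambda> ==> k\<in>\<Lambda> ==> l\<otimes>k\<in>\<Lambda>" using subgroup.m_closed[OF sub] .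
lemma Li: "l\<in>\<Lambda> ==> inv l\<in>\<Lambda>" using subgroup.m_inv_closed[OF sub] .
lemma L1: "\<one>\<in>\<Lambda>" using subgroup.one_closed[OF sub] .

lemma coset_iff: "y\<in>x <# \<Lambda> \<longleftrightarrow> (\<exists>l\<in>\<Lambda>. y = x\<otimes>l)"
 by (auto simp: l_coset_def)

lemma coset_in: "x\<in>carrier G ==> x <# \<Lambda>\<in>lcosets \<Lambda>"
 by (auto simp: LCOSETS_def)

lemma coset_self: "x\<in>carrier G ==> x\<in>x <# \<Lambda>"
 using L1 r_one by (force simp: coset_iff)

lemma coset_of: assumes "C\<in>lcosets \<Lambda>" "x\<in>C" shows "x\<in>carrier G" "C = x <# \<Lambda>"
proof -
 obtain a where a: "a\<in>carrier G" "C = a <# \<Lambda>" using assms(1) by (auto simp: LCOSETS_def)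
 then obtain l where l: "l\<in>\<Lambda>" "x = a\<otimes>l" using assms(2) coset_iff by blast
 show "x\<in>carrier G" using a l Lcl by simp
 have 1: "x\<otimes>k = a\<otimes>(l\<otimes>k)" if "k\<in>\<Lambda>" for k using a l Lcl that by (simp add: m_assoc)
 have 2: "a\<otimes>k = x\<otimes>(inv l\<otimes>k)" if "k\<in>\<Lambda>" for k
  using a l Lcl that by (simp add: m_assoc)
 show "C = x <# \<Lambda>" unfolding a(2)
 proof (intro equalityI subsetI)
  fix y assume "y\<in>a <# \<Lambda>"
  then obtain k where "k\<in>\<Lambda>" "y = a\<otimes>k" by (auto simp: coset_iff)
  then show "y\<in>x <# \<Lambda>" using 2 Lm Li l(1) unfolding coset_iff by blast
 next
  fix y assume "y\<in>x <# \<Lambda>"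
  then obtain k where "k\<in>\<Lambda>" "y = x\<otimes>k" by (auto simp: coset_iff)
  then show "y\<in>a <# \<Lambda>" using 1 Lm l(1) unfolding coset_iff by blast
 qed
qed

lemma coset_translate:
 assumes "g\<in>carrier G" "C\<in>lcosets \<Lambda>"
 shows "g <# C = (\<lambda>x. g\<otimes>x) ` C" "g <# C\<in>lcosets \<Lambda>"
proof -
 show 1: "g <# C = (\<lambda>x. g\<otimes>x) ` C" by (auto simp: l_coset_def)
 obtain a where a: "a\<in>carrier G" "C = a <# \<Lambda>" using assms(2) by (auto simp: LCOSETS_def)
 have "g <# C = (g\<otimes>a) <# \<Lambda>" using a assms Lcl by (auto simp: l_coset_def m_assoc)
 then show "g <# C\<in>lcosets \<Lambda>" using coset_in a(1) assms(1) by simp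
qed

lemma topspace_X: "topspace X = lcosets \<Lambda>"
proof
 have "openin X (topspace X)" by (rule openin_topspace)
 then show "topspace X\<subseteq>lcosets \<Lambda>" unfolding openin_coset_space by blast
 have "{x\<in>topspace T. x <# \<Lambda>\<in>lcosets \<Lambda>} = topspace T" using coset_in by auto
 then have "openin X (lcosets \<Lambda>)" unfolding openin_coset_space by (simp del: top)
 then show "lcosets \<Lambda>\<subseteq>topspace X" by (rule openin_subset)
qed

lemma space_mu: "space \<mu> = lcosets \<Lambda>"
 using sets_eq_imp_space_eq[OF sets_mu] topspace_X by simp

text \<open>The cosets meeting \<open>A\<close>, that is, the image of \<open>A\<close> in \<open>G/\<Lambda>\<close>.\<close>
definition hit :: "'g set => 'g set set" where
 "hit A = {C\<in>lcosets \<Lambda>. C \<inter> A\<noteq>{}}"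

lemma open_hit: assumes "openin T A" shows "openin X (hit A)"
proof -
 have "{x\<in>topspace T. x <# \<Lambda>\<in>hit A} = (\<Union>l\<in>\<Lambda>. {x\<in>topspace T. x\<otimes>l\<in>A})"
  using coset_in by (auto simp: hit_def coset_iff) (metis IntI coset_iff empty_iff)+
 moreover have "openin T {x\<in>topspace T. x\<otimes>l\<in>A}" if "l\<in>\<Lambda>" for l
  using rtrans[OF Lcl[OF that]] assms by (simp add: continuous_map_def)
 ultimately show ?thesis unfolding openin_coset_space by (auto simp: hit_def)
qed

lemma meas_hit: "openin T A ==> hit A\<in>sets \<mu>"
 using openin_borel_on[OF open_hit] sets_mu by simp

lemma translate_measurable:
 assumes g: "g\<in>carrier G" shows "(\<lambda>C. g <# C)\<in>measurable \<mu> \<mu>"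
proof -
 have "continuous_map X X (\<lambda>C. g <# C)"
  unfolding continuous_map_def
 proof (intro conjI allI impI)
  show "(\<lambda>C. g <# C)\<in>topspace X \<rightarrow> topspace X" using coset_translate(2)[OF g] topspace_X by auto
  fix U assume U: "openin X U"
  have "{x\<in>topspace T. x <# \<Lambda>\<in>{C\<in>topspace X. g <# C\<in>U}} = {x\<in>topspace T. g\<otimes>x\<in>{y\<in>topspace T. y <# \<Lambda>\<in>U}}"
  proof -
   have "g <# (x <# \<Lambda>) = (g\<otimes>x) <# \<Lambda>" if "x\<in>carrier G" for x
    using that g Lcl by (auto simp: l_coset_def m_assoc)
   then show ?thesis using g coset_in by (auto simp: topspace_X)
  qed
  moreover have "openin T {y\<in>topspace T. y <# \<Lambda>\<in>U}" using U by (simp add: openin_coset_space)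
  ultimately show "openin X {C\<in>topspace X. g <# C\<in>U}"
   using ltrans[OF g] unfolding openin_coset_space continuous_map_def by (auto simp: topspace_X)
 qed
 from continuous_map_measurable[OF this] show ?thesis
  using sets_mu measurable_cong_sets by blast
qed

lemma measure_translate:
 assumes g: "g\<in>carrier G" and A: "A\<in>sets \<mu>"
 shows "measure \<mu> {C\<in>space \<mu>. g <# C\<in>A} = measure \<mu> A"
proof -
 have "measure \<mu> A = measure (distr \<mu> \<mu> (\<lambda>C. g <# C)) A" using invariant[OF g] by simp
 also have "\<dots> = measure \<mu> {C\<in>space \<mu>. g <# C\<in>A}"
  by (subst measure_distr[OF translate_measurable[OF g] A]) (rule arg_cong[where f="measure \<mu>"], auto)
 finally show ?thesis by simp
qed

lemma hit_translate:
 assumes g: "g\<in>carrier G" and A: "A\<subseteq>carrier G"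
 shows "hit A = {C\<in>space \<mu>. g <# C\<in>hit ((\<lambda>x. g\<otimes>x) ` A)}"
proof -
 have "C \<inter> A\<noteq>{} \<longleftrightarrow> (\<lambda>x. g\<otimes>x) ` C \<inter> (\<lambda>x. g\<otimes>x) ` A\<noteq>{}" if "C\<in>lcosets \<Lambda>" for C
 proof -
  have "C\<subseteq>carrier G" using coset_of(1)[OF that] by blast
  then have "inj_on (\<lambda>x. g\<otimes>x) (C \<union> A)" using A g by (intro inj_onI) (auto simp: subset_iff)
  then show ?thesis by (metis image_is_empty inj_on_image_Int sup_ge1 sup_ge2)
 qed
 then have "C\<in>hit A \<longleftrightarrow> g <# C\<in>hit ((\<lambda>x. g\<otimes>x) ` A)" if "C\<in>lcosets \<Lambda>" for C
  using coset_translate[OF g that] that by (simp add: hit_def)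
 then show ?thesis by (auto simp: space_mu hit_def)
qed

lemma measure_hit_translate:
 assumes "g\<in>carrier G" "openin T A"
 shows "measure \<mu> (hit ((\<lambda>x. g\<otimes>x) ` A)) = measure \<mu> (hit A)"
 using measure_translate[OF assms(1) meas_hit[OF open_ltrans[OF assms]]] hit_translate[OF assms(1) open_subset[OF assms(2)]] by simp

text \<open>Countably many translates of \<open>A\<close> cover \<open>G\<close>, and all their images in \<open>G/\<Lambda>\<close> have the same measure.\<close>
lemma hit_positive:
 assumes A: "openin T A" "A\<noteq>{}" shows "measure \<mu> (hit A) > 0"
proof (rule ccontr)
 assume "\<not> ?thesis"
 then have z: "measure \<mu> (hit A) = 0" using measure_nonneg[of \<mu> "hit A"] by linarith
 obtain a where a: "a\<in>A" "a\<in>carrier G" using A open_subset by blast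
 define V where "V = (\<lambda>x. inv a\<otimes>x) ` A"
 have V: "openin T V" "\<one>\<in>V" unfolding V_def using open_ltrans[OF _ A(1)] a by (auto simp: image_iff intro!: bexI[of _ a])
 obtain c :: "nat => 'g" where c: "\<forall>n. c n\<in>carrier G" "\<forall>x\<in>carrier G. \<exists>n. inv (c n)\<otimes>x\<in>V"
  using countable_translates_cover[OF sc V] by blast
 have zero: "measure \<mu> (hit ((\<lambda>x. c n\<otimes>x) ` V)) = 0" for n
  using measure_hit_translate[of "c n" V] measure_hit_translate[of "inv a" A] c(1) V a z A by (simp add: V_def)
 have "C\<in>(\<Union>n. hit ((\<lambda>x. c n\<otimes>x) ` V))" if C: "C\<in>lcosets \<Lambda>" for C
 proof -
  obtain x where x: "x\<in>carrier G" "C = x <# \<Lambda>" using C by (auto simp: LCOSETS_def)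
  obtain n where n: "inv (c n)\<otimes>x\<in>V" using c(2) x by blast
  have "x = c n\<otimes>(inv (c n)\<otimes>x)" using c(1) x(1) by simp
  then have "x\<in>(\<lambda>x. c n\<otimes>x) ` V" using n by blast
  then have "C\<in>hit ((\<lambda>x. c n\<otimes>x) ` V)" using C coset_self x by (auto simp: hit_def)
  then show ?thesis by blast
 qed
 then have "space \<mu> = (\<Union>n. hit ((\<lambda>x. c n\<otimes>x) ` V))" by (auto simp: space_mu hit_def)
 moreover have "hit ((\<lambda>x. c n\<otimes>x) ` V)\<in>null_sets \<mu>" for n
  using zero[of n] meas_hit[OF open_ltrans, of "c n" V] V c by (simp add: null_setsI emeasure_eq_measure)
 then have "(\<Union>n. hit ((\<lambda>x. c n\<otimes>x) ` V))\<in>null_sets \<mu>" by (rule null_sets_UN)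
 ultimately show False using prob_space by (simp add: null_sets_def emeasure_eq_measure)
qed

text \<open>Poincare recurrence: infinitely many sets of equal positive measure cannot be disjoint in a probability space.\<close>
lemma recurrence:
 assumes A: "openin T A" "A\<noteq>{}" and g: "\<And>n :: nat. g n\<in>carrier G"
 shows "\<exists>i j a b l. i < j \<and> a\<in>A \<and> b\<in>A \<and> l\<in>\<Lambda> \<and> g i\<otimes>a\<otimes>l = g j\<otimes>b"
proof (rule ccontr)
 assume no: "\<not> ?thesis"
 define H where "H = (\<lambda>n. hit ((\<lambda>x. g n\<otimes>x) ` A))"
 have mH: "H n\<in>sets \<mu>" for n unfolding H_def using meas_hit open_ltrans[OF g A(1)] by blast
 have disj: "H i \<inter> H j = {}" if "i < j" for i j
 proof (rule ccontr)
  assume "H i \<inter> H j\<noteq>{}"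
  then obtain C where C: "C\<in>lcosets \<Lambda>" "C \<inter> (\<lambda>x. g i\<otimes>x) ` A\<noteq>{}" "C \<inter> (\<lambda>x. g j\<otimes>x) ` A\<noteq>{}"
   unfolding H_def hit_def by blast
  then obtain a b where ab: "a\<in>A" "b\<in>A" "g i\<otimes>a\<in>C" "g j\<otimes>b\<in>C" by blast
  then have "g j\<otimes>b\<in>(g i\<otimes>a) <# \<Lambda>" using coset_of(2)[OF C(1) ab(3)] by simp
  then obtain l where "l\<in>\<Lambda>" "g j\<otimes>b = g i\<otimes>a\<otimes>l" by (auto simp: coset_iff)
  then show False using no ab \<open>i < j\<close> by metis
 qed
 have df: "disjoint_family H" unfolding disjoint_family_on_def
  using disj by (metis Int_commute linorder_neqE_nat)
 define \<delta> where "\<delta> = measure \<mu> (hit A)"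
 have "\<delta> > 0" unfolding \<delta>_def by (rule hit_positive[OF A])
 have eq: "measure \<mu> (H n) = \<delta>" for n unfolding H_def \<delta>_def by (rule measure_hit_translate[OF g A(1)])
 obtain n :: nat where n: "real n * \<delta> > 1" using reals_Archimedean3[OF \<open>\<delta> > 0\<close>] by blast
 have "real n * \<delta> = (\<Sum>i<n. measure \<mu> (H i))" using eq by simp
 also have "\<dots> = measure \<mu> (\<Union>i<n. H i)"
  by (rule finite_measure_finite_Union[symmetric]) (use mH df in \<open>auto simp: disjoint_family_on_def\<close>)
 also have "\<dots>\<le>1" by (rule prob_le_1)
 finally show False using n by simp
qed

lemma discrete_nbhd: "\<exists>V. openin T V \<and> \<one>\<in>V \<and> (\<forall>x\<in>V. \<forall>y\<in>V. inv x\<otimes>y\<in>\<Lambda> --> x = y)"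
proof -
 have "openin (subtopology T \<Lambda>) {\<one>}" using discr L1 by simp
 then obtain W where W: "openin T W" "{\<one>} = W \<inter> \<Lambda>" unfolding openin_subtopology by blast
 then obtain V where V: "openin T V" "\<one>\<in>V" "\<forall>x\<in>V. \<forall>y\<in>V. inv x\<otimes>y\<in>W \<and> x\<otimes>inv y\<in>W \<and> x\<otimes>y\<in>W"
  using one_nbhd_quot[of W] by blast
 have "x = y" if "x\<in>V" "y\<in>V" "inv x\<otimes>y\<in>\<Lambda>" for x y
 proof -
  have "inv x\<otimes>y = \<one>" using V(3) that W(2) by blast
  then have "y = x\<otimes>\<one>" using open_subset[OF V(1)] that by (metis inv_solve_left' l_one one_closed r_one subsetD inv_closed inv_inv)
  then show ?thesis using open_subset[OF V(1)] that by auto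
 qed
 then show ?thesis using V by blast
qed

text \<open>By discreteness, small open sets meet each coset at most once. Countably many of them cover \<open>G\<close>, and the section picks the
point of the coset in the first one that it meets.\<close>
lemma borel_section:
 "\<exists>s. s\<in>measurable \<mu> (borel_on T) \<and> (\<forall>C\<in>lcosets \<Lambda>. s C\<in>C)"
proof -
 obtain V where V: "openin T V" "\<one>\<in>V" "\<forall>x\<in>V. \<forall>y\<in>V. inv x\<otimes>y\<in>\<Lambda> --> x = y"
  using discrete_nbhd by blast
 obtain c :: "nat => 'g" where c: "\<forall>n. c n\<in>carrier G" "\<forall>x\<in>carrier G. \<exists>n. inv (c n)\<otimes>x\<in>V"
  using countable_translates_cover[OF sc V(1,2)] by blast
 define W where "W = (\<lambda>n. (\<lambda>x. c n\<otimes>x) ` V)"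
 have oW: "openin T (W n)" for n unfolding W_def using open_ltrans V(1) c(1) by blast
 have uniq: "x = y" if x: "x\<in>C \<inter> W n" and y: "y\<in>C \<inter> W n" and C: "C\<in>lcosets \<Lambda>" for x y C n
 proof -
  obtain v w where vw: "v\<in>V" "w\<in>V" "x = c n\<otimes>v" "y = c n\<otimes>w" using x y unfolding W_def by blast
  have cl: "v\<in>carrier G" "w\<in>carrier G" "c n\<in>carrier G" using vw open_subset[OF V(1)] c by auto
  have "y\<in>x <# \<Lambda>" using coset_of(2)[OF C, of x] x y by blast
  then obtain l where l: "l\<in>\<Lambda>" "y = x\<otimes>l" by (auto simp: coset_iff)
  then have "w = v\<otimes>l" using vw cl Lcl[OF l(1)] by (simp add: m_assoc)
  then have "inv v\<otimes>w = l" using cl Lcl[OF l(1)] by simp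
  then show ?thesis using V(3) vw l(1) by blast
 qed
 have ex: "\<exists>n. C\<in>hit (W n)" if C: "C\<in>lcosets \<Lambda>" for C
 proof -
  obtain x where x: "x\<in>carrier G" "C = x <# \<Lambda>" using C by (auto simp: LCOSETS_def)
  obtain n where n: "inv (c n)\<otimes>x\<in>V" using c(2) x by blast
  have "x = c n\<otimes>(inv (c n)\<otimes>x)" using c(1) x(1) by simp
  then have "x\<in>W n" unfolding W_def using n by blast
  then show ?thesis using C coset_self x by (auto simp: hit_def)
 qed
 define N where "N = (\<lambda>C. LEAST n. C\<in>hit (W n))"
 define s where "s = (\<lambda>C. SOME x. x\<in>C \<inter> W (N C))"
 have Nh: "C\<in>hit (W (N C))" if "C\<in>lcosets \<Lambda>" for C
  unfolding N_def using ex[OF that] by (metis LeastI)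
 have sC: "s C\<in>C \<inter> W (N C)" if "C\<in>lcosets \<Lambda>" for C
 proof -
  have "\<exists>x. x\<in>C \<inter> W (N C)" using Nh[OF that] by (auto simp: hit_def)
  then show ?thesis unfolding s_def by (rule someI_ex)
 qed
 have "s\<in>measurable \<mu> (sigma (topspace T) {U. openin T U})"
 proof (rule measurable_measure_of)
  show "{U. openin T U}\<subseteq>Pow (topspace T)" using openin_subset by blast
  show "s\<in>space \<mu> \<rightarrow> topspace T" using sC coset_of(1) by (auto simp: space_mu)
  fix U assume "U\<in>{U. openin T U}"
  then have U: "openin T U" by simp
  have "s -` U \<inter> space \<mu> = (\<Union>n. hit (W n \<inter> U) - (\<Union>m<n. hit (W m)))"
  proof (intro equalityI subsetI)
   fix C assume C: "C\<in>s -` U \<inter> space \<mu>"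
   then have C': "C\<in>lcosets \<Lambda>" by (simp add: space_mu)
   then have "C\<in>hit (W (N C) \<inter> U)" using sC[OF C'] C by (auto simp: hit_def)
   moreover have "C\<notin>hit (W m)" if "m < N C" for m using not_less_Least[of m "\<lambda>n. C\<in>hit (W n)"] that by (simp add: N_def)
   ultimately show "C\<in>(\<Union>n. hit (W n \<inter> U) - (\<Union>m<n. hit (W m)))" by blast
  next
   fix C assume "C\<in>(\<Union>n. hit (W n \<inter> U) - (\<Union>m<n. hit (W m)))"
   then obtain n where n: "C\<in>hit (W n \<inter> U)" "\<forall>m<n. C\<notin>hit (W m)" by blast
   then have C': "C\<in>lcosets \<Lambda>" "C\<in>hit (W n)" by (auto simp: hit_def)
   have "N C = n" unfolding N_def
    by (rule Least_equality) (use n C' not_less in blast)+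
   obtain x where x: "x\<in>C" "x\<in>W n" "x\<in>U" using n(1) by (auto simp: hit_def)
   have "s C = x" by (rule uniq[OF _ _ C'(1), of _ n]) (use sC[OF C'(1)] \<open>N C = n\<close> x in auto)
   then show "C\<in>s -` U \<inter> space \<mu>" using x C' by (simp add: space_mu)
  qed
  also have "\<dots>\<in>sets \<mu>" using meas_hit oW U by (intro sets.countable_UN sets.Diff sets.finite_UN) (auto simp: openin_Int)
  finally show "s -` U \<inter> space \<mu>\<in>sets \<mu>" .
 qed
 then show ?thesis using sC unfolding borel_on_def by blast
qed

text \<open>The orbit map of a \<open>\<Lambda>\<close>-fixed point is a function on \<open>G/\<Lambda>\<close>, whose barycenter is invariant because the measure is.\<close>
lemma average_fixed_point:
 assumes K: "affine_flow H \<sigma> K" and \<phi>: "\<phi>\<in>hom G H" and x: "x\<in>K"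
  and fixed: "\<And>l. l\<in>\<Lambda> ==> x \<circ> \<sigma> (\<phi> l) = x"
  and cont: "\<And>i. continuous_map T euclideanreal (\<lambda>g. x (\<sigma> (\<phi> g) i))"
 shows "\<exists>y\<in>K. \<forall>g\<in>carrier G. y \<circ> \<sigma> (\<phi> g) = y"
proof -
 obtain s where s: "s\<in>measurable \<mu> (borel_on T)" "\<forall>C\<in>lcosets \<Lambda>. s C\<in>C"
  using borel_section by blast
 define F where "F = (\<lambda>g. x \<circ> \<sigma> (\<phi> g))"
 have \<phi>c: "\<phi> g\<in>carrier H" if "g\<in>carrier G" for g using hom_in_carrier[OF \<phi> that] .
 have Fm: "F (g\<otimes>h) = F h \<circ> \<sigma> (\<phi> g)" if "g\<in>carrier G" "h\<in>carrier G" for g h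
  using affine_flowD(1)[OF K \<phi>c[OF that(1)] \<phi>c[OF that(2)]] hom_mult[OF \<phi> that] by (auto simp: F_def)
 have FL: "F (g\<otimes>l) = F g" if "g\<in>carrier G" "l\<in>\<Lambda>" for g l
  using Fm[OF that(1) Lcl[OF that(2)]] fixed[OF that(2)] by (simp add: F_def)
 have const: "F a = F b" if C: "C\<in>lcosets \<Lambda>" "a\<in>C" "b\<in>C" for a b C
 proof -
  have "b\<in>a <# \<Lambda>" using coset_of(2)[OF C(1,2)] C(3) by simp
  then show ?thesis using FL coset_of(1)[OF C(1,2)] by (auto simp: coset_iff)
 qed
 have sc: "s C\<in>carrier G" if "C\<in>space \<mu>" for C using s(2) that coset_of(1) space_mu by blast
 have meas: "(\<lambda>C. F (s C) i)\<in>borel_measurable \<mu>" for i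
 proof -
  have "(\<lambda>g. F g i)\<in>borel_measurable (borel_on T)"
   by (rule continuous_map_borel_measurable) (use cont in \<open>simp_all add: F_def\<close>)
  from measurable_compose[OF s(1) this] show ?thesis .
 qed
 define y where "y = (\<lambda>i. \<integral>C. F (s C) i \<partial>\<mu>)"
 have yK: "y\<in>K" unfolding y_def
  by (rule barycenter_in(1)[OF affine_flowD(3,4)[OF K] prob])
   (use affine_flowD(6)[OF K \<phi>c[OF sc] x] meas in \<open>simp_all add: F_def comp_def\<close>)
 have "y \<circ> \<sigma> (\<phi> g) = y" if g: "g\<in>carrier G" for g
 proof
  fix i
  have "(y \<circ> \<sigma> (\<phi> g)) i = (\<integral>C. F (s C) (\<sigma> (\<phi> g) i) \<partial>\<mu>)" by (simp add: y_def)
  also have "\<dots> = (\<integral>C. F (s (g <# C)) i \<partial>\<mu>)"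
  proof (rule Bochner_Integration.integral_cong)
   fix C assume C: "C\<in>space \<mu>"
   then have C': "C\<in>lcosets \<Lambda>" by (simp add: space_mu)
   have gC: "g <# C\<in>lcosets \<Lambda>" by (rule coset_translate(2)[OF g C'])
   have "g\<otimes>s C\<in>g <# C" using coset_translate(1)[OF g C'] s(2) C' by auto
   then have "F (s (g <# C)) = F (g\<otimes>s C)" using const[OF gC] s(2) gC by blast
   then show "F (s C) (\<sigma> (\<phi> g) i) = F (s (g <# C)) i" using Fm[OF g sc[OF C]] by simp
  qed simp
  also have "\<dots> = (\<integral>C. F (s C) i \<partial>distr \<mu> \<mu> (\<lambda>C. g <# C))"
   by (rule integral_distr[symmetric]) (rule translate_measurable[OF g], rule meas)
  also have "\<dots> = y i" using invariant[OF g] by (simp add: y_def)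
  finally show "(y \<circ> \<sigma> (\<phi> g)) i = y i" .
 qed
 then show ?thesis using yK by blast
qed

text \<open>If \<open>H\<close> were not compact, elements \<open>\<phi> (g\<^sub>i)\<close> could be spread so that no \<open>\<phi> (g\<^sub>i)\<^sup>-\<^sup>1 \<phi> (g\<^sub>j)\<close> lies in a given compact set.
Recurrence in \<open>G/\<Lambda>\<close> puts one of these quotients into \<open>Q \<phi>(\<Lambda>) Q\<^sup>-\<^sup>1\<close>, where \<open>Q\<close> is a compact neighbourhood of 1, and
this set is compact because \<open>\<phi>(\<Lambda>)\<close> is finite.\<close>
lemma compact_of_finite_image:
 fixes H :: "('k, 'n) monoid_scheme"
 assumes H: "topological_group H S" "Hausdorff_space S" "locally_compact_space S"
  and \<phi>: "\<phi>\<in>hom G H" "continuous_map T S \<phi>" and dense: "S closure_of (\<phi> ` carrier G) = topspace S"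
  and fin: "finite (\<phi> ` \<Lambda>)"
 shows "compact_space S"
proof (rule ccontr)
 assume nc: "\<not> compact_space S"
 interpret H: tgroup H S by (unfold_locales) (rule H(1))
 interpret \<phi>: group_hom G H \<phi> using \<phi>(1) by (intro group_hom.intro) (auto simp: group_hom_axioms_def)
 obtain V Q where V: "openin S V" "compactin S Q" "\<one>\<^bsub>H\<^esub>\<in>V" "V\<subseteq>Q"
  using H(3) unfolding locally_compact_space_def by (metis H.top H.one_closed)
 define P where "P = {a \<otimes>\<^bsub>H\<^esub> b | a b. a\<in>{a \<otimes>\<^bsub>H\<^esub> b | a b. a\<in>Q \<and> b\<in>\<phi> ` \<Lambda>} \<and> b\<in>(\<lambda>a. inv\<^bsub>H\<^esub> a) ` Q}"
 have "compactin S (\<phi> ` \<Lambda>)" using fin Lcl by (intro finite_imp_compactin) auto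
 then have P: "compactin S P" unfolding P_def
  by (intro H.compactin_product_set H.compactin_inverse_set V(2))
 obtain h :: "nat => 'k" where h: "\<forall>n. h n\<in>\<phi> ` carrier G \<and> (\<forall>i<n. inv\<^bsub>H\<^esub> (h i) \<otimes>\<^bsub>H\<^esub> h n\<notin>P)"
  using H.noncompact_spread[OF nc H(2) P dense] \<phi>.hom_closed by blast
 then have "\<forall>n. \<exists>g. g\<in>carrier G \<and> h n = \<phi> g" by blast
 then obtain g where g: "\<forall>n. g n\<in>carrier G \<and> h n = \<phi> (g n)" by metis
 define A where "A = {x\<in>carrier G. \<phi> x\<in>V}"
 have "openin T A" unfolding A_def using \<phi>(2) V(1) by (simp add: continuous_map_def)
 moreover have "\<one>\<in>A" unfolding A_def using V(3) by simp
 ultimately obtain i j a b l where r: "i < j" "a\<in>A" "b\<in>A" "l\<in>\<Lambda>" "g i\<otimes>a\<otimes>l = g j\<otimes>b"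
  using recurrence[of A g] g by blast
 have cl: "a\<in>carrier G" "b\<in>carrier G" "l\<in>carrier G" "g i\<in>carrier G" "g j\<in>carrier G"
  using r g Lcl by (auto simp: A_def)
 have "a\<otimes>l\<otimes>inv b = inv (g i)\<otimes>(g i\<otimes>a\<otimes>l)\<otimes>inv b" using cl by (simp add: m_assoc)
 also have "\<dots> = inv (g i)\<otimes>g j" using cl unfolding r(5) by (simp add: m_assoc)
 finally have "\<phi> (inv (g i)\<otimes>g j) = \<phi> (a\<otimes>l\<otimes>inv b)" by simp
 then have "inv\<^bsub>H\<^esub> (h i) \<otimes>\<^bsub>H\<^esub> h j = \<phi> a \<otimes>\<^bsub>H\<^esub> \<phi> l \<otimes>\<^bsub>H\<^esub> inv\<^bsub>H\<^esub> (\<phi> b)"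
  using cl g by simp
 also have "\<dots>\<in>P" unfolding P_def using r V(4) by (fastforce simp: A_def)
 finally show False using h r(1) by blast
qed

end

section \<open>Invariant functionals on compactly supported functions\<close>

locale lcgroup = tgroup H T for H :: "('h, 'm) monoid_scheme" (structure) and T :: "'h topology" +
 assumes haus: "Hausdorff_space T" and lc: "locally_compact_space T"
begin

definition CC :: "('h => real) set" where
 "CC = {f. continuous_map T euclideanreal f \<and> (\<exists>Q. compactin T Q \<and> (\<forall>x\<in>carrier H - Q. f x = 0))}"

lemma CC_cont: "f\<in>CC ==> continuous_map T euclideanreal f" by (simp add: CC_def)

lemma CC_supp: "f\<in>CC ==> \<exists>Q. compactin T Q \<and> (\<forall>x\<in>carrier H - Q. f x = 0)" by (simp add: CC_def)

lemma CC_dom: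
 assumes f: "continuous_map T euclideanreal f" and g: "g\<in>CC" and z: "\<And>x. x\<in>carrier H ==> g x = 0 ==> f x = 0"
 shows "f\<in>CC"
proof -
 obtain Q where "compactin T Q" "\<forall>x\<in>carrier H - Q. g x = 0" using CC_supp[OF g] by blast
 then have "compactin T Q \<and> (\<forall>x\<in>carrier H - Q. f x = 0)" using z by simp
 then show ?thesis using f unfolding CC_def by blast
qed

lemma CC_add: assumes "f\<in>CC" "g\<in>CC" shows "(\<lambda>x. f x + g x)\<in>CC"
proof -
 obtain P where P: "compactin T P" "\<forall>x\<in>carrier H - P. f x = 0" using CC_supp[OF assms(1)] by blast
 obtain Q where Q: "compactin T Q" "\<forall>x\<in>carrier H - Q. g x = 0" using CC_supp[OF assms(2)] by blast
 have "compactin T (P \<union> Q)" by (rule compactin_Un[OF P(1) Q(1)])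
 moreover have "\<forall>x\<in>carrier H - (P \<union> Q). f x + g x = 0" using P(2) Q(2) by auto
 ultimately show ?thesis using assms unfolding CC_def by (auto intro: continuous_map_add)
qed

lemma CC_mult: assumes "f\<in>CC" "continuous_map T euclideanreal g" shows "(\<lambda>x. f x * g x)\<in>CC"
 by (rule CC_dom[OF continuous_map_real_mult[OF CC_cont[OF assms(1)] assms(2)] assms(1)]) simp

lemma CC_scale: "f\<in>CC ==> (\<lambda>x. c * f x)\<in>CC"
 using CC_mult[of f "\<lambda>_. c"] by (simp add: mult.commute)

lemma CC_minus: "f\<in>CC ==> (\<lambda>x. - f x)\<in>CC"
 using CC_scale[of f "-1"] by simp

lemma CC_diff: "f\<in>CC ==> g\<in>CC ==> (\<lambda>x. f x - g x)\<in>CC"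
 using CC_add[OF _ CC_minus, of f g] by simp

lemma CC_abs: assumes "f\<in>CC" shows "(\<lambda>x. \<bar>f x\<bar>)\<in>CC"
 by (rule CC_dom[OF continuous_map_real_abs[OF CC_cont[OF assms]] assms]) simp

lemma CC_zero: "(\<lambda>x. 0)\<in>CC" unfolding CC_def using compactin_empty[of T] by auto

lemma CC_sum: assumes "finite I" "\<And>i. i\<in>I ==> f i\<in>CC" shows "(\<lambda>x. \<Sum>i\<in>I. f i x)\<in>CC"
 using assms by (induction I rule: finite_induct) (auto intro: CC_add CC_zero)

lemma CC_pull:
 assumes f: "f\<in>CC" and h: "continuous_map T T h" "continuous_map T T k" "\<And>x. x\<in>carrier H ==> k (h x) = x"
 shows "(\<lambda>x. f (h x))\<in>CC"
proof -
 obtain Q where Q: "compactin T Q" "\<forall>x\<in>carrier H - Q. f x = 0" using CC_supp[OF f] by blast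
 have "compactin T (k ` Q)" by (rule image_compactin[OF Q(1) h(2)])
 moreover have "f (h x) = 0" if x: "x\<in>carrier H - k ` Q" for x
 proof -
  have "h x\<in>carrier H" using h(1) x continuous_map_funspace[OF h(1)] by auto
  moreover have "h x\<notin>Q" using h(3)[of x] x by force
  ultimately show ?thesis using Q(2) by blast
 qed
 moreover have "continuous_map T euclideanreal (\<lambda>x. f (h x))"
  using continuous_map_compose[OF h(1) CC_cont[OF f]] by (simp add: o_def)
 ultimately show ?thesis unfolding CC_def by blast
qed

lemma CC_left: "f\<in>CC ==> a\<in>carrier H ==> (\<lambda>x. f (a\<otimes>x))\<in>CC"
 by (rule CC_pull[OF _ ltrans ltrans[of "inv a"]]) auto

lemma CC_right: "f\<in>CC ==> a\<in>carrier H ==> (\<lambda>x. f (x\<otimes>a))\<in>CC"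
 by (rule CC_pull[OF _ rtrans rtrans[of "inv a"]]) (auto simp: m_assoc)

lemma CC_inv: "f\<in>CC ==> (\<lambda>x. f (inv x))\<in>CC"
 by (rule CC_pull[OF _ cinv[OF cid] cinv[OF cid]]) auto

lemma CC_inv_left: "f\<in>CC ==> y\<in>carrier H ==> (\<lambda>x. f (inv x\<otimes>y))\<in>CC"
 using CC_inv[OF CC_right[of f y]] by simp

lemma CC_bounded: assumes "f\<in>CC" shows "\<exists>B>0. \<forall>x\<in>carrier H. \<bar>f x\<bar>\<le>B"
proof -
 obtain Q where Q: "compactin T Q" "\<forall>x\<in>carrier H - Q. f x = 0" using CC_supp[OF assms] by blast
 have "compactin euclideanreal (f ` Q)" by (rule image_compactin[OF Q(1) CC_cont[OF assms]])
 then have "bounded (f ` Q)" by (simp add: compact_imp_bounded)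
 then obtain B where B: "B > 0" "\<forall>y\<in>f ` Q. norm y\<le>B" by (auto simp: bounded_pos)
 then have "\<forall>x\<in>carrier H. \<bar>f x\<bar>\<le>B" using Q(2) by (metis Diff_iff abs_zero image_eqI less_imp_le real_norm_def)
 then show ?thesis using B(1) by blast
qed

lemma relatively_compact_nbhd: "\<exists>U Q. openin T U \<and> compactin T Q \<and> \<one>\<in>U \<and> U\<subseteq>Q"
 using lc unfolding locally_compact_space_def by simp

lemma bump:
 assumes U: "openin T U" "a\<in>U"
 shows "\<exists>e\<in>CC. (\<forall>x. 0\<le>e x \<and> e x\<le>1) \<and> e a = 1 \<and> (\<forall>x\<in>carrier H - U. e x = 0)"
proof -
 have a: "a\<in>carrier H" using U open_subset by blast
 obtain U' Q where U': "openin T U'" "compactin T Q" "a\<in>U'" "U'\<subseteq>Q"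
  using lc a unfolding locally_compact_space_def by auto
 have "completely_regular_space T"
  using locally_compact_Hausdorff_imp_regular_space[OF lc haus] completely_regular_eq_regular_space[OF lc] by simp
 moreover have "openin T (U \<inter> U')" "a\<in>U \<inter> U'" using U U' by (auto intro: openin_Int)
 ultimately obtain f where f: "continuous_map T euclideanreal f" "f a = 0" "f ` (topspace T - (U \<inter> U'))\<subseteq>{1}"
  unfolding completely_regular_space_alt' by blast
 define e where "e = (\<lambda>x. max 0 (min 1 (1 - f x)))"
 have c: "continuous_map T euclideanreal e" unfolding e_def
  by (intro continuous_map_real_max continuous_map_real_min continuous_map_diff f(1)) simp_all
 have z: "e x = 0" if "x\<in>carrier H - (U \<inter> U')" for x
 proof -
  have "f x = 1" using f(3) that by (auto simp: image_subset_iff)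
  then show ?thesis by (simp add: e_def)
 qed
 have "e\<in>CC" unfolding CC_def using c z U' by blast
 moreover have "\<forall>x. 0\<le>e x \<and> e x\<le>1" "e a = 1" using f(2) by (auto simp: e_def)
 ultimately show ?thesis using z by (intro bexI[of _ e]) auto
qed

lemma finite_translates_cover:
 assumes Q: "compactin T Q" and V: "openin T V" "\<one>\<in>V"
 shows "\<exists>F. finite F \<and> F\<subseteq>Q \<and> (\<forall>x\<in>Q. \<exists>a\<in>F. inv a\<otimes>x\<in>V)"
proof -
 have QH: "Q\<subseteq>carrier H" using compactin_subset_topspace[OF Q] by simp
 have "\<exists>\<F>. finite \<F> \<and> \<F>\<subseteq>(\<lambda>a. (\<lambda>x. a\<otimes>x) ` V) ` Q \<and> Q\<subseteq>\<Union>\<F>"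
 proof (rule compactinD[OF Q])
  show "openin T U" if "U\<in>(\<lambda>a. (\<lambda>x. a\<otimes>x) ` V) ` Q" for U using that open_ltrans V QH by blast
  show "Q\<subseteq>\<Union>((\<lambda>a. (\<lambda>x. a\<otimes>x) ` V) ` Q)"
  proof
   fix x assume x: "x\<in>Q"
   then have "x = x\<otimes>\<one>" using QH by auto
   then show "x\<in>\<Union>((\<lambda>a. (\<lambda>x. a\<otimes>x) ` V) ` Q)" using x V(2) by blast
  qed
 qed
 then obtain F where F: "finite F" "F\<subseteq>Q" "Q\<subseteq>\<Union>((\<lambda>a. (\<lambda>x. a\<otimes>x) ` V) ` F)"
  by (metis finite_subset_image)
 have "\<exists>a\<in>F. inv a\<otimes>x\<in>V" if x: "x\<in>Q" for x
 proof -
  obtain a v where a: "a\<in>F" "v\<in>V" "x = a\<otimes>v" using F(3) x by blast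
  then have "inv a\<otimes>x = v" using F(2) QH open_subset[OF V(1)] by (auto simp: subset_iff)
  then show ?thesis using a by blast
 qed
 then show ?thesis using F by blast
qed

lemma bump_cover:
 assumes Q: "compactin T Q" and W: "openin T W" "\<one>\<in>W"
 shows "\<exists>b\<in>CC. \<exists>F. finite F \<and> F\<subseteq>Q \<and> F\<subseteq>carrier H \<and> (\<forall>x. 0\<le>b x) \<and> (\<forall>x\<in>carrier H - W. b x = 0) \<and>
  (\<forall>x\<in>Q. 1/2\<le>(\<Sum>a\<in>F. b (inv a\<otimes>x)))"
proof -
 obtain b where b: "b\<in>CC" "\<forall>x. 0\<le>b x \<and> b x\<le>1" "b \<one> = 1" "\<forall>x\<in>carrier H - W. b x = 0"
  using bump[OF W] by blast
 define V where "V = {x\<in>topspace T. b x\<in>{1/2<..}}"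
 have V: "openin T V" "\<one>\<in>V" unfolding V_def using CC_cont[OF b(1)] b(3)
  by (auto simp del: greaterThan_iff top intro!: openin_continuous_map_preimage) simp_all
 obtain F where F: "finite F" "F\<subseteq>Q" "\<forall>x\<in>Q. \<exists>a\<in>F. inv a\<otimes>x\<in>V"
  using finite_translates_cover[OF Q V] by blast
 have "1/2\<le>(\<Sum>a\<in>F. b (inv a\<otimes>x))" if x: "x\<in>Q" for x
 proof -
  obtain a where a: "a\<in>F" "inv a\<otimes>x\<in>V" using F(3) x by blast
  then have "1/2\<le>b (inv a\<otimes>x)" by (simp add: V_def)
  also have "\<dots>\<le>(\<Sum>a\<in>F. b (inv a\<otimes>x))"
   by (rule member_le_sum[OF a(1), where f="\<lambda>a. b (inv a\<otimes>x)"]) (use b(2) F(1) in auto)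
  finally show ?thesis .
 qed
 moreover have "F\<subseteq>carrier H" using F(2) compactin_subset_topspace[OF Q] by auto
 ultimately show ?thesis using b F(1,2) by (intro bexI[of _ b] exI[of _ F]) auto
qed

lemma dominating:
 assumes Q: "compactin T Q" shows "\<exists>\<psi>\<in>CC. (\<forall>x. 0\<le>\<psi> x) \<and> (\<forall>x\<in>Q. 1\<le>\<psi> x)"
proof -
 obtain b F where b: "b\<in>CC" "finite F" "F\<subseteq>carrier H" "\<forall>x. 0\<le>b x" "\<forall>x\<in>Q. 1/2\<le>(\<Sum>a\<in>F. b (inv a\<otimes>x))"
  using bump_cover[OF Q open_carrier one_closed] by blast
 have "(\<lambda>x. 2 * (\<Sum>a\<in>F. b (inv a\<otimes>x)))\<in>CC"
  using b(3) by (intro CC_scale CC_sum[OF b(2)] CC_left[OF b(1)]) auto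
 then show ?thesis using b(4,5) by (intro bexI[of _ "\<lambda>x. 2 * (\<Sum>a\<in>F. b (inv a\<otimes>x))"]) (auto intro: sum_nonneg)
qed

text \<open>The differences vanish outside a fixed compact set \<open>P\<close> as long as \<open>v\<close> stays in a compact neighbourhood of the identity. Keeping a
dominating function \<open>\<psi>\<close> of compact support in the estimate allows it to be integrated.\<close>
lemma left_uniform_dominated:
 assumes f: "f\<in>CC"
 shows "\<exists>\<psi>\<in>CC. (\<forall>x. 0\<le>\<psi> x) \<and> (\<forall>\<epsilon>>0. \<exists>V. openin T V \<and> \<one>\<in>V \<and> (\<forall>v\<in>V. \<forall>x\<in>carrier H. \<bar>f (v\<otimes>x) - f x\<bar>\<le>\<epsilon> * \<psi> x))"
proof -
 obtain Q where Q: "compactin T Q" "\<forall>x\<in>carrier H - Q. f x = 0" using CC_supp[OF f] by blast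
 obtain U K where UK: "openin T U" "compactin T K" "\<one>\<in>U" "U\<subseteq>K" using relatively_compact_nbhd by blast
 have UH: "U\<subseteq>carrier H" by (rule open_subset[OF UK(1)])
 define P where "P = Q \<union> {a\<otimes>b | a b. a\<in>(\<lambda>a. inv a) ` K \<and> b\<in>Q}"
 have P: "compactin T P" unfolding P_def
  by (intro compactin_Un Q(1) compactin_product_set compactin_inverse_set UK(2))
 obtain \<psi> where \<psi>: "\<psi>\<in>CC" "\<forall>x. 0\<le>\<psi> x" "\<forall>x\<in>P. 1\<le>\<psi> x" using dominating[OF P] by blast
 have "\<exists>V. openin T V \<and> \<one>\<in>V \<and> (\<forall>v\<in>V. \<forall>x\<in>carrier H. \<bar>f (v\<otimes>x) - f x\<bar>\<le>\<epsilon> * \<psi> x)" if e: "0 < \<epsilon>" for \<epsilon>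
 proof -
  define W where "W = {p\<in>topspace (prod_topology T T). f (fst p\<otimes>snd p) - f (snd p)\<in>{-\<epsilon><..<\<epsilon>}}"
  have "continuous_map (prod_topology T T) euclideanreal (\<lambda>p. f (fst p\<otimes>snd p) - f (snd p))"
   using continuous_map_compose[OF cmult[OF continuous_map_fst continuous_map_snd] CC_cont[OF f]]
    continuous_map_compose[OF continuous_map_snd CC_cont[OF f]] by (intro continuous_map_diff) (simp_all add: o_def)
  then have W: "openin (prod_topology T T) W" unfolding W_def by (rule openin_continuous_map_preimage) simp
  have "{\<one>} \<times> P\<subseteq>W" using compactin_subset_topspace[OF P] e by (auto simp: W_def)
  then obtain V L where V: "openin T V" "openin T L" "{\<one>}\<subseteq>V" "P\<subseteq>L" "V \<times> L\<subseteq>W"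
   using Wallace_theorem_prod_topology[OF _ P W, of "{\<one>}"] by auto
  have "\<bar>f (v\<otimes>x) - f x\<bar>\<le>\<epsilon> * \<psi> x" if v: "v\<in>V \<inter> U" and x: "x\<in>carrier H" for v x
  proof (cases "x\<in>P")
   case True
   then have "\<epsilon> * 1\<le>\<epsilon> * \<psi> x" using \<psi>(3) e by (intro mult_left_mono) auto
   moreover have "(v, x)\<in>W" using True v V(4,5) by blast
   then have "\<bar>f (v\<otimes>x) - f x\<bar> < \<epsilon>" by (auto simp: W_def)
   ultimately show ?thesis by linarith
  next
   case False
   have vH: "v\<in>carrier H" using v UH by blast
   then have "x = inv v\<otimes>(v\<otimes>x)" using x by simp
   then have "v\<otimes>x\<notin>Q" "x\<notin>Q" using False v UK(4) unfolding P_def by blast+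
   then show ?thesis using Q(2) vH x e \<psi>(2) by simp
  qed
  then show ?thesis using V(1,3) UK(1,3) by (intro exI[of _ "V \<inter> U"]) auto
 qed
 then show ?thesis using \<psi> by blast
qed

lemma left_uniform:
 assumes f: "f\<in>CC" and e: "0 < \<epsilon>"
 shows "\<exists>V. openin T V \<and> \<one>\<in>V \<and> (\<forall>v\<in>V. \<forall>x\<in>carrier H. \<bar>f (v\<otimes>x) - f x\<bar> < \<epsilon> \<and> \<bar>f (inv v\<otimes>x) - f x\<bar> < \<epsilon>)"
proof -
 obtain \<psi> where \<psi>: "\<psi>\<in>CC" "\<forall>\<epsilon>>0. \<exists>V. openin T V \<and> \<one>\<in>V \<and> (\<forall>v\<in>V. \<forall>x\<in>carrier H. \<bar>f (v\<otimes>x) - f x\<bar>\<le>\<epsilon> * \<psi> x)"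
  using left_uniform_dominated[OF f] by blast
 obtain B where B: "0 < B" "\<forall>x\<in>carrier H. \<bar>\<psi> x\<bar>\<le>B" using CC_bounded[OF \<psi>(1)] by blast
 have "0 < \<epsilon> / (2 * B)" using e B(1) by simp
 from mp[OF spec[OF \<psi>(2)] this] obtain V
  where V: "openin T V" "\<one>\<in>V" "\<forall>v\<in>V. \<forall>x\<in>carrier H. \<bar>f (v\<otimes>x) - f x\<bar>\<le>\<epsilon> / (2 * B) * \<psi> x"
  by (elim exE conjE)
 have "\<epsilon> / (2 * B) * \<psi> x < \<epsilon>" if "x\<in>carrier H" for x
 proof -
  have "\<epsilon> / (2 * B) * \<psi> x\<le>\<epsilon> / (2 * B) * B" using B that e by (intro mult_left_mono) (auto dest: abs_le_D1)
  then show ?thesis using B(1) e by simp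
 qed
 then have *: "\<bar>f (v\<otimes>x) - f x\<bar> < \<epsilon>" if "v\<in>V" "x\<in>carrier H" for v x using V(3) that by (meson le_less_trans)
 obtain W where W: "openin T W" "\<one>\<in>W" "\<forall>x\<in>W. \<forall>y\<in>W. inv x\<otimes>y\<in>V \<and> x\<otimes>inv y\<in>V \<and> x\<otimes>y\<in>V"
  using one_nbhd_quot[OF V(1,2)] by blast
 have "v\<in>V \<and> inv v\<in>V" if "v\<in>W" for v
  using W(3)[rule_format, OF that W(2)] open_subset[OF W(1)] that by auto
 then show ?thesis using * W(1,2) by (intro exI[of _ W]) blast
qed

lemma right_uniform:
 assumes f: "f\<in>CC" and "0 < \<epsilon>"
 shows "\<exists>V. openin T V \<and> \<one>\<in>V \<and> (\<forall>v\<in>V. \<forall>x\<in>carrier H. \<bar>f (x\<otimes>v) - f x\<bar> < \<epsilon> \<and> \<bar>f (x\<otimes>inv v) - f x\<bar> < \<epsilon>)"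
proof -
 obtain V where V: "openin T V" "\<one>\<in>V" "\<forall>v\<in>V. \<forall>x\<in>carrier H. \<bar>f (inv (v\<otimes>x)) - f (inv x)\<bar> < \<epsilon> \<and> \<bar>f (inv (inv v\<otimes>x)) - f (inv x)\<bar> < \<epsilon>"
  using left_uniform[OF CC_inv[OF f] assms(2)] by blast
 have "\<bar>f (x\<otimes>v) - f x\<bar> < \<epsilon> \<and> \<bar>f (x\<otimes>inv v) - f x\<bar> < \<epsilon>" if "v\<in>V" "x\<in>carrier H" for v x
  using V(3)[rule_format, OF that(1), of "inv x"] that open_subset[OF V(1)] by (auto simp: inv_mult_group subset_iff)
 then show ?thesis using V by blast
qed

text \<open>Left Haar functionals. The zero functional is included, which makes the class closed under the constructions below.\<close>
definition haar :: "(('h => real) => real) => bool" where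
 "haar J \<longleftrightarrow> (\<forall>f\<in>CC. \<forall>g\<in>CC. J (\<lambda>x. f x + g x) = J f + J g) \<and> (\<forall>f\<in>CC. \<forall>c. J (\<lambda>x. c * f x) = c * J f) \<and>
  (\<forall>f\<in>CC. (\<forall>x\<in>carrier H. 0\<le>f x) --> 0\<le>J f) \<and> (\<forall>f\<in>CC. \<forall>a\<in>carrier H. J (\<lambda>x. f (a\<otimes>x)) = J f)"

lemma haarD:
 assumes "haar J"
 shows "f\<in>CC ==> g\<in>CC ==> J (\<lambda>x. f x + g x) = J f + J g" "f\<in>CC ==> J (\<lambda>x. c * f x) = c * J f"
  "f\<in>CC ==> (\<And>x. x\<in>carrier H ==> 0\<le>f x) ==> 0\<le>J f" "f\<in>CC ==> a\<in>carrier H ==> J (\<lambda>x. f (a\<otimes>x)) = J f"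
 using assms unfolding haar_def by blast+

lemma haar_diff:
 assumes "haar J" "f\<in>CC" "g\<in>CC" shows "J (\<lambda>x. f x - g x) = J f - J g"
 using haarD(1)[OF assms(1,2) CC_scale[OF assms(3), of "-1"]] haarD(2)[OF assms(1,3), of "-1"] by simp

lemma haar_mono:
 assumes "haar J" "f\<in>CC" "g\<in>CC" "\<And>x. x\<in>carrier H ==> f x\<le>g x" shows "J f\<le>J g"
 using haarD(3)[OF assms(1) CC_diff[OF assms(3,2)]] haar_diff[OF assms(1,3,2)] assms(4) by simp

lemma haar_cong:
 assumes "haar J" "f\<in>CC" "g\<in>CC" "\<And>x. x\<in>carrier H ==> f x = g x" shows "J f = J g"
 using haar_mono[OF assms(1,2,3)] haar_mono[OF assms(1,3,2)] assms(4) by force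

lemma haar_zero: "haar J ==> J (\<lambda>x. 0) = 0"
 using haarD(2)[OF _ CC_zero, of J 0] by simp

lemma haar_sum:
 assumes J: "haar J" and "finite I" "\<And>i. i\<in>I ==> f i\<in>CC" shows "J (\<lambda>x. \<Sum>i\<in>I. f i x) = (\<Sum>i\<in>I. J (f i))"
 using assms(2,3) by (induction I rule: finite_induct) (auto simp: haar_zero[OF J] haarD(1)[OF J] CC_sum)

lemma haar_abs_le:
 assumes J: "haar J" and f: "f\<in>CC" "g\<in>CC" "\<And>x. x\<in>carrier H ==> \<bar>f x\<bar>\<le>g x" shows "\<bar>J f\<bar>\<le>J g"
proof -
 have "J f\<le>J g" by (rule haar_mono[OF J f(1,2)]) (use f(3) in \<open>force dest: abs_le_D1\<close>)
 moreover have "- J f\<le>J g" using haar_mono[OF J CC_minus[OF f(1)] f(2)] haarD(2)[OF J f(1), of "-1"] f(3)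
  by (force dest: abs_le_D2)
 ultimately show ?thesis by linarith
qed

text \<open>Finitely many translates of \<open>e\<close> dominate \<open>f\<close>; their number does not depend on \<open>J\<close>.\<close>
lemma haar_dominated:
 assumes e: "e\<in>CC" "\<And>x. x\<in>carrier H ==> 0\<le>e x" "a\<in>carrier H" "0 < e a" and f: "f\<in>CC"
 shows "\<exists>C\<ge>0. \<forall>J. haar J --> J f\<le>C * J e"
proof -
 obtain Q where Q: "compactin T Q" "\<forall>x\<in>carrier H - Q. f x = 0" using CC_supp[OF f] by blast
 have QH: "Q\<subseteq>carrier H" using compactin_subset_topspace[OF Q(1)] by simp
 obtain B where B: "B > 0" "\<forall>x\<in>carrier H. \<bar>f x\<bar>\<le>B" using CC_bounded[OF f] by blast
 define V where "V = {x\<in>topspace T. e (a\<otimes>x)\<in>{e a / 2<..}}"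
 have V: "openin T V" "\<one>\<in>V" unfolding V_def using CC_cont[OF CC_left[OF e(1,3)]] e(3,4)
  by (auto simp del: greaterThan_iff top intro!: openin_continuous_map_preimage) simp_all
 obtain F where F: "finite F" "F\<subseteq>Q" "\<forall>x\<in>Q. \<exists>c\<in>F. inv c\<otimes>x\<in>V"
  using finite_translates_cover[OF Q(1) V] by blast
 define h where "h = (\<lambda>c x. (2 * B / e a) * e ((a\<otimes>inv c)\<otimes>x))"
 have hC: "h c\<in>CC" if "c\<in>F" for c unfolding h_def by (intro CC_scale CC_left e) (use that F QH e in auto)
 have hpos: "0\<le>h c x" if "c\<in>F" "x\<in>carrier H" for c x unfolding h_def
  by (intro mult_nonneg_nonneg e(2)) (use B e that F QH in \<open>auto intro!: m_closed\<close>)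
 have le: "f x\<le>(\<Sum>c\<in>F. h c x)" if x: "x\<in>carrier H" for x
 proof (cases "x\<in>Q")
  case True
  then obtain c where c: "c\<in>F" "inv c\<otimes>x\<in>V" using F(3) by blast
  have cH: "c\<in>carrier H" using c F QH by blast
  have "e (a\<otimes>inv c\<otimes>x) > e a / 2" using c(2) cH x e(3) by (simp add: V_def m_assoc)
  then have "(2 * B / e a) * (e a / 2)\<le>h c x" unfolding h_def using B e(4) by (intro mult_left_mono) auto
  then have "B\<le>h c x" using e(4) by simp
  then have "f x\<le>h c x" using B(2) x by force
  also have "\<dots>\<le>(\<Sum>c\<in>F. h c x)" by (rule member_le_sum[OF c(1)]) (use hpos x F in auto)
  finally show ?thesis .
 next
  case False
  then show ?thesis using Q(2) x sum_nonneg[of F "\<lambda>c. h c x"] hpos by simp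
 qed
 have "J f\<le>(2 * B / e a) * card F * J e" if J: "haar J" for J
 proof -
  have "J f\<le>J (\<lambda>x. \<Sum>c\<in>F. h c x)" by (rule haar_mono[OF J f CC_sum[OF F(1)]]) (simp_all add: hC le)
  also have "\<dots> = (\<Sum>c\<in>F. J (h c))" by (rule haar_sum[OF J F(1) hC])
  also have "\<dots> = (\<Sum>c\<in>F. (2 * B / e a) * J e)"
  proof (rule sum.cong[OF refl])
   fix c assume "c\<in>F"
   then have "a\<otimes>inv c\<in>carrier H" using F(2) QH e(3) by auto
   then show "J (h c) = (2 * B / e a) * J e" unfolding h_def
    by (simp only: haarD(2)[OF J CC_left[OF e(1)]] haarD(4)[OF J e(1)])
  qed
  finally show ?thesis by (simp add: mult.commute mult.left_commute)
 qed
 then show ?thesis using B(1) e(4) by (intro exI[of _ "(2 * B / e a) * card F"]) auto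
qed

lemma haar_pos:
 assumes J: "haar J" "f\<in>CC" "J f\<noteq>0" and e: "e\<in>CC" "\<And>x. x\<in>carrier H ==> 0\<le>e x" "a\<in>carrier H" "0 < e a"
 shows "0 < J e"
proof -
 obtain C where "C \<ge> 0" "J (\<lambda>x. \<bar>f x\<bar>)\<le>C * J e"
  using haar_dominated[OF e CC_abs[OF J(2)]] J(1) by blast
 moreover have "\<bar>J f\<bar>\<le>J (\<lambda>x. \<bar>f x\<bar>)" by (rule haar_abs_le[OF J(1,2) CC_abs[OF J(2)]]) simp
 moreover have "0\<le>J e" by (rule haarD(3)[OF J(1) e(1,2)])
 ultimately show ?thesis using J(3) by (cases "J e = 0") auto
qed

text \<open>Dividing the bumps of \<open>bump_cover\<close> by their sum, which is bounded below on \<open>Q\<close>, gives a partition of unity there; multiply it by \<open>f\<close>.\<close>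
lemma partition:
 assumes f: "f\<in>CC" and Q: "compactin T Q" "\<forall>x\<in>carrier H - Q. f x = 0" and W: "openin T W" "\<one>\<in>W"
 shows "\<exists>F p. finite F \<and> F\<subseteq>Q \<and> (\<forall>c\<in>F. p c\<in>CC \<and> (\<forall>x\<in>carrier H. p c x\<noteq>0 --> inv c\<otimes>x\<in>W)) \<and>
  (\<forall>x\<in>carrier H. (\<Sum>c\<in>F. p c x) = f x \<and> (\<Sum>c\<in>F. \<bar>p c x\<bar>) = \<bar>f x\<bar>)"
proof -
 obtain b F where b: "b\<in>CC" "finite F" "F\<subseteq>Q" "F\<subseteq>carrier H" "\<forall>x. 0\<le>b x" "\<forall>x\<in>carrier H - W. b x = 0"
  "\<forall>x\<in>Q. 1/2\<le>(\<Sum>a\<in>F. b (inv a\<otimes>x))" using bump_cover[OF Q(1) W] by blast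
 have FH: "c\<in>carrier H" if "c\<in>F" for c using that b(4) by blast
 define S where "S = (\<lambda>x. \<Sum>c\<in>F. b (inv c\<otimes>x))"
 have cb: "continuous_map T euclideanreal (\<lambda>x. b (inv c\<otimes>x))" if "c\<in>F" for c
  using CC_cont[OF CC_left[OF b(1), of "inv c"]] FH[OF that] by simp
 have cS: "continuous_map T euclideanreal S" unfolding S_def by (rule continuous_map_sum[OF b(2) cb])
 have SQ: "S x \<ge> 1/2" if "x\<in>Q" for x using b(7) that by (simp add: S_def)
 define p where "p = (\<lambda>c x. f x * (b (inv c\<otimes>x) / max (1/2) (S x)))"
 have pC: "p c\<in>CC" if "c\<in>F" for c unfolding p_def
  by (intro CC_mult[OF f] continuous_map_real_divide continuous_map_real_max cS cb[OF that]) (auto simp: max_def)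
 have psup: "inv c\<otimes>x\<in>W" if "c\<in>F" "x\<in>carrier H" "p c x\<noteq>0" for c x
 proof (rule ccontr)
  assume "inv c\<otimes>x\<notin>W"
  then have "b (inv c\<otimes>x) = 0" using b(6) FH[OF that(1)] that(2) by simp
  then show False using that(3) by (simp add: p_def)
 qed
 have sums: "(\<Sum>c\<in>F. p c x) = f x \<and> (\<Sum>c\<in>F. \<bar>p c x\<bar>) = \<bar>f x\<bar>" if x: "x\<in>carrier H" for x
 proof (cases "x\<in>Q")
  case True
  then have S: "S x \<ge> 1/2" by (rule SQ)
  have a: "\<bar>p c x\<bar> = \<bar>f x\<bar> * (b (inv c\<otimes>x) / S x)" for c
   unfolding p_def abs_mult using b(5) S by (simp add: max_absorb2)
  have "(\<Sum>c\<in>F. p c x) = f x * ((\<Sum>c\<in>F. b (inv c\<otimes>x)) / S x)"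
   unfolding p_def using S by (simp add: max_absorb2 sum_distrib_left sum_divide_distrib)
  moreover have "(\<Sum>c\<in>F. \<bar>p c x\<bar>) = \<bar>f x\<bar> * ((\<Sum>c\<in>F. b (inv c\<otimes>x)) / S x)"
   unfolding a by (simp add: sum_distrib_left sum_divide_distrib)
  moreover have "(\<Sum>c\<in>F. b (inv c\<otimes>x)) / S x = 1" using S by (simp add: S_def)
  ultimately show ?thesis by simp
 next
  case False
  then show ?thesis using Q(2) x by (simp add: p_def)
 qed
 show ?thesis
  by (rule exI[of _ F], rule exI[of _ p]) (use b(2,3) pC psup sums in blast)
qed

text \<open>The double integral of \<open>f x * e (x\<^sup>-\<^sup>1 y)\<close> is computed in two orders. Integrating first in \<open>x\<close> gives about
\<open>f y * J (e \<circ> inv)\<close>, as \<open>e\<close> is concentrated near 1; integrating first in \<open>y\<close> gives \<open>J' e * f x\<close>. The exchange is done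
without a product integral: \<open>partition\<close> replaces \<open>f\<close> by finitely many pieces, on each of which \<open>e (x\<^sup>-\<^sup>1 y)\<close> is nearly independent of \<open>x\<close>.\<close>
lemma haar_ratio:
 assumes J: "haar J" and J': "haar J'" and f: "f\<in>CC"
 shows "\<exists>C\<ge>0. \<forall>\<delta>>0. \<exists>V. openin T V \<and> \<one>\<in>V \<and>
  (\<forall>e\<in>CC. (\<forall>x\<in>carrier H. 0\<le>e x) \<and> (\<forall>x\<in>carrier H - V. e x = 0) -->
    \<bar>J' f * J (\<lambda>x. e (inv x)) - J' e * J f\<bar>\<le>\<delta> * J (\<lambda>x. e (inv x)) * C)"
proof -
 obtain Q where Q: "compactin T Q" "\<forall>x\<in>carrier H - Q. f x = 0" using CC_supp[OF f] by blast
 have QH: "Q\<subseteq>carrier H" using compactin_subset_topspace[OF Q(1)] by simp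
 obtain U K where UK: "openin T U" "compactin T K" "\<one>\<in>U" "U\<subseteq>K" using relatively_compact_nbhd by blast
 obtain \<psi> where \<psi>: "\<psi>\<in>CC" "\<forall>x. 0\<le>\<psi> x" "\<forall>x\<in>{a\<otimes>b | a b. a\<in>Q \<and> b\<in>K}. 1\<le>\<psi> x"
  using dominating[OF compactin_product_set[OF Q(1) UK(2)]] by blast
 show ?thesis
 proof (rule exI[of _ "J' \<psi>"], intro conjI allI impI)
  show "0\<le>J' \<psi>" by (rule haarD(3)[OF J' \<psi>(1)]) (use \<psi>(2) in blast)
  fix \<delta> :: real assume \<delta>: "0 < \<delta>"
  obtain V1 where V1: "openin T V1" "\<one>\<in>V1"
   "\<forall>v\<in>V1. \<forall>x\<in>carrier H. \<bar>f (x\<otimes>v) - f x\<bar> < \<delta> \<and> \<bar>f (x\<otimes>inv v) - f x\<bar> < \<delta>"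
   using right_uniform[OF f \<delta>] by blast
  have V: "openin T (V1 \<inter> U)" "\<one>\<in>V1 \<inter> U" using V1 UK by (auto intro: openin_Int)
  have main: "\<bar>J' f * J (\<lambda>x. e (inv x)) - J' e * J f\<bar>\<le>\<delta> * J (\<lambda>x. e (inv x)) * J' \<psi>"
   if e: "e\<in>CC" "\<forall>x\<in>carrier H. 0\<le>e x" "\<forall>x\<in>carrier H - (V1 \<inter> U). e x = 0" for e
  proof -
   define ec where "ec = (\<lambda>x. e (inv x))"
   have ec: "ec\<in>CC" unfolding ec_def by (rule CC_inv[OF e(1)])
   have fe: "(\<lambda>x. f x * e (inv x\<otimes>y))\<in>CC" if "y\<in>carrier H" for y
    by (rule CC_mult[OF f CC_cont[OF CC_inv_left[OF e(1) that]]])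
   have conv: "\<bar>J (\<lambda>x. f x * e (inv x\<otimes>y)) - f y * J ec\<bar>\<le>\<delta> * J ec" if y: "y\<in>carrier H" for y
   proof -
    have c1: "(\<lambda>u. f (y\<otimes>u) * ec u)\<in>CC"
     using CC_mult[OF ec CC_cont[OF CC_left[OF f y]]] by (simp add: mult.commute)
    have "J (\<lambda>x. f x * e (inv x\<otimes>y)) = J (\<lambda>u. f (y\<otimes>u) * e (inv (y\<otimes>u)\<otimes>y))"
     by (rule haarD(4)[OF J fe[OF y] y, symmetric])
    also have "\<dots> = J (\<lambda>u. f (y\<otimes>u) * ec u)"
     by (rule haar_cong[OF J CC_left[OF fe[OF y] y] c1]) (use y in \<open>simp add: ec_def inv_mult_group m_assoc\<close>)
    finally have "J (\<lambda>x. f x * e (inv x\<otimes>y)) - f y * J ec = J (\<lambda>u. f (y\<otimes>u) * ec u - f y * ec u)"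
     using haar_diff[OF J c1 CC_scale[OF ec]] haarD(2)[OF J ec] by simp
    also have "\<bar>\<dots>\<bar>\<le>J (\<lambda>u. \<delta> * ec u)"
    proof (rule haar_abs_le[OF J CC_diff[OF c1 CC_scale[OF ec]] CC_scale[OF ec]])
     fix u assume u: "u\<in>carrier H"
     show "\<bar>f (y\<otimes>u) * ec u - f y * ec u\<bar>\<le>\<delta> * ec u"
     proof (cases "inv u\<in>V1 \<inter> U")
      case True
      then have "\<bar>f (y\<otimes>inv (inv u)) - f y\<bar> < \<delta>" using V1(3) y by blast
      then have "\<bar>f (y\<otimes>u) - f y\<bar> * ec u\<le>\<delta> * ec u"
       using u e(2) by (intro mult_right_mono) (auto simp: ec_def)
      then show ?thesis using e(2) u by (simp add: left_diff_distrib[symmetric] abs_mult ec_def)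
     next
      case False
      then have "ec u = 0" using e(3) u by (simp add: ec_def)
      then show ?thesis by simp
     qed
    qed
    also have "\<dots> = \<delta> * J ec" by (rule haarD(2)[OF J ec])
    finally show ?thesis .
   qed
   have app: "\<bar>J' f * J ec - J' e * J f\<bar>\<le>(\<delta> * J ec + \<epsilon> * J (\<lambda>x. \<bar>f x\<bar>)) * J' \<psi>" if \<epsilon>: "0 < \<epsilon>" for \<epsilon>
   proof -
    obtain W where W: "openin T W" "\<one>\<in>W"
     "\<forall>v\<in>W. \<forall>x\<in>carrier H. \<bar>e (v\<otimes>x) - e x\<bar> < \<epsilon> \<and> \<bar>e (inv v\<otimes>x) - e x\<bar> < \<epsilon>"
     using left_uniform[OF e(1) \<epsilon>] by blast
    obtain F p where F: "finite F" "F\<subseteq>Q"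
     and p: "\<forall>c\<in>F. p c\<in>CC \<and> (\<forall>x\<in>carrier H. p c x\<noteq>0 --> inv c\<otimes>x\<in>W)"
     and ps: "\<forall>x\<in>carrier H. (\<Sum>c\<in>F. p c x) = f x \<and> (\<Sum>c\<in>F. \<bar>p c x\<bar>) = \<bar>f x\<bar>"
     using partition[OF f Q W(1,2)] by blast
    have FH: "c\<in>carrier H" if "c\<in>F" for c using that F(2) QH by blast
    have pC: "p c\<in>CC" if "c\<in>F" for c using p that by blast
    define D where "D = (\<lambda>y. \<Sum>c\<in>F. J (p c) * e (inv c\<otimes>y))"
    have DC: "(\<lambda>y. J (p c) * e (inv c\<otimes>y))\<in>CC" if "c\<in>F" for c
     by (rule CC_scale[OF CC_left[OF e(1)]]) (use FH[OF that] in simp)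
    have D: "D\<in>CC" unfolding D_def by (rule CC_sum[OF F(1) DC])
    have pe: "(\<lambda>x. p c x * e (inv x\<otimes>y))\<in>CC" if "c\<in>F" "y\<in>carrier H" for c y
     by (rule CC_mult[OF pC[OF that(1)] CC_cont[OF CC_inv_left[OF e(1) that(2)]]])
    have near: "\<bar>J (\<lambda>x. f x * e (inv x\<otimes>y)) - D y\<bar>\<le>\<epsilon> * J (\<lambda>x. \<bar>f x\<bar>)" if y: "y\<in>carrier H" for y
    proof -
     have "J (\<lambda>x. f x * e (inv x\<otimes>y)) = J (\<lambda>x. \<Sum>c\<in>F. p c x * e (inv x\<otimes>y))"
      by (rule haar_cong[OF J fe[OF y] CC_sum[OF F(1) pe[OF _ y]]]) (use ps in \<open>auto simp: sum_distrib_right[symmetric]\<close>)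
     also have "\<dots> = (\<Sum>c\<in>F. J (\<lambda>x. p c x * e (inv x\<otimes>y)))" by (rule haar_sum[OF J F(1) pe[OF _ y]])
     finally have "\<bar>J (\<lambda>x. f x * e (inv x\<otimes>y)) - D y\<bar> = \<bar>\<Sum>c\<in>F. J (\<lambda>x. p c x * e (inv x\<otimes>y)) - J (p c) * e (inv c\<otimes>y)\<bar>"
      by (simp add: D_def sum_subtractf)
     also have "\<dots>\<le>(\<Sum>c\<in>F. \<bar>J (\<lambda>x. p c x * e (inv x\<otimes>y)) - J (p c) * e (inv c\<otimes>y)\<bar>)" by (rule sum_abs)
     also have "\<dots>\<le>(\<Sum>c\<in>F. \<epsilon> * J (\<lambda>x. \<bar>p c x\<bar>))"
     proof (rule sum_mono)
      fix c assume c: "c\<in>F"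
      let ?k = "e (inv c\<otimes>y)"
      have s: "(\<lambda>x. ?k * p c x)\<in>CC" by (rule CC_scale[OF pC[OF c]])
      have "J (\<lambda>x. p c x * e (inv x\<otimes>y)) - J (p c) * ?k = J (\<lambda>x. p c x * e (inv x\<otimes>y) - ?k * p c x)"
       using haar_diff[OF J pe[OF c y] s] haarD(2)[OF J pC[OF c], of ?k] by simp
      also have "\<bar>\<dots>\<bar>\<le>J (\<lambda>x. \<epsilon> * \<bar>p c x\<bar>)"
      proof (rule haar_abs_le[OF J CC_diff[OF pe[OF c y] s] CC_scale[OF CC_abs[OF pC[OF c]]]])
       fix x assume x: "x\<in>carrier H"
       show "\<bar>p c x * e (inv x\<otimes>y) - ?k * p c x\<bar>\<le>\<epsilon> * \<bar>p c x\<bar>"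
       proof (cases "p c x = 0")
        case False
        then have w: "inv c\<otimes>x\<in>W" using p c x by blast
        have "inv (inv c\<otimes>x)\<otimes>(inv c\<otimes>y) = inv x\<otimes>y"
         using x y FH[OF c] by (simp add: inv_mult_group m_assoc)
        then have "\<bar>e (inv x\<otimes>y) - ?k\<bar> < \<epsilon>" using W(3) w y FH[OF c] by (metis inv_closed m_closed)
        then have "\<bar>e (inv x\<otimes>y) - ?k\<bar> * \<bar>p c x\<bar>\<le>\<epsilon> * \<bar>p c x\<bar>" by (intro mult_right_mono) auto
        then show ?thesis by (simp add: abs_mult[symmetric] algebra_simps)
       qed simp
      qed
      also have "\<dots> = \<epsilon> * J (\<lambda>x. \<bar>p c x\<bar>)" by (rule haarD(2)[OF J CC_abs[OF pC[OF c]]])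
      finally show "\<bar>J (\<lambda>x. p c x * e (inv x\<otimes>y)) - J (p c) * ?k\<bar>\<le>\<epsilon> * J (\<lambda>x. \<bar>p c x\<bar>)" .
     qed
     also have "\<dots> = \<epsilon> * J (\<lambda>x. \<Sum>c\<in>F. \<bar>p c x\<bar>)"
      using haar_sum[OF J F(1) CC_abs[OF pC]] by (simp add: sum_distrib_left)
     also have "J (\<lambda>x. \<Sum>c\<in>F. \<bar>p c x\<bar>) = J (\<lambda>x. \<bar>f x\<bar>)"
      by (rule haar_cong[OF J CC_sum[OF F(1) CC_abs[OF pC]] CC_abs[OF f]]) (use ps in auto)
     finally show ?thesis .
    qed
    let ?B = "\<delta> * J ec + \<epsilon> * J (\<lambda>x. \<bar>f x\<bar>)"
    have "0\<le>J ec" by (rule haarD(3)[OF J ec]) (use e(2) in \<open>simp add: ec_def\<close>)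
    moreover have "0\<le>J (\<lambda>x. \<bar>f x\<bar>)" by (rule haarD(3)[OF J CC_abs[OF f]]) simp
    ultimately have B0: "0\<le>?B" using \<delta> \<epsilon> by simp
    have "\<bar>J' (\<lambda>y. J ec * f y - D y)\<bar>\<le>J' (\<lambda>y. ?B * \<psi> y)"
    proof (rule haar_abs_le[OF J' CC_diff[OF CC_scale[OF f] D] CC_scale[OF \<psi>(1)]])
     fix y assume y: "y\<in>carrier H"
     show "\<bar>J ec * f y - D y\<bar>\<le>?B * \<psi> y"
     proof (cases "\<exists>a\<in>Q. \<exists>b\<in>U. y = a\<otimes>b")
      case True
      then have "1\<le>\<psi> y" using \<psi>(3) UK(4) by blast
      then have b1: "?B\<le>?B * \<psi> y" using mult_left_mono[of 1 "\<psi> y" ?B] B0 by simp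
      have "\<bar>J ec * f y - D y\<bar>\<le>?B" using conv[OF y] near[OF y] by (simp add: mult.commute)
      then show ?thesis using b1 by (rule order_trans)
     next
      case False
      have "y\<notin>Q" using False UK(3) y r_one by force
      then have "f y = 0" using Q(2) y by blast
      moreover have "e (inv c\<otimes>y) = 0" if c: "c\<in>F" for c
      proof -
       have "c\<otimes>(inv c\<otimes>y) = y" using FH[OF c] y by simp
       then have "inv c\<otimes>y\<notin>U" using False c F(2) by (metis subsetD)
       then show ?thesis using e(3) FH[OF c] y by simp
      qed
      ultimately show ?thesis using B0 \<psi>(2) by (simp add: D_def)
     qed
    qed
    also have "\<dots> = ?B * J' \<psi>" by (rule haarD(2)[OF J' \<psi>(1)])
    also have "J' (\<lambda>y. J ec * f y - D y) = J ec * J' f - J' D"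
     using haar_diff[OF J' CC_scale[OF f] D] haarD(2)[OF J' f] by simp
    also have "J' D = (\<Sum>c\<in>F. J' (\<lambda>y. J (p c) * e (inv c\<otimes>y)))"
     unfolding D_def by (rule haar_sum[OF J' F(1) DC])
    also have "\<dots> = (\<Sum>c\<in>F. J (p c) * J' e)"
    proof (rule sum.cong[OF refl])
     fix c assume c: "c\<in>F"
     then have ic: "inv c\<in>carrier H" using FH by simp
     show "J' (\<lambda>y. J (p c) * e (inv c\<otimes>y)) = J (p c) * J' e"
      by (simp only: haarD(2)[OF J' CC_left[OF e(1) ic]] haarD(4)[OF J' e(1) ic])
    qed
    also have "\<dots> = J (\<lambda>x. \<Sum>c\<in>F. p c x) * J' e" using haar_sum[OF J F(1) pC] by (simp add: sum_distrib_right)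
    also have "J (\<lambda>x. \<Sum>c\<in>F. p c x) = J f"
     by (rule haar_cong[OF J CC_sum[OF F(1) pC] f]) (use ps in auto)
    finally show ?thesis by (simp add: mult.commute)
   qed
   have "\<bar>J' f * J ec - J' e * J f\<bar>\<le>\<delta> * J ec * J' \<psi>"
   proof (rule field_le_epsilon)
    fix \<eta> :: real assume "0 < \<eta>"
    define A where "A = J (\<lambda>x. \<bar>f x\<bar>) * J' \<psi>"
    have "0\<le>J (\<lambda>x. \<bar>f x\<bar>)" by (rule haarD(3)[OF J CC_abs[OF f]]) simp
    moreover have "0\<le>J' \<psi>" by (rule haarD(3)[OF J' \<psi>(1)]) (use \<psi>(2) in blast)
    ultimately have A0: "0\<le>A" by (simp add: A_def)
    have "\<bar>J' f * J ec - J' e * J f\<bar>\<le>\<delta> * J ec * J' \<psi> + \<eta> / (A + 1) * A"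
     using app[of "\<eta> / (A + 1)"] \<open>0 < \<eta>\<close> A0 by (simp add: A_def algebra_simps)
    also have "\<eta> / (A + 1) * A\<le>\<eta>" using A0 \<open>0 < \<eta>\<close> by (simp add: field_simps)
    finally show "\<bar>J' f * J ec - J' e * J f\<bar>\<le>\<delta> * J ec * J' \<psi> + \<eta>" by simp
   qed
   then show ?thesis by (simp add: ec_def)
  qed
  show "\<exists>V. openin T V \<and> \<one>\<in>V \<and>
  (\<forall>e\<in>CC. (\<forall>x\<in>carrier H. 0\<le>e x) \<and> (\<forall>x\<in>carrier H - V. e x = 0) -->
    \<bar>J' f * J (\<lambda>x. e (inv x)) - J' e * J f\<bar>\<le>\<delta> * J (\<lambda>x. e (inv x)) * J' \<psi>)"
   using V main by (intro exI[of _ "V1 \<inter> U"]) blast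
 qed
qed

text \<open>By \<open>haar_ratio\<close> both quotients \<open>J' f / J f\<close> and \<open>J' g / J g\<close> are close to \<open>J' e / J (e \<circ> inv)\<close> for one sufficiently concentrated \<open>e\<close>.\<close>
lemma haar_unique:
 assumes J: "haar J" and J': "haar J'" and f: "f\<in>CC" "g\<in>CC"
 shows "J' f * J g = J' g * J f"
proof (cases "\<exists>f0\<in>CC. J f0\<noteq>0")
 case False then show ?thesis using f by simp
next
 case True
 then obtain f0 where f0: "f0\<in>CC" "J f0\<noteq>0" by blast
 obtain C where C: "C \<ge> 0" "\<forall>\<delta>>0. \<exists>V. openin T V \<and> \<one>\<in>V \<and>
  (\<forall>e\<in>CC. (\<forall>x\<in>carrier H. 0\<le>e x) \<and> (\<forall>x\<in>carrier H - V. e x = 0) -->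
    \<bar>J' f * J (\<lambda>x. e (inv x)) - J' e * J f\<bar>\<le>\<delta> * J (\<lambda>x. e (inv x)) * C)"
  using haar_ratio[OF J J' f(1)] by blast
 obtain D where D: "D \<ge> 0" "\<forall>\<delta>>0. \<exists>V. openin T V \<and> \<one>\<in>V \<and>
  (\<forall>e\<in>CC. (\<forall>x\<in>carrier H. 0\<le>e x) \<and> (\<forall>x\<in>carrier H - V. e x = 0) -->
    \<bar>J' g * J (\<lambda>x. e (inv x)) - J' e * J g\<bar>\<le>\<delta> * J (\<lambda>x. e (inv x)) * D)"
  using haar_ratio[OF J J' f(2)] by blast
 have "\<bar>J' f * J g - J' g * J f\<bar>\<le>0 + \<eta>" if \<eta>: "0 < \<eta>" for \<eta>
 proof -
  define A where "A = C * \<bar>J g\<bar> + D * \<bar>J f\<bar>"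
  have A0: "0\<le>A" using C(1) D(1) by (simp add: A_def)
  define \<delta> where "\<delta> = \<eta> / (A + 1)"
  have \<delta>: "0 < \<delta>" "\<delta> * A\<le>\<eta>" using A0 \<eta> by (auto simp: \<delta>_def field_simps)
  obtain V where V: "openin T V" "\<one>\<in>V" "\<forall>e\<in>CC. (\<forall>x\<in>carrier H. 0\<le>e x) \<and> (\<forall>x\<in>carrier H - V. e x = 0) -->
    \<bar>J' f * J (\<lambda>x. e (inv x)) - J' e * J f\<bar>\<le>\<delta> * J (\<lambda>x. e (inv x)) * C" using mp[OF spec[OF C(2)] \<delta>(1)] by (elim exE conjE)
  obtain W where W: "openin T W" "\<one>\<in>W" "\<forall>e\<in>CC. (\<forall>x\<in>carrier H. 0\<le>e x) \<and> (\<forall>x\<in>carrier H - W. e x = 0) -->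
    \<bar>J' g * J (\<lambda>x. e (inv x)) - J' e * J g\<bar>\<le>\<delta> * J (\<lambda>x. e (inv x)) * D" using mp[OF spec[OF D(2)] \<delta>(1)] by (elim exE conjE)
  obtain e where e: "e\<in>CC" "\<forall>x. 0\<le>e x \<and> e x\<le>1" "e \<one> = 1" "\<forall>x\<in>carrier H - V \<inter> W. e x = 0"
   using bump[OF openin_Int[OF V(1) W(1)], of \<one>] V(2) W(2) by auto
  define r where "r = J (\<lambda>x. e (inv x))"
  have r: "0 < r" unfolding r_def
   by (rule haar_pos[OF J f0 CC_inv[OF e(1)], of \<one>]) (use e in auto)
  have 1: "\<bar>J' f * r - J' e * J f\<bar>\<le>\<delta> * r * C" unfolding r_def
   by (rule bspec[OF V(3) e(1), THEN mp]) (use e(2,4) in blast)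
  have 2: "\<bar>J' g * r - J' e * J g\<bar>\<le>\<delta> * r * D" unfolding r_def
   by (rule bspec[OF W(3) e(1), THEN mp]) (use e(2,4) in blast)
  have "(J' f * r - J' e * J f) * J g - (J' g * r - J' e * J g) * J f = r * (J' f * J g - J' g * J f)"
   by (simp add: algebra_simps)
  then have "r * \<bar>J' f * J g - J' g * J f\<bar> = \<bar>(J' f * r - J' e * J f) * J g - (J' g * r - J' e * J g) * J f\<bar>"
   using r by (simp add: abs_mult)
  also have "\<dots>\<le>\<bar>J' f * r - J' e * J f\<bar> * \<bar>J g\<bar> + \<bar>J' g * r - J' e * J g\<bar> * \<bar>J f\<bar>"
   by (metis abs_mult abs_triangle_ineq4)
  also have "\<dots>\<le>\<delta> * r * C * \<bar>J g\<bar> + \<delta> * r * D * \<bar>J f\<bar>"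
   using 1 2 by (intro add_mono mult_right_mono) auto
  also have "\<dots> = r * (\<delta> * A)" by (simp add: A_def algebra_simps)
  finally have "\<bar>J' f * J g - J' g * J f\<bar>\<le>\<delta> * A" using r by simp
  then show ?thesis using \<delta>(2) by simp
 qed
 then have "\<bar>J' f * J g - J' g * J f\<bar>\<le>0" by (rule field_le_epsilon)
 then show ?thesis by simp
qed

end

section \<open>Means on uniformly continuous functions\<close>

lemma continuous_map_realI:
 assumes "\<And>x \<epsilon>. x\<in>topspace X ==> 0 < \<epsilon> ==> \<exists>U. openin X U \<and> x\<in>U \<and> (\<forall>y\<in>U. \<bar>f y - f x\<bar> < \<epsilon>)"
 shows "continuous_map X euclideanreal f"
 unfolding continuous_map_def
proof (intro conjI allI impI)
 fix S assume "openin euclideanreal S"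
 then have S: "open S" by simp
 show "openin X {x\<in>topspace X. f x\<in>S}"
 proof (subst openin_subopen, intro ballI)
  fix x assume "x\<in>{x\<in>topspace X. f x\<in>S}"
  then have x: "x\<in>topspace X" "f x\<in>S" by auto
  then obtain e where e: "0 < e" "\<forall>y. dist y (f x) < e --> y\<in>S" using S open_dist by blast
  obtain U where U: "openin X U" "x\<in>U" "\<forall>y\<in>U. \<bar>f y - f x\<bar> < e" using assms[OF x(1) e(1)] by blast
  have "U\<subseteq>{x\<in>topspace X. f x\<in>S}" using U e(2) openin_subset[OF U(1)] by (auto simp: dist_real_def)
  then show "\<exists>T. openin X T \<and> x\<in>T \<and> T\<subseteq>{x\<in>topspace X. f x\<in>S}" using U by blast
 qed
qed simp

context tgroup begin

text \<open>Uniform continuity on this side makes \<open>g \<mapsto> shift g f\<close> continuous for the supremum norm, so that orbits of means are continuous.\<close>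
definition UL :: "('h => real) set" where
 "UL = {f. (\<exists>B. \<forall>h\<in>carrier H. \<bar>f h\<bar>\<le>B) \<and>
  (\<forall>\<epsilon>>0. \<exists>V. openin T V \<and> \<one>\<in>V \<and> (\<forall>v\<in>V. \<forall>h\<in>carrier H. \<bar>f (v\<otimes>h) - f h\<bar> < \<epsilon>))}"

lemma UL_bounded: "f\<in>UL ==> \<exists>B>0. \<forall>h\<in>carrier H. \<bar>f h\<bar>\<le>B"
proof -
 assume "f\<in>UL"
 then obtain B where "\<forall>h\<in>carrier H. \<bar>f h\<bar>\<le>B" unfolding UL_def by blast
 then have "\<forall>h\<in>carrier H. \<bar>f h\<bar>\<le>\<bar>B\<bar> + 1" by force
 then show ?thesis by (intro exI[of _ "\<bar>B\<bar> + 1"]) auto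
qed

lemma UL_uniform: "f\<in>UL ==> 0 < \<epsilon> ==> \<exists>V. openin T V \<and> \<one>\<in>V \<and> (\<forall>v\<in>V. \<forall>h\<in>carrier H. \<bar>f (v\<otimes>h) - f h\<bar> < \<epsilon>)"
 unfolding UL_def by blast

lemma ULI: "(\<And>h. h\<in>carrier H ==> \<bar>f h\<bar>\<le>B) ==>
 (\<And>\<epsilon>. 0 < \<epsilon> ==> \<exists>V. openin T V \<and> \<one>\<in>V \<and> (\<forall>v\<in>V. \<forall>h\<in>carrier H. \<bar>f (v\<otimes>h) - f h\<bar> < \<epsilon>)) ==> f\<in>UL"
 unfolding UL_def by blast

lemma UL_const: "(\<lambda>_. c)\<in>UL"
 by (rule ULI[of _ "\<bar>c\<bar>"]) (auto intro!: exI[of _ "topspace T"])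

lemma UL_add: assumes f: "f\<in>UL" and g: "g\<in>UL" shows "(\<lambda>h. f h + g h)\<in>UL"
proof -
 obtain B where B: "\<forall>h\<in>carrier H. \<bar>f h\<bar>\<le>B" using UL_bounded[OF f] by blast
 obtain C where C: "\<forall>h\<in>carrier H. \<bar>g h\<bar>\<le>C" using UL_bounded[OF g] by blast
 show ?thesis
 proof (rule ULI[of _ "B + C"])
  show "\<bar>f h + g h\<bar>\<le>B + C" if "h\<in>carrier H" for h using B C that by (meson abs_triangle_ineq add_mono order_trans)
  fix \<epsilon> :: real assume "0 < \<epsilon>"
  then have e: "0 < \<epsilon> / 2" by simp
  obtain V where V: "openin T V" "\<one>\<in>V" "\<forall>v\<in>V. \<forall>h\<in>carrier H. \<bar>f (v\<otimes>h) - f h\<bar> < \<epsilon>/2"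
   using UL_uniform[OF f e] by blast
  obtain W where W: "openin T W" "\<one>\<in>W" "\<forall>v\<in>W. \<forall>h\<in>carrier H. \<bar>g (v\<otimes>h) - g h\<bar> < \<epsilon>/2"
   using UL_uniform[OF g e] by blast
  have "\<bar>(f (v\<otimes>h) + g (v\<otimes>h)) - (f h + g h)\<bar> < \<epsilon>" if "v\<in>V \<inter> W" "h\<in>carrier H" for v h
  proof -
   have "\<bar>f (v\<otimes>h) - f h\<bar> < \<epsilon>/2" "\<bar>g (v\<otimes>h) - g h\<bar> < \<epsilon>/2" using V(3) W(3) that by blast+
   then show ?thesis by linarith
  qed
  then show "\<exists>V. openin T V \<and> \<one>\<in>V \<and> (\<forall>v\<in>V. \<forall>h\<in>carrier H. \<bar>f (v\<otimes>h) + g (v\<otimes>h) - (f h + g h)\<bar> < \<epsilon>)"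
   using V W by (intro exI[of _ "V \<inter> W"]) auto
 qed
qed

lemma UL_scale: assumes f: "f\<in>UL" shows "(\<lambda>h. c * f h)\<in>UL"
proof -
 obtain B where B: "\<forall>h\<in>carrier H. \<bar>f h\<bar>\<le>B" using UL_bounded[OF f] by blast
 show ?thesis
 proof (rule ULI[of _ "\<bar>c\<bar> * B"])
  show "\<bar>c * f h\<bar>\<le>\<bar>c\<bar> * B" if "h\<in>carrier H" for h using B that by (simp add: abs_mult mult_left_mono)
  fix \<epsilon> :: real assume e: "0 < \<epsilon>"
  then obtain V where V: "openin T V" "\<one>\<in>V" "\<forall>v\<in>V. \<forall>h\<in>carrier H. \<bar>f (v\<otimes>h) - f h\<bar> < \<epsilon>/(\<bar>c\<bar> + 1)"
   using UL_uniform[OF f, of "\<epsilon>/(\<bar>c\<bar> + 1)"] by auto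
  have "\<bar>c * f (v\<otimes>h) - c * f h\<bar> < \<epsilon>" if "v\<in>V" "h\<in>carrier H" for v h
  proof -
   have "\<bar>c * f (v\<otimes>h) - c * f h\<bar> = \<bar>c\<bar> * \<bar>f (v\<otimes>h) - f h\<bar>" by (simp add: abs_mult[symmetric] algebra_simps)
   also have "\<dots>\<le>\<bar>c\<bar> * (\<epsilon>/(\<bar>c\<bar> + 1))" using V(3) that by (intro mult_left_mono) (auto intro: less_imp_le)
   also have "\<dots> < \<epsilon>" using e by (simp add: field_simps)
   finally show ?thesis .
  qed
  then show "\<exists>V. openin T V \<and> \<one>\<in>V \<and> (\<forall>v\<in>V. \<forall>h\<in>carrier H. \<bar>c * f (v\<otimes>h) - c * f h\<bar> < \<epsilon>)"
   using V by blast
 qed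
qed

lemma UL_diff: "f\<in>UL ==> g\<in>UL ==> (\<lambda>h. f h - g h)\<in>UL"
 using UL_add[OF _ UL_scale[of g "-1"], of f] by simp

lemma UL_cong:
 assumes "f\<in>UL" "\<And>h. h\<in>carrier H ==> f h = g h" shows "g\<in>UL"
proof -
 obtain B where B: "\<forall>h\<in>carrier H. \<bar>f h\<bar>\<le>B" using UL_bounded[OF assms(1)] by blast
 show ?thesis
 proof (rule ULI[of _ B])
  show "\<bar>g h\<bar>\<le>B" if "h\<in>carrier H" for h using B assms(2) that by simp
  fix \<epsilon> :: real assume e: "0 < \<epsilon>"
  obtain V where V: "openin T V" "\<one>\<in>V" "\<forall>v\<in>V. \<forall>h\<in>carrier H. \<bar>f (v\<otimes>h) - f h\<bar> < \<epsilon>"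
   using UL_uniform[OF assms(1) e] by blast
  have "\<forall>v\<in>V. \<forall>h\<in>carrier H. \<bar>g (v\<otimes>h) - g h\<bar> < \<epsilon>"
   using V(3) assms(2) open_subset[OF V(1)] by (metis m_closed subsetD)
  then show "\<exists>V. openin T V \<and> \<one>\<in>V \<and> (\<forall>v\<in>V. \<forall>h\<in>carrier H. \<bar>g (v\<otimes>h) - g h\<bar> < \<epsilon>)" using V by blast
 qed
qed

lemma UL_translate: assumes f: "f\<in>UL" and g: "g\<in>carrier H" shows "(\<lambda>h. f (g\<otimes>h))\<in>UL"
proof -
 obtain B where B: "\<forall>h\<in>carrier H. \<bar>f h\<bar>\<le>B" using UL_bounded[OF f] by blast
 show ?thesis
 proof (rule ULI[of _ B])
  show "\<bar>f (g\<otimes>h)\<bar>\<le>B" if "h\<in>carrier H" for h using B g that by simp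
  fix \<epsilon> :: real assume e: "0 < \<epsilon>"
  obtain V where V: "openin T V" "\<one>\<in>V" "\<forall>v\<in>V. \<forall>h\<in>carrier H. \<bar>f (v\<otimes>h) - f h\<bar> < \<epsilon>"
   using UL_uniform[OF f e] by blast
  define W where "W = {v\<in>topspace T. g\<otimes>v\<otimes>inv g\<in>V}"
  have "openin T W" unfolding W_def
   by (rule openin_continuous_map_preimage[OF _ V(1)]) (intro cmult cconst cid g inv_closed)
  moreover have "\<one>\<in>W" using g V(2) by (simp add: W_def)
  moreover have "\<bar>f (g\<otimes>(v\<otimes>h)) - f (g\<otimes>h)\<bar> < \<epsilon>" if v: "v\<in>W" and h: "h\<in>carrier H" for v h
  proof -
   have vH: "v\<in>carrier H" "g\<otimes>v\<otimes>inv g\<in>V" using v by (auto simp: W_def)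
   have "g\<otimes>v\<otimes>inv g\<otimes>(g\<otimes>h) = g\<otimes>(v\<otimes>h)" using g vH h by (simp add: m_assoc)
   then show ?thesis using V(3)[rule_format, OF vH(2), of "g\<otimes>h"] g h by simp
  qed
  ultimately show "\<exists>V. openin T V \<and> \<one>\<in>V \<and> (\<forall>v\<in>V. \<forall>h\<in>carrier H. \<bar>f (g\<otimes>(v\<otimes>h)) - f (g\<otimes>h)\<bar> < \<epsilon>)"
   by blast
 qed
qed

sublocale mean_class H UL
proof
 show "\<exists>B. \<forall>h\<in>carrier H. \<bar>f h\<bar>\<le>B" if "f\<in>UL" for f using UL_bounded[OF that] by blast
qed (fact UL_const, fact UL_add, fact UL_scale, fact UL_translate, fact UL_cong)

text \<open>A mean is bounded by the supremum norm, so the estimate holds for all means at once.\<close>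
lemma means_equicontinuous:
 assumes f: "f\<in>UL" and e: "0 < \<epsilon>"
 shows "\<exists>V. openin T V \<and> \<one>\<in>V \<and> (\<forall>v\<in>V. \<forall>g\<in>carrier H. \<forall>M\<in>means. \<bar>M (shift (v\<otimes>g) f) - M (shift g f)\<bar> < \<epsilon>)"
proof -
 obtain V where V: "openin T V" "\<one>\<in>V" "\<forall>v\<in>V. \<forall>h\<in>carrier H. \<bar>f (v\<otimes>h) - f h\<bar> < \<epsilon>/2"
  using UL_uniform[OF f, of "\<epsilon>/2"] e by auto
 have "\<bar>M (shift (v\<otimes>g) f) - M (shift g f)\<bar> < \<epsilon>" if v: "v\<in>V" and g: "g\<in>carrier H" and M: "M\<in>means" for v g M
 proof -
  have vH: "v\<in>carrier H" using v open_subset[OF V(1)] by blast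
  have s: "shift (v\<otimes>g) f\<in>UL" "shift g f\<in>UL" using shift_F f vH g by auto
  have "\<bar>M (\<lambda>h. shift (v\<otimes>g) f h - shift g f h)\<bar>\<le>\<epsilon>/2"
  proof (rule means_abs_le[OF M UL_diff[OF s]])
   fix h assume h: "h\<in>carrier H"
   have "\<bar>f (v\<otimes>(g\<otimes>h)) - f (g\<otimes>h)\<bar> < \<epsilon>/2" using V(3) v g h by blast
   then show "\<bar>shift (v\<otimes>g) f h - shift g f h\<bar>\<le>\<epsilon>/2" using vH g h by (simp add: shift_def m_assoc)
  qed
  then show ?thesis using means_diff[OF M s] e by simp
 qed
 then show ?thesis using V by blast
qed

lemma means_orbit_continuous:
 assumes M: "M\<in>means" shows "continuous_map T euclideanreal (\<lambda>g. M (shift g f))"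
proof (cases "f\<in>UL")
 case False
 have "continuous_map T euclideanreal (\<lambda>g. 0)" by simp
 then show ?thesis by (rule continuous_map_eq) (use False shift_F_iff meansD(5)[OF M] in auto)
next
 case True
 show ?thesis
 proof (rule continuous_map_realI)
  fix g and \<epsilon> :: real assume "g\<in>topspace T" and e: "0 < \<epsilon>"
  then have g: "g\<in>carrier H" by simp
  obtain V where V: "openin T V" "\<one>\<in>V" "\<forall>v\<in>V. \<forall>g\<in>carrier H. \<forall>M\<in>means. \<bar>M (shift (v\<otimes>g) f) - M (shift g f)\<bar> < \<epsilon>"
   using means_equicontinuous[OF True e] by blast
  show "\<exists>U. openin T U \<and> g\<in>U \<and> (\<forall>y\<in>U. \<bar>M (shift y f) - M (shift g f)\<bar> < \<epsilon>)"
  proof (intro exI[of _ "(\<lambda>x. x\<otimes>g) ` V"] conjI ballI)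
   show "openin T ((\<lambda>x. x\<otimes>g) ` V)" by (rule open_rtrans[OF g V(1)])
   show "g\<in>(\<lambda>x. x\<otimes>g) ` V" using V(2) g by force
   fix y assume "y\<in>(\<lambda>x. x\<otimes>g) ` V"
   then show "\<bar>M (shift y f) - M (shift g f)\<bar> < \<epsilon>" using V(3) g M by auto
  qed
 qed
qed

end

lemma (in tgroup) separated_maximal:
 assumes "openin T V" "\<one>\<in>V"
 shows "\<exists>P\<subseteq>carrier H. (\<forall>x\<in>P. \<forall>y\<in>P. x\<noteq>y --> x\<otimes>inv y\<notin>V) \<and>
  (\<forall>y\<in>carrier H. \<exists>p\<in>P. y\<otimes>inv p\<in>V \<or> p\<otimes>inv y\<in>V)"
proof -
 define \<A> where "\<A> = {P. P\<subseteq>carrier H \<and> (\<forall>x\<in>P. \<forall>y\<in>P. x\<noteq>y --> x\<otimes>inv y\<notin>V)}"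
 have "\<exists>P\<in>\<A>. \<forall>X\<in>\<A>. P\<subseteq>X --> X = P"
 proof (rule subset_Zorn)
  fix C assume C: "subset.chain \<A> C"
  have sub: "C\<subseteq>\<A>" and lin: "\<And>X Y. X\<in>C ==> Y\<in>C ==> X\<subseteq>Y \<or> Y\<subseteq>X"
   using C unfolding subset.chain_def by auto
  have "\<Union>C\<in>\<A>" unfolding \<A>_def
  proof (intro CollectI conjI ballI impI)
   show "\<Union>C\<subseteq>carrier H" using sub by (auto simp: \<A>_def)
   fix x y assume xy: "x\<in>\<Union>C" "y\<in>\<Union>C" "x\<noteq>y"
   then obtain X Y where "X\<in>C" "x\<in>X" "Y\<in>C" "y\<in>Y" by blast
   then obtain Z where "Z\<in>C" "x\<in>Z" "y\<in>Z" using lin[of X Y] by blast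
   then show "x\<otimes>inv y\<notin>V" using sub xy(3) unfolding \<A>_def by blast
  qed
  then show "\<exists>U\<in>\<A>. \<forall>X\<in>C. X\<subseteq>U" by blast
 qed
 then obtain P where P: "P\<in>\<A>" "\<forall>X\<in>\<A>. P\<subseteq>X --> X = P" by blast
 have "\<exists>p\<in>P. y\<otimes>inv p\<in>V \<or> p\<otimes>inv y\<in>V" if y: "y\<in>carrier H" for y
 proof (rule ccontr)
  assume no: "\<not> ?thesis"
  then have "insert y P\<in>\<A>" using P(1) y unfolding \<A>_def by auto
  then have "y\<in>P" using P(2) by blast
  then show False using no y assms(2) by auto
 qed
 moreover have "P\<subseteq>carrier H \<and> (\<forall>x\<in>P. \<forall>y\<in>P. x\<noteq>y --> x\<otimes>inv y\<notin>V)"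
  using P(1) unfolding \<A>_def by (rule CollectD)
 ultimately show ?thesis by (intro exI[of _ P]) simp
qed

definition (in tgroup) BC :: "('h => real) set" where
 "BC = {k. continuous_map T euclideanreal k \<and> (\<exists>B. \<forall>x\<in>carrier H. \<bar>k x\<bar>\<le>B)}"

locale inv_mean = lcgroup H T for H :: "('h, 'm) monoid_scheme" (structure) and T :: "'h topology" +
 fixes M :: "('h => real) => real"
 assumes M: "M\<in>means" and inv: "\<And>f g. f\<in>UL ==> g\<in>carrier H ==> M (\<lambda>h. f (g\<otimes>h)) = M f"
begin

text \<open>Sum the translates of \<open>f\<close> over a maximal separated set \<open>P\<close>. The sums are locally finite and uniformly continuous, the invariant mean
of the sum is an invariant functional of \<open>f\<close>, and it does not vanish because \<open>P\<close> is syndetic.\<close>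
lemma haar_exists: "\<exists>J f. haar J \<and> f\<in>CC \<and> J f = 1"
proof -
 obtain U K where UK: "openin T U" "compactin T K" "\<one>\<in>U" "U\<subseteq>K" using relatively_compact_nbhd by blast
 obtain P where P: "P\<subseteq>carrier H" "\<forall>x\<in>P. \<forall>y\<in>P. x\<noteq>y --> x\<otimes>inv y\<notin>U"
  "\<forall>y\<in>carrier H. \<exists>p\<in>P. y\<otimes>inv p\<in>U \<or> p\<otimes>inv y\<in>U" using separated_maximal[OF UK(1,3)] by blast
 have PH: "p\<in>carrier H" if "p\<in>P" for p using P(1) that by blast
 have count: "\<exists>n. \<forall>g\<in>carrier H. finite {p\<in>P. g\<otimes>inv p\<in>Q} \<and> card {p\<in>P. g\<otimes>inv p\<in>Q}\<le>n"
  if Q: "compactin T Q" for Q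
 proof -
  obtain V where V: "openin T V" "\<one>\<in>V" "\<forall>x\<in>V. \<forall>y\<in>V. inv x\<otimes>y\<in>U \<and> x\<otimes>inv y\<in>U \<and> x\<otimes>y\<in>U"
   using one_nbhd_quot[OF UK(1,3)] by blast
  obtain F where F: "finite F" "F\<subseteq>Q" "\<forall>x\<in>Q. \<exists>a\<in>F. inv a\<otimes>x\<in>V"
   using finite_translates_cover[OF Q V(1,2)] by blast
  have FH: "a\<in>carrier H" if "a\<in>F" for a using that F(2) compactin_subset_topspace[OF Q] by auto
  have "finite {p\<in>P. g\<otimes>inv p\<in>Q} \<and> card {p\<in>P. g\<otimes>inv p\<in>Q}\<le>card F" if g: "g\<in>carrier H" for g
  proof -
   define A where "A = {p\<in>P. g\<otimes>inv p\<in>Q}"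
   have "\<forall>p\<in>A. \<exists>a. a\<in>F \<and> inv a\<otimes>(g\<otimes>inv p)\<in>V" using F(3) unfolding A_def by blast
   then obtain a where a: "\<forall>p\<in>A. a p\<in>F \<and> inv (a p)\<otimes>(g\<otimes>inv p)\<in>V" by metis
   have "inj_on a A"
   proof (rule inj_onI, rule ccontr)
    fix p q assume pq: "p\<in>A" "q\<in>A" "a p = a q" "p\<noteq>q"
    have cl: "p\<in>carrier H" "q\<in>carrier H" "a q\<in>carrier H" using pq a FH PH by (auto simp: A_def)
    have "inv (inv (a p)\<otimes>(g\<otimes>inv p))\<otimes>(inv (a q)\<otimes>(g\<otimes>inv q))\<in>U" using V(3) a pq(1,2) by blast
    also have "inv (inv (a p)\<otimes>(g\<otimes>inv p))\<otimes>(inv (a q)\<otimes>(g\<otimes>inv q)) = p\<otimes>inv q"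
     unfolding pq(3) using cl g by (simp add: inv_mult_group m_assoc)
    finally show False using P(2) pq by (auto simp: A_def)
   qed
   moreover have "a ` A\<subseteq>F" using a by blast
   ultimately have "finite A" "card A\<le>card F" using F(1) inj_on_finite card_inj_on_le by blast+
   then show ?thesis unfolding A_def by simp
  qed
  then show ?thesis by blast
 qed
 define S where "S = (\<lambda>f g. \<Sum>p\<in>{p\<in>P. f (g\<otimes>inv p)\<noteq>(0::real)}. f (g\<otimes>inv p))"
 have fin: "finite {p\<in>P. f (g\<otimes>inv p)\<noteq>0}" if f: "f\<in>CC" and g: "g\<in>carrier H" for f g
 proof -
  obtain Q where Q: "compactin T Q" "\<forall>x\<in>carrier H - Q. f x = 0" using CC_supp[OF f] by blast
  then have "{p\<in>P. f (g\<otimes>inv p)\<noteq>0}\<subseteq>{p\<in>P. g\<otimes>inv p\<in>Q}" using g PH by auto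
  then show ?thesis using count[OF Q(1)] g finite_subset by blast
 qed
 have S_eq: "S f g = (\<Sum>p\<in>A. f (g\<otimes>inv p))" if "finite A" "A\<subseteq>P" "{p\<in>P. f (g\<otimes>inv p)\<noteq>0}\<subseteq>A" for A f g
  unfolding S_def by (rule sum.mono_neutral_left) (use that in auto)
 have S_add: "S (\<lambda>x. f x + h x) g = S f g + S h g" if f: "f\<in>CC" and h: "h\<in>CC" and g: "g\<in>carrier H" for f h g
 proof -
  define A where "A = {p\<in>P. f (g\<otimes>inv p)\<noteq>0} \<union> {p\<in>P. h (g\<otimes>inv p)\<noteq>0}"
  have A: "finite A" "A\<subseteq>P" unfolding A_def using fin f h g by auto
  have "S (\<lambda>x. f x + h x) g = (\<Sum>p\<in>A. f (g\<otimes>inv p) + h (g\<otimes>inv p))" by (rule S_eq[OF A]) (auto simp: A_def)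
  moreover have "S f g = (\<Sum>p\<in>A. f (g\<otimes>inv p))" by (rule S_eq[OF A]) (auto simp: A_def)
  moreover have "S h g = (\<Sum>p\<in>A. h (g\<otimes>inv p))" by (rule S_eq[OF A]) (auto simp: A_def)
  ultimately show ?thesis by (simp add: sum.distrib)
 qed
 have S_scale: "S (\<lambda>x. c * f x) g = c * S f g" for f c g
 proof (cases "c = 0")
  case False
  then show ?thesis by (simp add: S_def sum_distrib_left)
 qed (simp add: S_def)
 have S_pos: "0\<le>S f g" if "\<And>x. x\<in>carrier H ==> 0\<le>f x" "g\<in>carrier H" for f g
  unfolding S_def by (rule sum_nonneg) (use that PH in auto)
 have S_diff: "S (\<lambda>x. f x - h x) g = S f g - S h g" if f: "f\<in>CC" and h: "h\<in>CC" and g: "g\<in>carrier H" for f h g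
  using S_add[OF f CC_scale[OF h, of "-1"] g] S_scale[of "-1" h g] by simp
 have S_abs: "\<bar>S f g\<bar>\<le>S h g" if f: "f\<in>CC" and h: "h\<in>CC" and le: "\<And>x. x\<in>carrier H ==> \<bar>f x\<bar>\<le>h x" and g: "g\<in>carrier H" for f h g
 proof -
  have "0\<le>S (\<lambda>x. h x - f x) g" by (rule S_pos[OF _ g]) (use le in \<open>auto dest: abs_le_D1\<close>)
  moreover have "0\<le>S (\<lambda>x. h x + f x) g" by (rule S_pos[OF _ g]) (use le in \<open>force dest: abs_le_D2\<close>)
  ultimately show ?thesis using S_diff[OF h f g] S_add[OF h f g] by auto
 qed
 have S_bound: "\<exists>B>0. \<forall>g\<in>carrier H. \<bar>S f g\<bar>\<le>B" if f: "f\<in>CC" for f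
 proof -
  obtain Q where Q: "compactin T Q" "\<forall>x\<in>carrier H - Q. f x = 0" using CC_supp[OF f] by blast
  obtain n where n: "\<forall>g\<in>carrier H. finite {p\<in>P. g\<otimes>inv p\<in>Q} \<and> card {p\<in>P. g\<otimes>inv p\<in>Q}\<le>n" using count[OF Q(1)] by blast
  obtain B where B: "B > 0" "\<forall>x\<in>carrier H. \<bar>f x\<bar>\<le>B" using CC_bounded[OF f] by blast
  have "\<bar>S f g\<bar>\<le>real (Suc n) * B" if g: "g\<in>carrier H" for g
  proof -
   let ?A = "{p\<in>P. g\<otimes>inv p\<in>Q}"
   have "S f g = (\<Sum>p\<in>?A. f (g\<otimes>inv p))" by (rule S_eq) (use n g Q PH in auto)
   also have "\<bar>\<dots>\<bar>\<le>(\<Sum>p\<in>?A. B)" by (rule order_trans[OF sum_abs sum_mono]) (use B g PH in auto)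
   also have "\<dots>\<le>real (Suc n) * B" using n g B(1) by (auto intro!: mult_right_mono simp: le_SucI)
   finally show ?thesis .
  qed
  then show ?thesis using B(1) by (intro exI[of _ "real (Suc n) * B"]) auto
 qed
 have S_trans: "S f (a\<otimes>g) = S (\<lambda>x. f (a\<otimes>x)) g" if "a\<in>carrier H" "g\<in>carrier H" for f a g
 proof -
  have "a\<otimes>g\<otimes>inv p = a\<otimes>(g\<otimes>inv p)" if "p\<in>P" for p using \<open>a\<in>carrier H\<close> \<open>g\<in>carrier H\<close> PH[OF that] by (simp add: m_assoc)
  then show ?thesis unfolding S_def by (intro sum.cong) auto
 qed
 have S_UL: "S f\<in>UL" if f: "f\<in>CC" for f
 proof -
  obtain B where B: "\<forall>g\<in>carrier H. \<bar>S f g\<bar>\<le>B" using S_bound[OF f] by blast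
  obtain \<psi> where \<psi>: "\<psi>\<in>CC" "\<forall>x. 0\<le>\<psi> x" "\<forall>\<epsilon>>0. \<exists>V. openin T V \<and> \<one>\<in>V \<and> (\<forall>v\<in>V. \<forall>x\<in>carrier H. \<bar>f (v\<otimes>x) - f x\<bar>\<le>\<epsilon> * \<psi> x)"
   using left_uniform_dominated[OF f] by blast
  obtain D where D: "D > 0" "\<forall>g\<in>carrier H. \<bar>S \<psi> g\<bar>\<le>D" using S_bound[OF \<psi>(1)] by blast
  show ?thesis
  proof (rule ULI[of _ B])
   show "\<bar>S f h\<bar>\<le>B" if "h\<in>carrier H" for h using B that by blast
   fix \<epsilon> :: real assume e: "0 < \<epsilon>"
   have e': "0 < \<epsilon> / (2 * D)" using e D(1) by simp
   obtain V where V: "openin T V" "\<one>\<in>V" "\<forall>v\<in>V. \<forall>x\<in>carrier H. \<bar>f (v\<otimes>x) - f x\<bar>\<le>\<epsilon> / (2 * D) * \<psi> x"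
    using mp[OF spec[OF \<psi>(3)] e'] by (elim exE conjE)
   have "\<bar>S f (v\<otimes>g) - S f g\<bar> < \<epsilon>" if v: "v\<in>V" and g: "g\<in>carrier H" for v g
   proof -
    have vH: "v\<in>carrier H" using v open_subset[OF V(1)] by blast
    have "\<bar>S f (v\<otimes>g) - S f g\<bar> = \<bar>S (\<lambda>x. f (v\<otimes>x) - f x) g\<bar>"
     using S_trans[OF vH g] S_diff[OF CC_left[OF f vH] f g] by simp
    also have "\<dots>\<le>S (\<lambda>x. \<epsilon> / (2 * D) * \<psi> x) g"
     by (rule S_abs[OF CC_diff[OF CC_left[OF f vH] f] CC_scale[OF \<psi>(1)] _ g]) (use V(3) v in blast)
    also have "\<dots> = \<epsilon> / (2 * D) * S \<psi> g" by (rule S_scale)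
    also have "\<dots>\<le>\<epsilon> / (2 * D) * D" using D g e' by (intro mult_left_mono) (auto dest: abs_le_D1)
    also have "\<dots> < \<epsilon>" using D(1) e by simp
    finally show ?thesis .
   qed
   then show "\<exists>V. openin T V \<and> \<one>\<in>V \<and> (\<forall>v\<in>V. \<forall>h\<in>carrier H. \<bar>S f (v\<otimes>h) - S f h\<bar> < \<epsilon>)" using V by blast
  qed
 qed
 define J where "J = (\<lambda>f. M (S f))"
 have J: "haar J" unfolding haar_def
 proof (intro conjI ballI allI impI)
  fix f h assume f: "f\<in>CC" and h: "h\<in>CC"
  have "J (\<lambda>x. f x + h x) = M (\<lambda>g. S f g + S h g)" unfolding J_def
   by (rule means_cong[OF M S_UL[OF CC_add[OF f h]]]) (rule S_add[OF f h])
  then show "J (\<lambda>x. f x + h x) = J f + J h" using meansD(1)[OF M S_UL[OF f] S_UL[OF h]] by (simp add: J_def)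
 next
  fix f c assume f: "f\<in>CC"
  have "S (\<lambda>x. c * f x) = (\<lambda>g. c * S f g)" using S_scale by blast
  then show "J (\<lambda>x. c * f x) = c * J f" using meansD(2)[OF M S_UL[OF f]] by (simp add: J_def)
 next
  fix f assume "f\<in>CC" "\<forall>x\<in>carrier H. 0\<le>f x"
  then show "0\<le>J f" unfolding J_def using meansD(3)[OF M S_UL] S_pos by blast
 next
  fix f a assume f: "f\<in>CC" and a: "a\<in>carrier H"
  have "J (\<lambda>x. f (a\<otimes>x)) = M (\<lambda>g. S f (a\<otimes>g))" unfolding J_def
   by (rule means_cong[OF M S_UL[OF CC_left[OF f a]]]) (simp add: S_trans[OF a])
  then show "J (\<lambda>x. f (a\<otimes>x)) = J f" using inv[OF S_UL[OF f] a] by (simp add: J_def)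
 qed
 obtain \<psi> where \<psi>: "\<psi>\<in>CC" "\<forall>x. 0\<le>\<psi> x" "\<forall>x\<in>K \<union> (\<lambda>a. inv a) ` K. 1\<le>\<psi> x"
  using dominating[OF compactin_Un[OF UK(2) compactin_inverse_set[OF UK(2)]]] by blast
 have "1\<le>S \<psi> g" if g: "g\<in>carrier H" for g
 proof -
  obtain p where p: "p\<in>P" "g\<otimes>inv p\<in>U \<or> p\<otimes>inv g\<in>U" using P(3) g by blast
  have "g\<otimes>inv p = inv (p\<otimes>inv g)" using g PH[OF p(1)] by (simp add: inv_mult_group)
  then have "g\<otimes>inv p\<in>K \<union> (\<lambda>a. inv a) ` K" using p(2) UK(4) by blast
  then have 1: "1\<le>\<psi> (g\<otimes>inv p)" using \<psi>(3) by blast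
  have "\<psi> (g\<otimes>inv p)\<le>S \<psi> g" unfolding S_def
   by (rule member_le_sum[where f="\<lambda>p. \<psi> (g\<otimes>inv p)"]) (use 1 p(1) \<psi>(2) fin[OF \<psi>(1) g] in auto)
  then show ?thesis using 1 by linarith
 qed
 then have "M (\<lambda>_. 1)\<le>J \<psi>" unfolding J_def by (intro means_mono[OF M UL_const S_UL[OF \<psi>(1)]]) auto
 then have "1\<le>J \<psi>" using meansD(4)[OF M] by simp
 then have "J (\<lambda>x. (1 / J \<psi>) * \<psi> x) = 1" using haarD(2)[OF J \<psi>(1), of "1 / J \<psi>"] by simp
 then show ?thesis using J CC_scale[OF \<psi>(1)] by blast
qed

lemma BC_add: "k\<in>BC ==> l\<in>BC ==> (\<lambda>x. k x + l x)\<in>BC"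
 unfolding BC_def by (auto intro!: continuous_map_add) (meson abs_triangle_ineq add_mono order_trans)

text \<open>Smoothing: for \<open>k \<in> BC\<close> the convolution \<open>N k \<theta>\<close> with \<open>\<theta> \<in> CC\<close> lies in \<open>UL\<close>. As a functional of \<open>\<theta>\<close> its mean is left
invariant, hence \<open>c k * J \<theta>\<close> by uniqueness. A left translate of \<open>k\<close> amounts to a right translate of \<open>\<theta>\<close>, and right
translation multiplies \<open>J\<close> by a constant, which cancels; so \<open>c\<close> is invariant.\<close>
lemma mean_BC:
 "\<exists>c. (\<forall>k\<in>BC. \<forall>l\<in>BC. c (\<lambda>x. k x + l x) = c k + (c l :: real)) \<and> (\<forall>k\<in>BC. (\<forall>x\<in>carrier H. 0\<le>k x) --> 0\<le>c k) \<and>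
  c (\<lambda>_. 1) = 1 \<and> (\<forall>k\<in>BC. \<forall>w\<in>carrier H. (\<forall>x\<in>carrier H. 0\<le>k x) --> c (\<lambda>x. k (w\<otimes>x)) = c k) \<and>
  (\<forall>k\<in>BC. \<forall>l\<in>BC. (\<forall>x\<in>carrier H. k x = l x) --> c k = c l)"
proof -
 obtain J f0 where J: "haar J" and f0: "f0\<in>CC" "J f0 = 1" using haar_exists by blast
 define N where "N = (\<lambda>k \<theta> g. J (\<lambda>x. \<theta> x * k (inv x\<otimes>g)))"
 have kC: "continuous_map T euclideanreal (\<lambda>x. k (inv x\<otimes>g))" if k: "k\<in>BC" and g: "g\<in>carrier H" for k g
 proof -
  have "continuous_map T T (\<lambda>x. inv x\<otimes>g)" by (intro cmult cinv cid cconst g)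
  then show ?thesis using continuous_map_compose[of T T "\<lambda>x. inv x\<otimes>g" euclideanreal k] k by (simp add: o_def BC_def)
 qed
 have tk: "(\<lambda>x. \<theta> x * k (inv x\<otimes>g))\<in>CC" if "\<theta>\<in>CC" "k\<in>BC" "g\<in>carrier H" for \<theta> k g
  by (rule CC_mult[OF that(1) kC[OF that(2,3)]])
 have N_trans: "N k \<theta> (v\<otimes>g) = N k (\<lambda>x. \<theta> (v\<otimes>x)) g" if \<theta>: "\<theta>\<in>CC" and k: "k\<in>BC" and v: "v\<in>carrier H" and g: "g\<in>carrier H" for k \<theta> v g
 proof -
  have vg: "v\<otimes>g\<in>carrier H" using v g by simp
  have "N k \<theta> (v\<otimes>g) = J (\<lambda>x. \<theta> (v\<otimes>x) * k (inv (v\<otimes>x)\<otimes>(v\<otimes>g)))"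
   unfolding N_def by (rule haarD(4)[OF J tk[OF \<theta> k vg] v, symmetric])
  also have "\<dots> = N k (\<lambda>x. \<theta> (v\<otimes>x)) g" unfolding N_def
   by (rule haar_cong[OF J CC_left[OF tk[OF \<theta> k vg] v] tk[OF CC_left[OF \<theta> v] k g]]) (use v g in \<open>simp add: inv_mult_group m_assoc\<close>)
  finally show ?thesis .
 qed
 have N_le: "\<bar>N k \<theta> g\<bar>\<le>B * J \<phi>" if \<theta>: "\<theta>\<in>CC" and k: "k\<in>BC" and g: "g\<in>carrier H" and \<phi>: "\<phi>\<in>CC"
   and le: "\<forall>x\<in>carrier H. \<bar>\<theta> x\<bar>\<le>\<phi> x" and B: "\<forall>x\<in>carrier H. \<bar>k x\<bar>\<le>B" for k \<theta> \<phi> g B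
 proof -
  have "\<bar>N k \<theta> g\<bar>\<le>J (\<lambda>x. B * \<phi> x)" unfolding N_def
  proof (rule haar_abs_le[OF J tk[OF \<theta> k g] CC_scale[OF \<phi>]])
   fix x assume x: "x\<in>carrier H"
   then have "\<bar>\<theta> x\<bar> * \<bar>k (inv x\<otimes>g)\<bar>\<le>\<phi> x * B" using le B g by (intro mult_mono) (auto intro: order_trans[OF abs_ge_zero])
   then show "\<bar>\<theta> x * k (inv x\<otimes>g)\<bar>\<le>B * \<phi> x" by (simp add: abs_mult mult.commute)
  qed
  then show ?thesis using haarD(2)[OF J \<phi>] by simp
 qed
 have N_UL: "N k \<theta>\<in>UL" if \<theta>: "\<theta>\<in>CC" and k: "k\<in>BC" for k \<theta>
 proof -
  obtain B0 where B0: "\<forall>x\<in>carrier H. \<bar>k x\<bar>\<le>B0" using k by (auto simp: BC_def)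
  define B where "B = \<bar>B0\<bar>"
  have B: "\<forall>x\<in>carrier H. \<bar>k x\<bar>\<le>B" "0\<le>B" using B0 unfolding B_def by force+
  obtain \<psi> where \<psi>: "\<psi>\<in>CC" "\<forall>x. 0\<le>\<psi> x" "\<forall>\<epsilon>>0. \<exists>V. openin T V \<and> \<one>\<in>V \<and> (\<forall>v\<in>V. \<forall>x\<in>carrier H. \<bar>\<theta> (v\<otimes>x) - \<theta> x\<bar>\<le>\<epsilon> * \<psi> x)"
   using left_uniform_dominated[OF \<theta>] by blast
  have J\<psi>: "0\<le>J \<psi>" by (rule haarD(3)[OF J \<psi>(1)]) (use \<psi>(2) in blast)
  show ?thesis
  proof (rule ULI)
   show "\<bar>N k \<theta> h\<bar>\<le>B * J (\<lambda>x. \<bar>\<theta> x\<bar>)" if "h\<in>carrier H" for h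
    by (rule N_le[OF \<theta> k that CC_abs[OF \<theta>] _ B(1)]) simp
   fix \<epsilon> :: real assume e: "0 < \<epsilon>"
   define \<epsilon>' where "\<epsilon>' = \<epsilon> / (B * J \<psi> + 1)"
   have BJ: "0\<le>B * J \<psi>" using B(2) J\<psi> by simp
   have e': "0 < \<epsilon>'" "B * (\<epsilon>' * J \<psi>) < \<epsilon>" using e BJ unfolding \<epsilon>'_def by (auto simp: field_simps)
   obtain V where V: "openin T V" "\<one>\<in>V" "\<forall>v\<in>V. \<forall>x\<in>carrier H. \<bar>\<theta> (v\<otimes>x) - \<theta> x\<bar>\<le>\<epsilon>' * \<psi> x"
    using mp[OF spec[OF \<psi>(3)] e'(1)] by (elim exE conjE)
   have "\<bar>N k \<theta> (v\<otimes>g) - N k \<theta> g\<bar> < \<epsilon>" if v: "v\<in>V" and g: "g\<in>carrier H" for v g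
   proof -
    have vH: "v\<in>carrier H" using v open_subset[OF V(1)] by blast
    have \<theta>v: "(\<lambda>x. \<theta> (v\<otimes>x))\<in>CC" by (rule CC_left[OF \<theta> vH])
    have "N k \<theta> (v\<otimes>g) - N k \<theta> g = N k (\<lambda>x. \<theta> (v\<otimes>x) - \<theta> x) g"
     using N_trans[OF \<theta> k vH g] haar_diff[OF J tk[OF \<theta>v k g] tk[OF \<theta> k g]] by (simp add: N_def left_diff_distrib)
    also have "\<bar>\<dots>\<bar>\<le>B * J (\<lambda>x. \<epsilon>' * \<psi> x)"
     by (rule N_le[OF CC_diff[OF \<theta>v \<theta>] k g CC_scale[OF \<psi>(1)] _ B(1)]) (use V(3) v in blast)
    also have "\<dots> < \<epsilon>" using e'(2) haarD(2)[OF J \<psi>(1)] by simp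
    finally show ?thesis .
   qed
   then show "\<exists>V. openin T V \<and> \<one>\<in>V \<and> (\<forall>v\<in>V. \<forall>h\<in>carrier H. \<bar>N k \<theta> (v\<otimes>h) - N k \<theta> h\<bar> < \<epsilon>)" using V by blast
  qed
 qed
 have N_haar: "haar (\<lambda>\<theta>. M (N k \<theta>))" if k: "k\<in>BC" and pos: "\<forall>x\<in>carrier H. 0\<le>k x" for k
  unfolding haar_def
 proof (intro conjI ballI allI impI)
  fix f h assume f: "f\<in>CC" and h: "h\<in>CC"
  have "M (N k (\<lambda>x. f x + h x)) = M (\<lambda>g. N k f g + N k h g)"
  proof (rule means_cong[OF M N_UL[OF CC_add[OF f h] k]])
   fix g assume g: "g\<in>carrier H"
   show "N k (\<lambda>x. f x + h x) g = N k f g + N k h g"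
    unfolding N_def using haarD(1)[OF J tk[OF f k g] tk[OF h k g]] by (simp add: distrib_right)
  qed
  then show "M (N k (\<lambda>x. f x + h x)) = M (N k f) + M (N k h)" using meansD(1)[OF M N_UL[OF f k] N_UL[OF h k]] by simp
 next
  fix f c assume f: "f\<in>CC"
  have "M (N k (\<lambda>x. c * f x)) = M (\<lambda>g. c * N k f g)"
  proof (rule means_cong[OF M N_UL[OF CC_scale[OF f] k]])
   fix g assume g: "g\<in>carrier H"
   show "N k (\<lambda>x. c * f x) g = c * N k f g"
    unfolding N_def using haarD(2)[OF J tk[OF f k g]] by (simp add: mult.assoc)
  qed
  then show "M (N k (\<lambda>x. c * f x)) = c * M (N k f)" using meansD(2)[OF M N_UL[OF f k]] by simp
 next
  fix f assume f: "f\<in>CC" "\<forall>x\<in>carrier H. 0\<le>f x"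
  show "0\<le>M (N k f)"
  proof (rule meansD(3)[OF M N_UL[OF f(1) k]])
   fix g assume g: "g\<in>carrier H"
   show "0\<le>N k f g" unfolding N_def by (rule haarD(3)[OF J tk[OF f(1) k g]]) (use f(2) pos g in simp)
  qed
 next
  fix f a assume f: "f\<in>CC" and a: "a\<in>carrier H"
  have "M (N k (\<lambda>x. f (a\<otimes>x))) = M (\<lambda>g. N k f (a\<otimes>g))"
   by (rule means_cong[OF M N_UL[OF CC_left[OF f a] k]]) (use N_trans[OF f k a] in simp)
  then show "M (N k (\<lambda>x. f (a\<otimes>x))) = M (N k f)" using inv[OF N_UL[OF f k] a] by simp
 qed
 define c where "c = (\<lambda>k. M (N k f0))"
 have cN: "M (N k \<theta>) = c k * J \<theta>" if "k\<in>BC" "\<forall>x\<in>carrier H. 0\<le>k x" "\<theta>\<in>CC" for k \<theta>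
  using haar_unique[OF J N_haar[OF that(1,2)] that(3) f0(1)] f0(2) by (simp add: c_def)
 have ccong: "c k = c l" if k: "k\<in>BC" "l\<in>BC" "\<forall>x\<in>carrier H. k x = l x" for k l
  unfolding c_def
 proof (rule means_cong[OF M N_UL[OF f0(1) k(1)]])
  fix g assume g: "g\<in>carrier H"
  show "N k f0 g = N l f0 g" unfolding N_def
   by (rule haar_cong[OF J tk[OF f0(1) k(1) g] tk[OF f0(1) k(2) g]]) (use k(3) g in simp)
 qed
 show ?thesis
 proof (rule exI[of _ c], intro conjI ballI allI impI)
  fix k l assume k: "k\<in>BC" and l: "l\<in>BC"
  have "c (\<lambda>x. k x + l x) = M (\<lambda>g. N k f0 g + N l f0 g)" unfolding c_def
  proof (rule means_cong[OF M N_UL[OF f0(1) BC_add[OF k l]]])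
   fix g assume g: "g\<in>carrier H"
   show "N (\<lambda>x. k x + l x) f0 g = N k f0 g + N l f0 g"
    unfolding N_def using haarD(1)[OF J tk[OF f0(1) k g] tk[OF f0(1) l g]] by (simp add: distrib_left)
  qed
  then show "c (\<lambda>x. k x + l x) = c k + c l" unfolding c_def using meansD(1)[OF M N_UL[OF f0(1) k] N_UL[OF f0(1) l]] by simp
 next
  fix k assume k: "k\<in>BC" "\<forall>x\<in>carrier H. 0\<le>k x"
  have "0\<le>c k * J (\<lambda>x. \<bar>f0 x\<bar>)" using cN[OF k CC_abs[OF f0(1)]] haarD(3)[OF N_haar[OF k] CC_abs[OF f0(1)]] by simp
  moreover have "1\<le>J (\<lambda>x. \<bar>f0 x\<bar>)" using haar_abs_le[OF J f0(1) CC_abs[OF f0(1)]] f0(2) by simp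
  ultimately show "0\<le>c k" by (simp add: zero_le_mult_iff)
 next
  have "N (\<lambda>_. 1) f0 g = 1" for g unfolding N_def using f0(2) by simp
  then have "N (\<lambda>_. 1) f0 = (\<lambda>_. 1)" by blast
  then show "c (\<lambda>_. 1) = 1" unfolding c_def using meansD(4)[OF M] by simp
 next
  fix k w assume k: "k\<in>BC" and w: "w\<in>carrier H" and pos: "\<forall>x\<in>carrier H. 0\<le>k x"
  define Jw where "Jw = (\<lambda>f. J (\<lambda>x. f (x\<otimes>inv w)))"
  have iw: "inv w\<in>carrier H" using w by simp
  have Jw: "haar Jw" unfolding haar_def
  proof (intro conjI ballI allI impI)
   fix f a assume f: "f\<in>CC" and a: "a\<in>carrier H"
   show "Jw (\<lambda>x. f (a\<otimes>x)) = Jw f" unfolding Jw_def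
    using haarD(4)[OF J CC_right[OF f iw] a] haar_cong[OF J CC_left[OF CC_right[OF f iw] a] CC_right[OF CC_left[OF f a] iw]] a w
    by (simp add: m_assoc)
  qed (use haarD(1-3)[OF J] CC_right[OF _ iw] w in \<open>simp_all add: Jw_def\<close>)
  have f0w: "(\<lambda>x. f0 (x\<otimes>w))\<in>CC" by (rule CC_right[OF f0(1) w])
  have kw: "(\<lambda>x. k (w\<otimes>x))\<in>BC"
  proof -
   have "continuous_map T euclideanreal (\<lambda>x. k (w\<otimes>x))"
    using continuous_map_compose[OF ltrans[OF w], of euclideanreal k] k by (simp add: o_def BC_def)
   then show ?thesis using k w by (auto simp: BC_def)
  qed
  have *: "N (\<lambda>x. k (w\<otimes>x)) f0 g = Jw f0 * N k (\<lambda>x. f0 (x\<otimes>w)) g" if g: "g\<in>carrier H" for g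
  proof -
   let ?q = "\<lambda>y. f0 (y\<otimes>w) * k (inv y\<otimes>g)"
   have q: "?q\<in>CC" by (rule tk[OF f0w k g])
   have "N (\<lambda>x. k (w\<otimes>x)) f0 g = Jw ?q" unfolding N_def Jw_def
    by (rule haar_cong[OF J tk[OF f0(1) kw g] CC_right[OF q iw]]) (use w g in \<open>simp add: inv_mult_group m_assoc\<close>)
   also have "\<dots> = Jw f0 * J ?q" using haar_unique[OF J Jw q f0(1)] f0(2) by simp
   finally show ?thesis by (simp add: N_def)
  qed
  have "c (\<lambda>x. k (w\<otimes>x)) = M (\<lambda>g. Jw f0 * N k (\<lambda>x. f0 (x\<otimes>w)) g)" unfolding c_def
   by (rule means_cong[OF M N_UL[OF f0(1) kw]]) (rule *)
  also have "\<dots> = Jw f0 * (c k * J (\<lambda>x. f0 (x\<otimes>w)))"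
   using meansD(2)[OF M N_UL[OF f0w k]] cN[OF k pos f0w] by simp
  also have "\<dots> = c k * (Jw f0 * J (\<lambda>x. f0 (x\<otimes>w)))" by simp
  also have "Jw f0 * J (\<lambda>x. f0 (x\<otimes>w)) = Jw (\<lambda>x. f0 (x\<otimes>w))"
   using haar_unique[OF J Jw f0w f0(1)] f0(2) by simp
  also have "Jw (\<lambda>x. f0 (x\<otimes>w)) = J f0" unfolding Jw_def
   by (rule haar_cong[OF J CC_right[OF f0w iw] f0(1)]) (use w in \<open>simp add: m_assoc\<close>)
  finally show "c (\<lambda>x. k (w\<otimes>x)) = c k" using f0(2) by (simp add: algebra_simps)
 next
  fix k l assume "k\<in>BC" "l\<in>BC" "\<forall>x\<in>carrier H. k x = l x"
  then show "c k = c l" by (rule ccong)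
 qed
qed

end

section \<open>Invariant means and discrete free subgroups\<close>

lemma continuous_map_suminf:
 fixes f :: "nat => 'x => real"
 assumes cont: "\<And>i. continuous_map X euclideanreal (f i)" and bd: "\<And>i x. x\<in>topspace X ==> \<bar>f i x\<bar>\<le>(1/2)^i"
 shows "continuous_map X euclideanreal (\<lambda>x. (suminf (\<lambda>i. f i x)))"
proof (rule continuous_map_realI)
 fix x and \<epsilon> :: real assume x: "x\<in>topspace X" and e: "0 < \<epsilon>"
 have "uniform_limit (topspace X) (\<lambda>n x. \<Sum>i<n. f i x) (\<lambda>x. (suminf (\<lambda>i. f i x))) sequentially"
  by (rule Weierstrass_m_test[of _ _ "\<lambda>i. (1/2)^i"]) (use bd in \<open>auto simp: summable_geometric\<close>)
 then have "\<forall>\<^sub>F n in sequentially. \<forall>x\<in>topspace X. dist (\<Sum>i<n. f i x) (suminf (\<lambda>i. f i x)) < \<epsilon>/3"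
  using e by (intro uniform_limitD) auto
 then obtain n where n: "\<forall>x\<in>topspace X. \<bar>(\<Sum>i<n. f i x) - (suminf (\<lambda>i. f i x))\<bar> < \<epsilon>/3"
  unfolding eventually_sequentially dist_real_def by blast
 have "continuous_map X euclideanreal (\<lambda>x. \<Sum>i<n. f i x)" by (intro continuous_map_sum cont) simp
 then have op: "openin X {y\<in>topspace X. (\<Sum>i<n. f i y)\<in>{(\<Sum>i<n. f i x) - \<epsilon>/3<..<(\<Sum>i<n. f i x) + \<epsilon>/3}}"
  by (rule openin_continuous_map_preimage) simp
 show "\<exists>U. openin X U \<and> x\<in>U \<and> (\<forall>y\<in>U. \<bar>(suminf (\<lambda>i. f i y)) - (suminf (\<lambda>i. f i x))\<bar> < \<epsilon>)"
 proof (intro exI conjI ballI, rule op)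
  show "x\<in>{y\<in>topspace X. (\<Sum>i<n. f i y)\<in>{(\<Sum>i<n. f i x) - \<epsilon>/3<..<(\<Sum>i<n. f i x) + \<epsilon>/3}}" using x e by simp
  fix y assume y: "y\<in>{y\<in>topspace X. (\<Sum>i<n. f i y)\<in>{(\<Sum>i<n. f i x) - \<epsilon>/3<..<(\<Sum>i<n. f i x) + \<epsilon>/3}}"
  then have "\<bar>(\<Sum>i<n. f i y) - (suminf (\<lambda>i. f i y))\<bar> < \<epsilon>/3" "\<bar>(\<Sum>i<n. f i x) - (suminf (\<lambda>i. f i x))\<bar> < \<epsilon>/3" using n x by auto
  moreover have "\<bar>(\<Sum>i<n. f i y) - (\<Sum>i<n. f i x)\<bar> < \<epsilon>/3" using y unfolding mem_Collect_eq greaterThanLessThan_iff abs_less_iff by linarith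
  ultimately show "\<bar>(suminf (\<lambda>i. f i y)) - (suminf (\<lambda>i. f i x))\<bar> < \<epsilon>" by linarith
 qed
qed

context inv_mean begin

text \<open>A Bruhat function: from a bump at the identity one builds a continuous function \<open>N A\<close> for each \<open>A \<subseteq> L\<close>, additive in \<open>A\<close> and
equivariant under \<open>L\<close>, with \<open>N L > 0\<close> everywhere. The measure of \<open>A\<close> is the mean of \<open>N A / N L\<close>. This quotient is
continuous and bounded but in general not in \<open>UL\<close>, which is why \<open>mean_BC\<close> is needed.\<close>
lemma discrete_subgroup_mean:
 assumes sc: "second_countable_space T" and L: "subgroup L H" and V: "openin T V" "L \<inter> V = {\<one>}"
 shows "\<exists>m :: 'h set => real. (\<forall>A\<subseteq>L. 0\<le>m A) \<and> m L = 1 \<and>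
  (\<forall>A\<subseteq>L. \<forall>B\<subseteq>L. A \<inter> B = {} --> m (A \<union> B) = m A + m B) \<and>
  (\<forall>A\<subseteq>L. \<forall>u\<in>L. m ((\<lambda>x. u\<otimes>x) ` A) = m A)"
proof -
 have LH: "w\<in>carrier H" if "w\<in>L" for w using subgroup.mem_carrier[OF L that] .
 have Lm: "w\<otimes>u\<in>L" if "w\<in>L" "u\<in>L" for w u using subgroup.m_closed[OF L that] .
 have Li: "inv w\<in>L" if "w\<in>L" for w using subgroup.m_inv_closed[OF L that] .
 have V1: "\<one>\<in>V" using V(2) by blast
 obtain W where W: "openin T W" "\<one>\<in>W" "\<forall>x\<in>W. \<forall>y\<in>W. inv x\<otimes>y\<in>V \<and> x\<otimes>inv y\<in>V \<and> x\<otimes>y\<in>V"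
  using one_nbhd_quot[OF V(1) V1] by blast
 obtain W2 where W2: "openin T W2" "\<one>\<in>W2" "\<forall>x\<in>W2. \<forall>y\<in>W2. inv x\<otimes>y\<in>W \<and> x\<otimes>inv y\<in>W \<and> x\<otimes>y\<in>W"
  using one_nbhd_quot[OF W(1,2)] by blast
 obtain W3 where W3: "openin T W3" "\<one>\<in>W3" "\<forall>x\<in>W3. \<forall>y\<in>W3. inv x\<otimes>y\<in>W2 \<and> x\<otimes>inv y\<in>W2 \<and> x\<otimes>y\<in>W2"
  using one_nbhd_quot[OF W2(1,2)] by blast
 have W2H: "x\<in>carrier H" if "x\<in>W2" for x using that open_subset[OF W2(1)] by blast
 have W2W: "x\<in>W" if "x\<in>W2" for x using W2(3)[rule_format, OF that W2(2)] W2H[OF that] by simp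
 obtain \<phi> where \<phi>: "\<phi>\<in>CC" "\<forall>x. 0\<le>\<phi> x \<and> \<phi> x\<le>1" "\<phi> \<one> = 1" "\<forall>x\<in>carrier H - W2. \<phi> x = 0"
  using bump[OF W2(1,2)] by blast
 \<comment> \<open>Near any point at most one \<open>L\<close>-translate of the bump \<open>\<phi>\<close> is non-zero, so \<open>\<Theta>\<close> is continuous.\<close>
 have one_term: "u = w" if u: "u\<in>L" "w\<in>L" and y: "y\<in>carrier H" "z\<in>carrier H" "inv y\<otimes>z\<in>W2"
  "\<phi> (inv u\<otimes>y)\<noteq>0" "\<phi> (inv w\<otimes>z)\<noteq>0" for u w y z
 proof -
  have cl: "u\<in>carrier H" "w\<in>carrier H" using u LH by auto
  have 1: "inv u\<otimes>y\<in>W2" "inv w\<otimes>z\<in>W2" using \<phi>(4) y cl by auto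
  then have "(inv u\<otimes>y)\<otimes>(inv y\<otimes>z)\<in>W" using W2(3) y(3) by blast
  then have "((inv u\<otimes>y)\<otimes>(inv y\<otimes>z))\<otimes>inv (inv w\<otimes>z)\<in>V" using W(3) W2W[OF 1(2)] by blast
  also have "((inv u\<otimes>y)\<otimes>(inv y\<otimes>z))\<otimes>inv (inv w\<otimes>z) = inv u\<otimes>w" using cl y by (simp add: m_assoc inv_mult_group)
  finally have "inv u\<otimes>w = \<one>" using V(2) Lm[OF Li[OF u(1)] u(2)] by blast
  then have "u\<otimes>(inv u\<otimes>w) = u" using cl by simp
  then show ?thesis using cl by simp
 qed
 define \<Theta> where "\<Theta> = (\<lambda>A x. \<Sum>w\<in>{w\<in>A. \<phi> (inv w\<otimes>x)\<noteq>0}. \<phi> (inv w\<otimes>x))"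
 have \<Theta>_eq: "\<Theta> A x = (if w\<in>A then \<phi> (inv w\<otimes>x) else 0)"
  if A: "A\<subseteq>L" and w: "\<And>u. u\<in>L ==> \<phi> (inv u\<otimes>x)\<noteq>0 ==> u = w" for A x w
 proof -
  have "{w\<in>A. \<phi> (inv w\<otimes>x)\<noteq>0} = (if w\<in>A \<and> \<phi> (inv w\<otimes>x)\<noteq>0 then {w} else {})"
   using A w by auto
  then show ?thesis unfolding \<Theta>_def by auto
 qed
 have loc: "\<exists>U w. openin T U \<and> x\<in>U \<and> w\<in>L \<and> (\<forall>y\<in>U. \<forall>u\<in>L. \<phi> (inv u\<otimes>y)\<noteq>0 --> u = w)" if x: "x\<in>carrier H" for x
 proof -
  define U where "U = (\<lambda>y. x\<otimes>y) ` W3"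
  have U: "openin T U" "x\<in>U" unfolding U_def using open_ltrans[OF x W3(1)] W3(2) x by force+
  have quot: "inv y\<otimes>z\<in>W2" if yz: "y\<in>U" "z\<in>U" for y z
  proof -
   obtain a b where ab: "a\<in>W3" "b\<in>W3" "y = x\<otimes>a" "z = x\<otimes>b" using yz unfolding U_def by blast
   then have "a\<in>carrier H" "b\<in>carrier H" using open_subset[OF W3(1)] by auto
   then have "inv y\<otimes>z = inv a\<otimes>b" using ab x by (simp add: inv_mult_group m_assoc)
   then show ?thesis using W3(3) ab by simp
  qed
  have UH: "y\<in>carrier H" if "y\<in>U" for y using that open_subset[OF U(1)] by blast
  show ?thesis
  proof (cases "\<exists>y\<in>U. \<exists>u\<in>L. \<phi> (inv u\<otimes>y)\<noteq>0")
   case True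
   then obtain y0 w where w: "y0\<in>U" "w\<in>L" "\<phi> (inv w\<otimes>y0)\<noteq>0" by blast
   have "\<forall>y\<in>U. \<forall>u\<in>L. \<phi> (inv u\<otimes>y)\<noteq>0 --> u = w"
    using one_term[OF _ w(2) UH UH[OF w(1)] quot[OF _ w(1)] _ w(3)] by blast
   then show ?thesis using U w(2) by blast
  next
   case False
   then show ?thesis using U subgroup.one_closed[OF L] by blast
  qed
 qed
 have loc0: "\<exists>w. \<forall>u\<in>L. \<phi> (inv u\<otimes>x)\<noteq>0 --> u = w" if x: "x\<in>carrier H" for x
  using loc[OF x] by (elim exE conjE) blast
 have \<Theta>_bd: "0\<le>\<Theta> A x \<and> \<Theta> A x\<le>1" if A: "A\<subseteq>L" and x: "x\<in>carrier H" for A x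
 proof -
  obtain w where w: "\<forall>u\<in>L. \<phi> (inv u\<otimes>x)\<noteq>0 --> u = w" using loc0[OF x] by (elim exE)
  have "\<Theta> A x = (if w\<in>A then \<phi> (inv w\<otimes>x) else 0)" by (rule \<Theta>_eq[OF A]) (use w in blast)
  then show ?thesis using \<phi>(2) by simp
 qed
 have \<Theta>_cont: "continuous_map T euclideanreal (\<Theta> A)" if A: "A\<subseteq>L" for A
 proof (rule continuous_map_realI)
  fix x and \<epsilon> :: real assume "x\<in>topspace T" and e: "0 < \<epsilon>"
  then have x: "x\<in>carrier H" by simp
  obtain U w where U: "openin T U" "x\<in>U" "w\<in>L" "\<forall>y\<in>U. \<forall>u\<in>L. \<phi> (inv u\<otimes>y)\<noteq>0 --> u = w" using loc[OF x] by blast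
  have eq: "\<Theta> A y = (if w\<in>A then \<phi> (inv w\<otimes>y) else 0)" if "y\<in>U" for y
   by (rule \<Theta>_eq[OF A]) (use U(4) that in blast)
  have cw: "continuous_map T euclideanreal (\<lambda>y. \<phi> (inv w\<otimes>y))" using CC_cont[OF CC_left[OF \<phi>(1), of "inv w"]] LH[OF U(3)] by simp
  let ?D = "{y\<in>topspace T. \<phi> (inv w\<otimes>y)\<in>{\<phi> (inv w\<otimes>x) - \<epsilon><..<\<phi> (inv w\<otimes>x) + \<epsilon>}}"
  have "openin T ?D" by (rule openin_continuous_map_preimage[OF cw]) simp
  then have "openin T (U \<inter> ?D)" using U(1) by (rule openin_Int[rotated])
  moreover have "x\<in>U \<inter> ?D" using U(2) x e by simp
  moreover have "\<bar>\<Theta> A y - \<Theta> A x\<bar> < \<epsilon>" if y: "y\<in>U \<inter> ?D" for y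
  proof -
   have "\<bar>\<phi> (inv w\<otimes>y) - \<phi> (inv w\<otimes>x)\<bar> < \<epsilon>" using y by (auto simp: abs_less_iff)
   then show ?thesis using eq[of y] eq[OF U(2)] y e by simp
  qed
  ultimately show "\<exists>U. openin T U \<and> x\<in>U \<and> (\<forall>y\<in>U. \<bar>\<Theta> A y - \<Theta> A x\<bar> < \<epsilon>)" by blast
 qed
 have \<Theta>_add: "\<Theta> (A \<union> B) x = \<Theta> A x + \<Theta> B x" if AB: "A\<subseteq>L" "B\<subseteq>L" "A \<inter> B = {}" and x: "x\<in>carrier H" for A B x
 proof -
  obtain w where "\<forall>u\<in>L. \<phi> (inv u\<otimes>x)\<noteq>0 --> u = w" using loc0[OF x] by (elim exE)
  then have "\<And>u. u\<in>L ==> \<phi> (inv u\<otimes>x)\<noteq>0 ==> u = w" by blast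
  note eq = \<Theta>_eq[OF _ this]
  have "A \<union> B\<subseteq>L" using AB by blast
  from eq[OF this] eq[OF AB(1)] eq[OF AB(2)] show ?thesis using AB(3) by auto
 qed
 have \<Theta>_trans: "\<Theta> ((\<lambda>x. u\<otimes>x) ` A) x = \<Theta> A (inv u\<otimes>x)" if A: "A\<subseteq>L" and u: "u\<in>L" and x: "x\<in>carrier H" for A u x
 proof -
  have eq: "inv (u\<otimes>w)\<otimes>x = inv w\<otimes>(inv u\<otimes>x)" if "w\<in>A" for w
   using LH[OF u] LH[of w] A that x by (auto simp: inv_mult_group m_assoc)
  have inj: "inj_on (\<lambda>x. u\<otimes>x) {w\<in>A. \<phi> (inv w\<otimes>(inv u\<otimes>x))\<noteq>0}"
  proof (rule inj_onI)
   fix y z assume "y\<in>{w\<in>A. \<phi> (inv w\<otimes>(inv u\<otimes>x))\<noteq>0}" "z\<in>{w\<in>A. \<phi> (inv w\<otimes>(inv u\<otimes>x))\<noteq>0}"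
   then have "y\<in>carrier H" "z\<in>carrier H" using A LH by auto
   then show "u\<otimes>y = u\<otimes>z ==> y = z" using LH[OF u] by simp
  qed
  have "{w\<in>(\<lambda>x. u\<otimes>x) ` A. \<phi> (inv w\<otimes>x)\<noteq>0} = (\<lambda>x. u\<otimes>x) ` {w\<in>A. \<phi> (inv w\<otimes>(inv u\<otimes>x))\<noteq>0}"
   using eq by auto
  then have "\<Theta> ((\<lambda>x. u\<otimes>x) ` A) x = (\<Sum>w\<in>{w\<in>A. \<phi> (inv w\<otimes>(inv u\<otimes>x))\<noteq>0}. \<phi> (inv (u\<otimes>w)\<otimes>x))"
   unfolding \<Theta>_def by (simp add: sum.reindex[OF inj])
  also have "\<dots> = \<Theta> A (inv u\<otimes>x)" unfolding \<Theta>_def by (rule sum.cong) (use eq in auto)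
  finally show ?thesis .
 qed
 define V' where "V' = {y\<in>topspace T. \<phi> (inv y)\<in>{0<..}}"
 have "openin T V'" unfolding V'_def by (rule openin_continuous_map_preimage[OF CC_cont[OF CC_inv[OF \<phi>(1)]]]) simp
 moreover have "\<one>\<in>V'" unfolding V'_def using \<phi>(3) by simp
 ultimately obtain d :: "nat => 'h" where d: "\<forall>n. d n\<in>carrier H" "\<forall>x\<in>carrier H. \<exists>n. inv (d n)\<otimes>x\<in>V'"
  using countable_translates_cover[OF sc] by blast
 have dH: "d n\<in>carrier H" for n using d(1) by blast
 \<comment> \<open>The right translates by \<open>d i\<close> make \<open>N L\<close> positive everywhere; the weights make the sum converge.\<close>
 define t where "t = (\<lambda>A i g. (1/2::real)^i * \<Theta> A (g\<otimes>d i))"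
 have t_bd: "0\<le>t A i g" "\<bar>t A i g\<bar>\<le>(1/2)^i" if "A\<subseteq>L" "g\<in>carrier H" for A i g
  using \<Theta>_bd[OF that(1), of "g\<otimes>d i"] that(2) dH by (auto simp: t_def abs_mult)
 have t_sum: "summable (\<lambda>i. t A i g)" if "A\<subseteq>L" "g\<in>carrier H" for A g
  by (rule summable_comparison_test'[of "\<lambda>i. (1/2)^i" 0]) (use t_bd[OF that] in \<open>auto simp: summable_geometric\<close>)
 define N where "N = (\<lambda>A g. suminf (\<lambda>i. t A i g))"
 have N_cont: "continuous_map T euclideanreal (N A)" if A: "A\<subseteq>L" for A
  unfolding N_def
 proof (rule continuous_map_suminf)
  show "continuous_map T euclideanreal (t A i)" for i unfolding t_def
   using continuous_map_compose[OF rtrans[OF dH] \<Theta>_cont[OF A]] by (intro continuous_map_real_mult) (simp_all add: o_def)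
  show "\<bar>t A i x\<bar>\<le>(1/2)^i" if "x\<in>topspace T" for i x using t_bd(2)[OF A] that by simp
 qed
 have N_nonneg: "0\<le>N A g" if "A\<subseteq>L" "g\<in>carrier H" for A g
  unfolding N_def by (rule suminf_nonneg[OF t_sum[OF that]]) (use t_bd[OF that] in simp)
 have N_pos: "0 < N L g" if g: "g\<in>carrier H" for g
 proof -
  obtain n where n: "inv (d n)\<otimes>inv g\<in>V'" using d(2) g by (meson inv_closed)
  then have "0 < \<phi> (inv \<one>\<otimes>(g\<otimes>d n))" using g dH by (simp add: V'_def inv_mult_group)
  moreover have gd: "g\<otimes>d n\<in>carrier H" using g dH by simp
  obtain w where "\<forall>u\<in>L. \<phi> (inv u\<otimes>(g\<otimes>d n))\<noteq>0 --> u = w" using loc0[OF gd] by (elim exE)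
  then have w: "\<And>u. u\<in>L ==> \<phi> (inv u\<otimes>(g\<otimes>d n))\<noteq>0 ==> u = w" by blast
  then have "w = \<one>" using w[OF subgroup.one_closed[OF L]] calculation by force
  ultimately have "0 < \<Theta> L (g\<otimes>d n)" using \<Theta>_eq[OF subset_refl w] subgroup.one_closed[OF L] by simp
  then have "0 < t L n g" by (simp add: t_def)
  then show ?thesis unfolding N_def by (intro suminf_pos2[OF t_sum[OF subset_refl g]]) (use t_bd(1)[OF subset_refl g] in auto)
 qed
 have N_add: "N (A \<union> B) g = N A g + N B g" if AB: "A\<subseteq>L" "B\<subseteq>L" "A \<inter> B = {}" and g: "g\<in>carrier H" for A B g
 proof -
  have "t (A \<union> B) i g = t A i g + t B i g" for i using \<Theta>_add[OF AB, of "g\<otimes>d i"] g dH by (simp add: t_def distrib_left)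
  then show ?thesis unfolding N_def using suminf_add[OF t_sum[OF AB(1) g] t_sum[OF AB(2) g]] by simp
 qed
 have N_trans: "N ((\<lambda>x. u\<otimes>x) ` A) g = N A (inv u\<otimes>g)" if "A\<subseteq>L" "u\<in>L" "g\<in>carrier H" for A u g
  unfolding N_def t_def using \<Theta>_trans[OF that(1,2)] that dH LH by (simp add: m_assoc)
 have uL: "(\<lambda>x. u\<otimes>x) ` L = L" if u: "u\<in>L" for u
 proof (intro equalityI subsetI)
  fix x assume x: "x\<in>L"
  then have "x = u\<otimes>(inv u\<otimes>x)" using LH u by simp
  then show "x\<in>(\<lambda>x. u\<otimes>x) ` L" using Lm[OF Li[OF u] x] by blast
 qed (use Lm u in auto)
 define k where "k = (\<lambda>A g. N A g / N L g)"
 have k_le: "N A g\<le>N L g" if A: "A\<subseteq>L" and g: "g\<in>carrier H" for A g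
 proof -
  have "A \<union> (L - A) = L" using A by blast
  then show ?thesis using N_add[OF A _ _ g, of "L - A"] N_nonneg[OF _ g, of "L - A"] by auto
 qed
 have k_nonneg: "\<forall>g\<in>carrier H. 0\<le>k A g" if A: "A\<subseteq>L" for A
  unfolding k_def using N_nonneg[OF A] N_pos by (simp add: less_imp_le)
 have k_BC: "k A\<in>BC" if A: "A\<subseteq>L" for A
  unfolding BC_def
 proof (intro CollectI conjI exI[of _ 1] ballI)
  show "continuous_map T euclideanreal (k A)" unfolding k_def
   using N_pos by (intro continuous_map_real_divide N_cont A) force+
  fix g assume g: "g\<in>carrier H"
  show "\<bar>k A g\<bar>\<le>1" using N_nonneg[OF A g] k_le[OF A g] N_pos[OF g] by (simp add: k_def)
 qed
 obtain c where c: "\<forall>k\<in>BC. \<forall>l\<in>BC. c (\<lambda>x. k x + l x) = c k + (c l :: real)"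
  "\<forall>k\<in>BC. (\<forall>x\<in>carrier H. 0\<le>k x) --> 0\<le>c k"
  "c (\<lambda>_. 1) = 1" "\<forall>k\<in>BC. \<forall>w\<in>carrier H. (\<forall>x\<in>carrier H. 0\<le>k x) --> c (\<lambda>x. k (w\<otimes>x)) = c k"
  "\<forall>k\<in>BC. \<forall>l\<in>BC. (\<forall>x\<in>carrier H. k x = l x) --> c k = c l" using mean_BC by blast
 have one: "(\<lambda>_. 1)\<in>BC" by (auto simp: BC_def)
 show ?thesis
 proof (rule exI[of _ "\<lambda>A. c (k A)"], intro conjI allI impI ballI)
  show "0\<le>c (k A)" if "A\<subseteq>L" for A using c(2) k_BC[OF that] k_nonneg[OF that] by blast
  have "c (k L) = c (\<lambda>_. 1)"
   using c(5)[rule_format, OF k_BC[OF subset_refl] one] N_pos by (force simp: k_def)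
  then show "c (k L) = 1" using c(3) by simp
  show "c (k (A \<union> B)) = c (k A) + c (k B)" if AB: "A\<subseteq>L" "B\<subseteq>L" "A \<inter> B = {}" for A B
  proof -
   have "A \<union> B\<subseteq>L" using AB by blast
   then have "c (k (A \<union> B)) = c (\<lambda>g. k A g + k B g)"
    using c(5)[rule_format, OF k_BC BC_add[OF k_BC[OF AB(1)] k_BC[OF AB(2)]]] N_add[OF AB] by (simp add: k_def add_divide_distrib)
   then show ?thesis using c(1) k_BC AB(1,2) by simp
  qed
  show "c (k ((\<lambda>x. u\<otimes>x) ` A)) = c (k A)" if A: "A\<subseteq>L" and u: "u\<in>L" for A u
  proof -
   have uA: "(\<lambda>x. u\<otimes>x) ` A\<subseteq>L" using A u Lm by auto
   have iu: "inv u\<in>carrier H" using LH[OF u] by simp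
   have sh: "(\<lambda>g. k A (inv u\<otimes>g))\<in>BC"
   proof -
    have "continuous_map T euclideanreal (\<lambda>g. k A (inv u\<otimes>g))"
     using continuous_map_compose[OF ltrans[OF iu], of euclideanreal "k A"] k_BC[OF A] by (simp add: o_def BC_def)
    then show ?thesis using k_BC[OF A] iu by (auto simp: BC_def)
   qed
   have "k ((\<lambda>x. u\<otimes>x) ` A) g = k A (inv u\<otimes>g)" if g: "g\<in>carrier H" for g
    using N_trans[OF A u g] N_trans[OF subset_refl u g] uL[OF u] by (simp add: k_def)
   then have "c (k ((\<lambda>x. u\<otimes>x) ` A)) = c (\<lambda>g. k A (inv u\<otimes>g))"
    using c(5)[rule_format, OF k_BC[OF uA] sh] by blast
   also have "\<dots> = c (k A)" using c(4) k_BC[OF A] iu k_nonneg[OF A] by blast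
   finally show ?thesis .
  qed
 qed
qed

end

context ep_action begin

text \<open>Each of the two pairs of opposite letters would carry the whole mass, yet the four pieces are disjoint.\<close>
lemma schottky_no_invariant_measure:
 fixes m :: "'a set => real"
 assumes S: "schottky v T O'" and D: "D\<subseteq>carrier \<Gamma>" "\<And>l w. w\<in>D ==> v l\<otimes>w\<in>D"
  and pos: "\<And>A. A\<subseteq>D ==> 0\<le>m A" and one: "m D = 1"
  and add: "\<And>A B. A\<subseteq>D ==> B\<subseteq>D ==> A \<inter> B = {} ==> m (A \<union> B) = m A + m B"
  and inv: "\<And>A l. A\<subseteq>D ==> m ((\<lambda>x. v l\<otimes>x) ` A) = m A"
 shows False
proof -
 obtain x where x: "x\<in>topspace Z" using nonempty by blast
 have vl: "v l\<in>carrier \<Gamma>" for l by (rule schottkyD(3)[OF S])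
 define A where "A = (\<lambda>l. {w\<in>D. \<zeta> w x\<in>T l})"
 have AD: "A l\<subseteq>D" for l by (auto simp: A_def)
 have mono: "m B\<le>m C" if "B\<subseteq>C" "C\<subseteq>D" for B C
 proof -
  have "m C = m B + m (C - B)" using add[of B "C - B"] that by (auto simp: Un_absorb1)
  then show ?thesis using pos[of "C - B"] that by auto
 qed
 have sub: "m (B \<union> C)\<le>m B + m C" if "B\<subseteq>D" "C\<subseteq>D" for B C
 proof -
  have "m (B \<union> C) = m B + m (C - B)" using add[of B "C - B"] that by auto
  then show ?thesis using mono[of "C - B" C] that by auto
 qed
 have half: "1\<le>m (A l) + m (A (fst l, \<not> snd l))" for l
 proof -
  let ?B = "(\<lambda>x. v l\<otimes>x) ` A (fst l, \<not> snd l)"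
  have BD: "?B\<subseteq>D" using D(2) AD by blast
  have "D\<subseteq>A l \<union> ?B"
  proof
   fix w assume w: "w\<in>D"
   then have wc: "w\<in>carrier \<Gamma>" using D(1) by blast
   show "w\<in>A l \<union> ?B"
   proof (cases "\<zeta> w x\<in>T l")
    case True then show ?thesis using w by (simp add: A_def)
   next
    case False
    have "inv (v l) = v (fst l, \<not> snd l)" using schottkyD(7)[OF S] by simp
    then have "inv (v l)\<otimes>w\<in>D" using D(2) w by simp
    moreover have "\<zeta> (inv (v l)\<otimes>w) x\<in>T (fst l, \<not> snd l)"
     using schottky_paradox(1)[OF S wc x, of l] False by (auto split: if_splits)
    ultimately have "inv (v l)\<otimes>w\<in>A (fst l, \<not> snd l)" by (simp add: A_def)
    moreover have "w = v l\<otimes>(inv (v l)\<otimes>w)" using wc vl by simp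
    ultimately show ?thesis by blast
   qed
  qed
  then have "A l \<union> ?B = D" using AD BD by blast
  then have "1\<le>m (A l) + m ?B" using sub[OF AD BD, of l] one by simp
  then show ?thesis using inv[OF AD] by simp
 qed
 have disj: "A l \<inter> A n = {}" if "l\<noteq>n" for l n using schottkyD(6)[OF S, of n l] that by (auto simp: A_def)
 have disj2: "A (False, b) \<inter> A (True, b') = {}" "A (b', False) \<inter> A (b', True) = {}" for b b'
  by (rule disj, simp)+
 let ?a = "A (False, False)" and ?b = "A (False, True)" and ?c = "A (True, False)" and ?d = "A (True, True)"
 have "m (?a \<union> ?b \<union> (?c \<union> ?d)) = m (?a \<union> ?b) + m (?c \<union> ?d)"
  by (rule add) (use AD disj2 in blast)+
 also have "m (?a \<union> ?b) = m ?a + m ?b" by (rule add) (use AD disj2 in blast)+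
 also have "m (?c \<union> ?d) = m ?c + m ?d" by (rule add) (use AD disj2 in blast)+
 finally have "m ?a + m ?b + (m ?c + m ?d)\<le>1" using mono[of "?a \<union> ?b \<union> (?c \<union> ?d)" D] AD one by auto
 then show False using half[of "(False, True)"] half[of "(True, True)"] by simp
qed

end

context micro_action begin

text \<open>By \<open>near_identity_meets\<close> and \<open>schottky_wandering\<close> the image of the ping-pong group is discrete in \<open>H\<close>, and it would inherit
an invariant mean.\<close>
lemma no_invariant_mean:
 assumes H: "lcsc_group H T" and p: "p\<in>hom \<Gamma> H" "inj_on p (carrier \<Gamma>)" and S: "schottky v T' O'"
  and M: "M\<in>mean_class.means H (tgroup.UL H T)" and inv: "\<And>g. g\<in>carrier H ==> M \<circ> mean_class.shift H g = M"
 shows False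
proof -
 have tg: "topological_group H T" and haus: "Hausdorff_space T" using H by (auto simp: lcsc_group_def)
 have sc: "second_countable_space T" using H by (simp add: lcsc_group_def)
 interpret H: tgroup H T by (unfold_locales) (rule tg)
 interpret H: inv_mean H T M
 proof unfold_locales
  show "Hausdorff_space T" "locally_compact_space T" using H by (auto simp: lcsc_group_def)
  show "M\<in>H.means" by (rule M)
  show "M (\<lambda>h. f (g \<otimes>\<^bsub>H\<^esub> h)) = M f" if "f\<in>H.UL" "g\<in>carrier H" for f g
   using fun_cong[OF inv[OF that(2)], of f] H.means_shift[OF M that] by simp
 qed
 interpret p: group_hom \<Gamma> H p using grp p by (simp add: group_hom_def group_hom_axioms_def H.group_axioms)
 define F where "F = generate \<Gamma> (range v)"
 have vl: "v l\<in>carrier \<Gamma>" for l by (rule schottkyD(3)[OF S])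
 have Fs: "subgroup F \<Gamma>" unfolding F_def by (rule generate_is_subgroup) (use vl in auto)
 have FH: "w\<in>carrier \<Gamma>" if "w\<in>F" for w using subgroup.mem_carrier[OF Fs that] .
 have vF: "v l\<in>F" for l unfolding F_def by (rule generate.incl) simp
 have pF: "subgroup (p ` F) H" by (rule p.subgroup_img_is_subgroup[OF Fs])
 obtain V where V: "openin T V" "\<one>\<^bsub>H\<^esub>\<in>V" "\<forall>u\<in>carrier \<Gamma>. p u\<in>V --> \<zeta> u ` O' \<inter> O'\<noteq>{}"
  using near_identity_meets[OF tg haus p schottkyD(1,2)[OF S]] by blast
 have pFV: "p ` F \<inter> V = {\<one>\<^bsub>H\<^esub>}"
 proof (intro equalityI subsetI)
  fix x assume "x\<in>p ` F \<inter> V"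
  then obtain w where w: "w\<in>F" "x = p w" "p w\<in>V" by blast
  then have "\<zeta> w ` O' \<inter> O'\<noteq>{}" using V(3) FH by blast
  then have "w = \<one>" using schottky_wandering[OF S] w(1) unfolding F_def by blast
  then show "x\<in>{\<one>\<^bsub>H\<^esub>}" using w(2) by simp
 next
  fix x assume "x\<in>{\<one>\<^bsub>H\<^esub>}"
  then show "x\<in>p ` F \<inter> V" using V(2) subgroup.one_closed[OF pF] by simp
 qed
 obtain m :: "_ => real" where m: "\<forall>A\<subseteq>p ` F. 0\<le>m A" "m (p ` F) = 1"
  "\<forall>A\<subseteq>p ` F. \<forall>B\<subseteq>p ` F. A \<inter> B = {} --> m (A \<union> B) = m A + m B"
  "\<forall>A\<subseteq>p ` F. \<forall>u\<in>p ` F. m ((\<lambda>x. u \<otimes>\<^bsub>H\<^esub> x) ` A) = m A"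
  using H.discrete_subgroup_mean[OF sc pF V(1) pFV] by (elim exE conjE)
 show False
 proof (rule schottky_no_invariant_measure[OF S, of F "\<lambda>A. m (p ` A)"])
  show "F\<subseteq>carrier \<Gamma>" using FH by blast
  show "v l\<otimes>w\<in>F" if "w\<in>F" for l w using subgroup.m_closed[OF Fs vF that] .
  show "0\<le>m (p ` A)" if "A\<subseteq>F" for A using m(1) that by (simp add: image_mono)
  show "m (p ` F) = 1" by (rule m(2))
  show "m (p ` (A \<union> B)) = m (p ` A) + m (p ` B)" if AB: "A\<subseteq>F" "B\<subseteq>F" "A \<inter> B = {}" for A B
  proof -
   have "A\<subseteq>carrier \<Gamma>" "B\<subseteq>carrier \<Gamma>" using AB FH by blast+
   then have "p ` A \<inter> p ` B = {}" using inj_on_image_Int[OF p(2), of A B] AB(3) by simp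
   moreover have "p ` A\<subseteq>p ` F" "p ` B\<subseteq>p ` F" using AB by blast+
   ultimately show ?thesis using m(3) unfolding image_Un by blast
  qed
  show "m (p ` (\<lambda>x. v l\<otimes>x) ` A) = m (p ` A)" if A: "A\<subseteq>F" for A l
  proof -
   have "p ` (\<lambda>x. v l\<otimes>x) ` A = (\<lambda>x. p (v l) \<otimes>\<^bsub>H\<^esub> x) ` p ` A"
    unfolding image_image using A FH p.hom_mult[OF vl] by (intro image_cong[OF refl]) blast
   moreover have "p ` A\<subseteq>p ` F" "p (v l)\<in>p ` F" using A vF by blast+
   ultimately show ?thesis using m(4) by metis
  qed
 qed
qed

end

section \<open>Concentration in two factors at once\<close>

lemma (in tgroup) means_equicontinuous_finite:
 assumes J: "finite J" and e: "0 < \<epsilon>"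
 shows "\<exists>V. openin T V \<and> \<one>\<in>V \<and>
  (\<forall>v\<in>V. \<forall>g\<in>carrier H. \<forall>M\<in>means. \<forall>f\<in>J. \<bar>M (shift (v\<otimes>g) f) - M (shift g f)\<bar> < \<epsilon>)"
 using J
proof (induction J rule: finite_induct)
 case empty
 show ?case by (rule exI[of _ "carrier H"]) (simp add: open_carrier)
next
 case (insert f J)
 obtain V where V: "openin T V" "\<one>\<in>V" "\<forall>v\<in>V. \<forall>g\<in>carrier H. \<forall>M\<in>means. \<forall>f\<in>J. \<bar>M (shift (v\<otimes>g) f) - M (shift g f)\<bar> < \<epsilon>"
  using insert(3) by (elim exE conjE)
 have "\<exists>W. openin T W \<and> \<one>\<in>W \<and> (\<forall>v\<in>W. \<forall>g\<in>carrier H. \<forall>M\<in>means. \<bar>M (shift (v\<otimes>g) f) - M (shift g f)\<bar> < \<epsilon>)"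
 proof (cases "f\<in>UL")
  case True then show ?thesis by (rule means_equicontinuous[OF _ e])
 next
  case False
  have "M (shift g f) = 0" if "g\<in>carrier H" "M\<in>means" for g M
   using meansD(5)[OF that(2)] shift_F_iff[OF that(1)] False by blast
  then have "\<bar>M (shift (v\<otimes>g) f) - M (shift g f)\<bar> < \<epsilon>" if "v\<in>carrier H" "g\<in>carrier H" "M\<in>means" for v g M
   using e that by (metis abs_zero diff_self m_closed)
  then show ?thesis using open_carrier by (intro exI[of _ "carrier H"]) blast
 qed
 then obtain W where W: "openin T W" "\<one>\<in>W" "\<forall>v\<in>W. \<forall>g\<in>carrier H. \<forall>M\<in>means. \<bar>M (shift (v\<otimes>g) f) - M (shift g f)\<bar> < \<epsilon>"
  by (elim exE conjE)
 show ?case using V W by (intro exI[of _ "V \<inter> W"]) (simp add: openin_Int)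
qed

lemma (in tgroup) close_translate:
 assumes J: "finite J" and e: "0 < \<epsilon>" and a: "a\<in>carrier H"
 shows "\<exists>V. openin T V \<and> a\<in>V \<and>
  (\<forall>b\<in>V. \<forall>g\<in>carrier H. \<forall>M\<in>means. \<forall>f\<in>J. \<bar>M (shift (b\<otimes>g) f) - M (shift (a\<otimes>g) f)\<bar> < \<epsilon>)"
proof -
 obtain V where V: "openin T V" "\<one>\<in>V" "\<forall>v\<in>V. \<forall>g\<in>carrier H. \<forall>M\<in>means. \<forall>f\<in>J. \<bar>M (shift (v\<otimes>g) f) - M (shift g f)\<bar> < \<epsilon>"
  using means_equicontinuous_finite[OF J e] by (elim exE conjE)
 have "\<bar>M (shift (b\<otimes>g) f) - M (shift (a\<otimes>g) f)\<bar> < \<epsilon>"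
  if b: "b\<in>(\<lambda>x. x\<otimes>a) ` V" and g: "g\<in>carrier H" and M: "M\<in>means" and f: "f\<in>J" for b g M f
 proof -
  obtain v where v: "v\<in>V" "b = v\<otimes>a" using b by blast
  then have "b\<otimes>g = v\<otimes>(a\<otimes>g)" using open_subset[OF V(1)] a g by (auto simp: m_assoc)
  then show ?thesis using V(3) v(1) M f a g by simp
 qed
 moreover have "openin T ((\<lambda>x. x\<otimes>a) ` V)" by (rule open_rtrans[OF a V(1)])
 moreover have "a\<in>(\<lambda>x. x\<otimes>a) ` V" using V(2) a by force
 ultimately show ?thesis by (intro exI[of _ "(\<lambda>x. x\<otimes>a) ` V"] conjI ballI)
qed

locale lattice_factor = lattice G T \<Lambda> \<mu> + H: tgroup H T'
 for G :: "('g, 'm) monoid_scheme" and T :: "'g topology" and \<Lambda> \<mu>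
  and H :: "('h, 'n) monoid_scheme" (structure) and T' :: "'h topology" +
 fixes \<phi> :: "'g => 'h"
 assumes \<phi>: "\<phi>\<in>hom G H" "continuous_map T T' \<phi>"
begin

sublocale \<phi>: group_hom G H \<phi>
 using \<phi> by (simp add: group_hom_def group_hom_axioms_def H.group_axioms group_axioms)

lemma shift_product:
 assumes "a\<in>carrier H" "g\<in>carrier G" "l\<in>carrier G"
 shows "x \<circ> H.shift (a\<otimes>\<phi> (g \<otimes>\<^bsub>G\<^esub> l)) = (x \<circ> H.shift (\<phi> l)) \<circ> H.shift (a\<otimes>\<phi> g)"
 using H.shift_mult[of "a\<otimes>\<phi> g" "\<phi> l"] assms by (simp add: H.m_assoc o_def)

text \<open>Membership in a box survives a small perturbation of the group element at the price of a larger box.\<close>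
lemma near_identity_box:
 assumes J: "finite J" and e: "0 < e" and a: "a\<in>carrier H"
 shows "\<exists>N. openin T N \<and> \<one>\<^bsub>G\<^esub>\<in>N \<and> (\<forall>g\<in>N. \<forall>x\<in>H.means.
  x \<circ> H.shift (a\<otimes>\<phi> g)\<in>box_at J (2 * e) p --> x \<circ> H.shift a\<in>box_at J (3 * e) p)"
proof -
 obtain V where V: "openin T' V" "a\<in>V"
  "\<forall>b\<in>V. \<forall>g\<in>carrier H. \<forall>M\<in>H.means. \<forall>f\<in>J. \<bar>M (H.shift (b\<otimes>g) f) - M (H.shift (a\<otimes>g) f)\<bar> < e"
  using H.close_translate[OF J e a] by (elim exE conjE)
 define N where "N = {g\<in>topspace T. a\<otimes>\<phi> g\<in>V}"
 have "openin T N" unfolding N_def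
  by (intro openin_continuous_map_preimage[OF _ V(1)] H.cmult H.cconst a \<phi>(2))
 moreover have "\<one>\<^bsub>G\<^esub>\<in>N" using V(2) a by (simp add: N_def)
 moreover have "x \<circ> H.shift a\<in>box_at J (3 * e) p"
  if g: "g\<in>N" and x: "x\<in>H.means" and b: "x \<circ> H.shift (a\<otimes>\<phi> g)\<in>box_at J (2 * e) p" for g x
  unfolding box_at_def
 proof (intro CollectI ballI)
  fix f assume f: "f\<in>J"
  have gc: "g\<in>carrier G" "a\<otimes>\<phi> g\<in>V" using g by (auto simp: N_def)
  have "\<bar>x (H.shift (a\<otimes>\<phi> g\<otimes>\<one>) f) - x (H.shift (a\<otimes>\<one>) f)\<bar> < e" using V(3) gc(2) x f by blast
  moreover have "\<bar>x (H.shift (a\<otimes>\<phi> g) f) - p f\<bar> < 2 * e" using b f by (simp add: box_at_def)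
  ultimately show "\<bar>(x \<circ> H.shift a) f - p f\<bar> < 3 * e" using gc(1) a by simp
 qed
 ultimately show ?thesis by blast
qed

text \<open>Apply \<open>concentration\<close> to the point \<open>x\<close> moved by the Borel section over the probability space \<open>G/\<Lambda>\<close>. The element of \<open>H\<close> found
there can be varied in an open set, since means are equicontinuous; so it can be approximated by \<open>\<phi> g\<close>.\<close>
lemma orbit_concentration:
 assumes K: "irreducible_flow H H.shift K" "K\<subseteq>H.means" and x: "x\<in>K"
  and s: "s\<in>measurable \<mu> (borel_on T)" "\<forall>C\<in>lcosets\<^bsub>G\<^esub> \<Lambda>. s C\<in>C"
  and J: "finite J" and e: "0 < e" "0 < \<eta>" and a: "a\<in>carrier H"
 shows "\<exists>U A. openin T' U \<and> U\<noteq>{} \<and> A\<in>sets \<mu> \<and> measure \<mu> A\<le>\<eta> \<and> (\<forall>g\<in>carrier G. \<phi> g\<in>U -->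
  (\<forall>C\<in>space \<mu> - A. x \<circ> H.shift (a\<otimes>\<phi> (g \<otimes>\<^bsub>G\<^esub> s C))\<in>box_at J (2 * e) (far_point K J)))"
proof -
 note fl = affine_flowD[OF K(1)[unfolded irreducible_flow_def, THEN conjunct1]]
 let ?p = "far_point K J"
 have xM: "x\<in>H.means" using K(2) x by blast
 have sG: "s C\<in>carrier G" if "C\<in>space \<mu>" for C using s(2) that coset_of(1) space_mu by blast
 define u where "u = (\<lambda>C. x \<circ> H.shift (\<phi> (s C)))"
 have uK: "u C\<in>K" if "C\<in>space \<mu>" for C using fl(6)[OF _ x] sG[OF that] by (simp add: u_def)
 have um: "(\<lambda>C. u C i)\<in>borel_measurable \<mu>" for i
 proof -
  have "continuous_map T euclideanreal (\<lambda>g. x (H.shift (\<phi> g) i))"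
   using continuous_map_compose[OF \<phi>(2) H.means_orbit_continuous[OF xM]] by (simp add: o_def)
  from measurable_compose[OF s(1) continuous_map_borel_measurable[OF this refl]] show ?thesis by (simp add: u_def)
 qed
 obtain b where b: "b\<in>carrier H" "measure \<mu> {C\<in>space \<mu>. u C \<circ> H.shift b\<notin>box_at J e ?p}\<le>\<eta>"
  using concentration[OF H.group_axioms K(1) J e prob uK um] by blast
 obtain W where W: "openin T' W" "b\<in>W"
  "\<forall>c\<in>W. \<forall>g\<in>carrier H. \<forall>M\<in>H.means. \<forall>f\<in>J. \<bar>M (H.shift (c\<otimes>g) f) - M (H.shift (b\<otimes>g) f)\<bar> < e"
  using H.close_translate[OF J e(1) b(1)] by (elim exE conjE)
 define U where "U = {h\<in>topspace T'. a\<otimes>h\<in>W}"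
 define A where "A = {C\<in>space \<mu>. u C \<circ> H.shift b\<notin>box_at J e ?p}"
 have "openin T' U" unfolding U_def by (rule openin_continuous_map_preimage[OF H.ltrans[OF a] W(1)])
 moreover have "inv a\<otimes>b\<in>U" using a b(1) W(2) by (simp add: U_def)
 moreover have "A\<in>sets \<mu>" unfolding A_def by (rule box_event_sets[OF J um])
 moreover have "x \<circ> H.shift (a\<otimes>\<phi> (g \<otimes>\<^bsub>G\<^esub> s C))\<in>box_at J (2 * e) ?p"
  if g: "g\<in>carrier G" "\<phi> g\<in>U" and C: "C\<in>space \<mu> - A" for g C
  unfolding box_at_def
 proof (intro CollectI ballI)
  fix f assume f: "f\<in>J"
  have sc: "s C\<in>carrier G" "\<phi> (s C)\<in>carrier H" using sG C by auto
  have "\<bar>x (H.shift (b\<otimes>\<phi> (s C)) f) - ?p f\<bar> < e"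
   using C f H.shift_mult[OF b(1) sc(2)] by (simp add: box_at_def A_def u_def)
  moreover have "a\<otimes>\<phi> g\<in>W" using g(2) by (simp add: U_def)
  then have "\<bar>x (H.shift (a\<otimes>\<phi> g\<otimes>\<phi> (s C)) f) - x (H.shift (b\<otimes>\<phi> (s C)) f)\<bar> < e"
   using W(3) sc(2) xM f by blast
  ultimately show "\<bar>(x \<circ> H.shift (a\<otimes>\<phi> (g \<otimes>\<^bsub>G\<^esub> s C))) f - ?p f\<bar> < 2 * e"
   using a g(1) sc by (simp add: H.m_assoc)
 qed
 ultimately show ?thesis using b(2) unfolding A_def[symmetric] by (intro exI[of _ U] exI[of _ A]) blast
qed

end

text \<open>By density one element \<open>g\<close> serves both factors: for all cosets \<open>C\<close> outside a set of small measure, \<open>g * s C\<close> moves the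
base points \<open>x0\<close> and \<open>y0\<close> into both boxes. As \<open>\<mu>\<close> is invariant, the translate \<open>g C\<close> meets a given open set \<open>N\<close> with fixed
positive probability, so for some such \<open>C\<close> there is \<open>n \<in> N\<close> with \<open>g * s C = n * l\<close>, where \<open>l \<in> \<Lambda>\<close>. Then \<open>l\<close>
moves \<open>(x0, y0)\<close> within \<open>R\<close>, and \<open>n\<close>, close to the identity, can be dropped after enlarging the boxes.\<close>
lemma product_concentration:
 fixes H1 :: "('h, 'n) monoid_scheme" and H2 :: "('k, 'l) monoid_scheme" and R
 assumes F1: "lattice_factor G T \<Lambda> \<mu> H1 T1 \<phi>1" and F2: "lattice_factor G T \<Lambda> \<mu> H2 T2 \<phi>2"
  and dense: "\<And>U V h k. openin T1 U ==> openin T2 V ==> h\<in>U ==> k\<in>V ==> \<exists>g\<in>carrier G. \<phi>1 g\<in>U \<and> \<phi>2 g\<in>V"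
  and K1: "irreducible_flow H1 (mean_class.shift H1) K1" "K1\<subseteq>mean_class.means H1 (tgroup.UL H1 T1)"
  and K2: "irreducible_flow H2 (mean_class.shift H2) K2" "K2\<subseteq>mean_class.means H2 (tgroup.UL H2 T2)"
  and R: "\<And>x y. R x y ==> x\<in>K1 \<and> y\<in>K2" "R x0 y0"
   "\<And>x y l. R x y ==> l\<in>\<Lambda> ==> R (x \<circ> mean_class.shift H1 (\<phi>1 l)) (y \<circ> mean_class.shift H2 (\<phi>2 l))"
  and J: "finite J1" "finite J2" and e: "0 < e" and a: "a\<in>carrier H1" and b: "b\<in>carrier H2"
 shows "\<exists>x y. R x y \<and> x \<circ> mean_class.shift H1 a\<in>box_at J1 (3 * e) (far_point K1 J1) \<and>
  y \<circ> mean_class.shift H2 b\<in>box_at J2 (3 * e) (far_point K2 J2)"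
proof (rule ccontr)
 interpret F1: lattice_factor G T \<Lambda> \<mu> H1 T1 \<phi>1 by (rule F1)
 interpret F2: lattice_factor G T \<Lambda> \<mu> H2 T2 \<phi>2 by (rule F2)
 assume no: "\<not> ?thesis"
 define P where "P = (\<lambda>g. \<exists>x y. R x y \<and> x \<circ> F1.H.shift (a \<otimes>\<^bsub>H1\<^esub> \<phi>1 g)\<in>box_at J1 (2 * e) (far_point K1 J1) \<and>
  y \<circ> F2.H.shift (b \<otimes>\<^bsub>H2\<^esub> \<phi>2 g)\<in>box_at J2 (2 * e) (far_point K2 J2))"
 have PL: "P g" if "P (g \<otimes>\<^bsub>G\<^esub> l)" "g\<in>carrier G" "l\<in>\<Lambda>" for g l
  using that R(3) unfolding P_def F1.shift_product[OF a that(2) F1.Lcl[OF that(3)]] F2.shift_product[OF b that(2) F1.Lcl[OF that(3)]] by blast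
 obtain N1 where N1: "openin T N1" "\<one>\<^bsub>G\<^esub>\<in>N1" "\<forall>g\<in>N1. \<forall>x\<in>F1.H.means.
  x \<circ> F1.H.shift (a \<otimes>\<^bsub>H1\<^esub> \<phi>1 g)\<in>box_at J1 (2 * e) (far_point K1 J1) --> x \<circ> F1.H.shift a\<in>box_at J1 (3 * e) (far_point K1 J1)"
  using F1.near_identity_box[OF J(1) e a, of "far_point K1 J1"] by (elim exE conjE)
 obtain N2 where N2: "openin T N2" "\<one>\<^bsub>G\<^esub>\<in>N2" "\<forall>g\<in>N2. \<forall>y\<in>F2.H.means.
  y \<circ> F2.H.shift (b \<otimes>\<^bsub>H2\<^esub> \<phi>2 g)\<in>box_at J2 (2 * e) (far_point K2 J2) --> y \<circ> F2.H.shift b\<in>box_at J2 (3 * e) (far_point K2 J2)"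
  using F2.near_identity_box[OF J(2) e b, of "far_point K2 J2"] by (elim exE conjE)
 define N where "N = N1 \<inter> N2"
 have N: "openin T N" "N\<noteq>{}" unfolding N_def using N1(1,2) N2(1,2) by (auto simp: openin_Int)
 have notP: "\<not> P g" if g: "g\<in>N" for g
 proof
  assume "P g"
  then obtain x y where xy: "R x y" "x \<circ> F1.H.shift (a \<otimes>\<^bsub>H1\<^esub> \<phi>1 g)\<in>box_at J1 (2 * e) (far_point K1 J1)"
   "y \<circ> F2.H.shift (b \<otimes>\<^bsub>H2\<^esub> \<phi>2 g)\<in>box_at J2 (2 * e) (far_point K2 J2)" unfolding P_def by blast
  have "x\<in>F1.H.means" "y\<in>F2.H.means" using R(1)[OF xy(1)] K1(2) K2(2) by auto
  then show False using no xy N1(3) N2(3) g unfolding N_def by blast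
 qed
 define \<delta> where "\<delta> = measure \<mu> (F1.hit N)"
 have \<delta>: "0 < \<delta>" unfolding \<delta>_def by (rule F1.hit_positive[OF N])
 then have \<delta>3: "0 < \<delta> / 3" by simp
 obtain s where s: "s\<in>measurable \<mu> (borel_on T)" "\<forall>C\<in>lcosets\<^bsub>G\<^esub> \<Lambda>. s C\<in>C" using F1.borel_section by blast
 obtain U A where U: "openin T1 U" "U\<noteq>{}" and A: "A\<in>sets \<mu>" "measure \<mu> A\<le>\<delta> / 3"
  and UA: "\<forall>g\<in>carrier G. \<phi>1 g\<in>U --> (\<forall>C\<in>space \<mu> - A. x0 \<circ> F1.H.shift (a \<otimes>\<^bsub>H1\<^esub> \<phi>1 (g \<otimes>\<^bsub>G\<^esub> s C))\<in>box_at J1 (2 * e) (far_point K1 J1))"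
  using F1.orbit_concentration[OF K1 conjunct1[OF R(1)[OF R(2)]] s J(1) e \<delta>3 a] by (elim exE conjE)
 obtain V B where V: "openin T2 V" "V\<noteq>{}" and B: "B\<in>sets \<mu>" "measure \<mu> B\<le>\<delta> / 3"
  and VB: "\<forall>g\<in>carrier G. \<phi>2 g\<in>V --> (\<forall>C\<in>space \<mu> - B. y0 \<circ> F2.H.shift (b \<otimes>\<^bsub>H2\<^esub> \<phi>2 (g \<otimes>\<^bsub>G\<^esub> s C))\<in>box_at J2 (2 * e) (far_point K2 J2))"
  using F2.orbit_concentration[OF K2 conjunct2[OF R(1)[OF R(2)]] s J(2) e \<delta>3 b] by (elim exE conjE)
 obtain g where g: "g\<in>carrier G" "\<phi>1 g\<in>U" "\<phi>2 g\<in>V" using dense[OF U(1) V(1)] U(2) V(2) by blast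
 have "{C\<in>space \<mu>. g <#\<^bsub>G\<^esub> C\<in>F1.hit N}\<subseteq>A \<union> B"
 proof (rule subsetI, rule ccontr)
  fix C assume C: "C\<in>{C\<in>space \<mu>. g <#\<^bsub>G\<^esub> C\<in>F1.hit N}" "C\<notin>A \<union> B"
  then have C': "C\<in>lcosets\<^bsub>G\<^esub> \<Lambda>" "s C\<in>C" using F1.space_mu s(2) by auto
  have sc: "s C\<in>carrier G" by (rule F1.coset_of(1)[OF C'])
  have gs: "g \<otimes>\<^bsub>G\<^esub> s C\<in>g <#\<^bsub>G\<^esub> C" using F1.coset_translate(1)[OF g(1) C'(1)] C'(2) by blast
  obtain n where n: "n\<in>N" "n\<in>g <#\<^bsub>G\<^esub> C" using C(1) by (auto simp: F1.hit_def)
  have "g \<otimes>\<^bsub>G\<^esub> s C\<in>n <#\<^bsub>G\<^esub> \<Lambda>" "n\<in>carrier G"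
   using F1.coset_of[OF F1.coset_translate(2)[OF g(1) C'(1)] n(2)] gs by auto
  moreover obtain l where "l\<in>\<Lambda>" "g \<otimes>\<^bsub>G\<^esub> s C = n \<otimes>\<^bsub>G\<^esub> l" using calculation(1) F1.coset_iff by blast
  moreover have "P (g \<otimes>\<^bsub>G\<^esub> s C)" unfolding P_def using R(2) UA VB g C by blast
  ultimately show False using notP[OF n(1)] PL by metis
 qed
 then have "measure \<mu> {C\<in>space \<mu>. g <#\<^bsub>G\<^esub> C\<in>F1.hit N}\<le>measure \<mu> (A \<union> B)"
  by (rule F1.finite_measure_mono) (use A B in blast)
 also have "\<dots>\<le>\<delta> / 3 + \<delta> / 3" using measure_Un_le[OF A(1) B(1)] A(2) B(2) by linarith
 finally show False using F1.measure_translate[OF g(1) F1.meas_hit[OF N(1)]] \<delta> unfolding \<delta>_def by simp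
qed

section \<open>One projection of the lattice has a kernel\<close>

lemma product_map_projections:
 assumes H: "lcsc_group H1 T1" "lcsc_group H2 T2"
  and \<pi>: "\<pi>\<in>hom G (H1 \<times>\<times> H2)" "continuous_map T (prod_topology T1 T2) \<pi>"
  and d: "prod_topology T1 T2 closure_of (\<pi> ` carrier G) = topspace (prod_topology T1 T2)"
 shows "(\<lambda>g. fst (\<pi> g))\<in>hom G H1" "(\<lambda>g. snd (\<pi> g))\<in>hom G H2"
  and "continuous_map T T1 (\<lambda>g. fst (\<pi> g))" "continuous_map T T2 (\<lambda>g. snd (\<pi> g))"
  and "T1 closure_of ((\<lambda>g. fst (\<pi> g)) ` carrier G) = topspace T1" (is "T1 closure_of ?A = _")
  and "T2 closure_of ((\<lambda>g. snd (\<pi> g)) ` carrier G) = topspace T2" (is "T2 closure_of ?B = _")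
proof -
 have "\<pi> g\<in>carrier H1 \<times> carrier H2" if "g\<in>carrier G" for g using hom_in_carrier[OF \<pi>(1) that] by (simp add: DirProd_def)
 moreover have "\<pi> (g \<otimes>\<^bsub>G\<^esub> h) = (fst (\<pi> g) \<otimes>\<^bsub>H1\<^esub> fst (\<pi> h), snd (\<pi> g) \<otimes>\<^bsub>H2\<^esub> snd (\<pi> h))"
  if "g\<in>carrier G" "h\<in>carrier G" for g h
  using hom_mult[OF \<pi>(1) that] by (simp add: DirProd_def case_prod_beta)
 ultimately show "(\<lambda>g. fst (\<pi> g))\<in>hom G H1" "(\<lambda>g. snd (\<pi> g))\<in>hom G H2" by (auto simp: hom_def mem_Times_iff)
 show "continuous_map T T1 (\<lambda>g. fst (\<pi> g))" "continuous_map T T2 (\<lambda>g. snd (\<pi> g))"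
  using continuous_map_compose[OF \<pi>(2) continuous_map_fst] continuous_map_compose[OF \<pi>(2) continuous_map_snd] by (simp_all add: o_def)
 have ne: "topspace T1\<noteq>{}" "topspace T2\<noteq>{}"
  using H by (auto simp: lcsc_group_def topological_group_def dest: group.is_monoid[THEN monoid.one_closed])
 have "prod_topology T1 T2 closure_of (\<pi> ` carrier G)\<subseteq>prod_topology T1 T2 closure_of (?A \<times> ?B)"
  by (rule closure_of_mono) (simp add: image_subset_iff mem_Times_iff)
 then have "topspace T1 \<times> topspace T2\<subseteq>(T1 closure_of ?A) \<times> (T2 closure_of ?B)" unfolding d by (simp add: closure_of_Times)
 then show "T1 closure_of ?A = topspace T1" "T2 closure_of ?B = topspace T2"
  using ne closure_of_subset_topspace[of T1] closure_of_subset_topspace[of T2] by (auto simp: times_subset_iff)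
qed

lemma closed_fixed: "closed {x :: 'i => real. x \<circ> \<tau> = x}"
proof -
 have "{x :: 'i => real. x \<circ> \<tau> = x} = (\<Inter>i. {x. x (\<tau> i) = x i})" by (auto simp: fun_eq_iff)
 also have "closed \<dots>" by (intro closed_INT ballI closed_Collect_eq continuous_on_coord)
 finally show ?thesis .
qed

lemma affine_flow_pullback:
 assumes K: "affine_flow H \<sigma> K" and p: "p\<in>hom \<Gamma> H" and grp: "group \<Gamma>" "group H"
 shows "affine_flow \<Gamma> (\<lambda>g. \<sigma> (p g)) K"
proof -
 interpret p: group_hom \<Gamma> H p using p grp by (simp add: group_hom_def group_hom_axioms_def)
 show ?thesis using affine_flowD[OF K] unfolding affine_flow_def by auto
qed

lemma hom_comp: "f\<in>hom A B ==> g\<in>hom B C ==> (\<lambda>x. g (f x))\<in>hom A C"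
 by (auto simp: hom_def Pi_iff)

context ep_action begin

definition germs :: "'z => 'a set" where
 "germs z = {g\<in>carrier \<Gamma>. \<exists>U. openin Z U \<and> z\<in>U \<and> (\<forall>y\<in>U. \<zeta> g y = y)}"

lemma germs_conj:
 assumes g: "g\<in>germs z" and h: "h\<in>carrier \<Gamma>" shows "h\<otimes>g\<otimes>inv h\<in>germs (\<zeta> h z)"
proof -
 obtain U where U: "g\<in>carrier \<Gamma>" "openin Z U" "z\<in>U" "\<forall>y\<in>U. \<zeta> g y = y" using g by (auto simp: germs_def)
 have "\<forall>y\<in>\<zeta> h ` U. \<zeta> (h\<otimes>g\<otimes>inv h) y = y"
  using fixes_conj[OF U(1) h openin_subset[OF U(2)]] U(4) by blast
 then show ?thesis using U h act_open[OF h U(2)] unfolding germs_def by blast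
qed

lemma germs_fixed_translate:
 assumes \<tau>: "affine_flow \<Gamma> \<tau> K" and x: "\<forall>g\<in>germs z. x \<circ> \<tau> g = x" and z: "z\<in>topspace Z" and h: "h\<in>carrier \<Gamma>"
 shows "\<forall>g\<in>germs (\<zeta> h z). (x \<circ> \<tau> h) \<circ> \<tau> g = x \<circ> \<tau> h"
proof
 fix g assume g: "g\<in>germs (\<zeta> h z)"
 then have gc: "g\<in>carrier \<Gamma>" by (simp add: germs_def)
 define k where "k = inv h\<otimes>g\<otimes>h"
 have k: "k\<in>carrier \<Gamma>" "g\<otimes>h = h\<otimes>k" using gc h by (simp_all add: k_def m_assoc)
 have "k\<in>germs z" using germs_conj[OF g, of "inv h"] h z by (simp add: k_def)
 then have "x (\<tau> k i) = x i" for i using x by (auto simp: fun_eq_iff)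
 moreover have "\<tau> h (\<tau> g i) = \<tau> k (\<tau> h i)" for i
  using affine_flowD(1)[OF \<tau> gc h, of i] affine_flowD(1)[OF \<tau> h k(1), of i] k(2) by simp
 ultimately show "(x \<circ> \<tau> h) \<circ> \<tau> g = x \<circ> \<tau> h" by (simp add: o_def)
qed

lemma germs_finite_open:
 assumes "finite S" "S\<subseteq>germs z" "z\<in>topspace Z"
 shows "\<exists>U. openin Z U \<and> z\<in>U \<and> (\<forall>s\<in>S. \<forall>y\<in>U. \<zeta> s y = y)"
 using assms(1,2)
proof (induction S rule: finite_induct)
 case empty then show ?case using assms(3) by (intro exI[of _ "topspace Z"]) auto
next
 case (insert s S)
 obtain U where U: "openin Z U" "z\<in>U" "\<forall>s\<in>S. \<forall>y\<in>U. \<zeta> s y = y" using insert by blast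
 obtain V where V: "openin Z V" "z\<in>V" "\<forall>y\<in>V. \<zeta> s y = y" using insert(4) by (auto simp: germs_def)
 show ?case using U V by (intro exI[of _ "U \<inter> V"]) (auto simp: openin_Int)
qed

text \<open>By compactness it suffices to treat finitely many germs; these lie in one point stabilizer of the Furstenberg boundary.\<close>
lemma germs_fixed_point:
 fixes K :: "('i => real) set"
 assumes count: "countable (carrier \<Gamma>)" and F: "Furstenberg_boundary \<Gamma> (disc \<Gamma>) B \<beta>"
  and eq: "stabilizer_URS \<Gamma> (disc \<Gamma>) Z \<zeta> = stabilizer_URS \<Gamma> (disc \<Gamma>) B \<beta>"
  and K: "affine_flow \<Gamma> \<tau> K" and z: "z\<in>topspace Z"
 shows "\<exists>x\<in>K. \<forall>g\<in>germs z. x \<circ> \<tau> g = x"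
proof -
 have "K \<inter> \<Inter>((\<lambda>g. {x :: 'i => real. x \<circ> \<tau> g = x}) ` germs z)\<noteq>{}"
 proof (rule compact_imp_fip[OF affine_flowD(3)[OF K]])
  show "closed C" if "C\<in>(\<lambda>g. {x :: 'i => real. x \<circ> \<tau> g = x}) ` germs z" for C
   using that by (auto intro: closed_fixed)
  fix \<F> assume "finite \<F>" "\<F>\<subseteq>(\<lambda>g. {x :: 'i => real. x \<circ> \<tau> g = x}) ` germs z"
  then obtain S where S: "finite S" "S\<subseteq>germs z" "\<F> = (\<lambda>g. {x :: 'i => real. x \<circ> \<tau> g = x}) ` S" by (meson finite_subset_image)
  obtain U where U: "openin Z U" "z\<in>U" "\<forall>s\<in>S. \<forall>y\<in>U. \<zeta> s y = y" using germs_finite_open[OF S(1,2) z] by blast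
  have "S\<subseteq>carrier \<Gamma>" using S(2) by (auto simp: germs_def)
  then obtain b where b: "b\<in>topspace B" "S\<subseteq>stabilizer \<Gamma> \<beta> b"
   using finite_fixing_set_in_stabilizer[OF count eq S(1) _ U(1) _ U(3)] U(2) by blast
  obtain x where "x\<in>K" "\<forall>g\<in>stabilizer \<Gamma> \<beta> b. x \<circ> \<tau> g = x"
   using Furstenberg_stabilizer_fixes[OF grp F K b(1)] by blast
  then have "x\<in>K \<inter> \<Inter>\<F>" using b(2) S(3) by auto
  then show "K \<inter> \<Inter>\<F>\<noteq>{}" by blast
 qed
 then show ?thesis by blast
qed

end

context micro_action begin

lemma schottky_ex: "\<exists>v T O'. schottky v T O'"
 by (rule schottky_exists[OF split_open])

text \<open>A point fixed by the envelope yields successively a point fixed by \<open>\<Gamma>\<close>, by \<open>G\<close> and, by density, by \<open>H\<close>.\<close>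
lemma envelope_moves_mean:
 assumes L: "lattice G T (\<iota> ` carrier \<Gamma>) \<mu>" and \<iota>: "\<iota>\<in>hom \<Gamma> G"
  and \<nu>: "invariant_coset_mean \<Gamma> (generate \<Gamma> fixopen) \<nu>"
  and H: "lcsc_group H T'" and \<phi>: "\<phi>\<in>hom G H" "continuous_map T T' \<phi>"
  and dense: "T' closure_of (\<phi> ` carrier G) = topspace T'"
  and inj: "inj_on (\<lambda>g. \<phi> (\<iota> g)) (carrier \<Gamma>)"
  and K: "affine_flow H (mean_class.shift H) K" "K\<subseteq>mean_class.means H (tgroup.UL H T')" and x: "x\<in>K"
 shows "\<exists>s\<in>fixopen. x \<circ> mean_class.shift H (\<phi> (\<iota> s))\<noteq>x"
proof (rule ccontr)
 assume "\<not> ?thesis"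
 then have fixS: "x \<circ> mean_class.shift H (\<phi> (\<iota> s)) = x" if "s\<in>fixopen" for s using that by blast
 interpret L: lattice G T "\<iota> ` carrier \<Gamma>" \<mu> by (rule L)
 interpret H: tgroup H T' using H by unfold_locales (simp add: lcsc_group_def)
 have p: "(\<lambda>g. \<phi> (\<iota> g))\<in>hom \<Gamma> H" by (rule hom_comp[OF \<iota> \<phi>(1)])
 have fl: "affine_flow \<Gamma> (\<lambda>g. H.shift (\<phi> (\<iota> g))) K" by (rule affine_flow_pullback[OF K(1) p grp H.group_axioms])
 note fd = affine_flowD[OF fl]
 define S where "S = {g\<in>carrier \<Gamma>. x \<circ> H.shift (\<phi> (\<iota> g)) = x}"
 have "subgroup S \<Gamma>"
 proof (rule subgroupI)
  show "S\<subseteq>carrier \<Gamma>" by (auto simp: S_def)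
  have "x \<circ> H.shift (\<phi> (\<iota> \<one>)) = x" by (simp add: o_def fd(2))
  then show "S\<noteq>{}" by (auto simp: S_def)
  fix a assume a: "a\<in>S"
  have ac: "a\<in>carrier \<Gamma>" "\<And>i. x (H.shift (\<phi> (\<iota> a)) i) = x i" using a by (auto simp: S_def fun_eq_iff)
  have "x (H.shift (\<phi> (\<iota> (inv a))) i) = x i" for i
   using fd(1)[of "inv a" a i] fd(2)[of i] ac(2)[of "H.shift (\<phi> (\<iota> (inv a))) i"] ac(1) by simp
  then show "inv a\<in>S" using ac(1) by (auto simp: S_def)
  fix b assume b: "b\<in>S"
  have bc: "b\<in>carrier \<Gamma>" "\<And>i. x (H.shift (\<phi> (\<iota> b)) i) = x i" using b by (auto simp: S_def fun_eq_iff)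
  have "x (H.shift (\<phi> (\<iota> (a\<otimes>b))) i) = x i" for i
   using fd(1)[OF ac(1) bc(1)] ac(2) bc(2) by simp
  then show "a\<otimes>b\<in>S" using ac(1) bc(1) by (auto simp: S_def)
 qed
 moreover have "fixopen\<subseteq>S" using fixS by (auto simp: S_def fixopen_def)
 ultimately have ES: "generate \<Gamma> fixopen\<subseteq>S" using generate_subgroup_incl by blast
 have EG: "generate \<Gamma> fixopen\<subseteq>carrier \<Gamma>" by (rule generate_incl) (auto simp: fixopen_def)
 have xE: "x \<circ> H.shift (\<phi> (\<iota> e)) = x" if "e\<in>generate \<Gamma> fixopen" for e using ES that by (auto simp: S_def)
 obtain y where y: "y\<in>K" "\<forall>g\<in>carrier \<Gamma>. y \<circ> H.shift (\<phi> (\<iota> g)) = y"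
  using invariant_coset_mean_fixed_point[OF grp EG \<nu> fl x xE] by blast
 have yL: "y \<circ> H.shift (\<phi> l) = y" if "l\<in>\<iota> ` carrier \<Gamma>" for l using y(2) that by blast
 have oc: "continuous_map T' euclideanreal (\<lambda>h. M (H.shift h i))" if "M\<in>K" for M i
  using H.means_orbit_continuous K(2) that by blast
 have yc: "continuous_map T euclideanreal (\<lambda>g. y (H.shift (\<phi> g) i))" for i
  using continuous_map_compose[OF \<phi>(2) oc[OF y(1)]] by (simp add: o_def)
 have "\<exists>M\<in>K. \<forall>g\<in>carrier G. M \<circ> H.shift (\<phi> g) = M"
  by (rule L.average_fixed_point[OF K(1) \<phi>(1) y(1)]) (fact yL, fact yc)
 then obtain M where M: "M\<in>K" "\<forall>g\<in>carrier G. M \<circ> H.shift (\<phi> g) = M" by blast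
 have "M \<circ> H.shift h = M" if h: "h\<in>carrier H" for h
 proof
  fix i
  have cl: "closedin T' {h\<in>topspace T'. M (H.shift h i)\<in>{M i}}"
   by (rule closedin_continuous_map_preimage[OF oc[OF M(1)]]) simp
  have "\<phi> ` carrier G\<subseteq>{h\<in>topspace T'. M (H.shift h i)\<in>{M i}}"
   using M(2) hom_in_carrier[OF \<phi>(1)] by (auto simp: fun_eq_iff)
  from closure_of_minimal[OF this cl] show "(M \<circ> H.shift h) i = M i" using dense h by auto
 qed
 moreover obtain v T0 O' where "schottky v T0 O'" using schottky_ex by blast
 ultimately show False using no_invariant_mean[OF H p inj] M(1) K(2) by blast
qed

text \<open>Compactness of \<open>K\<close> makes \<open>envelope_moves_mean\<close> uniform on boxes of one size, in particular around the far point of the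
coordinates \<open>J\<close> that define those boxes.\<close>
lemma envelope_box:
 fixes H :: "('h, 'n) monoid_scheme"
 assumes L: "lattice G T (\<iota> ` carrier \<Gamma>) \<mu>" and \<iota>: "\<iota>\<in>hom \<Gamma> G"
  and \<nu>: "invariant_coset_mean \<Gamma> (generate \<Gamma> fixopen) \<nu>"
  and H: "lcsc_group H T'" and \<phi>: "\<phi>\<in>hom G H" "continuous_map T T' \<phi>"
  and dense: "T' closure_of (\<phi> ` carrier G) = topspace T'"
  and inj: "inj_on (\<lambda>g. \<phi> (\<iota> g)) (carrier \<Gamma>)"
  and K: "affine_flow H (mean_class.shift H) K" "K\<subseteq>mean_class.means H (tgroup.UL H T')"
 shows "\<exists>J e s. finite J \<and> 0 < e \<and> s\<in>fixopen \<and>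
  (\<forall>x\<in>box_at J e (far_point K J). x \<circ> mean_class.shift H (\<phi> (\<iota> s))\<noteq>x)"
proof -
 let ?\<U> = "(\<lambda>s. {x. x \<circ> mean_class.shift H (\<phi> (\<iota> s))\<noteq>x}) ` fixopen"
 have op: "open {x :: ('h => real) => real. x \<circ> \<tau>\<noteq>x}" for \<tau>
  using closed_fixed[of \<tau>] by (simp add: closed_def Collect_neg_eq)
 have cov: "\<exists>U\<in>?\<U>. open U \<and> x\<in>U" if x: "x\<in>K" for x
 proof -
  obtain s where "s\<in>fixopen" "x \<circ> mean_class.shift H (\<phi> (\<iota> s))\<noteq>x"
   using envelope_moves_mean[OF L \<iota> \<nu> H \<phi> dense inj K x] by blast
  then show ?thesis using op by blast
 qed
 have "\<exists>J e. finite J \<and> 0 < e \<and> (\<forall>x\<in>K. \<exists>U\<in>?\<U>. box_at J e x\<subseteq>U)"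
  by (rule Lebesgue_box[OF affine_flowD(3)[OF K(1)] cov])
 then obtain J e where J: "finite J" "0 < e" "\<forall>x\<in>K. \<exists>U\<in>?\<U>. box_at J e x\<subseteq>U" by (elim exE conjE)
 have "far_point K J\<in>K" by (rule far_point(1)[OF affine_flowD(3,5)[OF K(1)]])
 then obtain s where "s\<in>fixopen" "box_at J e (far_point K J)\<subseteq>{x. x \<circ> mean_class.shift H (\<phi> (\<iota> s))\<noteq>x}"
  using J(3) by blast
 then show ?thesis using J(1,2) by blast
qed

theorem not_both_injective:
 assumes count: "countable (carrier \<Gamma>)" and F: "Furstenberg_boundary \<Gamma> (disc \<Gamma>) B \<beta>"
  and eq: "stabilizer_URS \<Gamma> (disc \<Gamma>) Z \<zeta> = stabilizer_URS \<Gamma> (disc \<Gamma>) B \<beta>"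
  and \<nu>: "invariant_coset_mean \<Gamma> (generate \<Gamma> fixopen) \<nu>"
  and L: "lattice G T (\<iota> ` carrier \<Gamma>) \<mu>" and \<iota>: "\<iota>\<in>hom \<Gamma> G"
  and H1: "lcsc_group H1 T1" and H2: "lcsc_group H2 T2"
  and \<pi>: "\<pi>\<in>hom G (H1 \<times>\<times> H2)" "continuous_map T (prod_topology T1 T2) \<pi>"
  and d: "prod_topology T1 T2 closure_of (\<pi> ` carrier G) = topspace (prod_topology T1 T2)"
  and inj: "inj_on (\<lambda>g. fst (\<pi> (\<iota> g))) (carrier \<Gamma>)" "inj_on (\<lambda>g. snd (\<pi> (\<iota> g))) (carrier \<Gamma>)"
 shows False
proof -
 define \<phi>1 \<phi>2 where \<phi>_def: "\<phi>1 = (\<lambda>g. fst (\<pi> g))" "\<phi>2 = (\<lambda>g. snd (\<pi> g))"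
 note pr = product_map_projections[OF H1 H2 \<pi> d, folded \<phi>_def]
 note \<phi>1 = pr(1,3) and \<phi>2 = pr(2,4) and d1 = pr(5) and d2 = pr(6)
 have inj: "inj_on (\<lambda>g. \<phi>1 (\<iota> g)) (carrier \<Gamma>)" "inj_on (\<lambda>g. \<phi>2 (\<iota> g)) (carrier \<Gamma>)" using inj by (simp_all add: \<phi>_def)
 have dense: "\<exists>g\<in>carrier G. \<phi>1 g\<in>U \<and> \<phi>2 g\<in>V" if UV: "openin T1 U" "openin T2 V" "h\<in>U" "k\<in>V" for U V h k
 proof -
  have "(h, k)\<in>prod_topology T1 T2 closure_of (\<pi> ` carrier G)"
   unfolding d using UV openin_subset[OF UV(1)] openin_subset[OF UV(2)] by auto
  moreover have "openin (prod_topology T1 T2) (U \<times> V)" "(h, k)\<in>U \<times> V" using UV by (simp_all add: openin_prod_Times_iff)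
  ultimately have "\<exists>y. y\<in>\<pi> ` carrier G \<and> y\<in>U \<times> V" unfolding in_closure_of by metis
  then show ?thesis by (auto simp: mem_Times_iff \<phi>_def)
 qed
 have tg1: "topological_group H1 T1" and tg2: "topological_group H2 T2" using H1 H2 by (simp_all add: lcsc_group_def)
 interpret L: lattice G T "\<iota> ` carrier \<Gamma>" \<mu> by (rule L)
 interpret H1: tgroup H1 T1 by unfold_locales (rule tg1)
 interpret H2: tgroup H2 T2 by unfold_locales (rule tg2)
 have p1: "(\<lambda>g. \<phi>1 (\<iota> g))\<in>hom \<Gamma> H1" and p2: "(\<lambda>g. \<phi>2 (\<iota> g))\<in>hom \<Gamma> H2"
  by (rule hom_comp[OF \<iota> \<phi>1(1)], rule hom_comp[OF \<iota> \<phi>2(1)])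
 interpret p1: group_hom \<Gamma> H1 "\<lambda>g. \<phi>1 (\<iota> g)" using p1 grp H1.group_axioms by (simp add: group_hom_def group_hom_axioms_def)
 interpret p2: group_hom \<Gamma> H2 "\<lambda>g. \<phi>2 (\<iota> g)" using p2 grp H2.group_axioms by (simp add: group_hom_def group_hom_axioms_def)
 have F1: "lattice_factor G T (\<iota> ` carrier \<Gamma>) \<mu> H1 T1 \<phi>1" and F2: "lattice_factor G T (\<iota> ` carrier \<Gamma>) \<mu> H2 T2 \<phi>2"
  by (intro lattice_factor.intro lattice_factor_axioms.intro L H1.tgroup_axioms H2.tgroup_axioms \<phi>1 \<phi>2)+
 obtain K1 where K1: "K1\<subseteq>H1.means" "irreducible_flow H1 H1.shift K1" using irreducible_exists[OF H1.means_flow] .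
 obtain K2 where K2: "K2\<subseteq>H2.means" "irreducible_flow H2 H2.shift K2" using irreducible_exists[OF H2.means_flow] .
 have f1: "affine_flow H1 H1.shift K1" and f2: "affine_flow H2 H2.shift K2" using K1 K2 by (simp_all add: irreducible_flow_def)
 have g1: "affine_flow \<Gamma> (\<lambda>g. H1.shift (\<phi>1 (\<iota> g))) K1" by (rule affine_flow_pullback[OF f1 p1 grp H1.group_axioms])
 have g2: "affine_flow \<Gamma> (\<lambda>g. H2.shift (\<phi>2 (\<iota> g))) K2" by (rule affine_flow_pullback[OF f2 p2 grp H2.group_axioms])
 obtain J1 e1 s1 where J1: "finite J1" "0 < e1" "s1\<in>fixopen"
  "\<forall>x\<in>box_at J1 e1 (far_point K1 J1). x \<circ> H1.shift (\<phi>1 (\<iota> s1))\<noteq>x"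
  using envelope_box[OF L \<iota> \<nu> H1 \<phi>1 d1 inj(1) f1 K1(1)] by blast
 obtain J2 e2 s2 where J2: "finite J2" "0 < e2" "s2\<in>fixopen"
  "\<forall>y\<in>box_at J2 e2 (far_point K2 J2). y \<circ> H2.shift (\<phi>2 (\<iota> s2))\<noteq>y"
  using envelope_box[OF L \<iota> \<nu> H2 \<phi>2 d2 inj(2) f2 K2(1)] by blast
 obtain O1 where O1: "s1\<in>carrier \<Gamma>" "openin Z O1" "O1\<noteq>{}" "\<forall>x\<in>O1. \<zeta> s1 x = x" using J1(3) by (auto simp: fixopen_def)
 obtain O2 where O2: "s2\<in>carrier \<Gamma>" "openin Z O2" "O2\<noteq>{}" "\<forall>x\<in>O2. \<zeta> s2 x = x" using J2(3) by (auto simp: fixopen_def)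
 have O1Z: "O1\<subseteq>topspace Z" by (rule openin_subset[OF O1(2)])
 have "closedin Z (topspace Z - O1)" "topspace Z - O1\<noteq>topspace Z" using O1(2,3) O1Z by auto
 \<comment> \<open>Every point of \<open>Z\<close> lies in \<open>O2\<close> or is moved into \<open>O1\<close> by the inverse of \<open>\<gamma>\<close>.\<close>
 then obtain \<gamma> where \<gamma>: "\<gamma>\<in>carrier \<Gamma>" "\<zeta> \<gamma> ` (topspace Z - O1)\<subseteq>O2" using compress[OF _ _ O2(2,3)] by blast
 define R where "R = (\<lambda>x y. x\<in>K1 \<and> y\<in>K2 \<and> (\<exists>z\<in>topspace Z. \<forall>g\<in>germs z. x \<circ> H1.shift (\<phi>1 (\<iota> g)) = x \<and> y \<circ> H2.shift (\<phi>2 (\<iota> g)) = y))"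
 obtain z0 where z0: "z0\<in>topspace Z" using nonempty by blast
 obtain x0 where x0: "x0\<in>K1" "\<forall>g\<in>germs z0. x0 \<circ> H1.shift (\<phi>1 (\<iota> g)) = x0" using germs_fixed_point[OF count F eq g1 z0] by blast
 obtain y0 where y0: "y0\<in>K2" "\<forall>g\<in>germs z0. y0 \<circ> H2.shift (\<phi>2 (\<iota> g)) = y0" using germs_fixed_point[OF count F eq g2 z0] by blast
 have R0: "R x0 y0" unfolding R_def using x0 y0 z0 by blast
 have Rinv: "R (x \<circ> H1.shift (\<phi>1 l)) (y \<circ> H2.shift (\<phi>2 l))" if xy: "R x y" and l: "l\<in>\<iota> ` carrier \<Gamma>" for x y l
 proof -
  obtain h where h: "h\<in>carrier \<Gamma>" "l = \<iota> h" using l by blast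
  obtain z where z: "z\<in>topspace Z" "\<forall>g\<in>germs z. x \<circ> H1.shift (\<phi>1 (\<iota> g)) = x \<and> y \<circ> H2.shift (\<phi>2 (\<iota> g)) = y" and xK: "x\<in>K1" "y\<in>K2"
   using xy unfolding R_def by blast
  have "\<forall>g\<in>germs (\<zeta> h z). (x \<circ> H1.shift (\<phi>1 (\<iota> h))) \<circ> H1.shift (\<phi>1 (\<iota> g)) = x \<circ> H1.shift (\<phi>1 (\<iota> h))"
   "\<forall>g\<in>germs (\<zeta> h z). (y \<circ> H2.shift (\<phi>2 (\<iota> h))) \<circ> H2.shift (\<phi>2 (\<iota> g)) = y \<circ> H2.shift (\<phi>2 (\<iota> h))"
   using germs_fixed_translate[OF g1 _ z(1) h(1), of x] germs_fixed_translate[OF g2 _ z(1) h(1), of y] z(2) by blast+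
  moreover have "\<zeta> h z\<in>topspace Z" using h z by simp
  ultimately show ?thesis unfolding R_def h(2) using affine_flowD(6)[OF g1 h(1) xK(1)] affine_flowD(6)[OF g2 h(1) xK(2)] by blast
 qed
 \<comment> \<open>\<open>product_concentration\<close> enlarges the boxes threefold; the first factor is tested after translation by the inverse of \<open>\<gamma>\<close>.\<close>
 define e where "e = min e1 e2 / 3"
 have e: "0 < e" "3 * e\<le>e1" "3 * e\<le>e2" using J1(2) J2(2) by (auto simp: e_def)
 have a0: "inv\<^bsub>H1\<^esub> (\<phi>1 (\<iota> \<gamma>))\<in>carrier H1" using \<gamma>(1) by simp
 have RK: "x\<in>K1 \<and> y\<in>K2" if "R x y" for x y using that by (simp add: R_def)
 have "\<exists>x y. R x y \<and> x \<circ> H1.shift (inv\<^bsub>H1\<^esub> (\<phi>1 (\<iota> \<gamma>)))\<in>box_at J1 (3 * e) (far_point K1 J1) \<and>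
  y \<circ> H2.shift \<one>\<^bsub>H2\<^esub>\<in>box_at J2 (3 * e) (far_point K2 J2)"
  by (rule product_concentration[OF F1 F2 dense K1(2,1) K2(2,1) RK R0 Rinv J1(1) J2(1) e(1) a0 H2.one_closed])
 then obtain x y where xy: "R x y" "x \<circ> H1.shift (inv\<^bsub>H1\<^esub> (\<phi>1 (\<iota> \<gamma>)))\<in>box_at J1 (3 * e) (far_point K1 J1)"
  "y \<circ> H2.shift \<one>\<^bsub>H2\<^esub>\<in>box_at J2 (3 * e) (far_point K2 J2)"
  by (elim exE conjE)
 obtain z where z: "z\<in>topspace Z" "\<forall>g\<in>germs z. x \<circ> H1.shift (\<phi>1 (\<iota> g)) = x \<and> y \<circ> H2.shift (\<phi>2 (\<iota> g)) = y"
  using xy(1) unfolding R_def by blast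
 define w where "w = \<zeta> (inv \<gamma>) z"
 have w: "w\<in>topspace Z" "z = \<zeta> \<gamma> w" using \<gamma>(1) z(1) by (simp_all add: w_def)
 show False
 proof (cases "w\<in>O1")
  case True
  then have "s1\<in>germs w" using O1 unfolding germs_def by blast
  moreover have "inv\<^bsub>H1\<^esub> (\<phi>1 (\<iota> \<gamma>)) = \<phi>1 (\<iota> (inv \<gamma>))" using \<gamma>(1) by simp
  moreover have "\<forall>g\<in>germs w. (x \<circ> H1.shift (\<phi>1 (\<iota> (inv \<gamma>)))) \<circ> H1.shift (\<phi>1 (\<iota> g)) = x \<circ> H1.shift (\<phi>1 (\<iota> (inv \<gamma>)))"
   unfolding w_def by (rule germs_fixed_translate[OF g1 _ z(1)]) (use z(2) \<gamma>(1) in auto)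
  moreover have "x \<circ> H1.shift (inv\<^bsub>H1\<^esub> (\<phi>1 (\<iota> \<gamma>)))\<in>box_at J1 e1 (far_point K1 J1)" using xy(2) e(2) by (force simp: box_at_def)
  ultimately show False using J1(4) by metis
 next
  case False
  then have "z\<in>O2" using \<gamma>(2) w by blast
  then have "s2\<in>germs z" using O2 unfolding germs_def by blast
  then have "y \<circ> H2.shift (\<phi>2 (\<iota> s2)) = y" using z(2) by blast
  moreover have "y \<circ> H2.shift \<one>\<^bsub>H2\<^esub> = y" by (auto simp: H2.shift_one)
  then have "y\<in>box_at J2 e2 (far_point K2 J2)" using xy(3) e(3) by (force simp: box_at_def)
  ultimately show False using J2(4) by blast
 qed
qed

end

section \<open>Compact factors\<close>

text \<open>A homomorphism with commutative image factors through the abelianization.\<close>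
lemma finite_image_of_finite_abelianization:
 assumes K: "group K" and H: "group H" and p: "p\<in>hom K H"
  and comm: "\<And>x y. x\<in>carrier K ==> y\<in>carrier K ==> p x \<otimes>\<^bsub>H\<^esub> p y = p y \<otimes>\<^bsub>H\<^esub> p x"
  and fin: "finite (carrier (abelianization K))"
 shows "finite (p ` carrier K)"
proof -
 interpret K: group K by (rule K)
 interpret H: group H by (rule H)
 interpret p: group_hom K H p using p K H by (simp add: group_hom_def group_hom_axioms_def)
 define D where "D = derived K (carrier K)"
 have "derived_set K (carrier K)\<subseteq>kernel K H p"
 proof
  fix d assume "d\<in>derived_set K (carrier K)"
  then obtain x y where d: "x\<in>carrier K" "y\<in>carrier K" "d = x \<otimes>\<^bsub>K\<^esub> y \<otimes>\<^bsub>K\<^esub> inv\<^bsub>K\<^esub> x \<otimes>\<^bsub>K\<^esub> inv\<^bsub>K\<^esub> y" by blast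
  have "p d = (p x \<otimes>\<^bsub>H\<^esub> p y) \<otimes>\<^bsub>H\<^esub> inv\<^bsub>H\<^esub> (p x) \<otimes>\<^bsub>H\<^esub> inv\<^bsub>H\<^esub> (p y)" using d by simp
  also have "\<dots> = \<one>\<^bsub>H\<^esub>" unfolding comm[OF d(1,2)] using d by (simp add: H.m_assoc)
  finally show "d\<in>kernel K H p" using d by (simp add: kernel_def)
 qed
 then have Dk: "D\<subseteq>kernel K H p" unfolding D_def derived_def
  by (rule K.generate_subgroup_incl[OF _ p.subgroup_kernel])
 have Ds: "subgroup D K" unfolding D_def by (rule K.derived_is_subgroup) simp
 have R: "finite (rcosets\<^bsub>K\<^esub> D)" using fin by (simp add: abelianization_def FactGroup_def D_def)
 have "p ` carrier K\<subseteq>(\<lambda>C. p (SOME x. x\<in>C)) ` (rcosets\<^bsub>K\<^esub> D)"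
 proof
  fix h assume "h\<in>p ` carrier K"
  then obtain x where x: "x\<in>carrier K" "h = p x" by blast
  define C where "C = D #>\<^bsub>K\<^esub> x"
  have C: "C\<in>rcosets\<^bsub>K\<^esub> D" "x\<in>C" unfolding C_def
   using K.rcosetsI[OF subgroup.subset[OF Ds] x(1)] K.rcos_self[OF x(1) Ds] by auto
  have "(SOME x. x\<in>C)\<in>C" using C(2) by (rule someI)
  then obtain d where d: "d\<in>D" "(SOME x. x\<in>C) = d \<otimes>\<^bsub>K\<^esub> x" unfolding C_def r_coset_def by blast
  have "d\<in>carrier K" "p d = \<one>\<^bsub>H\<^esub>" using d(1) Dk by (auto simp: kernel_def)
  then have "p (SOME x. x\<in>C) = h" using d(2) x by simp
  then show "h\<in>(\<lambda>C. p (SOME x. x\<in>C)) ` (rcosets\<^bsub>K\<^esub> D)" using C(1) by blast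
 qed
 then show ?thesis using R finite_surj by blast
qed

lemma finite_image_of_finite_index:
 assumes G: "group G" and H: "group H" and p: "p\<in>hom G H" and L: "subgroup L G"
  and fi: "finite_index G L" and fin: "finite (p ` L)"
 shows "finite (p ` carrier G)"
proof -
 interpret G: group G by (rule G)
 interpret p: group_hom G H p using p G H by (simp add: group_hom_def group_hom_axioms_def)
 have "p ` carrier G\<subseteq>(\<lambda>(h, C). h \<otimes>\<^bsub>H\<^esub> p (SOME x. x\<in>C)) ` (p ` L \<times> rcosets\<^bsub>G\<^esub> L)"
 proof
  fix h assume "h\<in>p ` carrier G"
  then obtain x where x: "x\<in>carrier G" "h = p x" by blast
  define C where "C = L #>\<^bsub>G\<^esub> x"
  have C: "C\<in>rcosets\<^bsub>G\<^esub> L" "x\<in>C" unfolding C_def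
   using G.rcosetsI[OF subgroup.subset[OF L] x(1)] G.rcos_self[OF x(1) L] by auto
  have "(SOME x. x\<in>C)\<in>C" using C(2) by (rule someI)
  then obtain d where d: "d\<in>L" "(SOME x. x\<in>C) = d \<otimes>\<^bsub>G\<^esub> x" unfolding C_def r_coset_def by blast
  have dc: "d\<in>carrier G" "inv\<^bsub>G\<^esub> d\<in>L" using subgroup.mem_carrier[OF L d(1)] subgroup.m_inv_closed[OF L d(1)] by auto
  have "x = inv\<^bsub>G\<^esub> d \<otimes>\<^bsub>G\<^esub> (d \<otimes>\<^bsub>G\<^esub> x)" using dc x by simp
  then have "h = p (inv\<^bsub>G\<^esub> d) \<otimes>\<^bsub>H\<^esub> p (SOME x. x\<in>C)" using dc x d(2) by (metis G.inv_closed G.m_closed p.hom_mult)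
  then show "h\<in>(\<lambda>(h, C). h \<otimes>\<^bsub>H\<^esub> p (SOME x. x\<in>C)) ` (p ` L \<times> rcosets\<^bsub>G\<^esub> L)" using C(1) dc(2) by force
 qed
 moreover have "finite (p ` L \<times> rcosets\<^bsub>G\<^esub> L)" using fin fi by (simp add: finite_index_def)
 ultimately show ?thesis using finite_surj by blast
qed

text \<open>The commutator with a fixed element is a continuous function vanishing at the identity.\<close>
lemma (in tgroup) commutators_near_one:
 assumes S: "finite S" "S\<subseteq>carrier H" and V: "openin T V" "\<one>\<in>V"
 shows "\<exists>W. openin T W \<and> \<one>\<in>W \<and> (\<forall>x\<in>W. \<forall>s\<in>S. x\<otimes>s\<otimes>inv x\<otimes>inv s\<in>V)"
 using S
proof (induction S rule: finite_induct)
 case empty then show ?case using V by blast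
next
 case (insert s S)
 obtain W where W: "openin T W" "\<one>\<in>W" "\<forall>x\<in>W. \<forall>s\<in>S. x\<otimes>s\<otimes>inv x\<otimes>inv s\<in>V" using insert by auto
 have s: "s\<in>carrier H" using insert by simp
 define W' where "W' = {x\<in>topspace T. x\<otimes>s\<otimes>inv x\<otimes>inv s\<in>V}"
 have "openin T W'" unfolding W'_def
  by (rule openin_continuous_map_preimage[OF _ V(1)]) (intro cmult cinv cconst cid s inv_closed)
 moreover have "\<one>\<in>W'" using s V(2) by (simp add: W'_def)
 ultimately show ?case using W by (intro exI[of _ "W \<inter> W'"]) (auto simp: W'_def openin_Int)
qed

context ep_action begin

lemma envelope_subgroup: "subgroup (generate \<Gamma> fixopen) \<Gamma>"
 by (rule generate_is_subgroup) (auto simp: fixopen_def)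

text \<open>Otherwise \<open>U\<close> would be a single point, \<open>Z\<close> would be finite by minimality and compactness, and so would be the faithful group.\<close>
lemma infinite_split_open:
 assumes inf: "infinite (carrier \<Gamma>)" and U: "openin Z U" "U\<noteq>{}"
 shows "\<exists>V W. openin Z V \<and> V\<noteq>{} \<and> openin Z W \<and> W\<noteq>{} \<and> V\<subseteq>U \<and> W\<subseteq>U \<and> V \<inter> W = {}"
proof (cases "\<exists>x\<in>U. \<exists>y\<in>U. x\<noteq>y")
 case True
 then obtain x y where xy: "x\<in>U" "y\<in>U" "x\<noteq>y" by blast
 then have "x\<in>topspace Z" "y\<in>topspace Z" using openin_subset[OF U(1)] by auto
 then obtain V W where VW: "openin Z V" "openin Z W" "x\<in>V" "y\<in>W" "disjnt V W"
  using Haus xy(3) unfolding Hausdorff_space_def by metis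
 then show ?thesis using U xy
  by (intro exI[of _ "U \<inter> V"] exI[of _ "U \<inter> W"]) (auto simp: disjnt_def openin_Int)
next
 case False
 then obtain x where x: "U = {x}" using U(2) by blast
 have op: "openin Z {y}" if y: "y\<in>topspace Z" for y
 proof -
  obtain g where g: "g\<in>carrier \<Gamma>" "\<zeta> g y\<in>U" using orbit_meets[OF y U] by blast
  then have "y = \<zeta> (inv g) x" using x y by auto
  then have "{y} = \<zeta> (inv g) ` U" using x by simp
  then show ?thesis using act_open[OF _ U(1), of "inv g"] g(1) by simp
 qed
 have fZ: "finite (topspace Z)"
 proof -
  have "\<exists>\<F>. finite \<F> \<and> \<F>\<subseteq>(\<lambda>y. {y}) ` topspace Z \<and> topspace Z\<subseteq>\<Union>\<F>"
   by (rule compactinD[OF comp[unfolded compact_space_def]]) (use op in auto)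
  then obtain \<F> where \<F>: "finite \<F>" "\<F>\<subseteq>(\<lambda>y. {y}) ` topspace Z" "topspace Z\<subseteq>\<Union>\<F>" by blast
  have "finite (\<Union>\<F>)" using \<F>(1,2) by (intro finite_Union) auto
  then show ?thesis using \<F>(3) finite_subset by blast
 qed
 have "inj_on (\<lambda>g. restrict (\<zeta> g) (topspace Z)) (carrier \<Gamma>)"
 proof (rule inj_onI)
  fix g h assume gh: "g\<in>carrier \<Gamma>" "h\<in>carrier \<Gamma>" "restrict (\<zeta> g) (topspace Z) = restrict (\<zeta> h) (topspace Z)"
  show "g = h" by (rule act_eqI[OF gh(1,2)]) (use gh(3) in \<open>metis restrict_apply'\<close>)
 qed
 moreover have "(\<lambda>g. restrict (\<zeta> g) (topspace Z)) ` carrier \<Gamma>\<subseteq>(\<Pi>\<^sub>E x\<in>topspace Z. topspace Z)" by auto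
 moreover have "finite (\<Pi>\<^sub>E x\<in>topspace Z. topspace Z)" using fZ by (intro finite_PiE) auto
 ultimately have "finite (carrier \<Gamma>)" using inj_on_finite by blast
 then show ?thesis using inf by blast
qed

text \<open>If the envelope were trivial, \<open>\<nu>\<close> would be an invariant mean on \<open>\<Gamma>\<close> itself, which a ping-pong pair excludes.\<close>
lemma not_topologically_free:
 assumes inf: "infinite (carrier \<Gamma>)" and \<nu>: "invariant_coset_mean \<Gamma> (generate \<Gamma> fixopen) \<nu>"
 shows "\<exists>s\<in>fixopen. s\<noteq>\<one>"
proof (rule ccontr)
 assume no: "\<not> ?thesis"
 have E: "generate \<Gamma> fixopen = {\<one>}"
 proof -
  have "generate \<Gamma> fixopen\<subseteq>{\<one>}" using no by (intro generate_subgroup_incl triv_subgroup) auto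
  then show ?thesis using generate.one by blast
 qed
 have L: "{\<one>}\<subseteq>carrier \<Gamma>" by simp
 let ?F = "coset_functions \<Gamma> {\<one>}"
 interpret M: mean_class \<Gamma> ?F by (rule mean_class_coset_functions[OF grp L])
 have \<nu>M: "\<nu>\<in>M.means" and inv: "\<nu> (M.shift g f) = \<nu> f" if "g\<in>carrier \<Gamma>" for g f
  using \<nu> that unfolding invariant_coset_mean_def E by (auto simp: fun_eq_iff)
 have \<nu>M: "\<nu>\<in>M.means" using \<nu>M[OF one_closed] .
 obtain v T O' where S: "schottky v T O'" using schottky_exists[OF infinite_split_open[OF inf]] by blast
 have vl: "v l\<in>carrier \<Gamma>" for l by (rule schottkyD(3)[OF S])
 have ind: "(indicat_real A)\<in>?F" for A
  unfolding coset_functions_def by (auto simp: indicator_def intro!: exI[of _ 1])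
 show False
 proof (rule schottky_no_invariant_measure[OF S, of "carrier \<Gamma>" "\<lambda>A. \<nu> (indicat_real A)"])
  show "0\<le>\<nu> (indicat_real A)" for A by (rule M.meansD(3)[OF \<nu>M ind]) simp
  show "\<nu> (indicat_real (carrier \<Gamma>)) = 1"
   using M.means_cong[OF \<nu>M ind, of "carrier \<Gamma>" "\<lambda>_. 1"] M.meansD(4)[OF \<nu>M] by simp
  show "\<nu> (indicat_real (A \<union> B)) = \<nu> (indicat_real A) + \<nu> (indicat_real B)" if "A \<inter> B = {}" for A B
  proof -
   have "indicat_real (A \<union> B) = (\<lambda>h. indicat_real A h + indicat_real B h)"
    using that by (auto simp: indicator_def fun_eq_iff)
   then show ?thesis using M.meansD(1)[OF \<nu>M ind ind, of A B] by simp
  qed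
  show "\<nu> (indicat_real ((\<lambda>x. v l\<otimes>x) ` A)) = \<nu> (indicat_real A)" if A: "A\<subseteq>carrier \<Gamma>" for A l
  proof -
   let ?B = "(\<lambda>x. v l\<otimes>x) ` A"
   have "M.shift (v l) (indicat_real ?B) h = indicat_real A h" if h: "h\<in>carrier \<Gamma>" for h
   proof -
    have "v l\<otimes>h\<in>?B \<longleftrightarrow> h\<in>A" using A h vl[of l] by (auto simp: subset_iff)
    then show ?thesis using h by (simp add: M.shift_def indicator_def)
   qed
   then have "\<nu> (M.shift (v l) (indicat_real ?B)) = \<nu> (indicat_real A)"
    by (intro M.means_cong[OF \<nu>M M.shift_F[OF ind vl]])
   then show ?thesis using inv[OF vl] by simp
  qed
 qed (use vl in auto)
qed

end

context micro_action begin

text \<open>The first projection is commutative on the envelope. An element of the envelope whose second projection is close to 1 therefore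
has commutators with the generators that are trivial in the first factor and close to 1 in the second, hence trivial, and
so it centralizes the envelope and is 1. Applied to commutators with arbitrary elements this shows that \<open>\<Gamma>\<close> is discrete in the second
factor. If the first factor were not compact, recurrence for elements \<open>(h, 1)\<close> with \<open>h\<close> escaping to infinity would
produce a return by a lattice element close to 1 in the second factor, that is, by 1; but then \<open>h\<close> did not escape.\<close>
lemma compact_factor_of_fg_envelope:
 assumes fg: "finite S0" "generate \<Gamma> S0 = generate \<Gamma> fixopen" "S0\<subseteq>carrier \<Gamma>"
  and L: "lattice G T (\<iota> ` carrier \<Gamma>) \<mu>" and \<iota>: "\<iota>\<in>hom \<Gamma> G" "inj_on \<iota> (carrier \<Gamma>)"
  and H1: "lcsc_group H1 T1" and H2: "lcsc_group H2 T2"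
  and \<phi>1: "\<phi>1\<in>hom G H1" "continuous_map T T1 \<phi>1" and \<phi>2: "\<phi>2\<in>hom G H2" "continuous_map T T2 \<phi>2"
  and lift: "\<And>h. h\<in>carrier H1 ==> \<exists>g\<in>carrier G. \<phi>1 g = h \<and> \<phi>2 g = \<one>\<^bsub>H2\<^esub>"
  and V1: "openin T1 V1" "\<one>\<^bsub>H1\<^esub>\<in>V1" and V2: "openin T2 V2" "\<one>\<^bsub>H2\<^esub>\<in>V2"
  and sep: "\<And>l. l\<in>\<iota> ` carrier \<Gamma> ==> \<phi>1 l\<in>V1 ==> \<phi>2 l\<in>V2 ==> l = \<one>\<^bsub>G\<^esub>"
  and n: "n\<in>carrier \<Gamma>" "n\<noteq>\<one>" "\<phi>1 (\<iota> n) = \<one>\<^bsub>H1\<^esub>"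
 shows "compact_space T1"
proof (rule ccontr)
 assume nc: "\<not> compact_space T1"
 interpret L: lattice G T "\<iota> ` carrier \<Gamma>" \<mu> by (rule L)
 interpret H1: tgroup H1 T1 using H1 by unfold_locales (simp add: lcsc_group_def)
 interpret H2: tgroup H2 T2 using H2 by unfold_locales (simp add: lcsc_group_def)
 interpret \<phi>1: group_hom G H1 \<phi>1 using \<phi>1 by (simp add: group_hom_def group_hom_axioms_def H1.group_axioms L.group_axioms)
 interpret \<phi>2: group_hom G H2 \<phi>2 using \<phi>2 by (simp add: group_hom_def group_hom_axioms_def H2.group_axioms L.group_axioms)
 have p1: "(\<lambda>g. \<phi>1 (\<iota> g))\<in>hom \<Gamma> H1" and p2: "(\<lambda>g. \<phi>2 (\<iota> g))\<in>hom \<Gamma> H2"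
  by (rule hom_comp[OF \<iota>(1) \<phi>1(1)], rule hom_comp[OF \<iota>(1) \<phi>2(1)])
 interpret p1: group_hom \<Gamma> H1 "\<lambda>g. \<phi>1 (\<iota> g)" using p1 grp H1.group_axioms by (simp add: group_hom_def group_hom_axioms_def)
 interpret p2: group_hom \<Gamma> H2 "\<lambda>g. \<phi>2 (\<iota> g)" using p2 grp H2.group_axioms by (simp add: group_hom_def group_hom_axioms_def)
 interpret \<iota>: group_hom \<Gamma> G \<iota> using \<iota>(1) grp L.group_axioms by (simp add: group_hom_def group_hom_axioms_def)
 let ?E = "generate \<Gamma> fixopen"
 have S0E: "s\<in>?E" if "s\<in>S0" for s using fg(2) generate.incl[OF that] by blast
 have EG: "x\<in>carrier \<Gamma>" if "x\<in>?E" for x using subgroup.mem_carrier[OF envelope_subgroup that] .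
 have \<iota>1: "\<gamma> = \<one>" if "\<gamma>\<in>carrier \<Gamma>" "\<iota> \<gamma> = \<one>\<^bsub>G\<^esub>" for \<gamma>
  using inj_onD[OF \<iota>(2), of \<gamma> \<one>] that by simp
 have central: "\<gamma> = \<one>" if \<gamma>: "\<gamma>\<in>carrier \<Gamma>" and c: "\<And>s. s\<in>S0 ==> \<gamma>\<otimes>s\<otimes>inv \<gamma>\<otimes>inv s = \<one>" for \<gamma>
 proof (rule centralizer_fixopen[OF \<gamma>])
  have com: "\<gamma>\<otimes>s = s\<otimes>\<gamma>" if s: "s\<in>S0" for s
  proof -
   have sc: "s\<in>carrier \<Gamma>" using s fg(3) by blast
   have "\<gamma>\<otimes>s = (\<gamma>\<otimes>s\<otimes>inv \<gamma>\<otimes>inv s)\<otimes>(s\<otimes>\<gamma>)" using \<gamma> sc by (simp add: m_assoc)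
   then show ?thesis using c[OF s] \<gamma> sc by simp
  qed
  show "\<gamma>\<otimes>s = s\<otimes>\<gamma>" if s: "s\<in>fixopen" for s
  proof (rule generate_commute[OF fg(3) \<gamma> com])
   show "s\<in>generate \<Gamma> S0" unfolding fg(2) using s by (rule generate.incl)
  qed
 qed
 have P2S: "finite ((\<lambda>g. \<phi>2 (\<iota> g)) ` S0)" "(\<lambda>g. \<phi>2 (\<iota> g)) ` S0\<subseteq>carrier H2" using fg(1,3) by auto
 obtain A where A: "openin T2 A" "\<one>\<^bsub>H2\<^esub>\<in>A"
  "\<forall>x\<in>A. \<forall>s\<in>(\<lambda>g. \<phi>2 (\<iota> g)) ` S0. x \<otimes>\<^bsub>H2\<^esub> s \<otimes>\<^bsub>H2\<^esub> inv\<^bsub>H2\<^esub> x \<otimes>\<^bsub>H2\<^esub> inv\<^bsub>H2\<^esub> s\<in>V2"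
  using H2.commutators_near_one[OF P2S V2] by (elim exE conjE)
 have e1: "x = \<one>" if x: "x\<in>?E" "\<phi>2 (\<iota> x)\<in>A" for x
 proof (rule central[OF EG[OF x(1)]])
  fix s assume s: "s\<in>S0"
  let ?c = "x\<otimes>s\<otimes>inv x\<otimes>inv s"
  have cl: "x\<in>carrier \<Gamma>" "s\<in>carrier \<Gamma>" using EG[OF x(1)] s fg(3) by auto
  have com: "\<phi>1 (\<iota> x) \<otimes>\<^bsub>H1\<^esub> \<phi>1 (\<iota> s) = \<phi>1 (\<iota> s) \<otimes>\<^bsub>H1\<^esub> \<phi>1 (\<iota> x)"
   by (rule hom_kernel_envelope_commute[OF H1.group_axioms p1 n x(1) S0E[OF s]])
  have "\<phi>1 (\<iota> ?c) = (\<phi>1 (\<iota> x) \<otimes>\<^bsub>H1\<^esub> \<phi>1 (\<iota> s)) \<otimes>\<^bsub>H1\<^esub> inv\<^bsub>H1\<^esub> (\<phi>1 (\<iota> x)) \<otimes>\<^bsub>H1\<^esub> inv\<^bsub>H1\<^esub> (\<phi>1 (\<iota> s))"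
   using cl by simp
  also have "\<dots> = \<one>\<^bsub>H1\<^esub>" unfolding com using cl by (simp add: H1.m_assoc)
  finally have "\<phi>1 (\<iota> ?c)\<in>V1" using V1(2) by simp
  moreover have "\<phi>2 (\<iota> ?c)\<in>V2" using A(3) x(2) s cl by simp
  moreover have cc: "?c\<in>carrier \<Gamma>" using cl by simp
  ultimately have "\<iota> ?c = \<one>\<^bsub>G\<^esub>" by (intro sep imageI)
  then show "?c = \<one>" by (rule \<iota>1[OF cc])
 qed
 obtain A' where A': "openin T2 A'" "\<one>\<^bsub>H2\<^esub>\<in>A'"
  "\<forall>x\<in>A'. \<forall>s\<in>(\<lambda>g. \<phi>2 (\<iota> g)) ` S0. x \<otimes>\<^bsub>H2\<^esub> s \<otimes>\<^bsub>H2\<^esub> inv\<^bsub>H2\<^esub> x \<otimes>\<^bsub>H2\<^esub> inv\<^bsub>H2\<^esub> s\<in>A"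
  using H2.commutators_near_one[OF P2S A(1,2)] by (elim exE conjE)
 have g1: "\<gamma> = \<one>" if \<gamma>: "\<gamma>\<in>carrier \<Gamma>" "\<phi>2 (\<iota> \<gamma>)\<in>A'" for \<gamma>
 proof (rule central[OF \<gamma>(1)])
  fix s assume s: "s\<in>S0"
  have sc: "s\<in>carrier \<Gamma>" using s fg(3) by auto
  have "\<gamma>\<otimes>s\<otimes>inv \<gamma>\<otimes>inv s\<in>?E"
   by (rule subgroup.m_closed[OF envelope_subgroup envelope_conj[OF \<gamma>(1) S0E[OF s]] subgroup.m_inv_closed[OF envelope_subgroup S0E[OF s]]])
  moreover have "\<phi>2 (\<iota> (\<gamma>\<otimes>s\<otimes>inv \<gamma>\<otimes>inv s))\<in>A" using A'(3) \<gamma> s sc by simp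
  ultimately show "\<gamma>\<otimes>s\<otimes>inv \<gamma>\<otimes>inv s = \<one>" by (rule e1)
 qed
 obtain W2 where W2: "openin T2 W2" "\<one>\<^bsub>H2\<^esub>\<in>W2" "\<forall>x\<in>W2. \<forall>y\<in>W2. inv\<^bsub>H2\<^esub> x \<otimes>\<^bsub>H2\<^esub> y\<in>A' \<and> x \<otimes>\<^bsub>H2\<^esub> inv\<^bsub>H2\<^esub> y\<in>A' \<and> x \<otimes>\<^bsub>H2\<^esub> y\<in>A'"
  using H2.one_nbhd_quot[OF A'(1,2)] by blast
 obtain W1 Q where W1: "openin T1 W1" "compactin T1 Q" "\<one>\<^bsub>H1\<^esub>\<in>W1" "W1\<subseteq>Q"
  using H1 unfolding lcsc_group_def locally_compact_space_def by (metis H1.top H1.one_closed)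
 define P where "P = {a \<otimes>\<^bsub>H1\<^esub> b | a b. a\<in>Q \<and> b\<in>(\<lambda>a. inv\<^bsub>H1\<^esub> a) ` Q}"
 have P: "compactin T1 P" unfolding P_def by (intro H1.compactin_product_set H1.compactin_inverse_set W1(2))
 have h1: "Hausdorff_space T1" using H1 by (simp add: lcsc_group_def)
 obtain h :: "nat => _" where h: "\<forall>k. h k\<in>carrier H1 \<and> (\<forall>i<k. inv\<^bsub>H1\<^esub> (h i) \<otimes>\<^bsub>H1\<^esub> h k\<notin>P)"
  using H1.noncompact_spread[OF nc h1 P, of "carrier H1"] closure_of_topspace[of T1] by auto
 have "\<forall>k. \<exists>g. g\<in>carrier G \<and> \<phi>1 g = h k \<and> \<phi>2 g = \<one>\<^bsub>H2\<^esub>" using lift h by blast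
 then obtain g where g: "\<forall>k. g k\<in>carrier G \<and> \<phi>1 (g k) = h k \<and> \<phi>2 (g k) = \<one>\<^bsub>H2\<^esub>" by metis
 define B where "B = {x\<in>topspace T. \<phi>1 x\<in>W1} \<inter> {x\<in>topspace T. \<phi>2 x\<in>W2}"
 have "openin T B" unfolding B_def
  by (intro openin_Int openin_continuous_map_preimage[OF \<phi>1(2) W1(1)] openin_continuous_map_preimage[OF \<phi>2(2) W2(1)])
 moreover have "\<one>\<^bsub>G\<^esub>\<in>B" using W1(3) W2(2) by (simp add: B_def)
 ultimately obtain i j a b l where r: "i < j" "a\<in>B" "b\<in>B" "l\<in>\<iota> ` carrier \<Gamma>" "g i \<otimes>\<^bsub>G\<^esub> a \<otimes>\<^bsub>G\<^esub> l = g j \<otimes>\<^bsub>G\<^esub> b"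
  using L.recurrence[of B g] g by blast
 obtain \<gamma> where \<gamma>: "\<gamma>\<in>carrier \<Gamma>" "l = \<iota> \<gamma>" using r(4) by blast
 have cl: "a\<in>carrier G" "b\<in>carrier G" "l\<in>carrier G" "g i\<in>carrier G" "g j\<in>carrier G"
  using r g \<gamma> by (auto simp: B_def)
 have "\<phi>2 (g i \<otimes>\<^bsub>G\<^esub> a \<otimes>\<^bsub>G\<^esub> l) = \<phi>2 (g j \<otimes>\<^bsub>G\<^esub> b)" using r(5) by simp
 then have "\<phi>2 a \<otimes>\<^bsub>H2\<^esub> \<phi>2 l = \<phi>2 b" using cl g by simp
 then have "\<phi>2 l = inv\<^bsub>H2\<^esub> (\<phi>2 a) \<otimes>\<^bsub>H2\<^esub> \<phi>2 b" using cl by (metis H2.inv_cancel(1) \<phi>2.hom_closed)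
 also have "\<dots>\<in>A'" using W2(3) r(2,3) by (simp add: B_def)
 finally have "\<gamma> = \<one>" using g1 \<gamma> by simp
 then have l1: "l = \<one>\<^bsub>G\<^esub>" using \<gamma>(2) by simp
 have "\<phi>1 (g i \<otimes>\<^bsub>G\<^esub> a) = \<phi>1 (g j \<otimes>\<^bsub>G\<^esub> b)" using r(5) l1 cl by simp
 then have eq: "h i \<otimes>\<^bsub>H1\<^esub> \<phi>1 a = h j \<otimes>\<^bsub>H1\<^esub> \<phi>1 b" using cl g by simp
 have hc: "h i\<in>carrier H1" "h j\<in>carrier H1" using h by auto
 have "inv\<^bsub>H1\<^esub> (h i) \<otimes>\<^bsub>H1\<^esub> h j = inv\<^bsub>H1\<^esub> (h i) \<otimes>\<^bsub>H1\<^esub> (h j \<otimes>\<^bsub>H1\<^esub> \<phi>1 b) \<otimes>\<^bsub>H1\<^esub> inv\<^bsub>H1\<^esub> (\<phi>1 b)" using hc cl by (simp add: H1.m_assoc)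
 also have "\<dots> = \<phi>1 a \<otimes>\<^bsub>H1\<^esub> inv\<^bsub>H1\<^esub> (\<phi>1 b)" unfolding eq[symmetric] using hc cl by simp
 also have "\<dots>\<in>P" unfolding P_def using r(2,3) W1(4) by (auto simp: B_def)
 finally show False using h r(1) by blast
qed

text \<open>The image of the envelope is abelian, hence finite, and so is the image of \<open>\<Gamma>\<close>.\<close>
lemma compact_factor_of_finite_abelianization:
 assumes fi: "finite_index \<Gamma> (generate \<Gamma> fixopen)"
  and ab: "finite (carrier (abelianization (\<Gamma>\<lparr>carrier := generate \<Gamma> fixopen\<rparr>)))"
  and L: "lattice G T (\<iota> ` carrier \<Gamma>) \<mu>" and \<iota>: "\<iota>\<in>hom \<Gamma> G"
  and H: "lcsc_group H T'" and \<phi>: "\<phi>\<in>hom G H" "continuous_map T T' \<phi>"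
  and dense: "T' closure_of (\<phi> ` carrier G) = topspace T'"
  and n: "n\<in>carrier \<Gamma>" "n\<noteq>\<one>" "\<phi> (\<iota> n) = \<one>\<^bsub>H\<^esub>"
 shows "compact_space T'"
proof -
 interpret L: lattice G T "\<iota> ` carrier \<Gamma>" \<mu> by (rule L)
 have gH: "group H" using H by (simp add: lcsc_group_def topological_group_def)
 let ?E = "generate \<Gamma> fixopen" and ?p = "\<lambda>g. \<phi> (\<iota> g)"
 have p: "?p\<in>hom \<Gamma> H" by (rule hom_comp[OF \<iota> \<phi>(1)])
 have pE: "?p\<in>hom (\<Gamma>\<lparr>carrier := ?E\<rparr>) H"
  using p subgroup.mem_carrier[OF envelope_subgroup] by (auto simp: hom_def)
 have "finite (?p ` carrier (\<Gamma>\<lparr>carrier := ?E\<rparr>))"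
  by (rule finite_image_of_finite_abelianization[OF subgroup_imp_group[OF envelope_subgroup] gH pE _ ab])
   (use hom_kernel_envelope_commute[OF gH p n] in simp)
 then have "finite (?p ` carrier \<Gamma>)" using finite_image_of_finite_index[OF grp gH p envelope_subgroup fi] by simp
 then have "finite (\<phi> ` \<iota> ` carrier \<Gamma>)" by (simp add: image_image)
 then show ?thesis using L.compact_of_finite_image[OF _ _ _ \<phi> dense] H by (simp add: lcsc_group_def)
qed

end

context ep_action begin

lemma some_projection_not_injective:
 assumes count: "countable (carrier \<Gamma>)" and inf: "infinite (carrier \<Gamma>)" and F: "Furstenberg_boundary \<Gamma> (disc \<Gamma>) B \<beta>"
  and eq: "stabilizer_URS \<Gamma> (disc \<Gamma>) Z \<zeta> = stabilizer_URS \<Gamma> (disc \<Gamma>) B \<beta>"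
  and \<nu>: "invariant_coset_mean \<Gamma> (generate \<Gamma> fixopen) \<nu>"
  and L: "lattice G T (\<iota> ` carrier \<Gamma>) \<mu>" and \<iota>: "\<iota>\<in>hom \<Gamma> G"
  and H1: "lcsc_group H1 T1" and H2: "lcsc_group H2 T2"
  and \<pi>: "\<pi>\<in>hom G (H1 \<times>\<times> H2)" "continuous_map T (prod_topology T1 T2) \<pi>"
  and dense: "prod_topology T1 T2 closure_of (\<pi> ` carrier G) = topspace (prod_topology T1 T2)"
 shows "micro_action \<Gamma> Z \<zeta> \<and> (\<exists>n\<in>carrier \<Gamma>. n\<noteq>\<one> \<and> (fst (\<pi> (\<iota> n)) = \<one>\<^bsub>H1\<^esub> \<or> snd (\<pi> (\<iota> n)) = \<one>\<^bsub>H2\<^esub>))"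
proof
 interpret micro_action \<Gamma> Z \<zeta> by unfold_locales (rule not_topologically_free[OF inf \<nu>])
 show "micro_action \<Gamma> Z \<zeta>" by unfold_locales
 have g1: "group H1" and g2: "group H2" using H1 H2 by (auto simp: lcsc_group_def topological_group_def)
 note pr = product_map_projections[OF H1 H2 \<pi> dense]
 have ker: "\<exists>n\<in>carrier \<Gamma>. n\<noteq>\<one> \<and> p n = \<one>\<^bsub>H\<^esub>" if p: "p\<in>hom \<Gamma> H" "group H" and ni: "\<not> inj_on p (carrier \<Gamma>)" for p and H :: "('x, 'y) monoid_scheme"
 proof -
  interpret p: group_hom \<Gamma> H p using p grp by (simp add: group_hom_def group_hom_axioms_def)
  obtain n where "n\<in>carrier \<Gamma>" "p n = \<one>\<^bsub>H\<^esub>" "n\<noteq>\<one>" using ni p.inj_on_one_iff by blast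
  then show ?thesis by blast
 qed
 show "\<exists>n\<in>carrier \<Gamma>. n\<noteq>\<one> \<and> (fst (\<pi> (\<iota> n)) = \<one>\<^bsub>H1\<^esub> \<or> snd (\<pi> (\<iota> n)) = \<one>\<^bsub>H2\<^esub>)"
 proof (rule ccontr)
  assume no: "\<not> ?thesis"
  have i1: "inj_on (\<lambda>g. fst (\<pi> (\<iota> g))) (carrier \<Gamma>)" using ker[OF hom_comp[OF \<iota> pr(1)] g1] no by blast
  have i2: "inj_on (\<lambda>g. snd (\<pi> (\<iota> g))) (carrier \<Gamma>)" using ker[OF hom_comp[OF \<iota> pr(2)] g2] no by blast
  show False by (rule not_both_injective[OF count F eq \<nu> L \<iota> H1 H2 \<pi> dense i1 i2])
 qed
qed

end

theorem theorem1p1: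
  fixes \<Gamma> :: "'a monoid"
    and B :: "'b topology" and \<beta> :: "'a \<Rightarrow> 'b \<Rightarrow> 'b"
    and \<A> :: "'a set set" and E :: "'a set"
    and Z :: "'z topology" and \<zeta> :: "'a \<Rightarrow> 'z \<Rightarrow> 'z"
    and G :: "'g monoid" and T :: "'g topology" and \<iota> :: "'a \<Rightarrow> 'g"
  assumes "group \<Gamma>" and "countable (carrier \<Gamma>)"
    and "Furstenberg_boundary \<Gamma> (discrete_topology (carrier \<Gamma>)) B \<beta>"
    and "\<A> = stabilizer_URS \<Gamma> (discrete_topology (carrier \<Gamma>)) B \<beta>"
    and "compact_G_space \<Gamma> (discrete_topology (carrier \<Gamma>)) Z \<zeta>"
    and "minimal_action \<Gamma> Z \<zeta>"
    and "extremely_proximal \<Gamma> Z \<zeta>"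
    and "faithful_action \<Gamma> (topspace Z) \<zeta>"
    and "stabilizer_URS \<Gamma> (discrete_topology (carrier \<Gamma>)) Z \<zeta> = \<A>"
    and "E = envelope \<Gamma> (discrete_topology (carrier \<Gamma>)) \<A>"
    and "lcsc_group G T"
    and "\<iota> \<in> mon \<Gamma> G" and "lattice_in G T (\<iota> ` carrier \<Gamma>)"
  shows
    "(finitely_generated \<Gamma> E \<and> co_amenable \<Gamma> (discrete_topology (carrier \<Gamma>)) E \<longrightarrow>
        \<not> (\<exists>(G1 :: 'h monoid) T1 (G2 :: 'k monoid) T2 \<pi>.
             lcsc_group G1 T1 \<and> lcsc_group G2 T2 \<and>
             \<not> compact_space T1 \<and> \<not> compact_space T2 \<and>
             \<pi> \<in> iso G (G1 \<times>\<times> G2) \<and> homeomorphic_map T (prod_topology T1 T2) \<pi>)) \<and>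
     (finite_index \<Gamma> E \<and> finite (carrier (abelianization (\<Gamma>\<lparr>carrier := E\<rparr>))) \<longrightarrow>
        (\<forall>(G1 :: 'h monoid) T1 (G2 :: 'k monoid) T2 \<pi>.
           lcsc_group G1 T1 \<and> lcsc_group G2 T2 \<and>
           \<pi> \<in> hom G (G1 \<times>\<times> G2) \<and> continuous_map T (prod_topology T1 T2) \<pi> \<and>
           prod_topology T1 T2 closure_of (\<pi> ` carrier G) = topspace (prod_topology T1 T2) \<longrightarrow>
           compact_space T1 \<or> compact_space T2))"
proof -
 interpret ep_action \<Gamma> Z \<zeta> by (intro ep_action.intro assms(1,5-8))
 let ?E = "generate \<Gamma> fixopen"
 have E: "E = ?E" using envelope_eq[OF assms(2)] assms(9,10) by simp
 have eq: "stabilizer_URS \<Gamma> (disc \<Gamma>) Z \<zeta> = stabilizer_URS \<Gamma> (disc \<Gamma>) B \<beta>"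
  using assms(4,9) by simp
 have \<iota>: "\<iota>\<in>hom \<Gamma> G" "inj_on \<iota> (carrier \<Gamma>)" using assms(12) by (auto simp: mon_def)
 obtain \<mu> where \<mu>: "prob_space \<mu>" "sets \<mu> = sets (borel_on (coset_space G T (\<iota> ` carrier \<Gamma>)))"
  "\<forall>g\<in>carrier G. distr \<mu> \<mu> (\<lambda>C. g <#\<^bsub>G\<^esub> C) = \<mu>" using assms(13) unfolding lattice_in_def by blast
 have L: "lattice G T (\<iota> ` carrier \<Gamma>) \<mu>"
  by (intro lattice.intro tgroup.intro lattice_axioms.intro)
   (use assms(11,13) \<mu> in \<open>simp_all add: lcsc_group_def lattice_in_def\<close>)
 interpret L: lattice G T "\<iota> ` carrier \<Gamma>" \<mu> by (rule L)
 have fin: "compact_space T1" if f: "finite (carrier \<Gamma>)" and H: "lcsc_group G1 T1" and \<phi>: "\<phi>\<in>hom G G1" "continuous_map T T1 \<phi>"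
  and dense: "T1 closure_of (\<phi> ` carrier G) = topspace T1" for G1 :: "('x, 'y) monoid_scheme" and T1 \<phi>
  using L.compact_of_finite_image[OF _ _ _ \<phi> dense] H f by (simp add: lcsc_group_def)
 show ?thesis
 proof (intro conjI impI notI allI)
  assume hyp: "finitely_generated \<Gamma> E \<and> co_amenable \<Gamma> (disc \<Gamma>) E"
   and "\<exists>(G1 :: 'h monoid) T1 (G2 :: 'k monoid) T2 \<pi>.
      lcsc_group G1 T1 \<and> lcsc_group G2 T2 \<and>
      \<not> compact_space T1 \<and> \<not> compact_space T2 \<and>
      \<pi>\<in>iso G (G1 \<times>\<times> G2) \<and> homeomorphic_map T (prod_topology T1 T2) \<pi>"
  then obtain G1 :: "'h monoid" and T1 and G2 :: "'k monoid" and T2 \<pi> where H: "lcsc_group G1 T1" "lcsc_group G2 T2"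
   and nc: "\<not> compact_space T1" "\<not> compact_space T2"
   and \<pi>: "\<pi>\<in>iso G (G1 \<times>\<times> G2)" "homeomorphic_map T (prod_topology T1 T2) \<pi>" by blast
  have \<pi>h: "\<pi>\<in>hom G (G1 \<times>\<times> G2)" and \<pi>c: "continuous_map T (prod_topology T1 T2) \<pi>"
   using \<pi> homeomorphic_imp_continuous_map by (auto simp: iso_def)
  have bij: "bij_betw \<pi> (carrier G) (carrier G1 \<times> carrier G2)" using \<pi>(1) by (simp add: iso_def DirProd_def)
  have im: "\<pi> ` carrier G = topspace (prod_topology T1 T2)" using homeomorphic_imp_surjective_map[OF \<pi>(2)] by simp
  have d: "prod_topology T1 T2 closure_of (\<pi> ` carrier G) = topspace (prod_topology T1 T2)" unfolding im by (rule closure_of_topspace)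
  note pr = product_map_projections[OF H \<pi>h \<pi>c d]
  have inf: "infinite (carrier \<Gamma>)"
   using fin[OF _ H(1) pr(1) pr(3) pr(5)] nc(1) by blast
  obtain \<nu> where \<nu>: "invariant_coset_mean \<Gamma> ?E \<nu>"
   using coamenable_coset_mean[OF grp assms(2) inf envelope_subgroup] hyp E by blast
  obtain S0 where S0: "finite S0" "generate \<Gamma> S0 = ?E" "S0\<subseteq>carrier \<Gamma>"
   using hyp subgroup.subset[OF envelope_subgroup] unfolding E finitely_generated_def by blast
  from some_projection_not_injective[OF assms(2) inf assms(3) eq \<nu> L \<iota>(1) H \<pi>h \<pi>c d]
  obtain n where mic: "micro_action \<Gamma> Z \<zeta>" and n: "n\<in>carrier \<Gamma>" "n\<noteq>\<one>\<^bsub>\<Gamma>\<^esub>"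
   "fst (\<pi> (\<iota> n)) = \<one>\<^bsub>G1\<^esub> \<or> snd (\<pi> (\<iota> n)) = \<one>\<^bsub>G2\<^esub>" by blast
  interpret micro_action \<Gamma> Z \<zeta> by (rule mic)
  have gG: "group G1" "group G2" using H by (auto simp: lcsc_group_def topological_group_def)
  interpret G1: group G1 by (rule gG)
  interpret G2: group G2 by (rule gG)
  interpret \<pi>: group_hom G "G1 \<times>\<times> G2" \<pi> using \<pi>h L.group_axioms DirProd_group[OF gG] by (simp add: group_hom_def group_hom_axioms_def)
  have \<pi>1: "\<pi> \<one>\<^bsub>G\<^esub> = (\<one>\<^bsub>G1\<^esub>, \<one>\<^bsub>G2\<^esub>)" using \<pi>.hom_one by (simp add: DirProd_def)
  have "openin (subtopology T (\<iota> ` carrier \<Gamma>)) {\<one>\<^bsub>G\<^esub>}" using L.discr L.L1 by simp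
  then obtain W where W: "openin T W" "{\<one>\<^bsub>G\<^esub>} = W \<inter> \<iota> ` carrier \<Gamma>" unfolding openin_subtopology by blast
  have oW: "openin (prod_topology T1 T2) (\<pi> ` W)" using \<pi>(2) W(1) homeomorphic_map_openness_eq by blast
  have "(\<one>\<^bsub>G1\<^esub>, \<one>\<^bsub>G2\<^esub>)\<in>\<pi> ` W" using \<pi>1 W(2) by (metis Int_iff image_eqI insertI1)
  then obtain V1 V2 where V: "openin T1 V1" "openin T2 V2" "\<one>\<^bsub>G1\<^esub>\<in>V1" "\<one>\<^bsub>G2\<^esub>\<in>V2" "V1 \<times> V2\<subseteq>\<pi> ` W"
   using oW unfolding openin_prod_topology_alt by meson
  have sep: "l = \<one>\<^bsub>G\<^esub>" if l: "l\<in>\<iota> ` carrier \<Gamma>" "fst (\<pi> l)\<in>V1" "snd (\<pi> l)\<in>V2" for l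
  proof -
   have "\<pi> l\<in>V1 \<times> V2" using l(2,3) by (simp add: mem_Times_iff)
   then have "\<pi> l\<in>\<pi> ` W" using V(5) by (rule subsetD[rotated])
   then have "l\<in>W"
    by (simp only: inj_on_image_mem_iff[OF bij_betw_imp_inj_on[OF bij] L.Lcl[OF l(1)] L.open_subset[OF W(1)]])
   then show ?thesis using W(2) l(1) by blast
  qed
  have lift: "\<exists>g\<in>carrier G. \<pi> g = (h, k)" if "h\<in>carrier G1" "k\<in>carrier G2" for h k
  proof -
   have "(h, k)\<in>\<pi> ` carrier G" using bij that by (simp add: bij_betw_def)
   then show ?thesis by auto
  qed
  have lift1: "\<exists>g\<in>carrier G. fst (\<pi> g) = h \<and> snd (\<pi> g) = \<one>\<^bsub>G2\<^esub>" if "h\<in>carrier G1" for h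
   using lift[OF that G2.one_closed] by force
  have lift2: "\<exists>g\<in>carrier G. snd (\<pi> g) = k \<and> fst (\<pi> g) = \<one>\<^bsub>G1\<^esub>" if "k\<in>carrier G2" for k
   using lift[OF G1.one_closed that] by force
  show False
   using n(3)
  proof
   assume "fst (\<pi> (\<iota> n)) = \<one>\<^bsub>G1\<^esub>"
   with n(1,2) have "compact_space T1"
    by (intro compact_factor_of_fg_envelope[OF S0 L \<iota> H pr(1) pr(3)
       pr(2) pr(4) lift1 V(1,3,2,4) sep])
   then show False using nc by blast
  next
   assume "snd (\<pi> (\<iota> n)) = \<one>\<^bsub>G2\<^esub>"
   with n(1,2) have "compact_space T2"
    by (intro compact_factor_of_fg_envelope[OF S0 L \<iota> H(2,1) pr(2) pr(4)
       pr(1) pr(3) lift2 V(2,4,1,3) sep])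
   then show False using nc by blast
  qed
 next
  fix G1 :: "'h monoid" and T1 and G2 :: "'k monoid" and T2 \<pi>
  assume hyp: "finite_index \<Gamma> E \<and> finite (carrier (abelianization (\<Gamma>\<lparr>carrier := E\<rparr>)))"
   and a: "lcsc_group G1 T1 \<and> lcsc_group G2 T2 \<and>
     \<pi>\<in>hom G (G1 \<times>\<times> G2) \<and> continuous_map T (prod_topology T1 T2) \<pi> \<and>
     prod_topology T1 T2 closure_of (\<pi> ` carrier G) = topspace (prod_topology T1 T2)"
  then have H: "lcsc_group G1 T1" "lcsc_group G2 T2" and \<pi>h: "\<pi>\<in>hom G (G1 \<times>\<times> G2)"
   and \<pi>c: "continuous_map T (prod_topology T1 T2) \<pi>"
   and d: "prod_topology T1 T2 closure_of (\<pi> ` carrier G) = topspace (prod_topology T1 T2)" by auto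
  note pr = product_map_projections[OF H \<pi>h \<pi>c d]
  show "compact_space T1 \<or> compact_space T2"
  proof (cases "finite (carrier \<Gamma>)")
   case True
   then show ?thesis using fin[OF True H(1) pr(1) pr(3) pr(5)] by blast
  next
   case inf: False
   have fi: "finite_index \<Gamma> ?E" and ab: "finite (carrier (abelianization (\<Gamma>\<lparr>carrier := ?E\<rparr>)))" using hyp E by auto
   obtain \<nu> where \<nu>: "invariant_coset_mean \<Gamma> ?E \<nu>" using finite_index_coset_mean[OF grp envelope_subgroup fi] by blast
   from some_projection_not_injective[OF assms(2) inf assms(3) eq \<nu> L \<iota>(1) H \<pi>h \<pi>c d]
   obtain n where mic: "micro_action \<Gamma> Z \<zeta>" and n: "n\<in>carrier \<Gamma>" "n\<noteq>\<one>\<^bsub>\<Gamma>\<^esub>"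
    "fst (\<pi> (\<iota> n)) = \<one>\<^bsub>G1\<^esub> \<or> snd (\<pi> (\<iota> n)) = \<one>\<^bsub>G2\<^esub>" by blast
   interpret micro_action \<Gamma> Z \<zeta> by (rule mic)
   show ?thesis
    using n(3) compact_factor_of_finite_abelianization[OF fi ab L \<iota>(1) H(1) pr(1) pr(3) pr(5) n(1,2)]
     compact_factor_of_finite_abelianization[OF fi ab L \<iota>(1) H(2) pr(2) pr(4) pr(6) n(1,2)] by blast
  qed
 qed
qed

end
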